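(* Assume that in the pencil of cubic fourfolds containing a complete intersection threefold $X_{3,3}\subset\mathbb{P}^5$ with only ordinary triple points as singularities there is a fourfold with a triple point. Then a threefold $\tilde{X}_{3,3}$ obtained by blowing up one of the triple points of $X_{3,3}$ is a double cover of a cubic threefold $Y_3$ ramified over a surface of degree $12$.
   Context: The ground field is $\mathbb{C}$. $X_{3,3}=V(F_3,G_3)\subset\mathbb{P}^5$ denotes a threefold that is a complete intersection of two hypersurfaces of degree $3$, where $F_3$ and $G_3$ are the homogeneous polynomials of degree $3$ defining them. A cubic fourfold is a hypersurface of degree $3$ in $\mathbb{P}^5$; the pencil of cubic fourfolds containing $X_{3,3}$ consists of the fourfolds $V(\alpha F_3+\beta G_3)$ with $\alpha,\beta\in\mathbb{C}$ not both zero. A triple point of a cubic fourfold is a point at which it has multiplicity $3$. An ordinary triple point on a threefold $X$ is an isolated singularity $O$ such that the tangent cone to $X$ at $O$ is a cone over a smooth surface of degree three.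
   Formalization: The triple point of the fourfold is assumed to lie on X_{3,3} (otherwise X_{3,3} may be smooth, with no triple point to blow up), and "double cover" means a surjective morphism that is generically two-to-one and may contract curves, since a finite double cover never occurs here. *)

theory Defs
  imports
    "HOL-Analysis.Analysis"
    "HOL-Library.Poly_Mapping"
    "HOL-Computational_Algebra.Computational_Algebra"
begin

section \<open>Polynomials over the complex numbers in finitely many variables\<close>

text \<open>The variables are indexed by a finite type; a monomial is its exponent vector.\<close>

type_synonym 'n mpoly = "('n \<Rightarrow>\<^sub>0 nat) \<Rightarrow>\<^sub>0 complex"

definition peval :: "('n::finite) mpoly \<Rightarrow> complex^'n \<Rightarrow> complex" where
  "peval P x =
     (\<Sum>m\<in>Poly_Mapping.keys P. Poly_Mapping.lookup P m * (\<Prod>i\<in>UNIV. (x $ i) ^ Poly_Mapping.lookup m i))"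

definition mdeg :: "('n::finite \<Rightarrow>\<^sub>0 nat) \<Rightarrow> nat" where
  "mdeg m = (\<Sum>i\<in>UNIV. Poly_Mapping.lookup m i)"

definition homogeneous :: "nat \<Rightarrow> ('n::finite) mpoly \<Rightarrow> bool" where
  "homogeneous d P \<longleftrightarrow> (\<forall>m\<in>Poly_Mapping.keys P. mdeg m = d)"

definition hom_part :: "nat \<Rightarrow> ('n::finite) mpoly \<Rightarrow> 'n mpoly" where
  "hom_part d P =
     (\<Sum>m\<in>{m\<in>Poly_Mapping.keys P. mdeg m = d}. Poly_Mapping.single m (Poly_Mapping.lookup P m))"

definition pscale :: "complex \<Rightarrow> ('n::finite) mpoly \<Rightarrow> 'n mpoly" where
  "pscale c P = Poly_Mapping.single 0 c * P"

interpretation mpoly: vector_space "pscale :: complex \<Rightarrow> ('n::finite) mpoly \<Rightarrow> 'n mpoly"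
proof
  fix a b :: complex and P Q :: "'n mpoly"
  show "pscale a (P + Q) = pscale a P + pscale a Q"
    by (simp add: pscale_def distrib_left)
  show "pscale (a + b) P = pscale a P + pscale b P"
    by (simp add: pscale_def distrib_right Poly_Mapping.single_add)
  show "pscale a (pscale b P) = pscale (a * b) P"
    by (simp add: pscale_def Poly_Mapping.mult_single flip: mult.assoc)
  show "pscale 1 P = P"
    by (simp add: pscale_def)
qed

definition ideal_of :: "'a::comm_ring_1 set \<Rightarrow> 'a set" where
  "ideal_of A = {f. \<exists>T c. finite T \<and> T \<subseteq> A \<and> f = (\<Sum>a\<in>T. c a * a)}"


section \<open>Projective space and the Zariski topology\<close>

text \<open>A point of the projective space with homogeneous coordinates indexed by \<open>'n\<close> is a line
  through the origin of \<^typ>\<open>complex^'n\<close>; thus \<open>6 pspace\<close> is projective 5-space.\<close>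

typedef (overloaded) ('n::finite) pspace =
  "{L. \<exists>x::complex^'n. x \<noteq> 0 \<and> L = range (\<lambda>c. c *s x)}"
  morphisms line_of Abs_pspace
proof -
  have "(1::complex^'n) \<noteq> 0" by simp
  then show ?thesis by blast
qed

definition pt :: "complex^('n::finite) \<Rightarrow> 'n pspace" where
  "pt x = Abs_pspace (range (\<lambda>c. c *s x))"

lemma line_of_pt: "x \<noteq> 0 \<Longrightarrow> line_of (pt x) = range (\<lambda>c. c *s x)"
  unfolding pt_def by (rule Abs_pspace_inverse) blast

definition hcoords :: "('n::finite) pspace \<Rightarrow> (complex^'n) set" where
  "hcoords q = line_of q - {0}"

lemma hcoords_iff: "x \<in> hcoords q \<longleftrightarrow> x \<noteq> 0 \<and> pt x = q"
proof
  assume x: "x \<in> hcoords q"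
  obtain y where y: "y \<noteq> 0" "line_of q = range (\<lambda>c. c *s y)"
    using line_of [of q] by blast
  with x obtain c where c: "x = c *s y" "x \<noteq> 0"
    by (auto simp: hcoords_def)
  then have "c \<noteq> 0" by auto
  have "range (\<lambda>c. c *s x) = range (\<lambda>c. c *s y)"
  proof (intro subset_antisym subsetI)
    fix z assume "z \<in> range (\<lambda>c. c *s x)"
    then show "z \<in> range (\<lambda>c. c *s y)" using c by (auto simp: vector_smult_assoc)
  next
    fix z assume "z \<in> range (\<lambda>c. c *s y)"
    then obtain d where "z = d *s y" by blast
    then have "z = (d / c) *s x" using c \<open>c \<noteq> 0\<close> by (simp add: vector_smult_assoc)
    then show "z \<in> range (\<lambda>c. c *s x)" by blast
  qed
  then have "pt x = Abs_pspace (line_of q)" by (simp add: pt_def y)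
  then show "x \<noteq> 0 \<and> pt x = q" using c by (simp add: line_of_inverse)
next
  assume "x \<noteq> 0 \<and> pt x = q"
  moreover have "x \<in> range (\<lambda>c. c *s x)" by (rule range_eqI [of _ _ 1]) simp
  ultimately show "x \<in> hcoords q" using line_of_pt [of x] by (auto simp: hcoords_def)
qed

definition zeros :: "('n::finite) mpoly set \<Rightarrow> 'n pspace set" where
  "zeros S = {q. \<forall>P\<in>S. \<forall>x\<in>hcoords q. peval P x = 0}"

definition zclosed :: "('n::finite) pspace set \<Rightarrow> bool" where
  "zclosed Z \<longleftrightarrow> (\<exists>S. (\<forall>P\<in>S. \<exists>d. homogeneous d P) \<and> Z = zeros S)"

definition zclosure :: "('n::finite) pspace set \<Rightarrow> 'n pspace set" where
  "zclosure A = \<Inter>{Z. zclosed Z \<and> A \<subseteq> Z}"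

definition zirreducible :: "('n::finite) pspace set \<Rightarrow> bool" where
  "zirreducible Z \<longleftrightarrow> zclosed Z \<and> Z \<noteq> {} \<and>
     (\<forall>A B. zclosed A \<and> zclosed B \<and> Z = A \<union> B \<longrightarrow> Z = A \<or> Z = B)"

definition components :: "('n::finite) pspace set \<Rightarrow> 'n pspace set set" where
  "components Z = {C. zirreducible C \<and> C \<subseteq> Z \<and> (\<forall>D. zirreducible D \<and> C \<subseteq> D \<and> D \<subseteq> Z \<longrightarrow> D = C)}"

text \<open>Vanishing on the whole line, origin included, makes this the homogeneous ideal of \<open>Z\<close>
  (for nonempty \<open>Z\<close>).\<close>

definition vanishing_ideal :: "('n::finite) pspace set \<Rightarrow> 'n mpoly set" where
  "vanishing_ideal Z = {P. \<forall>q\<in>Z. \<forall>x\<in>line_of q. peval P x = 0}"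


section \<open>Dimension and degree\<close>

text \<open>Dimension and degree are read off the Hilbert polynomial of the homogeneous coordinate
  ring: if it has degree \<open>r\<close> and leading coefficient \<open>a\<close>, they are \<open>r\<close> and \<open>r! a\<close>.\<close>

definition hilbert_function :: "('n::finite) pspace set \<Rightarrow> nat \<Rightarrow> nat" where
  "hilbert_function Z d =
     mpoly.dim {P :: 'n mpoly. homogeneous d P} - mpoly.dim {P \<in> vanishing_ideal Z. homogeneous d P}"

definition is_hilbert_poly :: "('n::finite) pspace set \<Rightarrow> real poly \<Rightarrow> bool" where
  "is_hilbert_poly Z h \<longleftrightarrow> (\<forall>\<^sub>F d in sequentially. poly h (real d) = real (hilbert_function Z d))"

definition has_dim :: "('n::finite) pspace set \<Rightarrow> nat \<Rightarrow> bool" where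
  "has_dim Z r \<longleftrightarrow> (\<exists>h. is_hilbert_poly Z h \<and> h \<noteq> 0 \<and> degree h = r)"

definition has_degree :: "('n::finite) pspace set \<Rightarrow> nat \<Rightarrow> bool" where
  "has_degree Z e \<longleftrightarrow>
     (\<exists>h. is_hilbert_poly Z h \<and> h \<noteq> 0 \<and> fact (degree h) * lead_coeff h = real e)"

definition is_surface :: "('n::finite) pspace set \<Rightarrow> bool" where
  "is_surface Z \<longleftrightarrow> zclosed Z \<and> Z \<noteq> {} \<and> (\<forall>C\<in>components Z. has_dim C 2)"


section \<open>Singular points, multiplicity and tangent cones\<close>

text \<open>The Zariski tangent space at a point of the affine cone over \<open>q\<close>. Its dimension is one more
  than that of the tangent space of \<open>Z\<close> at \<open>q\<close>.\<close>

definition tangent_space :: "('n::finite) pspace set \<Rightarrow> 'n pspace \<Rightarrow> (complex^'n) set" where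
  "tangent_space Z q =
     {v. \<forall>P\<in>vanishing_ideal Z. \<forall>x\<in>hcoords q. deriv (\<lambda>t. peval P (x + t *s v)) 0 = 0}"

text \<open>To be used for equidimensional \<open>Z\<close>.\<close>

definition singular_points :: "('n::finite) pspace set \<Rightarrow> 'n pspace set" where
  "singular_points Z = {q\<in>Z. \<exists>r. has_dim Z r \<and> vec.dim (tangent_space Z q) \<noteq> r + 1}"

definition isolated_singularity :: "('n::finite) pspace set \<Rightarrow> 'n pspace \<Rightarrow> bool" where
  "isolated_singularity Z p \<longleftrightarrow>
     p \<in> singular_points Z \<and> (\<exists>C. zclosed C \<and> p \<notin> C \<and> singular_points Z \<subseteq> insert p C)"

text \<open>An affine chart centred at \<open>p\<close>: \<open>v\<close> is mapped to the point with homogeneous coordinates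
  \<open>x + M v\<close>. Multiplicities and tangent cones do not depend on the chart.\<close>

definition affine_chart :: "('n::finite) pspace \<Rightarrow> complex^'n \<Rightarrow> complex^('m::finite)^'n \<Rightarrow> bool" where
  "affine_chart p x M \<longleftrightarrow> x \<in> hcoords p \<and> bij (\<lambda>(c, v). c *s x + M *v v)"

text \<open>\<open>Q\<close> is the polynomial \<open>P\<close> dehomogenised in that chart.\<close>

definition local_equation ::
  "complex^('n::finite) \<Rightarrow> complex^('m::finite)^'n \<Rightarrow> 'n mpoly \<Rightarrow> 'm mpoly \<Rightarrow> bool" where
  "local_equation x M P Q \<longleftrightarrow> (\<forall>v. peval Q v = peval P (x + M *v v))"

definition order_at_0 :: "('m::finite) mpoly \<Rightarrow> nat" where
  "order_at_0 Q = (LEAST d. hom_part d Q \<noteq> 0)"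

definition initial_form :: "('m::finite) mpoly \<Rightarrow> 'm mpoly" where
  "initial_form Q = hom_part (order_at_0 Q) Q"

text \<open>The multiplicity at \<open>p\<close> of the hypersurface in projective 5-space defined by \<open>H\<close>.\<close>

definition has_multiplicity :: "6 mpoly \<Rightarrow> 6 pspace \<Rightarrow> nat \<Rightarrow> bool" where
  "has_multiplicity H p k \<longleftrightarrow>
     (\<exists>x (M :: complex^5^6) Q. affine_chart p x M \<and> local_equation x M H Q \<and> Q \<noteq> 0 \<and> order_at_0 Q = k)"

definition tangent_cone_ideal ::
  "complex^('n::finite) \<Rightarrow> complex^('m::finite)^'n \<Rightarrow> 'n pspace set \<Rightarrow> 'm mpoly set" where
  "tangent_cone_ideal x M X =
     ideal_of {initial_form Q | Q. \<exists>P\<in>vanishing_ideal X. local_equation x M P Q}"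

text \<open>The tangent cone is taken with its scheme structure: it is the cone over a smooth surface
  \<open>S\<close> of degree three if its ideal is the homogeneous ideal of \<open>S\<close>. Here \<open>S\<close> lies in the
  projective 4-space of tangent directions of projective 5-space at \<open>p\<close>.\<close>

definition ordinary_triple_point :: "6 pspace set \<Rightarrow> 6 pspace \<Rightarrow> bool" where
  "ordinary_triple_point X p \<longleftrightarrow>
     isolated_singularity X p \<and>
     (\<exists>x (M :: complex^5^6) S. affine_chart p x M \<and>
        is_surface S \<and> singular_points S = {} \<and> has_degree S 3 \<and>
        tangent_cone_ideal x M X = vanishing_ideal S)"


section \<open>Complete intersections of two cubics\<close>

text \<open>\<open>X\<close> is a threefold which is the complete intersection of the cubics \<open>F = 0\<close> and \<open>G = 0\<close>:
  an irreducible threefold whose homogeneous ideal is generated by \<open>F\<close> and \<open>G\<close>.\<close>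

definition cubic_complete_intersection :: "6 mpoly \<Rightarrow> 6 mpoly \<Rightarrow> 6 pspace set \<Rightarrow> bool" where
  "cubic_complete_intersection F G X \<longleftrightarrow>
     homogeneous 3 F \<and> homogeneous 3 G \<and> X = zeros {F, G} \<and>
     zirreducible X \<and> has_dim X 3 \<and> vanishing_ideal X = ideal_of {F, G}"

definition cubic_threefold :: "5 pspace set \<Rightarrow> bool" where
  "cubic_threefold Y \<longleftrightarrow> (\<exists>f. homogeneous 3 f \<and> irreducible f \<and> Y = zeros {f})"


section \<open>Blowing up a point\<close>

definition segre :: "complex^('n::finite) \<Rightarrow> complex^('k::finite) \<Rightarrow> complex^('n \<times> 'k)" where
  "segre x y = (\<chi> k. x $ fst k * y $ snd k)"

text \<open>For fixed \<open>y\<close>, the \<open>minors y x\<close> are linear forms in \<open>x\<close> generating the ideal of the point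
  \<open>pt y\<close>. The blow-up of \<open>X\<close> at this point is the closure of the graph of the rational map they
  define, made a projective variety by the Segre embedding.\<close>

definition minors :: "complex^('n::finite) \<Rightarrow> complex^'n \<Rightarrow> complex^('n \<times> 'n)" where
  "minors y x = (\<chi> k. y $ fst k * x $ snd k - y $ snd k * x $ fst k)"

definition blowup :: "('n::finite) pspace set \<Rightarrow> 'n pspace \<Rightarrow> ('n \<times> 'n \<times> 'n) pspace set" where
  "blowup X p = zclosure {pt (segre x (minors y x)) | x y q. q \<in> X - {p} \<and> x \<in> hcoords q \<and> y \<in> hcoords p}"


section \<open>Double covers\<close>

definition regular_map ::
  "('n::finite) pspace set \<Rightarrow> ('n pspace \<Rightarrow> ('m::finite) pspace) \<Rightarrow> bool" where
  "regular_map W \<phi> \<longleftrightarrow>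
     (\<forall>w\<in>W. \<exists>C d (f :: 'm \<Rightarrow> 'n mpoly). zclosed C \<and> w \<notin> C \<and> (\<forall>j. homogeneous d (f j)) \<and>
        (\<forall>u\<in>W - C. \<forall>x\<in>hcoords u. (\<chi> j. peval (f j) x) \<noteq> 0 \<and> \<phi> u = pt (\<chi> j. peval (f j) x)))"

definition fibre :: "'a set \<Rightarrow> ('a \<Rightarrow> 'b) \<Rightarrow> 'b \<Rightarrow> 'a set" where
  "fibre W \<phi> y = {w\<in>W. \<phi> w = y}"

text \<open>A double cover is a surjective morphism onto an irreducible variety, generically two-to-one;
  it may contract curves. (The projection of a complete intersection of two cubics from the vertex
  of a cone in its pencil contracts the lines through the vertex: if the residual cubic is
  \<open>s\<^sup>2 L + s Q + C\<close>, these are given by \<open>L = Q = C = 0\<close> in the base of the cone, in general 18 points.)\<close>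

definition double_cover ::
  "('n::finite) pspace set \<Rightarrow> ('m::finite) pspace set \<Rightarrow> ('n pspace \<Rightarrow> 'm pspace) \<Rightarrow> bool" where
  "double_cover W Y \<phi> \<longleftrightarrow>
     zirreducible Y \<and> regular_map W \<phi> \<and> \<phi> ` W = Y \<and>
     (\<exists>C. zclosed C \<and> \<not> Y \<subseteq> C \<and> (\<forall>y\<in>Y - C. card (fibre W \<phi> y) = 2)) \<and>
     (\<forall>y\<in>Y. finite (fibre W \<phi> y) \<longrightarrow> card (fibre W \<phi> y) \<le> 2)"

text \<open>The cardinality of an infinite set being 0, the points with positive-dimensional fibre belong
  to the branch locus.\<close>

definition branch_locus ::
  "('n::finite) pspace set \<Rightarrow> ('m::finite) pspace set \<Rightarrow> ('n pspace \<Rightarrow> 'm pspace) \<Rightarrow> 'm pspace set" where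
  "branch_locus W Y \<phi> = {y\<in>Y. card (fibre W \<phi> y) \<noteq> 2}"

end

theory Submission
  imports Defs "HOL-Computational_Algebra.Field_as_Ring"
begin

text \<open>
  A cubic with a triple point is a cone. So the pencil contains a cone \<open>H\<close> whose vertex \<open>p\<close> lies on \<open>X\<close>; in
  coordinates \<open>(c, v)\<close> with \<open>p\<close> at \<open>v = 0\<close> it is a cubic form \<open>C(v)\<close>, and a second cubic of the pencil is
  \<open>G = c\<^sup>2 L(v) + c Q(v) + K(v)\<close>. Projection from \<open>p\<close> maps the blow-up of \<open>X\<close> at \<open>p\<close> to the cubic threefold \<open>C = 0\<close>. The
  fibre over \<open>v\<close> consists of the zeros \<open>(c : t)\<close> of \<open>c\<^sup>2 L + c t Q + t\<^sup>2 K\<close>, so that there are two points unless the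
  quartic \<open>D = Q\<^sup>2 - 4 L K\<close> vanishes. The branch locus is \<open>C = D = 0\<close>, of degree \<open>3 * 4 = 12\<close>.

  The vertex is singular on \<open>X\<close>, hence an ordinary triple point. Its tangent cone is given by \<open>C\<close> and the lowest
  nonzero form among \<open>L\<close>, \<open>Q\<close>, \<open>K\<close>; having degree three, it is the cone over \<open>C = L = 0\<close> (\<open>lowest_form_linear\<close>), which is
  therefore smooth. As the ideal of \<open>X\<close> is prime and generated by two cubics, \<open>C\<close> is irreducible and does not
  divide \<open>D\<close>.

  Degrees and dimensions are read off Hilbert polynomials, so the degree of the branch surface is known once the ideal
  generated by \<open>C\<close> and \<open>D\<close> is shown to be radical. This is the main point (\<open>radical\<close>). If it fails, then
  \<open>radical_or_dependent\<close> gives an open piece of the surface on which the derivatives of \<open>C\<close> and \<open>D\<close> are dependent. Where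
  \<open>L \<noteq> 0\<close>, \<open>X\<close> is singular above such points, while its singularities are isolated; and \<open>L = 0\<close> on the whole piece
  contradicts the smoothness of \<open>C = L = 0\<close>. The criterion \<open>radical_or_dependent\<close> comes from the norm of \<open>D\<close>
  along the three sheets of \<open>C = 0\<close> over a hyperplane.

  The dimension of the components (\<open>component_dim\<close>) needs the existence of Hilbert polynomials and the decomposition into
  irreducible sets; both are obtained from leading monomials and the lemma of Dickson. The blow-up is identified in
  \<open>blowup_eq\<close>: explicit equations show that the candidate is closed, and limits show that it is contained in
  the closure of the graph.
\<close>

no_notation fps_nth (infixl "$" 75)

section \<open>Polynomials in several variables\<close>

definition mon :: "('n::finite \<Rightarrow>\<^sub>0 nat) \<Rightarrow> complex^'n \<Rightarrow> complex" where
  "mon m x = (\<Prod>i\<in>UNIV. (x $ i) ^ Poly_Mapping.lookup m i)"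

lemma peval_superset:
  assumes "finite A" "Poly_Mapping.keys P \<subseteq> A"
  shows "peval P x = (\<Sum>m\<in>A. Poly_Mapping.lookup P m * mon m x)"
  unfolding peval_def mon_def
  by (rule sum.mono_neutral_left) (use assms in \<open>auto simp: in_keys_iff\<close>)

lemma peval_mon: "peval P x = (\<Sum>m\<in>Poly_Mapping.keys P. Poly_Mapping.lookup P m * mon m x)"
  by (rule peval_superset) auto

lemma peval_0 [simp]: "peval 0 x = 0"
  by (simp add: peval_def)

lemma peval_add [simp]: "peval (P + Q) x = peval P x + peval Q x"
proof -
  let ?A = "Poly_Mapping.keys P \<union> Poly_Mapping.keys Q"
  have "Poly_Mapping.keys (P + Q) \<subseteq> ?A" by (rule keys_add)
  then show ?thesis
    by (simp add: peval_superset [of ?A] lookup_add sum.distrib algebra_simps)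
qed

lemma peval_single [simp]: "peval (Poly_Mapping.single m c) x = c * mon m x"
  by (simp add: peval_mon)

lemma mon_0 [simp]: "mon 0 x = 1"
  by (simp add: mon_def)

lemma mon_add: "mon (m + n) x = mon m x * mon n x"
  by (simp add: mon_def lookup_add power_add prod.distrib)

lemma mon_scale: "mon m (c *s x) = c ^ mdeg m * mon m x"
  by (simp add: mon_def mdeg_def power_mult_distrib prod.distrib power_sum)

lemma peval_1 [simp]: "peval 1 x = 1"
  using peval_single [of 0 1 x] by simp

lemma peval_uminus [simp]: "peval (- P) x = - peval P x"
  using peval_add [of P "- P" x] by (simp add: add_eq_0_iff)

lemma peval_diff [simp]: "peval (P - Q) x = peval P x - peval Q x"
  using peval_add [of P "- Q" x] by simp

lemma peval_sum [simp]: "peval (sum f A) x = (\<Sum>a\<in>A. peval (f a) x)"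
  by (induction A rule: infinite_finite_induct) auto

lemma mpoly_decomp: "P = (\<Sum>m\<in>Poly_Mapping.keys P. Poly_Mapping.single m (Poly_Mapping.lookup P m))"
proof (rule poly_mapping_eqI)
  fix k
  show "Poly_Mapping.lookup P k = Poly_Mapping.lookup (\<Sum>m\<in>Poly_Mapping.keys P. Poly_Mapping.single m (Poly_Mapping.lookup P m)) k"
    by (cases "k \<in> Poly_Mapping.keys P")
      (auto simp: lookup_sum lookup_single when_def sum.delta' in_keys_iff)
qed

lemma mpoly_induct [case_names single add]:
  fixes P :: "('n::finite) mpoly"
  assumes "\<And>m c. \<Phi> (Poly_Mapping.single m c)" and "\<And>P Q. \<Phi> P \<Longrightarrow> \<Phi> Q \<Longrightarrow> \<Phi> (P + Q)"
  shows "\<Phi> P"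
proof -
  have z: "\<Phi> 0" using assms(1) [of 0 0] by simp
  have "\<Phi> (\<Sum>m\<in>A. Poly_Mapping.single m (Poly_Mapping.lookup P m))" for A
    by (induction A rule: infinite_finite_induct) (use z assms in auto)
  then show ?thesis using mpoly_decomp [of P] by metis
qed

lemma peval_mult [simp]: "peval (P * Q) x = peval P x * peval Q x"
proof (induction P rule: mpoly_induct)
  case (single m c)
  show ?case
  proof (induction Q rule: mpoly_induct)
    case (single n d)
    show ?case by (simp add: mult_single mon_add)
  qed (simp add: algebra_simps)
qed (simp add: algebra_simps)

lemma peval_power [simp]: "peval (P ^ k) x = peval P x ^ k"
  by (induction k) auto

lemma peval_prod [simp]: "peval (prod f A) x = (\<Prod>a\<in>A. peval (f a) x)"
  by (induction A rule: infinite_finite_induct) auto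

lemma peval_pscale [simp]: "peval (pscale c P) x = c * peval P x"
  by (simp add: pscale_def)

lemma mpoly_fun_induct [case_names const coord add mult]:
  fixes P :: "('n::finite) mpoly"
  assumes c: "\<And>c. \<Phi> (\<lambda>x. c)" and X: "\<And>i. \<Phi> (\<lambda>x. x $ i)"
    and a: "\<And>f g. \<Phi> f \<Longrightarrow> \<Phi> g \<Longrightarrow> \<Phi> (\<lambda>x. f x + g x)"
    and m: "\<And>f g. \<Phi> f \<Longrightarrow> \<Phi> g \<Longrightarrow> \<Phi> (\<lambda>x. f x * g x)"
  shows "\<Phi> (peval P)"
proof (induction P rule: mpoly_induct)
  case (single n d)
  have pw: "\<Phi> (\<lambda>x. x $ i ^ k)" for i k
    by (induction k) (use c [of 1] m [OF X] in auto)
  have "\<Phi> (\<lambda>x. \<Prod>i\<in>A. x $ i ^ Poly_Mapping.lookup n i)" for A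
    by (induction A rule: infinite_finite_induct) (use c [of 1] m [OF pw] in auto)
  from m [OF c this] have "\<Phi> (\<lambda>x. d * mon n x)" unfolding mon_def .
  moreover have "peval (Poly_Mapping.single n d) = (\<lambda>x. d * mon n x)" by auto
  ultimately show ?case by simp
next
  case (add P Q)
  moreover have "peval (P + Q) = (\<lambda>x. peval P x + peval Q x)" by auto
  ultimately show ?case using a by simp
qed

definition polyfun :: "(complex^('n::finite) \<Rightarrow> complex) \<Rightarrow> bool" where
  "polyfun f \<longleftrightarrow> (\<exists>P. \<forall>x. peval P x = f x)"

lemma polyfun_peval [intro]: "polyfun (peval P)" "polyfun (\<lambda>x. peval P x)"
  by (auto simp: polyfun_def)

lemma polyfun_const [intro]: "polyfun (\<lambda>x. c)"
  unfolding polyfun_def by (rule exI [of _ "Poly_Mapping.single 0 c"]) simp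

lemma polyfun_coord [intro]: fixes i :: "'n::finite" shows "polyfun (\<lambda>x. x $ i)"
proof -
  have "peval (Poly_Mapping.single (Poly_Mapping.single i 1) 1) x = x $ i" for x :: "complex^'n"
  proof -
    have "mon (Poly_Mapping.single i 1) x = (\<Prod>j\<in>UNIV. if j = i then x $ i else 1)"
      unfolding mon_def by (rule prod.cong) (auto simp: lookup_single when_def)
    then show ?thesis by simp
  qed
  then show ?thesis unfolding polyfun_def by blast
qed

lemma polyfun_add [intro]: "polyfun f \<Longrightarrow> polyfun g \<Longrightarrow> polyfun (\<lambda>x. f x + g x)"
  unfolding polyfun_def using peval_add by metis

lemma polyfun_mult [intro]: "polyfun f \<Longrightarrow> polyfun g \<Longrightarrow> polyfun (\<lambda>x. f x * g x)"
  unfolding polyfun_def using peval_mult by metis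

lemma polyfun_uminus [intro]: "polyfun f \<Longrightarrow> polyfun (\<lambda>x. - f x)"
  unfolding polyfun_def using peval_uminus by metis

lemma polyfun_diff [intro]: "polyfun f \<Longrightarrow> polyfun g \<Longrightarrow> polyfun (\<lambda>x. f x - g x)"
  unfolding polyfun_def using peval_diff by metis

lemma polyfun_power [intro]: "polyfun f \<Longrightarrow> polyfun (\<lambda>x. f x ^ k)"
  unfolding polyfun_def using peval_power by metis

lemma polyfun_sum [intro]: "(\<And>i. i \<in> A \<Longrightarrow> polyfun (f i)) \<Longrightarrow> polyfun (\<lambda>x. \<Sum>i\<in>A. f i x)"
  by (induction A rule: infinite_finite_induct) auto

lemma polyfun_comp:
  assumes "\<And>i. polyfun (\<lambda>x. g x $ i)" shows "polyfun (\<lambda>x. peval P (g x))"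
proof -
  have "polyfun (\<lambda>x. f (g x))" if "f = peval P" for f
  proof -
    have "polyfun (\<lambda>x. peval P (g x))"
      by (induction P rule: mpoly_fun_induct) (use assms in auto)
    then show ?thesis using that by simp
  qed
  then show ?thesis by blast
qed

lemma polyfun_linear: "polyfun (\<lambda>x. (M *v x) $ i)"
  unfolding matrix_vector_mult_def
  by (simp, intro polyfun_sum polyfun_mult polyfun_const polyfun_coord)

lemma polyfun_affine: "polyfun (\<lambda>v. peval P (x + M *v v))"
  by (rule polyfun_comp) (auto intro: polyfun_linear)

text \<open>Polynomials are determined by their values. The substitution \<open>x\<^sub>i = t ^ (B ^ i)\<close> for large \<open>B\<close> sends
  distinct monomials to distinct powers of \<open>t\<close>; that the powers are distinct is the uniqueness of digits
  in base \<open>B\<close>, and the claim is reduced to polynomials in one variable.\<close>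

lemma digits_unique:
  fixes a b :: "nat \<Rightarrow> nat"
  assumes "\<forall>k<n. a k < B" "\<forall>k<n. b k < B" "(\<Sum>k<n. a k * B ^ k) = (\<Sum>k<n. b k * B ^ k)"
  shows "\<forall>k<n. a k = b k"
  using assms
proof (induction n arbitrary: a b)
  case (Suc n)
  have e: "(\<Sum>k<Suc n. f k * B ^ k) = f 0 + B * (\<Sum>k<n. f (Suc k) * B ^ k)" for f :: "nat \<Rightarrow> nat"
    by (subst sum.lessThan_Suc_shift) (simp add: sum_distrib_left mult_ac)
  have eq: "a 0 + B * (\<Sum>k<n. a (Suc k) * B ^ k) = b 0 + B * (\<Sum>k<n. b (Suc k) * B ^ k)"
    using Suc.prems(3) unfolding e .
  have lt: "a 0 < B" "b 0 < B" using Suc.prems by auto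
  have "a 0 = b 0" using arg_cong [OF eq, of "\<lambda>z. z mod B"] lt by simp
  moreover have "(\<Sum>k<n. a (Suc k) * B ^ k) = (\<Sum>k<n. b (Suc k) * B ^ k)"
    using eq lt \<open>a 0 = b 0\<close> by simp
  then have "\<forall>k<n. a (Suc k) = b (Suc k)"
    by (intro Suc.IH) (use Suc.prems in auto)
  ultimately show ?case by (auto simp: less_Suc_eq_0_disj)
qed simp

lemma peval_inj_0:
  fixes P :: "('n::finite) mpoly"
  assumes "\<And>x. peval P x = 0" shows "P = 0"
proof (rule poly_mapping_eqI)
  fix m0
  obtain h :: "'n \<Rightarrow> nat" where h: "bij_betw h UNIV {0..<CARD('n)}"
    using ex_bij_betw_finite_nat [of "UNIV :: 'n set"] by auto
  define N where "N = CARD('n)"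
  define A where "A = insert m0 (Poly_Mapping.keys P)"
  define B where "B = Suc (Max (\<Union>m\<in>A. range (Poly_Mapping.lookup m)))"
  have B: "Poly_Mapping.lookup m i < B" if "m \<in> A" for m i
    unfolding B_def A_def less_Suc_eq_le by (rule Max_ge) (use that in \<open>auto simp: A_def\<close>)
  define e where "e m = (\<Sum>i\<in>UNIV. Poly_Mapping.lookup m i * B ^ h i)" for m
  have e: "e m = (\<Sum>k<N. Poly_Mapping.lookup m (inv_into UNIV h k) * B ^ k)" for m
  proof -
    have "bij_betw h UNIV {..<N}" using h by (simp add: N_def atLeast0LessThan)
    from sum.reindex_bij_betw [OF this, of "\<lambda>k. Poly_Mapping.lookup m (inv_into UNIV h k) * B ^ k"]
    show ?thesis using h by (simp add: e_def bij_betw_def inv_into_f_f)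
  qed
  have inj: "m = n" if "m \<in> A" "n \<in> A" "e m = e n" for m n
  proof (rule poly_mapping_eqI)
    fix i
    have "\<forall>k<N. Poly_Mapping.lookup m (inv_into UNIV h k) = Poly_Mapping.lookup n (inv_into UNIV h k)"
      by (rule digits_unique [of _ _ B]) (use that B e in auto)
    moreover have "h i < N" using h by (auto simp: N_def bij_betw_def)
    ultimately show "Poly_Mapping.lookup m i = Poly_Mapping.lookup n i"
      using h by (metis bij_betw_def inv_into_f_f UNIV_I)
  qed
  define q where "q = (\<Sum>m\<in>A. monom (Poly_Mapping.lookup P m) (e m))"
  have "poly q t = 0" for t
  proof -
    have "mon m (\<chi> i. t ^ (B ^ h i)) = t ^ e m" for m
      by (simp add: mon_def e_def power_sum power_mult [symmetric] mult.commute)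
    then have "poly q t = peval P (\<chi> i. t ^ (B ^ h i))"
      unfolding q_def by (subst peval_superset [of A]) (auto simp: A_def poly_sum poly_monom)
    then show ?thesis using assms by simp
  qed
  then have "q = 0" using poly_all_0_iff_0 by blast
  have "coeff q (e m0) = (\<Sum>m\<in>A. if m = m0 then Poly_Mapping.lookup P m else 0)"
    unfolding q_def coeff_sum coeff_monom
    by (rule sum.cong) (use inj [of _ m0] in \<open>auto simp: A_def\<close>)
  then have "coeff q (e m0) = Poly_Mapping.lookup P m0" by (simp add: A_def sum.delta')
  then show "Poly_Mapping.lookup P m0 = Poly_Mapping.lookup 0 m0" using \<open>q = 0\<close> by simp
qed

lemma peval_inj: "(\<And>x. peval P x = peval Q x) \<Longrightarrow> P = Q"
  using peval_inj_0 [of "P - Q"] by simp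

subsection \<open>Homogeneous polynomials and their parts\<close>

lemma peval_homogeneous: "homogeneous d P \<Longrightarrow> peval P (c *s x) = c ^ d * peval P x"
  by (simp add: peval_mon mon_scale homogeneous_def sum_distrib_left mult_ac)

lemma homogeneousI:
  fixes P :: "('n::finite) mpoly"
  assumes "\<And>c x. c \<noteq> 0 \<Longrightarrow> peval P (c *s x) = c ^ d * peval P x"
  shows "homogeneous d P"
  unfolding homogeneous_def
proof
  fix m assume m: "m \<in> Poly_Mapping.keys P"
  define R where "R = (\<Sum>m\<in>Poly_Mapping.keys P. Poly_Mapping.single m (Poly_Mapping.lookup P m * (2 ^ mdeg m - 2 ^ d)))"
  have "peval R x = peval P (2 *s x) - 2 ^ d * peval P x" for x
    unfolding R_def peval_mon [of P] by (simp add: mon_scale sum_distrib_left sum_subtractf [symmetric] algebra_simps)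
  then have "R = 0" using assms [of 2] by (intro peval_inj_0) simp
  have "Poly_Mapping.lookup R m = Poly_Mapping.lookup P m * (2 ^ mdeg m - 2 ^ d)"
    unfolding R_def using m by (simp add: lookup_sum lookup_single when_def)
  then have "(2::complex) ^ mdeg m = 2 ^ d" using \<open>R = 0\<close> m by (simp add: in_keys_iff)
  then have "norm ((2::complex) ^ mdeg m) = norm ((2::complex) ^ d)" by simp
  then have "(2::real) ^ mdeg m = 2 ^ d" by (simp add: norm_power)
  then show "mdeg m = d" by simp
qed

lemma homogeneous_0 [simp]: "homogeneous d 0"
  by (simp add: homogeneous_def)

lemma homogeneous_mult: "homogeneous d P \<Longrightarrow> homogeneous e Q \<Longrightarrow> homogeneous (d + e) (P * Q)"
  by (rule homogeneousI) (simp add: peval_homogeneous power_add)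

lemma homogeneous_add: "homogeneous d P \<Longrightarrow> homogeneous d Q \<Longrightarrow> homogeneous d (P + Q)"
  by (rule homogeneousI) (simp add: peval_homogeneous algebra_simps)

lemma homogeneous_pscale: "homogeneous d P \<Longrightarrow> homogeneous d (pscale c P)"
  by (rule homogeneousI) (simp add: peval_homogeneous)

lemma lookup_hom_part: "Poly_Mapping.lookup (hom_part d P) m = (if mdeg m = d then Poly_Mapping.lookup P m else 0)"
  unfolding hom_part_def by (auto simp: lookup_sum lookup_single when_def in_keys_iff)

lemma homogeneous_hom_part [simp]: "homogeneous d (hom_part d P)"
  unfolding homogeneous_def by (auto simp: in_keys_iff lookup_hom_part split: if_splits)

lemma hom_part_add: "hom_part d (P + Q) = hom_part d P + hom_part d Q"
  by (rule poly_mapping_eqI) (simp add: lookup_hom_part lookup_add)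

lemma hom_part_0 [simp]: "hom_part d 0 = 0"
  by (rule poly_mapping_eqI) (simp add: lookup_hom_part)

lemma hom_part_sum: "hom_part d (sum f A) = (\<Sum>a\<in>A. hom_part d (f a))"
  by (induction A rule: infinite_finite_induct) (auto simp: hom_part_add)

lemma hom_part_homogeneous: "homogeneous e P \<Longrightarrow> hom_part d P = (if d = e then P else 0)"
  by (rule poly_mapping_eqI) (auto simp: lookup_hom_part homogeneous_def in_keys_iff)

lemma hom_part_decomp: "P = (\<Sum>d\<in>mdeg ` Poly_Mapping.keys P. hom_part d P)"
  by (rule poly_mapping_eqI) (auto simp: lookup_sum lookup_hom_part sum.delta' in_keys_iff)

lemma hom_part_decomp':
  assumes "finite A" "mdeg ` Poly_Mapping.keys P \<subseteq> A"
  shows "P = (\<Sum>d\<in>A. hom_part d P)"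
proof (rule poly_mapping_eqI)
  fix k
  have "mdeg k \<notin> A \<Longrightarrow> Poly_Mapping.lookup P k = 0" using assms(2) by (metis image_subset_iff in_keys_iff)
  then show "Poly_Mapping.lookup P k = Poly_Mapping.lookup (\<Sum>d\<in>A. hom_part d P) k"
    using assms(1) by (auto simp: lookup_sum lookup_hom_part sum.delta')
qed

lemma hom_part_mult:
  assumes "homogeneous e H"
  shows "hom_part k (P * H) = (if e \<le> k then hom_part (k - e) P * H else 0)"
proof -
  let ?A = "mdeg ` Poly_Mapping.keys P"
  have "P * H = (\<Sum>d\<in>?A. hom_part d P) * H" using hom_part_decomp [of P] by simp
  also have "\<dots> = (\<Sum>d\<in>?A. hom_part d P * H)" by (simp add: sum_distrib_right)
  finally have "hom_part k (P * H) = (\<Sum>d\<in>?A. hom_part k (hom_part d P * H))"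
    by (simp add: hom_part_sum)
  also have "\<dots> = (\<Sum>d\<in>?A. if k = d + e then hom_part d P * H else 0)"
    by (intro sum.cong refl hom_part_homogeneous homogeneous_mult assms homogeneous_hom_part)
  also have "\<dots> = (if e \<le> k then hom_part (k - e) P * H else 0)"
  proof (cases "e \<le> k")
    case True
    then have "(\<Sum>d\<in>?A. if k = d + e then hom_part d P * H else 0) = (\<Sum>d\<in>?A. if d = k - e then hom_part d P * H else 0)"
      by (intro sum.cong) auto
    also have "\<dots> = (if k - e \<in> ?A then hom_part (k - e) P * H else 0)" by (simp add: sum.delta)
    also have "\<dots> = hom_part (k - e) P * H"
    proof (cases "k - e \<in> ?A")
      case False
      then have "mdeg m = k - e \<Longrightarrow> Poly_Mapping.lookup P m = 0" for m by (metis imageI in_keys_iff)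
      then have "hom_part (k - e) P = 0" by (intro poly_mapping_eqI) (simp add: lookup_hom_part)
      then show ?thesis by simp
    qed simp
    finally show ?thesis using True by simp
  qed (auto intro: sum.neutral)
  finally show ?thesis .
qed

lemma homogeneous_unique:
  assumes "homogeneous d P" "homogeneous e P" "P \<noteq> 0" shows "d = e"
  using hom_part_homogeneous [OF assms(1), of d] hom_part_homogeneous [OF assms(2), of d] assms(3)
  by metis

lemma homogeneous_nonzero_at_0: "homogeneous d P \<Longrightarrow> 0 < d \<Longrightarrow> peval P 0 = 0"
  using peval_homogeneous [of d P 0 0] by (simp add: zero_power)

lemma homogeneous_degree_0:
  assumes "homogeneous 0 P" shows "\<exists>c. P = Poly_Mapping.single 0 c"
proof (intro exI peval_inj)
  fix x
  show "peval P x = peval (Poly_Mapping.single 0 (peval P 0)) x"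
    using peval_homogeneous [OF assms, of 0 x] by simp
qed

subsection \<open>Continuity and directional derivatives\<close>

lemma continuous_peval [continuous_intros]: "continuous_on S f \<Longrightarrow> continuous_on S (\<lambda>x. peval P (f x))"
  unfolding peval_def by (intro continuous_intros)

lemma tendsto_peval [tendsto_intros]:
  "(f \<longlongrightarrow> l) F \<Longrightarrow> ((\<lambda>x. peval P (f x)) \<longlongrightarrow> peval P l) F"
  unfolding peval_def by (intro tendsto_intros)

lemma pderivs_ex:
  "\<exists>g::'n::finite \<Rightarrow> 'n mpoly. \<forall>x v t. ((\<lambda>t. peval P (x + t *s v)) has_field_derivative
      (\<Sum>i\<in>UNIV. peval (g i) (x + t *s v) * v $ i)) (at t)"
proof -
  define \<Phi> where "\<Phi> f \<longleftrightarrow> (\<exists>Q. f = peval Q) \<and> (\<exists>g::'n \<Rightarrow> 'n mpoly. \<forall>x v t. ((\<lambda>t. f (x + t *s v)) has_field_derivative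
      (\<Sum>i\<in>UNIV. peval (g i) (x + t *s v) * v $ i)) (at t))" for f :: "complex^'n \<Rightarrow> complex"
  have "\<Phi> (peval P)"
  proof (induction P rule: mpoly_fun_induct)
    case (const c)
    have "(\<lambda>x. c) = peval (Poly_Mapping.single 0 c)" by (auto simp: fun_eq_iff)
    then show ?case unfolding \<Phi>_def by (intro conjI exI [of _ "\<lambda>i. 0"] exI [of _ "Poly_Mapping.single 0 c"]) auto
  next
    case (coord i)
    obtain Q where Q: "\<forall>x::complex^'n. peval Q x = x $ i" using polyfun_coord unfolding polyfun_def by blast
    have s: "(\<Sum>j\<in>UNIV. peval (if j = i then 1 else 0) z * v $ j) = v $ i" for z v :: "complex^'n"
    proof -
      have "(\<Sum>j\<in>UNIV. peval (if j = i then 1 else 0) z * v $ j) = (\<Sum>j\<in>UNIV. if j = i then v $ j else 0)"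
        by (rule sum.cong) auto
      then show ?thesis by simp
    qed
    have d: "((\<lambda>t. (x + t *s v) $ i) has_field_derivative v $ i) (at t)" for x v :: "complex^'n" and t
      by (auto intro!: derivative_eq_intros)
    show ?case unfolding \<Phi>_def
    proof (intro conjI exI [of _ "\<lambda>j. if j = i then 1 else 0"] exI [of _ Q] allI)
      show "(\<lambda>x. x $ i) = peval Q" using Q by auto
      show "((\<lambda>t. (x + t *s v) $ i) has_field_derivative (\<Sum>j\<in>UNIV. peval (if j = i then 1 else 0) (x + t *s v) * v $ j)) (at t)" for x v :: "complex^'n" and t
        unfolding s by (rule d)
    qed
  next
    case (add f g)
    obtain P F where fP: "f = peval P"
      and F: "\<And>x v t. ((\<lambda>t. f (x + t *s v)) has_field_derivative (\<Sum>i\<in>UNIV. peval (F i) (x + t *s v) * v $ i)) (at t)"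
      using add(1) unfolding \<Phi>_def by blast
    obtain Q G where gQ: "g = peval Q"
      and G: "\<And>x v t. ((\<lambda>t. g (x + t *s v)) has_field_derivative (\<Sum>i\<in>UNIV. peval (G i) (x + t *s v) * v $ i)) (at t)"
      using add(2) unfolding \<Phi>_def by blast
    show ?case unfolding \<Phi>_def
    proof (intro conjI exI [of _ "P + Q"] exI [of _ "\<lambda>i. F i + G i"] allI)
      fix x v :: "complex^'n" and t
      show "((\<lambda>t. f (x + t *s v) + g (x + t *s v)) has_field_derivative (\<Sum>i\<in>UNIV. peval (F i + G i) (x + t *s v) * v $ i)) (at t)"
        by (rule DERIV_cong [OF DERIV_add [OF F G]]) (simp add: sum.distrib algebra_simps)
    qed (simp add: fun_eq_iff fP gQ)
  next
    case (mult f g)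
    obtain P F where fP: "f = peval P"
      and F: "\<And>x v t. ((\<lambda>t. f (x + t *s v)) has_field_derivative (\<Sum>i\<in>UNIV. peval (F i) (x + t *s v) * v $ i)) (at t)"
      using mult(1) unfolding \<Phi>_def by blast
    obtain Q G where gQ: "g = peval Q"
      and G: "\<And>x v t. ((\<lambda>t. g (x + t *s v)) has_field_derivative (\<Sum>i\<in>UNIV. peval (G i) (x + t *s v) * v $ i)) (at t)"
      using mult(2) unfolding \<Phi>_def by blast
    show ?case unfolding \<Phi>_def
    proof (intro conjI exI [of _ "P * Q"] exI [of _ "\<lambda>i. F i * Q + P * G i"] allI)
      fix x v :: "complex^'n" and t
      show "((\<lambda>t. f (x + t *s v) * g (x + t *s v)) has_field_derivative (\<Sum>i\<in>UNIV. peval (F i * Q + P * G i) (x + t *s v) * v $ i)) (at t)"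
        by (rule DERIV_cong [OF DERIV_mult [OF F G]])
          (simp add: fP gQ sum.distrib sum_distrib_left sum_distrib_right algebra_simps)
    qed (simp add: fun_eq_iff fP gQ)
  qed
  then show ?thesis unfolding \<Phi>_def by blast
qed

text \<open>The gradient is fixed by the property that it computes all derivatives along lines; its existence is
  an induction over the polynomial functions.\<close>

definition pderivs :: "('n::finite) mpoly \<Rightarrow> 'n \<Rightarrow> 'n mpoly" where
  "pderivs P = (SOME g. \<forall>x v t. ((\<lambda>t. peval P (x + t *s v)) has_field_derivative
      (\<Sum>i\<in>UNIV. peval (g i) (x + t *s v) * v $ i)) (at t))"

definition dP :: "('n::finite) mpoly \<Rightarrow> complex^'n \<Rightarrow> complex^'n \<Rightarrow> complex" where
  "dP P x v = (\<Sum>i\<in>UNIV. peval (pderivs P i) x * v $ i)"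

lemma has_deriv_dP: "((\<lambda>t. peval P (x + t *s v)) has_field_derivative dP P (x + t *s v) v) (at t)"
  unfolding dP_def pderivs_def using someI_ex [OF pderivs_ex [of P]] by blast

lemma has_deriv_dP_0: "((\<lambda>t. peval P (x + t *s v)) has_field_derivative dP P x v) (at 0)"
  using has_deriv_dP [of P x v 0] by simp

lemma deriv_peval: "deriv (\<lambda>t. peval P (x + t *s v)) 0 = dP P x v"
  using has_deriv_dP_0 by (rule DERIV_imp_deriv)

lemma dP_unique: "((\<lambda>t. peval P (x + t *s v)) has_field_derivative a) (at 0) \<Longrightarrow> dP P x v = a"
  using has_deriv_dP_0 DERIV_unique by blast

lemma dP_add_poly [simp]: "dP (P + Q) x v = dP P x v + dP Q x v"
  by (rule dP_unique) (auto intro!: derivative_eq_intros has_deriv_dP_0)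

lemma dP_mult_poly [simp]: "dP (P * Q) x v = dP P x v * peval Q x + peval P x * dP Q x v"
  by (rule dP_unique) (auto intro!: derivative_eq_intros has_deriv_dP_0)

lemma dP_uminus_poly [simp]: "dP (- P) x v = - dP P x v"
  by (rule dP_unique) (auto intro!: derivative_eq_intros has_deriv_dP_0)

lemma dP_diff_poly [simp]: "dP (P - Q) x v = dP P x v - dP Q x v"
  by (rule dP_unique) (auto intro!: derivative_eq_intros has_deriv_dP_0)

lemma dP_add [simp]: "dP P x (v + w) = dP P x v + dP P x w"
  by (simp add: dP_def sum.distrib algebra_simps)

lemma dP_scale [simp]: "dP P x (c *s v) = c * dP P x v"
  by (simp add: dP_def sum_distrib_left mult_ac)

lemma dP_0_right [simp]: "dP P x 0 = 0"
  by (simp add: dP_def)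

lemma polyfun_dP [intro]: "polyfun (\<lambda>x. dP P x v)"
  unfolding dP_def by (intro polyfun_sum polyfun_mult) auto

lemma continuous_dP [continuous_intros]: "continuous_on S f \<Longrightarrow> continuous_on S (\<lambda>x. dP P (f x) v)"
  unfolding dP_def by (intro continuous_intros)

lemma tendsto_dP [tendsto_intros]:
  "(f \<longlongrightarrow> l) F \<Longrightarrow> ((\<lambda>x. dP P (f x) v) \<longlongrightarrow> dP P l v) F"
  unfolding dP_def by (intro tendsto_intros)

lemma euler_dP:
  assumes "homogeneous d P" shows "dP P x x = of_nat d * peval P x"
proof (rule dP_unique)
  have "x + t *s x = (1 + t) *s x" for t by (simp add: vector_sadd_rdistrib)
  then have "(\<lambda>t. peval P (x + t *s x)) = (\<lambda>t. (1 + t) ^ d * peval P x)"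
    by (simp only: peval_homogeneous [OF assms])
  moreover have "((\<lambda>t. (1 + t) ^ d * peval P x) has_field_derivative of_nat d * peval P x) (at 0)"
    by (auto intro!: derivative_eq_intros)
  ultimately show "((\<lambda>t. peval P (x + t *s x)) has_field_derivative of_nat d * peval P x) (at 0)" by simp
qed

lemma dP_homogeneous:
  assumes "homogeneous (Suc d) P" "c \<noteq> 0" shows "dP P (c *s x) v = c ^ d * dP P x v"
proof -
  have "c * dP P (c *s x) v = dP P (c *s x) (c *s v)" by simp
  also have "\<dots> = c ^ Suc d * dP P x v"
  proof (rule dP_unique)
    have "c *s x + t *s (c *s v) = c *s (x + t *s v)" for t
      by (simp add: vector_smult_assoc vector_add_ldistrib mult.commute)
    then have "(\<lambda>t. peval P (c *s x + t *s (c *s v))) = (\<lambda>t. c ^ Suc d * peval P (x + t *s v))"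
      by (simp only: peval_homogeneous [OF assms(1)])
    then show "((\<lambda>t. peval P (c *s x + t *s (c *s v))) has_field_derivative c ^ Suc d * dP P x v) (at 0)"
      by (auto intro!: derivative_eq_intros has_deriv_dP_0)
  qed
  finally show ?thesis using assms(2) by simp
qed

lemma homogeneous_split_coords:
  fixes P :: "('n::finite) mpoly"
  assumes "homogeneous (Suc d) P"
  shows "\<exists>R. (\<forall>i. homogeneous d (R i)) \<and> (\<forall>x. peval P x = (\<Sum>i\<in>UNIV. x $ i * peval (R i) x))"
proof -
  have "\<exists>R. \<forall>x. peval R x = dP P x (axis i 1) / of_nat (Suc d)" for i
    using polyfun_mult [OF polyfun_dP polyfun_const [of "1 / of_nat (Suc d)"]]
    unfolding polyfun_def by (metis times_divide_eq_right mult.right_neutral)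
  then obtain R where R: "\<And>i x. peval (R i) x = dP P x (axis i 1) / of_nat (Suc d)" by metis
  have e: "dP P x (axis i 1) = peval (pderivs P i) x" for x i
    unfolding dP_def axis_def by (simp add: if_distrib cong: if_cong)
  show ?thesis
  proof (intro exI conjI allI)
    show "homogeneous d (R i)" for i
      by (rule homogeneousI) (simp add: R dP_homogeneous [OF assms])
    show "peval P x = (\<Sum>i\<in>UNIV. x $ i * peval (R i) x)" for x
    proof -
      have "(\<Sum>i\<in>UNIV. x $ i * peval (R i) x) = dP P x x / of_nat (Suc d)"
        unfolding R e sum_divide_distrib dP_def [of P x x] by (rule sum.cong) auto
      then show ?thesis using euler_dP [OF assms, of x] by (simp del: of_nat_Suc)
    qed
  qed
qed

section \<open>Unique factorisation and elimination in five variables\<close>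

text \<open>Polynomials in five variables are identified with iterated polynomials in one variable, whose ring is
  factorial by the lemma of Gauss. This transports unique factorisation, and with it elimination.\<close>

type_synonym tower = "complex poly poly poly poly poly"

definition tev :: "tower \<Rightarrow> complex^5 \<Rightarrow> complex" where
  "tev q x = poly (poly (poly (poly (poly q [:[:[:[:x$4:]:]:]:]) [:[:[:x$3:]:]:]) [:[:x$2:]:]) [:x$1:]) (x$0)"

abbreviation tconst :: "complex \<Rightarrow> tower" where "tconst c \<equiv> [:[:[:[:[:c:]:]:]:]:]"

lemma tev_simps [simp]:
  "tev 0 x = 0" "tev 1 x = 1" "tev (p + q) x = tev p x + tev q x" "tev (p * q) x = tev p x * tev q x"
  "tev (p - q) x = tev p x - tev q x" "tev (tconst c) x = c"
  by (simp_all add: tev_def)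

lemma tev_smult [simp]: "tev (smult [:[:[:[:c:]:]:]:] q) x = c * tev q x"
  by (simp add: tev_def)

lemma UNIV_5: "(UNIV :: 5 set) = {0, 1, 2, 3, 4}"
proof -
  have "card {0, 1, 2, 3, 4 :: 5} = CARD(5)" by simp
  then show ?thesis by (metis card_subset_eq finite subset_UNIV)
qed

lemma tev_of_peval: "\<exists>q. \<forall>x. tev q x = peval P x"
proof (induction P rule: mpoly_fun_induct)
  case (const c)
  show ?case by (rule exI [of _ "tconst c"]) simp
next
  case (coord i)
  have "i \<in> {0, 1, 2, 3, 4}" using UNIV_5 by blast
  then consider "i = 0" | "i = 1" | "i = 2" | "i = 3" | "i = 4" by blast
  then show ?case
  proof cases
    case 1 then show ?thesis by (intro exI [of _ "[:[:[:[:[:0,1:]:]:]:]:]"]) (simp add: tev_def)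
  next
    case 2 then show ?thesis by (intro exI [of _ "[:[:[:[:0,1:]:]:]:]"]) (simp add: tev_def)
  next
    case 3 then show ?thesis by (intro exI [of _ "[:[:[:0,1:]:]:]"]) (simp add: tev_def)
  next
    case 4 then show ?thesis by (intro exI [of _ "[:[:0,1:]:]"]) (simp add: tev_def)
  next
    case 5 then show ?thesis by (intro exI [of _ "[:0,1:]"]) (simp add: tev_def)
  qed
next
  case (add f g) then show ?case using tev_simps(3) by metis
next
  case (mult f g) then show ?case using tev_simps(4) by metis
qed

lemma polyfun_tev: "polyfun (tev q)"
proof -
  have 1: "polyfun (\<lambda>x::complex^5. poly p (x$0))" for p
    by (induction p) (auto intro!: polyfun_add polyfun_mult)
  have 2: "polyfun (\<lambda>x::complex^5. poly (poly p [:x$1:]) (x$0))" for p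
    by (induction p) (auto intro!: polyfun_add polyfun_mult 1)
  have 3: "polyfun (\<lambda>x::complex^5. poly (poly (poly p [:[:x$2:]:]) [:x$1:]) (x$0))" for p
    by (induction p) (auto intro!: polyfun_add polyfun_mult 2)
  have 4: "polyfun (\<lambda>x::complex^5. poly (poly (poly (poly p [:[:[:x$3:]:]:]) [:[:x$2:]:]) [:x$1:]) (x$0))" for p
    by (induction p) (auto intro!: polyfun_add polyfun_mult 3)
  have "polyfun (\<lambda>x. tev q x)"
    unfolding tev_def by (induction q) (auto intro!: polyfun_add polyfun_mult 4)
  then show ?thesis by simp
qed

lemma poly_inf_0:
  fixes q :: "'a::idom poly"
  assumes "inj h" "\<And>c::complex. poly q (h c) = 0" shows "q = 0"
proof (rule ccontr)
  assume "q \<noteq> 0"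
  then have "finite {x. poly q x = 0}" by (rule poly_roots_finite)
  moreover have "range h \<subseteq> {x. poly q x = 0}" using assms(2) by auto
  ultimately have "finite (range h)" by (rule rev_finite_subset)
  then show False using assms(1) infinite_UNIV_char_0 finite_imageD by blast
qed

lemma tev_inj_0: assumes "\<And>x. tev q x = 0" shows "q = 0"
proof -
  have z: "poly (poly (poly (poly (poly q [:[:[:[:x4:]:]:]:]) [:[:[:x3:]:]:]) [:[:x2:]:]) [:x1:]) x0 = 0" for x0 x1 x2 x3 x4
    using assms [of "\<chi> i. if i = 0 then x0 else if i = 1 then x1 else if i = 2 then x2 else if i = 3 then x3 else x4"]
    by (simp add: tev_def)
  have "poly (poly (poly (poly q [:[:[:[:x4:]:]:]:]) [:[:[:x3:]:]:]) [:[:x2:]:]) [:x1:] = 0" for x1 x2 x3 x4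
    by (rule poly_inf_0 [of "\<lambda>c. c"]) (auto simp: inj_def z)
  then have "poly (poly (poly q [:[:[:[:x4:]:]:]:]) [:[:[:x3:]:]:]) [:[:x2:]:] = 0" for x2 x3 x4
    by (intro poly_inf_0 [of "\<lambda>c. [:c:]"]) (auto simp: inj_def)
  then have "poly (poly q [:[:[:[:x4:]:]:]:]) [:[:[:x3:]:]:] = 0" for x3 x4
    by (intro poly_inf_0 [of "\<lambda>c. [:[:c:]:]"]) (auto simp: inj_def)
  then have "poly q [:[:[:[:x4:]:]:]:] = 0" for x4
    by (intro poly_inf_0 [of "\<lambda>c. [:[:[:c:]:]:]"]) (auto simp: inj_def)
  then show ?thesis
    by (intro poly_inf_0 [of "\<lambda>c. [:[:[:[:c:]:]:]:]"]) (auto simp: inj_def)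
qed

lemma tev_inj: "(\<And>x. tev p x = tev q x) \<Longrightarrow> p = q"
  using tev_inj_0 [of "p - q"] by simp

definition tower_of :: "5 mpoly \<Rightarrow> tower" where "tower_of P = (SOME q. \<forall>x. tev q x = peval P x)"

lemma tev_tower_of [simp]: "tev (tower_of P) x = peval P x"
  unfolding tower_of_def using someI_ex [OF tev_of_peval [of P]] by blast

lemma tower_of_surj: "\<exists>P. tower_of P = q"
  using polyfun_tev [of q] unfolding polyfun_def by (metis tev_inj tev_tower_of)

lemma tower_of_mult: "tower_of (P * Q) = tower_of P * tower_of Q"
  by (rule tev_inj) simp

lemma tower_of_1: "tower_of 1 = 1"
  by (rule tev_inj) simp

lemma tower_of_0: "tower_of 0 = 0"
  by (rule tev_inj) simp

lemma tower_of_eq: "tower_of P = tower_of Q \<longleftrightarrow> P = Q"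
  by (metis peval_inj tev_tower_of)

lemma tower_of_dvd: "tower_of P dvd tower_of Q \<longleftrightarrow> P dvd Q"
  unfolding dvd_def by (metis tower_of_mult tower_of_surj tower_of_eq)

lemma tower_of_unit: "is_unit (tower_of P) \<longleftrightarrow> P dvd 1"
  using tower_of_dvd [of P 1] by (simp add: tower_of_1)

lemma irreducible_imp_prime_mpoly:
  fixes f :: "5 mpoly" assumes "irreducible f" shows "prime_elem f"
proof -
  have "irreducible (tower_of f)"
  proof (rule irreducibleI)
    show "tower_of f \<noteq> 0" using assms by (metis tower_of_0 tower_of_eq irreducible_def)
    show "\<not> is_unit (tower_of f)" using assms by (simp add: tower_of_unit irreducible_def)
    fix a b assume ab: "tower_of f = a * b"
    obtain A B where A: "a = tower_of A" "b = tower_of B" using tower_of_surj by metis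
    with ab have "f = A * B" by (metis tower_of_mult tower_of_eq)
    then have "A dvd 1 \<or> B dvd 1" using assms by (simp add: irreducible_def)
    then show "is_unit a \<or> is_unit b" by (simp add: A tower_of_unit)
  qed
  then have p: "prime_elem (tower_of f)" by (rule irreducible_imp_prime_elem)
  show ?thesis
  proof (rule prime_elemI)
    show "f \<noteq> 0" using assms by (simp add: irreducible_def)
    show "\<not> f dvd 1" using assms by (simp add: irreducible_def)
    fix a b assume "f dvd a * b"
    then have "tower_of f dvd tower_of a * tower_of b" using tower_of_dvd [of f "a * b"] by (simp add: tower_of_mult)
    then show "f dvd a \<or> f dvd b" using p by (metis prime_elem_dvd_mult_iff tower_of_dvd)
  qed
qed

lemma prime_divisor_mpoly:
  fixes f :: "5 mpoly" assumes "f \<noteq> 0" "\<not> f dvd 1" shows "\<exists>\<sigma>. prime_elem \<sigma> \<and> \<sigma> dvd f"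
proof -
  have "tower_of f \<noteq> 0" using assms by (metis tower_of_0 tower_of_eq)
  moreover have "\<not> is_unit (tower_of f)" using assms by (simp add: tower_of_unit)
  ultimately obtain p where p: "p dvd tower_of f" "prime p" using prime_divisor_exists by blast
  obtain \<sigma> where s: "tower_of \<sigma> = p" using tower_of_surj by blast
  have "irreducible \<sigma>"
  proof (rule irreducibleI)
    have ip: "irreducible p" using p prime_elem_imp_irreducible prime_imp_prime_elem by blast
    show "\<sigma> \<noteq> 0" using ip s tower_of_0 by (metis irreducible_def)
    show "\<not> \<sigma> dvd 1" using ip s tower_of_unit by (metis irreducible_def)
    fix a b assume "\<sigma> = a * b"
    then have "p = tower_of a * tower_of b" using s tower_of_mult by simp
    then show "a dvd 1 \<or> b dvd 1" using ip tower_of_unit by (metis irreducible_def)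
  qed
  then show ?thesis using p(1) s tower_of_dvd irreducible_imp_prime_mpoly by metis
qed

text \<open>Over a factorial ring the Euclidean algorithm works up to denominators, so two polynomials without
  common factor of positive degree have a nonzero constant in the ideal that they generate.\<close>

lemma bezout_tower:
  fixes f g :: "tower poly"
  assumes f: "f \<noteq> 0" and cop: "\<And>\<pi>. prime_elem \<pi> \<Longrightarrow> \<pi> dvd f \<Longrightarrow> \<pi> dvd g \<Longrightarrow> degree \<pi> = 0"
  shows "\<exists>\<alpha> \<beta> r. r \<noteq> 0 \<and> \<alpha> * f + \<beta> * g = [:r:]"
proof -
  define I where "I = {\<alpha> * f + \<beta> * g | \<alpha> \<beta>. True}"
  have I_sub: "a * u - b * v \<in> I" if "u \<in> I" "v \<in> I" for a b u v
  proof -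
    from that obtain a1 b1 a2 b2 where "u = a1 * f + b1 * g" "v = a2 * f + b2 * g" unfolding I_def by blast
    then have "a * u - b * v = (a * a1 - b * a2) * f + (a * b1 - b * b2) * g" by (simp add: algebra_simps)
    then show ?thesis unfolding I_def by blast
  qed
  have fI: "f \<in> I" unfolding I_def by (rule CollectI, rule exI [of _ 1], rule exI [of _ 0]) simp
  have gI: "g \<in> I" unfolding I_def by (rule CollectI, rule exI [of _ 0], rule exI [of _ 1]) simp
  have "\<exists>h. (h \<in> I \<and> h \<noteq> 0) \<and> (\<forall>k. k \<in> I \<and> k \<noteq> 0 \<longrightarrow> degree h \<le> degree k)"
    by (rule ex_has_least_nat [of _ f]) (use f fI in auto)
  then obtain h where h: "h \<in> I" "h \<noteq> 0" and min: "\<And>k. k \<in> I \<Longrightarrow> k \<noteq> 0 \<Longrightarrow> degree h \<le> degree k" by blast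
  have div: "\<exists>a q. a \<noteq> 0 \<and> smult a u = h * q" if u: "u \<in> I" for u
  proof -
    obtain a q where a: "a \<noteq> 0" "smult a u = h * q + pseudo_mod u h" using pseudo_mod(1) [OF h(2)] by blast
    have "pseudo_mod u h = [:a:] * u - q * h" using a(2) by (simp add: algebra_simps)
    then have "pseudo_mod u h \<in> I" using I_sub u h(1) by metis
    then have "pseudo_mod u h = 0" using min pseudo_mod(2) [OF h(2), of u] by force
    then show ?thesis using a by auto
  qed
  show ?thesis
  proof (cases "degree h = 0")
    case True
    then obtain r where "h = [:r:]" by (rule degree_eq_zeroE)
    then show ?thesis using h unfolding I_def by (smt (verit) mem_Collect_eq pCons_0_0)
  next
    case False
    let ?h = "primitive_part h"
    have deg: "degree ?h = degree h" by simp
    have "\<not> is_unit ?h"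
    proof
      assume "is_unit ?h"
      then have "degree ?h \<le> degree (1 :: tower poly)" by (rule dvd_imp_degree_le) simp
      then show False using deg False by simp
    qed
    moreover have "?h \<noteq> 0" using h(2) by simp
    ultimately obtain \<pi> where pi: "prime \<pi>" "\<pi> dvd ?h" using prime_divisor_exists by blast
    have pe: "prime_elem \<pi>" using pi(1) by simp
    have dp: "degree \<pi> \<noteq> 0"
    proof
      assume "degree \<pi> = 0"
      then obtain c where c: "\<pi> = [:c:]" by (rule degree_eq_zeroE)
      then have "c dvd Polynomial.content ?h" using pi(2) by (simp add: const_poly_dvd_iff_dvd_content)
      then have "is_unit c" using h(2) by simp
      then have "is_unit \<pi>" using c by (simp add: is_unit_const_poly_iff)
      then show False using pe by (simp add: prime_elem_def)
    qed
    have ph: "\<pi> dvd h" using pi(2) by (metis content_times_primitive_part dvd_smult)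
    have "\<pi> dvd u" if uI: "u \<in> I" for u
    proof -
      obtain a q where a: "a \<noteq> 0" "smult a u = h * q" using div [OF uI] by blast
      have "[:a:] * u = h * q" using a(2) by simp
      then have "\<pi> dvd [:a:] * u" by (simp only: dvd_mult2 [OF ph])
      moreover have "\<not> \<pi> dvd [:a:]"
      proof
        assume "\<pi> dvd [:a:]"
        then have "degree \<pi> \<le> degree [:a:]" by (rule dvd_imp_degree_le) (use a in auto)
        then show False using dp by simp
      qed
      ultimately show ?thesis using prime_elem_dvd_multD [OF pe, of "[:a:]" u] by simp
    qed
    from cop [OF pe this [OF fI] this [OF gI]] dp show ?thesis by simp
  qed
qed

definition tev2 :: "tower poly \<Rightarrow> complex^5 \<Rightarrow> complex \<Rightarrow> complex" where
  "tev2 q x t = tev (poly q (tconst t)) x"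

lemma tev2_simps [simp]:
  "tev2 0 x t = 0" "tev2 1 x t = 1" "tev2 (p + q) x t = tev2 p x t + tev2 q x t"
  "tev2 (p * q) x t = tev2 p x t * tev2 q x t" "tev2 (p - q) x t = tev2 p x t - tev2 q x t"
  "tev2 [:a:] x t = tev a x" "tev2 (pCons a q) x t = tev a x + t * tev2 q x t"
  by (simp_all add: tev2_def)

lemma tev2_inj: assumes "\<And>x t. tev2 p x t = tev2 q x t" shows "p = q"
proof -
  have "poly (p - q) (tconst t) = 0" for t
    by (rule tev_inj_0) (use assms in \<open>simp add: tev2_def\<close>)
  then have "p - q = 0" by (intro poly_inf_0 [of tconst]) (auto simp: inj_def)
  then show ?thesis by simp
qed

lemma shift_tower_ex: "\<exists>q. \<forall>x t. tev2 q x t = tev f (x + t *s e)"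
proof -
  obtain P where P: "\<forall>x. peval P x = tev f x" using polyfun_tev [of f] unfolding polyfun_def by blast
  have "\<exists>q. \<forall>x t. tev2 q x t = peval P (x + t *s e)"
  proof (induction P rule: mpoly_fun_induct)
    case (const c)
    show ?case by (rule exI [of _ "[:tconst c:]"]) simp
  next
    case (coord i)
    obtain P where "\<forall>x::complex^5. peval P x = x $ i" using polyfun_coord [of i] unfolding polyfun_def by blast
    then obtain u where "\<forall>x. tev u x = x $ i" using tev_of_peval by metis
    then show ?case by (intro exI [of _ "[:u, tconst (e $ i):]"]) simp
  next
    case (add f g) then show ?case using tev2_simps(3) by metis
  next
    case (mult f g) then show ?case using tev2_simps(4) by metis
  qed
  then show ?thesis using P by simp
qed

lemma shift_tower_poly_ex: "\<exists>q'. \<forall>x t. tev2 q' x t = tev2 q (x + t *s e) t"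
proof (induction q)
  case 0
  show ?case by (rule exI [of _ 0]) simp
next
  case (pCons a q)
  obtain q' where q': "\<forall>x t. tev2 q' x t = tev2 q (x + t *s e) t" using pCons by blast
  obtain a' where a': "\<forall>x t. tev2 a' x t = tev a (x + t *s e)" using shift_tower_ex by blast
  show ?case by (rule exI [of _ "a' + pCons 0 q'"]) (simp add: q' a')
qed

text \<open>A resultant: along a fixed direction \<open>e\<close> the lines that meet the common zero set of two coprime
  polynomials lie over a proper hypersurface. It is the substitute for dimension theory in all later general
  position arguments.\<close>

lemma elimination:
  fixes f g :: "5 mpoly"
  assumes f: "f \<noteq> 0" and cop: "\<And>\<sigma>. prime_elem \<sigma> \<Longrightarrow> \<sigma> dvd f \<Longrightarrow> \<not> \<sigma> dvd g"
  shows "\<exists>r::5 mpoly. r \<noteq> 0 \<and> (\<forall>x t. peval f (x + t *s e) = 0 \<longrightarrow> peval g (x + t *s e) = 0 \<longrightarrow> peval r x = 0)"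
proof -
  obtain F where F: "\<And>x t. tev2 F x t = tev (tower_of f) (x + t *s e)" using shift_tower_ex by metis
  obtain G where G: "\<And>x t. tev2 G x t = tev (tower_of g) (x + t *s e)" using shift_tower_ex by metis
  have F0: "F \<noteq> 0"
  proof
    assume "F = 0"
    then have "peval f x = 0" for x using F [of x 0] by simp
    then show False using f peval_inj_0 by blast
  qed
  have "\<exists>\<alpha> \<beta> r. r \<noteq> 0 \<and> \<alpha> * F + \<beta> * G = [:r:]"
  proof (rule bezout_tower [OF F0])
    fix \<pi> assume pi: "prime_elem \<pi>" "\<pi> dvd F" "\<pi> dvd G"
    obtain p where p: "\<And>x t. tev2 p x t = tev2 \<pi> (x + t *s (- e)) t" using shift_tower_poly_ex by metis
    have d: "p dvd [:tower_of h:]" if piH: "\<pi> dvd H" and Hev: "\<And>x t. tev2 H x t = tev (tower_of h) (x + t *s e)" for H h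
    proof -
      obtain k where k: "H = \<pi> * k" using piH unfolding dvd_def by blast
      obtain k' where k': "\<And>x t. tev2 k' x t = tev2 k (x + t *s (- e)) t" using shift_tower_poly_ex by metis
      have "[:tower_of h:] = p * k'"
      proof (rule tev2_inj)
        fix x t
        have "tev2 (p * k') x t = tev2 H (x + t *s (- e)) t" by (simp add: p k' k)
        also have "\<dots> = tev (tower_of h) x" unfolding Hev by (simp add: vector_smult_rneg)
        finally show "tev2 [:tower_of h:] x t = tev2 (p * k') x t" by simp
      qed
      then show ?thesis by simp
    qed
    have pf: "p dvd [:tower_of f:]" and pg: "p dvd [:tower_of g:]" using d pi F G by blast+
    have "[:tower_of f:] \<noteq> 0" using f by (metis tower_of_0 tower_of_eq pCons_eq_0_iff)
    then have "degree p \<le> degree [:tower_of f:]" using pf by (intro dvd_imp_degree_le) auto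
    then obtain s where s: "p = [:s:]" using degree_eq_zeroE by (metis degree_pCons_0 le_zero_eq)
    obtain \<tau> where tau: "tower_of \<tau> = s" using tower_of_surj by blast
    have "\<tau> dvd f" "\<tau> dvd g" using pf pg unfolding s tau [symmetric] by (simp_all add: const_poly_dvd_const_poly_iff tower_of_dvd)
    then have "\<tau> \<noteq> 0" using f by auto
    have "\<tau> dvd 1"
    proof (rule ccontr)
      assume "\<not> \<tau> dvd 1"
      then obtain \<sigma> where "prime_elem \<sigma>" "\<sigma> dvd \<tau>" using prime_divisor_mpoly \<open>\<tau> \<noteq> 0\<close> by blast
      then show False using cop \<open>\<tau> dvd f\<close> \<open>\<tau> dvd g\<close> dvd_trans by blast
    qed
    then have "is_unit s" using tau tower_of_unit by blast
    then obtain s' where "s * s' = 1" by (metis dvdE)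
    have "is_unit \<pi>"
    proof -
      obtain q where q: "\<And>x t. tev2 q x t = tev2 [:s':] (x + t *s e) t" using shift_tower_poly_ex by metis
      have "1 = \<pi> * q"
      proof (rule tev2_inj)
        fix x t
        have "tev2 \<pi> x t = tev2 p (x + t *s e) t" unfolding p by (simp add: vector_smult_rneg)
        then have "tev2 (\<pi> * q) x t = tev (s * s') (x + t *s e)" by (simp add: s q)
        then show "tev2 1 x t = tev2 (\<pi> * q) x t" using \<open>s * s' = 1\<close> by simp
      qed
      then show ?thesis by (metis dvd_triv_left)
    qed
    then show "degree \<pi> = 0" using pi(1) by (simp add: prime_elem_def)
  qed
  then obtain \<alpha> \<beta> r where r: "r \<noteq> 0" "\<alpha> * F + \<beta> * G = [:r:]" by blast
  obtain R where R: "tower_of R = r" using tower_of_surj by blast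
  show ?thesis
  proof (intro exI conjI allI impI)
    show "R \<noteq> 0" using r(1) R tower_of_0 by blast
    fix x t assume z: "peval f (x + t *s e) = 0" "peval g (x + t *s e) = 0"
    have "peval R x = tev2 (\<alpha> * F + \<beta> * G) x t" unfolding r(2) by (simp flip: R)
    then show "peval R x = 0" by (simp add: F G z)
  qed
qed

section \<open>Restriction to lines and shifts in a direction\<close>

definition top_coeff :: "complex poly \<Rightarrow> nat \<Rightarrow> complex \<Rightarrow> bool" where
  "top_coeff p d c \<longleftrightarrow> degree p \<le> d \<and> coeff p d = c"

lemma top_coeff_mult:
  assumes "top_coeff p a u" "top_coeff q b v" shows "top_coeff (p * q) (a + b) (u * v)"
proof -
  have "coeff (p * q) (a + b) = (\<Sum>i\<le>a+b. coeff p i * coeff q (a + b - i))" by (rule coeff_mult)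
  also have "\<dots> = (\<Sum>i\<in>{a}. coeff p i * coeff q (a + b - i))"
  proof (rule sum.mono_neutral_right)
    show "\<forall>i\<in>{..a + b} - {a}. coeff p i * coeff q (a + b - i) = 0"
    proof
      fix i assume i: "i \<in> {..a + b} - {a}"
      show "coeff p i * coeff q (a + b - i) = 0"
      proof (cases "i < a")
        case True
        then have "degree q < a + b - i" using assms(2) by (auto simp: top_coeff_def)
        then show ?thesis by (simp add: coeff_eq_0)
      next
        case False
        then have "degree p < i" using i assms(1) by (auto simp: top_coeff_def)
        then show ?thesis by (simp add: coeff_eq_0)
      qed
    qed
  qed auto
  finally show ?thesis using assms degree_mult_le [of p q] by (auto simp: top_coeff_def)
qed

lemma top_coeff_power: "top_coeff p a u \<Longrightarrow> top_coeff (p ^ k) (a * k) (u ^ k)"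
proof (induction k)
  case 0 then show ?case by (simp add: top_coeff_def)
next
  case (Suc k) then show ?case using top_coeff_mult [of p a u "p ^ k" "a * k" "u ^ k"] by simp
qed

lemma top_coeff_prod:
  assumes "finite A" "\<And>i. i \<in> A \<Longrightarrow> top_coeff (f i) (a i) (u i)"
  shows "top_coeff (\<Prod>i\<in>A. f i) (\<Sum>i\<in>A. a i) (\<Prod>i\<in>A. u i)"
  using assms by (induction A rule: finite_induct) (auto simp: top_coeff_mult, simp add: top_coeff_def)

lemma line_poly:
  assumes "homogeneous d P"
  obtains p where "\<And>t. poly p t = peval P (x + t *s e)" "degree p \<le> d" "coeff p d = peval P e"
proof -
  define q where "q m = (\<Prod>i\<in>UNIV. [:x $ i, e $ i:] ^ Poly_Mapping.lookup m i)" for m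
  have q: "top_coeff (q m) (mdeg m) (mon m e)" for m
  proof -
    have "top_coeff [:x $ i, e $ i:] 1 (e $ i)" for i by (simp add: top_coeff_def)
    from top_coeff_power [OF this] have "top_coeff ([:x $ i, e $ i:] ^ k) k ((e $ i) ^ k)" for i k by simp
    then show ?thesis unfolding q_def mdeg_def mon_def by (intro top_coeff_prod) auto
  qed
  have qe: "poly (q m) t = mon m (x + t *s e)" for m t
    by (simp add: q_def mon_def poly_prod)
  define p where "p = (\<Sum>m\<in>Poly_Mapping.keys P. smult (Poly_Mapping.lookup P m) (q m))"
  have md: "mdeg m = d" if "m \<in> Poly_Mapping.keys P" for m using assms that by (simp add: homogeneous_def)
  show ?thesis
  proof
    show "poly p t = peval P (x + t *s e)" for t by (simp add: p_def peval_mon poly_sum qe)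
    show "degree p \<le> d" unfolding p_def
      by (rule degree_sum_le) (use q md in \<open>auto simp: top_coeff_def intro: order.trans [OF degree_smult_le]\<close>)
    have "coeff (q m) d = mon m e" if "m \<in> Poly_Mapping.keys P" for m
      using q [of m] md [OF that] by (simp add: top_coeff_def)
    then show "coeff p d = peval P e" by (simp add: p_def coeff_sum peval_mon)
  qed
qed

lemma line_poly_top:
  assumes "homogeneous d P" "peval P e \<noteq> 0"
  obtains p where "\<And>t. poly p t = peval P (x + t *s e)" "degree p = d" "lead_coeff p = peval P e"
proof -
  obtain p where p: "\<And>t. poly p t = peval P (x + t *s e)" "degree p \<le> d" "coeff p d = peval P e"
    using line_poly [OF assms(1)] by metis
  then have "degree p = d" using assms(2) by (metis le_antisym le_degree)
  then show ?thesis using p that by auto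
qed

text \<open>The product of the roots is the constant coefficient divided by the leading one, so some root is at most
  the geometric mean.\<close>

lemma small_root:
  fixes p :: "complex poly"
  assumes "0 < degree p"
  shows "\<exists>t. poly p t = 0 \<and> norm t ^ degree p * norm (lead_coeff p) \<le> norm (poly p 0)"
  using assms
proof (induction "degree p" arbitrary: p)
  case (Suc n)
  have "\<not> constant (poly p)" using Suc by (simp add: constant_degree)
  then obtain a where a: "poly p a = 0" using fundamental_theorem_of_algebra by blast
  then obtain q where q: "p = [:-a, 1:] * q" using poly_eq_0_iff_dvd by (metis dvd_def)
  have "p \<noteq> 0" using Suc by auto
  then have q0: "q \<noteq> 0" using q by auto
  have dp: "degree p = Suc (degree q)" unfolding q using q0 by (subst degree_mult_eq) auto
  have lc: "lead_coeff p = lead_coeff q" unfolding q by (simp only: lead_coeff_mult) simp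
  have p0: "norm (poly p 0) = norm a * norm (poly q 0)" by (simp add: q norm_mult)
  show ?case
  proof (cases "degree q = 0")
    case True
    then obtain c where "q = [:c:]" by (rule degree_eq_zeroE)
    then show ?thesis using a p0 lc dp by (intro exI [of _ a]) simp
  next
    case False
    obtain b where b: "poly q b = 0" "norm b ^ degree q * norm (lead_coeff q) \<le> norm (poly q 0)"
      using Suc.hyps(1) [of q] Suc.hyps(2) dp False by auto
    show ?thesis
    proof (cases "norm a \<le> norm b")
      case True
      have "norm a ^ degree q * norm (lead_coeff q) \<le> norm b ^ degree q * norm (lead_coeff q)"
        by (intro mult_right_mono power_mono True) auto
      then have "norm a ^ degree q * norm (lead_coeff q) \<le> norm (poly q 0)" using b(2) by linarith
      then have "norm a * (norm a ^ degree q * norm (lead_coeff q)) \<le> norm a * norm (poly q 0)"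
        by (rule mult_left_mono) simp
      then show ?thesis using a unfolding lc unfolding p0 dp by (intro exI [of _ a]) (simp add: mult_ac)
    next
      case False
      have "norm b * (norm b ^ degree q * norm (lead_coeff q)) \<le> norm a * norm (poly q 0)"
        by (rule mult_mono) (use b False in auto)
      then show ?thesis using b(1) unfolding lc unfolding p0 dp by (intro exI [of _ b]) (simp add: mult_ac q)
    qed
  qed
qed simp

lemma line_root:
  assumes "homogeneous d P" "0 < d" "peval P e \<noteq> 0"
  obtains t where "peval P (x + t *s e) = 0" "norm t ^ d * norm (peval P e) \<le> norm (peval P x)"
proof -
  obtain p where p: "\<And>t. poly p t = peval P (x + t *s e)" "degree p = d" "lead_coeff p = peval P e"
    using line_poly_top [OF assms(1,3)] by metis
  have "poly p 0 = peval P x" using p(1) [of 0] by simp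
  then show ?thesis using small_root [of p] p assms(2) that by metis
qed

lemma split_poly_ex: "\<exists>t1 t2 t3. p = [:-t1,1:] * ([:-t2,1:] * [:-t3,1:])"
  if deg3: "degree p = 3" and lc1: "lead_coeff p = 1" for p :: "complex poly"
proof -
  have step: "\<exists>a q. p = [:-a, 1:] * q \<and> degree p = Suc (degree q) \<and> lead_coeff q = lead_coeff p"
    if "0 < degree p" for p :: "complex poly"
  proof -
    have "\<not> constant (poly p)" using that by (simp add: constant_degree)
    then obtain a where a: "poly p a = 0" using fundamental_theorem_of_algebra by blast
    then obtain q where q: "p = [:-a, 1:] * q" using poly_eq_0_iff_dvd by (metis dvd_def)
    have q0: "q \<noteq> 0" using q that by auto
    have dp: "degree p = Suc (degree q)" unfolding q using q0 by (subst degree_mult_eq) auto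
    have lc: "lead_coeff p = lead_coeff q" unfolding q by (simp only: lead_coeff_mult) simp
    show ?thesis using q dp lc by metis
  qed
  obtain a q where 1: "p = [:-a, 1:] * q" "degree p = Suc (degree q)" "lead_coeff q = lead_coeff p"
    using step [of p] deg3 by (metis zero_less_numeral)
  have dq: "0 < degree q" using deg3 1(2) by linarith
  obtain b r where 2: "q = [:-b, 1:] * r" "degree q = Suc (degree r)" "lead_coeff r = lead_coeff q"
    using step [OF dq] by metis
  have dr: "0 < degree r" using deg3 1(2) 2(2) by linarith
  obtain c s where 3: "r = [:-c, 1:] * s" "degree r = Suc (degree s)" "lead_coeff s = lead_coeff r"
    using step [OF dr] by metis
  have "degree s = 0" using deg3 1(2) 2(2) 3(2) by simp
  then obtain k where "s = [:k:]" by (rule degree_eq_zeroE)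
  then have "s = 1" using lc1 1(3) 2(3) 3(3) by simp
  then have "p = [:-a,1:] * ([:-b,1:] * [:-c,1:])" using 1(1) 2(1) 3(1) by (simp only: mult_1_right)
  then show ?thesis by blast
qed

lemma hom_part_mult_general:
  assumes "finite B" "mdeg ` Poly_Mapping.keys Q \<subseteq> B"
  shows "hom_part k (P * Q) = (\<Sum>j\<in>B. if j \<le> k then hom_part (k - j) P * hom_part j Q else 0)"
proof -
  have "P * Q = (\<Sum>j\<in>B. P * hom_part j Q)"
    using hom_part_decomp' [OF assms] by (metis sum_distrib_left)
  then show ?thesis by (simp add: hom_part_sum hom_part_mult [OF homogeneous_hom_part])
qed

lemma hom_part_eq_0: "k \<notin> mdeg ` Poly_Mapping.keys P \<Longrightarrow> hom_part k P = 0"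
proof (rule poly_mapping_eqI)
  fix m assume "k \<notin> mdeg ` Poly_Mapping.keys P"
  then have "mdeg m = k \<Longrightarrow> Poly_Mapping.lookup P m = 0" by (metis imageI in_keys_iff)
  then show "Poly_Mapping.lookup (hom_part k P) m = Poly_Mapping.lookup 0 m" by (simp add: lookup_hom_part)
qed

lemma hom_part_neq_0: "k \<in> mdeg ` Poly_Mapping.keys P \<Longrightarrow> hom_part k P \<noteq> 0"
  by (metis imageE in_keys_iff lookup_hom_part lookup_zero)

lemma homogeneous_factor:
  fixes P Q :: "('n::{finite,linorder}) mpoly"
  assumes hom: "homogeneous d (P * Q)" and P: "P \<noteq> 0" and Q: "Q \<noteq> 0"
  shows "\<exists>i j. homogeneous i P \<and> homogeneous j Q \<and> i + j = d"
proof -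
  let ?A = "mdeg ` Poly_Mapping.keys P" and ?B = "mdeg ` Poly_Mapping.keys Q"
  have fin: "finite ?A" "finite ?B" "?A \<noteq> {}" "?B \<noteq> {}" using P Q by auto
  have PQ: "hom_part k (P * Q) = 0" if "k \<noteq> d" for k
    using hom_part_homogeneous [OF hom] that by simp
  have low: "Min ?A + Min ?B = d"
  proof (rule ccontr)
    let ?k = "Min ?A + Min ?B"
    assume "?k \<noteq> d"
    have "hom_part ?k (P * Q) = (\<Sum>j\<in>?B. if j \<le> ?k then hom_part (?k - j) P * hom_part j Q else 0)"
      by (rule hom_part_mult_general) (use fin in auto)
    also have "\<dots> = (\<Sum>j\<in>{Min ?B}. if j \<le> ?k then hom_part (?k - j) P * hom_part j Q else 0)"
    proof (rule sum.mono_neutral_right)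
      show "\<forall>j\<in>?B - {Min ?B}. (if j \<le> ?k then hom_part (?k - j) P * hom_part j Q else 0) = 0"
      proof
        fix j assume j: "j \<in> ?B - {Min ?B}"
        then have "Min ?B < j" using fin(2) by (metis DiffD1 DiffD2 Min_le insertI1 le_neq_implies_less)
        moreover have "?k - j \<notin> ?A" if "j \<le> ?k"
        proof
          assume "?k - j \<in> ?A"
          then have "Min ?A \<le> ?k - j" using fin(1) Min_le by blast
          then show False using that \<open>Min ?B < j\<close> by linarith
        qed
        ultimately show "(if j \<le> ?k then hom_part (?k - j) P * hom_part j Q else 0) = 0"
          by (simp add: hom_part_eq_0)
      qed
    qed (use fin in auto)
    finally have "hom_part (Min ?A) P * hom_part (Min ?B) Q = 0" using PQ [OF \<open>?k \<noteq> d\<close>] by simp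
    then show False using hom_part_neq_0 fin Min_in by (metis mult_eq_0_iff)
  qed
  have high: "Max ?A + Max ?B = d"
  proof (rule ccontr)
    let ?k = "Max ?A + Max ?B"
    assume "?k \<noteq> d"
    have "hom_part ?k (P * Q) = (\<Sum>j\<in>?B. if j \<le> ?k then hom_part (?k - j) P * hom_part j Q else 0)"
      by (rule hom_part_mult_general) (use fin in auto)
    also have "\<dots> = (\<Sum>j\<in>{Max ?B}. if j \<le> ?k then hom_part (?k - j) P * hom_part j Q else 0)"
    proof (rule sum.mono_neutral_right)
      show "\<forall>j\<in>?B - {Max ?B}. (if j \<le> ?k then hom_part (?k - j) P * hom_part j Q else 0) = 0"
      proof
        fix j assume j: "j \<in> ?B - {Max ?B}"
        then have "j < Max ?B" using fin(2) by (metis DiffD1 DiffD2 Max_ge insertI1 le_neq_implies_less)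
        moreover have "?k - j \<notin> ?A"
        proof
          assume "?k - j \<in> ?A"
          then have "?k - j \<le> Max ?A" using fin(1) Max_ge by blast
          then show False using \<open>j < Max ?B\<close> by linarith
        qed
        ultimately show "(if j \<le> ?k then hom_part (?k - j) P * hom_part j Q else 0) = 0"
          by (simp add: hom_part_eq_0)
      qed
    qed (use fin in auto)
    finally have "hom_part (Max ?A) P * hom_part (Max ?B) Q = 0" using PQ [OF \<open>?k \<noteq> d\<close>] by simp
    then show False using hom_part_neq_0 fin Max_in by (metis mult_eq_0_iff)
  qed
  have "Min ?A \<le> Max ?A" "Min ?B \<le> Max ?B" using fin by auto
  then have eq: "Min ?A = Max ?A" "Min ?B = Max ?B" using low high by linarith+
  have "homogeneous (Max ?A) P" unfolding homogeneous_def
    using eq(1) fin(1) by (metis Max_ge Min_le dual_order.antisym imageI)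
  moreover have "homogeneous (Max ?B) Q" unfolding homogeneous_def
    using eq(2) fin(2) by (metis Max_ge Min_le dual_order.antisym imageI)
  ultimately show ?thesis using high by blast
qed

text \<open>Polynomials in one more variable: the shift of a polynomial in a direction.\<close>

definition pev :: "('n::finite) mpoly poly \<Rightarrow> complex^'n \<Rightarrow> complex poly" where
  "pev q x = map_poly (\<lambda>a. peval a x) q"

lemma coeff_pev [simp]: "coeff (pev q x) k = peval (coeff q k) x"
  unfolding pev_def by (simp add: coeff_map_poly)

lemma degree_pev: "degree (pev q x) \<le> degree q"
  by (rule degree_le) (simp add: coeff_eq_0)

lemma pev_simps [simp]:
  "pev 0 x = 0" "pev 1 x = 1" "pev (p + q) x = pev p x + pev q x" "pev (p * q) x = pev p x * pev q x"
  "pev (p - q) x = pev p x - pev q x" "pev [:a:] x = [:peval a x:]"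
  "pev (pCons a q) x = pCons (peval a x) (pev q x)" "pev (smult a q) x = smult (peval a x) (pev q x)"
  by (auto simp: poly_eq_iff coeff_mult coeff_pCons split: nat.splits)

lemma pev_inj:
  assumes "\<And>x t. poly (pev p x) t = poly (pev q x) t" shows "p = q"
proof -
  have "pev p x = pev q x" for x using assms by (simp add: poly_eq_poly_eq_iff [symmetric] fun_eq_iff)
  then have "peval (coeff p k) x = peval (coeff q k) x" for k x by (metis coeff_pev)
  then have "coeff p k = coeff q k" for k using peval_inj by blast
  then show ?thesis by (simp add: poly_eq_iff)
qed

lemma shiftp_ex: "\<exists>q. \<forall>x t. poly (pev q x) t = peval f (x + t *s e)"
proof (induction f rule: mpoly_fun_induct)
  case (const c)
  show ?case by (rule exI [of _ "[:Poly_Mapping.single 0 c:]"]) simp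
next
  case (coord i)
  obtain P where "\<forall>x::complex^'a. peval P x = x $ i" using polyfun_coord [of i] unfolding polyfun_def by blast
  then show ?case by (intro exI [of _ "[:P, Poly_Mapping.single 0 (e $ i):]"]) (simp add: mult.commute)
next
  case (add f g) then show ?case using pev_simps(3) poly_add by metis
next
  case (mult f g) then show ?case using pev_simps(4) poly_mult by metis
qed

text \<open>\<open>shiftp e f\<close> is \<open>f(x + t e)\<close> as a polynomial in \<open>t\<close> with coefficients in the polynomials in \<open>x\<close>. If \<open>f\<close> is
  homogeneous and \<open>f e = 1\<close>, then it is monic, and division with remainder is available.\<close>

definition shiftp :: "complex^('n::finite) \<Rightarrow> 'n mpoly \<Rightarrow> 'n mpoly poly" where
  "shiftp e f = (SOME q. \<forall>x t. poly (pev q x) t = peval f (x + t *s e))"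

lemma poly_shiftp [simp]: "poly (pev (shiftp e f) x) t = peval f (x + t *s e)"
  unfolding shiftp_def using someI_ex [OF shiftp_ex] by blast

lemma shiftp_mult: "shiftp e (f * g) = shiftp e f * shiftp e g"
  by (rule pev_inj) simp

lemma shiftp_add: "shiftp e (f + g) = shiftp e f + shiftp e g"
  by (rule pev_inj) simp

lemma shiftp_invariant: "(\<And>x t. peval f (x + t *s e) = peval f x) \<Longrightarrow> shiftp e f = [:f:]"
  by (rule pev_inj) simp

lemma coeff_shiftp_0: "coeff (shiftp e f) 0 = f"
proof (rule peval_inj)
  fix x
  have "peval (coeff (shiftp e f) 0) x = poly (pev (shiftp e f) x) 0"
    unfolding poly_0_coeff_0 by simp
  then show "peval (coeff (shiftp e f) 0) x = peval f x" by simp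
qed

lemma shiftp_monic:
  assumes "homogeneous d f" "peval f e = 1"
  shows "degree (shiftp e f) = d" "lead_coeff (shiftp e f) = 1"
proof -
  have c: "peval (coeff (shiftp e f) k) x = (if k = d then 1 else if d < k then 0 else peval (coeff (shiftp e f) k) x)" for k x
  proof -
    obtain p where p: "\<And>t. poly p t = peval f (x + t *s e)" "degree p = d" "lead_coeff p = peval f e"
      using line_poly_top [OF assms(1), of e x] assms(2) by auto
    have "pev (shiftp e f) x = p" by (simp add: poly_eq_poly_eq_iff [symmetric] fun_eq_iff p)
    then have "peval (coeff (shiftp e f) k) x = coeff p k" by (metis coeff_pev)
    then show ?thesis using p assms(2) by (auto simp: coeff_eq_0)
  qed
  have 1: "coeff (shiftp e f) d = 1" by (rule peval_inj) (use c [of d] in simp)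
  have 2: "coeff (shiftp e f) k = 0" if "d < k" for k
    by (rule peval_inj) (use c [of k] that in simp)
  show "degree (shiftp e f) = d"
    by (rule antisym) (use 1 2 in \<open>auto intro: degree_le le_degree\<close>)
  then show "lead_coeff (shiftp e f) = 1" using 1 by simp
qed

lemma monic_division:
  fixes f p :: "'a::comm_ring_1 poly"
  assumes "lead_coeff f = 1"
  obtains q r where "p = f * q + r" "r = 0 \<or> degree r < degree f"
proof -
  have "f \<noteq> 0" using assms by auto
  obtain q r where qr: "pseudo_divmod p f = (q, r)" by fastforce
  show ?thesis using pseudo_divmod [OF \<open>f \<noteq> 0\<close> qr] assms that by simp
qed

lemma prime_mpoly_coprime:
  fixes f g :: "5 mpoly"
  assumes f: "prime_elem f" and g: "\<not> f dvd g" and s: "prime_elem \<sigma>" "\<sigma> dvd f"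
  shows "\<not> \<sigma> dvd g"
proof -
  obtain k where k: "f = \<sigma> * k" using s(2) unfolding dvd_def by blast
  have f0: "f \<noteq> 0" using f by (simp add: prime_elem_def)
  have "f dvd \<sigma> \<or> f dvd k" using prime_elem_dvd_multD [OF f, of \<sigma> k] k by simp
  then show ?thesis
  proof
    assume "f dvd \<sigma>" then show ?thesis using g dvd_trans by blast
  next
    assume "f dvd k"
    then obtain m where "k = f * m" unfolding dvd_def by blast
    then have "f * 1 = f * (\<sigma> * m)" using k by (simp add: mult_ac)
    then have "1 = \<sigma> * m" using f0 mult_left_cancel by blast
    then have "\<sigma> dvd 1" by (metis dvd_triv_left)
    then show ?thesis using s(1) by (simp add: prime_elem_def)
  qed
qed

lemma prime_homogeneous_pos:
  fixes f :: "5 mpoly"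
  assumes "prime_elem f" "homogeneous d f" shows "0 < d"
proof (rule ccontr)
  assume "\<not> 0 < d"
  then obtain c where c: "f = Poly_Mapping.single 0 c" using homogeneous_degree_0 assms(2) by auto
  then have "c \<noteq> 0" using assms(1) by (auto simp: prime_elem_def)
  then have "f * Poly_Mapping.single 0 (1 / c) = 1" by (intro peval_inj) (simp add: c)
  then have "f dvd 1" by (metis dvd_triv_left)
  then show False using assms(1) by (simp add: prime_elem_def)
qed

lemma peval_nonzero_ex: "P \<noteq> 0 \<Longrightarrow> \<exists>x. peval P x \<noteq> 0"
  using peval_inj_0 by blast

text \<open>If \<open>f\<close> did not divide \<open>g\<close>, then the lines meeting \<open>f = g = 0\<close> would lie over a proper hypersurface by
  \<open>elimination\<close>; but every line in a direction with \<open>f e \<noteq> 0\<close> meets \<open>f = 0\<close>, where \<open>g\<close> vanishes too.\<close>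

lemma hypersurface_nullstellensatz:
  fixes f g :: "5 mpoly"
  assumes pf: "prime_elem f" and hom: "homogeneous d f" and z: "\<And>x. peval f x = 0 \<Longrightarrow> peval g x = 0"
  shows "f dvd g"
proof (rule ccontr)
  assume ng: "\<not> f dvd g"
  have f0: "f \<noteq> 0" using pf by (simp add: prime_elem_def)
  obtain e where e: "peval f e \<noteq> 0" using peval_nonzero_ex [OF f0] by blast
  obtain r :: "5 mpoly" where r: "r \<noteq> 0" "\<And>x t. peval f (x + t *s e) = 0 \<Longrightarrow> peval g (x + t *s e) = 0 \<Longrightarrow> peval r x = 0"
    using elimination [OF f0, of g e] prime_mpoly_coprime [OF pf ng] by blast
  obtain x where x: "peval r x \<noteq> 0" using peval_nonzero_ex [OF r(1)] by blast
  obtain t where "peval f (x + t *s e) = 0" using line_root [OF hom prime_homogeneous_pos [OF pf hom] e] by metis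
  then show False using r(2) z x by blast
qed

lemma poly_degree_lt_3:
  fixes p :: "complex poly"
  assumes "degree p < 3"
  shows "poly p t = coeff p 0 + coeff p 1 * t + coeff p 2 * t ^ 2"
proof -
  have "poly p t = (\<Sum>i\<le>2. coeff p i * t ^ i)"
    unfolding poly_altdef by (rule sum.mono_neutral_left) (use assms in \<open>auto simp: coeff_eq_0\<close>)
  then show ?thesis by (simp add: numeral_2_eq_2)
qed

text \<open>The norm of \<open>D\<close> from the coordinate ring of \<open>C = 0\<close> down to the polynomials that are
  constant in the direction \<open>b\<close>.\<close>

section \<open>The norm of a quartic along a cubic\<close>

locale cubic_norm =
  fixes C D :: "5 mpoly" and b :: "complex^5"
  assumes hC: "homogeneous 3 C" and hD: "homogeneous 4 D" and b1: "peval C b = 1"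
begin

definition "Ch = shiftp b C"

lemma Ch_monic: "degree Ch = 3" "lead_coeff Ch = 1" "Ch \<noteq> 0"
  using shiftp_monic [OF hC b1] by (auto simp: Ch_def)

lemma poly_Ch: "poly (pev Ch x) t = peval C (x + t *s b)"
  by (simp add: Ch_def)

lemma pev_Ch_monic: "degree (pev Ch x) = 3" "lead_coeff (pev Ch x) = 1"
proof -
  have "coeff (pev Ch x) 3 = 1" using Ch_monic by simp
  moreover have "degree (pev Ch x) \<le> 3" using degree_pev [of Ch x] Ch_monic by simp
  ultimately show "degree (pev Ch x) = 3" by (metis le_antisym le_degree one_neq_zero)
  then show "lead_coeff (pev Ch x) = 1" using \<open>coeff (pev Ch x) 3 = 1\<close> by simp
qed

definition roots3 :: "complex^5 \<Rightarrow> complex \<Rightarrow> complex \<Rightarrow> complex \<Rightarrow> bool" where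
  "roots3 x t1 t2 t3 \<longleftrightarrow> pev Ch x = [:-t1,1:] * ([:-t2,1:] * [:-t3,1:])"

lemma roots3_ex: "\<exists>t1 t2 t3. roots3 x t1 t2 t3"
  unfolding roots3_def by (rule split_poly_ex [OF pev_Ch_monic])

lemma roots3_peval: "roots3 x t1 t2 t3 \<Longrightarrow> peval C (x + t *s b) = (t - t1) * (t - t2) * (t - t3)"
  using poly_Ch [of x t] by (simp add: roots3_def algebra_simps)

lemma roots3I: "(\<And>t. peval C (x + t *s b) = (t - t1) * (t - t2) * (t - t3)) \<Longrightarrow> roots3 x t1 t2 t3"
  unfolding roots3_def by (simp add: poly_eq_poly_eq_iff [symmetric] fun_eq_iff poly_Ch algebra_simps)

definition "e1 = - coeff Ch 2"
definition "e2 = coeff Ch 1"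
definition "e3 = - C"

lemma vieta:
  assumes "roots3 x t1 t2 t3"
  shows "peval e1 x = t1 + t2 + t3" "peval e2 x = t1 * t2 + t1 * t3 + t2 * t3" "peval e3 x = t1 * t2 * t3"
proof -
  have c: "coeff (pev Ch x) k = coeff ([:-t1,1:] * ([:-t2,1:] * [:-t3,1:])) k" for k
    using assms by (simp add: roots3_def)
  show "peval e1 x = t1 + t2 + t3" using c [of 2]
    by (simp add: e1_def numeral_2_eq_2 coeff_pCons)
  show "peval e2 x = t1 * t2 + t1 * t3 + t2 * t3" using c [of 1]
    by (simp add: e2_def coeff_pCons algebra_simps)
  show "peval e3 x = t1 * t2 * t3"
    using roots3_peval [OF assms, of 0] by (simp add: e3_def)
qed

definition "remD = (SOME r. (r = 0 \<or> degree r < 3) \<and> (\<exists>q. shiftp b D = Ch * q + r))"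

lemma remD: "degree remD < 3" "\<exists>q. shiftp b D = Ch * q + remD"
proof -
  obtain q r where "shiftp b D = Ch * q + r" "r = 0 \<or> degree r < degree Ch"
    by (rule monic_division [OF Ch_monic(2)])
  then have "\<exists>r. (r = 0 \<or> degree r < 3) \<and> (\<exists>q. shiftp b D = Ch * q + r)" using Ch_monic(1) by metis
  from someI_ex [OF this] have "(remD = 0 \<or> degree remD < 3) \<and> (\<exists>q. shiftp b D = Ch * q + remD)"
    unfolding remD_def .
  then show "degree remD < 3" "\<exists>q. shiftp b D = Ch * q + remD" by auto
qed

definition "d0 = coeff remD 0"
definition "d1 = coeff remD 1"
definition "d2 = coeff remD 2"

lemma D_root:
  assumes "peval C (x + t *s b) = 0"
  shows "peval D (x + t *s b) = peval d0 x + peval d1 x * t + peval d2 x * t ^ 2"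
proof -
  obtain q where q: "shiftp b D = Ch * q + remD" using remD(2) by blast
  have "poly (pev (shiftp b D) x) t = poly (pev remD x) t"
    unfolding q using assms by (simp add: poly_Ch)
  moreover have "degree (pev remD x) < 3" using degree_pev [of remD x] remD(1) by linarith
  ultimately show ?thesis by (simp add: poly_degree_lt_3 d0_def d1_def d2_def)
qed

text \<open>\<open>N\<close> is the product of the values of \<open>D\<close> at the three points of \<open>C = 0\<close> on the line, \<open>T\<close>
  their second elementary symmetric function, and \<open>Dst\<close> the product of the two values
  at the points other than the base point, if that lies on \<open>C = 0\<close>.\<close>

definition "N = d0^3 + d0^2*d1*e1 + d0^2*d2*(e1^2 - 2*e2) + d0*d1^2*e2 + d0*d1*d2*(e1*e2 - 3*e3)
  + d0*d2^2*(e2^2 - 2*e1*e3) + d1^3*e3 + d1^2*d2*e1*e3 + d1*d2^2*e2*e3 + d2^3*e3^2"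

definition "T = 3*d0^2 + 2*d0*d1*e1 + 2*d0*d2*(e1^2 - 2*e2) + d1^2*e2 + d1*d2*(e1*e2 - 3*e3)
  + d2^2*(e2^2 - 2*e1*e3)"

definition "Dst = d0^2 + d0*d1*e1 + d0*d2*(e1^2 - 2*e2) + d1^2*e2 + d1*d2*e1*e2 + d2^2*e2^2"

lemma peval_numeral [simp]: "peval (numeral k) x = numeral k"
proof -
  have "peval (of_nat n) x = of_nat n" for n by (induction n) auto
  from this [of "numeral k"] show ?thesis by simp
qed

lemma N_roots:
  assumes r: "roots3 x t1 t2 t3"
  shows "peval N x = peval D (x + t1 *s b) * peval D (x + t2 *s b) * peval D (x + t3 *s b)"
    "peval T x = peval D (x + t1 *s b) * peval D (x + t2 *s b) + peval D (x + t1 *s b) * peval D (x + t3 *s b)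
       + peval D (x + t2 *s b) * peval D (x + t3 *s b)"
proof -
  have D: "peval D (x + t *s b) = peval d0 x + peval d1 x * t + peval d2 x * t ^ 2" if "t \<in> {t1, t2, t3}" for t
    by (rule D_root) (use that roots3_peval [OF r] in auto)
  show "peval N x = peval D (x + t1 *s b) * peval D (x + t2 *s b) * peval D (x + t3 *s b)"
    by (simp add: N_def vieta [OF r] D) algebra
  show "peval T x = peval D (x + t1 *s b) * peval D (x + t2 *s b) + peval D (x + t1 *s b) * peval D (x + t3 *s b)
       + peval D (x + t2 *s b) * peval D (x + t3 *s b)"
    by (simp add: T_def vieta [OF r] D) algebra
qed

lemma Dst_roots:
  assumes r: "roots3 x 0 t2 t3"
  shows "peval Dst x = peval D (x + t2 *s b) * peval D (x + t3 *s b)"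
proof -
  have D: "peval D (x + t *s b) = peval d0 x + peval d1 x * t + peval d2 x * t ^ 2" if "t \<in> {t2, t3}" for t
    by (rule D_root) (use that roots3_peval [OF r] in auto)
  show ?thesis by (simp add: Dst_def vieta [OF r] D) algebra
qed

lemma N_eq: "\<exists>E. N = D * Dst + C * E"
proof -
  obtain q where q: "shiftp b D = Ch * q + remD" using remD(2) by blast
  have "coeff (shiftp b D) 0 = coeff Ch 0 * coeff q 0 + d0"
    unfolding q d0_def by (simp add: coeff_mult)
  then have "D = C * coeff q 0 + d0" by (simp add: coeff_shiftp_0 Ch_def)
  then have d0: "d0 = D - C * coeff q 0" by (metis add_diff_cancel_left')
  have "N = d0 * Dst + e3 * (- 3*d0*d1*d2 - 2*d0*d2^2*e1 + d1^3 + d1^2*d2*e1 + d1*d2^2*e2 + d2^3*e3)"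
    unfolding N_def Dst_def by algebra
  then have "N = d0 * Dst - C * (- 3*d0*d1*d2 - 2*d0*d2^2*e1 + d1^3 + d1^2*d2*e1 + d1*d2^2*e2 + d2^3*e3)"
    by (simp add: e3_def)
  then have "N = D * Dst + C * (- coeff q 0 * Dst - (- 3*d0*d1*d2 - 2*d0*d2^2*e1 + d1^3 + d1^2*d2*e1 + d1*d2^2*e2 + d2^3*e3))"
    using d0 by algebra
  then show ?thesis by blast
qed

lemma shift_point: "x + s *s b + t *s b = x + (s + t) *s b"
  by (simp add: vector_sadd_rdistrib add.assoc)

lemma roots3_shift:
  assumes r: "roots3 x t1 t2 t3" shows "roots3 (x + s *s b) (t1 - s) (t2 - s) (t3 - s)"
  by (rule roots3I) (simp only: shift_point roots3_peval [OF r], simp add: algebra_simps)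

lemma N_shift: "peval N (x + s *s b) = peval N x" and T_shift: "peval T (x + s *s b) = peval T x"
proof -
  obtain t1 t2 t3 where r: "roots3 x t1 t2 t3" using roots3_ex by blast
  show "peval N (x + s *s b) = peval N x" "peval T (x + s *s b) = peval T x"
    using N_roots [OF r] N_roots [OF roots3_shift [OF r, of s]] by (simp_all add: shift_point)
qed

lemma hN: "homogeneous 12 N"
proof (rule homogeneousI)
  fix c :: complex and x assume c: "c \<noteq> 0"
  obtain t1 t2 t3 where r: "roots3 x t1 t2 t3" using roots3_ex by blast
  have e: "c *s x + (c * t) *s b = c *s (x + t *s b)" for t by (simp add: vector_add_ldistrib vector_smult_assoc)
  have r': "roots3 (c *s x) (c * t1) (c * t2) (c * t3)"
  proof (rule roots3I)
    fix t
    have "c * (t / c) = t" using c by simp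
    then have "peval C (c *s x + t *s b) = peval C (c *s (x + (t / c) *s b))" using e [of "t / c"] by metis
    also have "\<dots> = c ^ 3 * ((t / c - t1) * (t / c - t2) * (t / c - t3))"
      by (simp only: peval_homogeneous [OF hC] roots3_peval [OF r])
    also have "\<dots> = (t - c * t1) * (t - c * t2) * (t - c * t3)"
      using c by (simp add: power3_eq_cube field_simps)
    finally show "peval C (c *s x + t *s b) = (t - c * t1) * (t - c * t2) * (t - c * t3)" .
  qed
  show "peval N (c *s x) = c ^ 12 * peval N x"
    unfolding N_roots(1) [OF r'] N_roots(1) [OF r] e peval_homogeneous [OF hD]
    by (simp add: algebra_simps flip: power_add)
qed

lemma N_zero_iff: "peval N x = 0 \<longleftrightarrow> (\<exists>t. peval C (x + t *s b) = 0 \<and> peval D (x + t *s b) = 0)"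
proof -
  obtain t1 t2 t3 where r: "roots3 x t1 t2 t3" using roots3_ex by blast
  have "peval C (x + t *s b) = 0 \<longleftrightarrow> t = t1 \<or> t = t2 \<or> t = t3" for t by (simp add: roots3_peval [OF r])
  then show ?thesis unfolding N_roots(1) [OF r] by auto
qed

lemma N_nonzero_ex:
  assumes "prime_elem C" "\<not> C dvd D" shows "\<exists>c. peval N c \<noteq> 0"
proof -
  have "C \<noteq> 0" using assms by (simp add: prime_elem_def)
  then obtain r :: "5 mpoly" where r: "r \<noteq> 0" "\<And>x t. peval C (x + t *s b) = 0 \<Longrightarrow> peval D (x + t *s b) = 0 \<Longrightarrow> peval r x = 0"
    using elimination [of C D b] prime_mpoly_coprime [OF assms] by blast
  obtain x where "peval r x \<noteq> 0" using peval_nonzero_ex [OF r(1)] by blast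
  then show ?thesis using r(2) N_zero_iff by blast
qed

text \<open>A polynomial belongs to the ideal of \<open>C\<close> and \<open>D\<close> if the remainder of its product with \<open>Dst\<close>
  is divisible by the norm.\<close>

lemma mem_idealI:
  assumes N0: "N \<noteq> 0" and div: "shiftp b (P * Dst) = Ch * k + r"
    and r: "\<And>i. N dvd coeff r i"
  shows "\<exists>\<alpha> \<beta>. P = \<alpha> * C + \<beta> * D"
proof -
  have "[:N:] dvd r" using r by (simp add: const_poly_dvd_iff)
  then obtain q where q: "r = [:N:] * q" unfolding dvd_def by blast
  obtain E where E: "N = D * Dst + C * E" using N_eq by blast
  have Nh: "[:N:] = shiftp b D * shiftp b Dst + Ch * shiftp b E"
    using shiftp_invariant [of N b, OF N_shift] E by (metis shiftp_add shiftp_mult Ch_def)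
  let ?P = "shiftp b P" and ?D = "shiftp b D" and ?S = "shiftp b Dst" and ?E = "shiftp b E"
  have "?P * ?S = Ch * k + (?D * ?S + Ch * ?E) * q" using div q Nh by (simp add: shiftp_mult)
  then have "?S * (?P - ?D * q) = Ch * (k + ?E * q)" by (simp add: algebra_simps)
  then have "?D * ?S * (?P - ?D * q) = ?D * (Ch * (k + ?E * q))" by (simp add: mult.assoc)
  moreover have "?D * ?S = [:N:] - Ch * ?E" using Nh by simp
  ultimately have "([:N:] - Ch * ?E) * (?P - ?D * q) = ?D * (Ch * (k + ?E * q))" by simp
  then have m: "[:N:] * (?P - ?D * q) = Ch * (?D * (k + ?E * q) + ?E * (?P - ?D * q))"
    by (simp add: algebra_simps)
  obtain u v where uv: "?P - ?D * q = Ch * u + v" "v = 0 \<or> degree v < degree Ch"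
    by (rule monic_division [OF Ch_monic(2)])
  have v: "[:N:] * v = Ch * (?D * (k + ?E * q) + ?E * (?P - ?D * q) - [:N:] * u)"
    using m unfolding uv(1) by (simp add: algebra_simps)
  have "v = 0"
  proof (rule ccontr)
    assume "v \<noteq> 0"
    let ?m = "?D * (k + ?E * q) + ?E * (?P - ?D * q) - [:N:] * u"
    have "[:N:] * v \<noteq> 0" using N0 \<open>v \<noteq> 0\<close> by simp
    then have "?m \<noteq> 0" using v by auto
    then have dR: "degree (Ch * ?m) = degree Ch + degree ?m" using Ch_monic(3) degree_mult_eq by blast
    have dL: "degree ([:N:] * v) = degree v" using N0 \<open>v \<noteq> 0\<close> by (simp add: degree_mult_eq)
    have "degree v = degree Ch + degree ?m" using arg_cong [OF v, of degree] unfolding dL dR .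
    then show False using uv(2) \<open>v \<noteq> 0\<close> by simp
  qed
  then have e: "?P = ?D * q + Ch * u" using uv(1) by (simp add: algebra_simps)
  have "P = coeff ?P 0" by (simp add: coeff_shiftp_0)
  also have "\<dots> = D * coeff q 0 + C * coeff u 0" unfolding e by (simp add: coeff_mult coeff_shiftp_0 Ch_def)
  finally show ?thesis by (metis mult.commute add.commute)
qed

text \<open>Polynomials that are constant along a plane missing \<open>C = D = 0\<close> are not zero divisors
  modulo the ideal of \<open>C\<close> and \<open>D\<close>.\<close>

text \<open>Multiplying by \<open>Dst\<close> turns membership in the ideal into divisibility by \<open>N\<close>, which is again a form monic
  in the direction \<open>c\<close>; a factor \<open>a\<close> that is constant along \<open>b\<close> and \<open>c\<close> can be cancelled there.\<close>

lemma torsion_free: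
  assumes c: "peval N c \<noteq> 0" and a0: "a \<noteq> 0"
    and ab: "\<And>x t. peval a (x + t *s b) = peval a x" and ac: "\<And>x t. peval a (x + t *s c) = peval a x"
    and eq: "a * P = \<alpha> * C + \<beta> * D"
  shows "\<exists>\<alpha> \<beta>. P = \<alpha> * C + \<beta> * D"
proof -
  have N0: "N \<noteq> 0" using c by auto
  obtain E where E: "N = D * Dst + C * E" using N_eq by blast
  obtain k p where p: "shiftp b (P * Dst) = Ch * k + p" "p = 0 \<or> degree p < degree Ch"
    by (rule monic_division [OF Ch_monic(2)])
  obtain l m where m: "shiftp b \<beta> = Ch * l + m" "m = 0 \<or> degree m < degree Ch"
    by (rule monic_division [OF Ch_monic(2)])
  have "a * (P * Dst) = N * \<beta> + C * (\<alpha> * Dst - E * \<beta>)"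
    using eq E by algebra
  then have "shiftp b a * shiftp b (P * Dst) = shiftp b N * shiftp b \<beta> + Ch * shiftp b (\<alpha> * Dst - E * \<beta>)"
    by (metis shiftp_add shiftp_mult Ch_def)
  then have "[:a:] * (Ch * k + p) = [:N:] * (Ch * l + m) + Ch * shiftp b (\<alpha> * Dst - E * \<beta>)"
    using shiftp_invariant [of N b, OF N_shift] shiftp_invariant [of a b, OF ab] p(1) m(1) by metis
  then have pm: "[:a:] * p - [:N:] * m = Ch * ([:N:] * l + shiftp b (\<alpha> * Dst - E * \<beta>) - [:a:] * k)"
    by (simp add: algebra_simps)
  have deg: "degree ([:a:] * p - [:N:] * m) < 3"
  proof -
    have "degree p < 3" "degree m < 3" using p m Ch_monic by auto
    then show ?thesis by (auto intro!: degree_diff_less le_less_trans [OF degree_smult_le])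
  qed
  have "[:a:] * p = [:N:] * m"
  proof (rule ccontr)
    let ?u = "[:N:] * l + shiftp b (\<alpha> * Dst - E * \<beta>) - [:a:] * k"
    assume "[:a:] * p \<noteq> [:N:] * m"
    then have "?u \<noteq> 0" using pm by auto
    then have "degree (Ch * ?u) = degree Ch + degree ?u" using Ch_monic(3) degree_mult_eq by blast
    then show False using deg pm Ch_monic by simp
  qed
  then have co: "a * coeff p i = N * coeff m i" for i
    by (metis coeff_smult mult_pCons_left mult_zero_left pCons_0_0 add.right_neutral)
  define c' where "c' = peval N c"
  define M where "M = pscale (1 / c') N"
  have hM: "homogeneous 12 M" unfolding M_def by (rule homogeneous_pscale [OF hN])
  have M1: "peval M c = 1" using c by (simp add: M_def c'_def)
  have NM: "N = Poly_Mapping.single 0 c' * M" using c by (intro peval_inj) (simp add: M_def c'_def)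
  have MN: "N dvd u" if Mu: "M dvd u" for u
  proof -
    have "M = Poly_Mapping.single 0 (1 / c') * N" by (simp add: M_def pscale_def)
    moreover have "N dvd M" 
      unfolding dvd_def using c by (intro exI [of _ "Poly_Mapping.single 0 (1 / c')"] peval_inj) (simp add: M_def)
    ultimately show ?thesis using Mu dvd_trans by blast
  qed
  let ?M = "shiftp c M"
  have Mm: "degree ?M = 12" "lead_coeff ?M = 1" using shiftp_monic [OF hM M1] by auto
  have "N dvd coeff p i" for i
  proof (rule MN)
    let ?p = "coeff p i" and ?m = "Poly_Mapping.single 0 c' * coeff m i"
    obtain q r where q: "shiftp c ?p = ?M * q + r" "r = 0 \<or> degree r < degree ?M"
      by (rule monic_division [OF Mm(2)])
    have "a * ?p = M * ?m" using co [of i] NM by (simp add: mult_ac)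
    then have "shiftp c a * shiftp c ?p = ?M * shiftp c ?m" by (metis shiftp_mult)
    then have "[:a:] * (?M * q + r) = ?M * shiftp c ?m" using shiftp_invariant [of a c, OF ac] q(1) by metis
    then have ar: "[:a:] * r = ?M * (shiftp c ?m - [:a:] * q)" by (simp add: algebra_simps)
    have "r = 0"
    proof (rule ccontr)
      assume "r \<noteq> 0"
      let ?u = "shiftp c ?m - [:a:] * q"
      have "[:a:] * r \<noteq> 0" using a0 \<open>r \<noteq> 0\<close> by simp
      then have "?u \<noteq> 0" using ar by auto
      moreover have "?M \<noteq> 0" using Mm by auto
      ultimately have dR: "degree (?M * ?u) = degree ?M + degree ?u" using degree_mult_eq by blast
      have dL: "degree ([:a:] * r) = degree r" using a0 by simp
      have "degree r = degree ?M + degree ?u" using arg_cong [OF ar, of degree] unfolding dL dR .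
      then show False using q(2) \<open>r \<noteq> 0\<close> by simp
    qed
    then have "coeff (shiftp c ?p) 0 = M * coeff q 0" using q(1) by (simp add: coeff_mult coeff_shiftp_0)
    then show "M dvd ?p" by (simp add: coeff_shiftp_0)
  qed
  then show ?thesis using mem_idealI [OF N0 p(1)] by blast
qed

end

lemma norm_smult_vec: "norm (c *s (x :: complex^'n)) = norm c * norm x"
  by (simp add: norm_vec_def L2_set_right_distrib norm_mult)

lemma dense_nonzero:
  fixes R :: "('n::finite) mpoly"
  assumes "R \<noteq> 0" shows "closure {x. peval R x \<noteq> 0} = UNIV"
proof (intro set_eqI iffI UNIV_I)
  fix x :: "complex^'n"
  obtain z where z: "peval R z \<noteq> 0" using assms peval_inj_0 by blast
  define p where "p = pev (shiftp (z - x) R) x"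
  have p: "poly p t = peval R (x + t *s (z - x))" for t by (simp add: p_def)
  have "poly p 1 \<noteq> 0" using z by (simp add: p)
  then have fin: "finite {t. poly p t = 0}" by (intro poly_roots_finite) auto
  show "x \<in> closure {x. peval R x \<noteq> 0}"
    unfolding closure_approachable
  proof (intro allI impI)
    fix e :: real assume e: "0 < e"
    define d where "d = e / (norm (z - x) + 1)"
    have d: "0 < d" unfolding d_def using e by (intro divide_pos_pos) (auto intro: add_nonneg_pos)
    have "infinite (ball (0::complex) d)" using uncountable_ball [OF d, of 0] countable_finite by blast
    then obtain t where t: "t \<in> ball 0 d" "poly p t \<noteq> 0" using fin by (metis (mono_tags, lifting) finite_subset mem_Collect_eq subsetI)
    have "norm t * norm (z - x) \<le> d * norm (z - x)" using t by (intro mult_right_mono) auto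
    also have "\<dots> < e"
    proof -
      have "d * (norm (z - x) + 1) = e" unfolding d_def using norm_ge_zero [of "z - x"] by (simp add: add_nonneg_eq_0_iff)
      then show ?thesis using d by (simp add: algebra_simps)
    qed
    finally have "norm (t *s (z - x)) < e" by (simp only: norm_smult_vec)
    then have "dist (x + t *s (z - x)) x < e" by (simp only: dist_norm add_diff_cancel_left')
    then show "\<exists>y\<in>{x. peval R x \<noteq> 0}. dist y x < e" using t(2) p by auto
  qed
qed

lemma open_nonzero: "continuous_on UNIV f \<Longrightarrow> open {x. peval R (f x) \<noteq> 0}"
  by (intro open_Collect_neq continuous_intros)

text \<open>The complement of a proper hypersurface is open and dense, so by the theorem of Baire countably many of
  them have a common point.\<close>

lemma nonzero_common:
  fixes R :: "'a \<Rightarrow> ('n::finite) mpoly"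
  assumes "countable S" "\<And>y. y \<in> S \<Longrightarrow> R y \<noteq> 0"
  shows "\<exists>b. \<forall>y\<in>S. peval (R y) b \<noteq> 0"
proof -
  have "UNIV \<subseteq> closure (\<Inter> ((\<lambda>y. {b. peval (R y) b \<noteq> 0}) ` S))"
  proof (rule Baire)
    fix T assume "T \<in> (\<lambda>y. {b. peval (R y) b \<noteq> 0}) ` S"
    then obtain y where y: "y \<in> S" "T = {b. peval (R y) b \<noteq> 0}" by blast
    show "openin (top_of_set UNIV) T \<and> UNIV \<subseteq> closure T"
      using open_nonzero [of "\<lambda>x. x" "R y"] dense_nonzero [OF assms(2) [OF y(1)]] y(2) by simp
  qed (use assms(1) in auto)
  then have "\<Inter> ((\<lambda>y. {b. peval (R y) b \<noteq> 0}) ` S) \<noteq> {}" by (metis UNIV_not_empty closure_empty subset_empty)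
  then show ?thesis by auto
qed

lemma not_in_span_ex:
  fixes S :: "(complex^'n) set"
  assumes "finite S" "card S < CARD('n)" shows "\<exists>a. a \<notin> vec.span S"
proof (rule ccontr)
  assume "\<nexists>a. a \<notin> vec.span S"
  then have "UNIV \<subseteq> vec.span S" by auto
  then have "vec.dim (UNIV :: (complex^'n) set) \<le> card S" by (rule vec.dim_le_card) (rule assms(1))
  then show False using assms(2) by (simp add: card_cart_basis)
qed

lemma mem_span2: "x *s a + y *s b \<in> vec.span {a, b}"
  by (intro vec.span_add vec.span_scale vec.span_base) auto

lemma prime_power_split:
  fixes f \<sigma> :: "5 mpoly"
  assumes f: "f \<noteq> 0" and s: "prime_elem \<sigma>" "\<sigma> dvd f"
  shows "\<exists>k \<tau>. f = \<sigma> ^ Suc k * \<tau> \<and> \<not> \<sigma> dvd \<tau>"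
proof -
  have 1: "tower_of f \<noteq> 0" using f by (metis tower_of_0 tower_of_eq)
  have 2: "\<not> is_unit (tower_of \<sigma>)" using s(1) by (simp add: tower_of_unit prime_elem_def)
  obtain y where y: "tower_of f = tower_of \<sigma> ^ multiplicity (tower_of \<sigma>) (tower_of f) * y" "\<not> tower_of \<sigma> dvd y"
    using multiplicity_decompose' [OF 1 2] by metis
  obtain \<tau> where t: "tower_of \<tau> = y" using tower_of_surj by blast
  have pw: "tower_of (\<sigma> ^ n) = tower_of \<sigma> ^ n" for n by (induction n) (auto simp: tower_of_1 tower_of_mult)
  define m where "m = multiplicity (tower_of \<sigma>) (tower_of f)"
  have f': "f = \<sigma> ^ m * \<tau>" using y(1) t by (metis pw tower_of_mult tower_of_eq m_def)
  have nd: "\<not> \<sigma> dvd \<tau>" using y(2) t tower_of_dvd by metis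
  have "m \<noteq> 0" using f' nd s(2) by (metis mult_1 power_0)
  then show ?thesis using f' nd by (metis not0_implies_Suc)
qed

lemma prime_factor_zero:
  fixes f \<sigma> :: "5 mpoly"
  assumes f: "f \<noteq> 0" "homogeneous d f" and s: "prime_elem \<sigma>" "\<sigma> dvd f"
  shows "\<exists>k \<tau> x. f = \<sigma> ^ Suc k * \<tau> \<and> \<not> \<sigma> dvd \<tau> \<and> peval \<sigma> x = 0 \<and> peval \<tau> x \<noteq> 0"
proof -
  obtain k \<tau> where kt: "f = \<sigma> ^ Suc k * \<tau>" "\<not> \<sigma> dvd \<tau>" using prime_power_split [OF f(1) s] by blast
  obtain m where m: "f = \<sigma> * m" using s(2) unfolding dvd_def by blast
  then have "\<sigma> \<noteq> 0" "m \<noteq> 0" using f(1) by auto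
  then obtain i where i: "homogeneous i \<sigma>" using homogeneous_factor [of d \<sigma> m] f(2) m by blast
  show ?thesis using hypersurface_nullstellensatz [OF s(1) i, of \<tau>] kt by blast
qed

lemma card_roots_rsquarefree:
  fixes p :: "complex poly" assumes "rsquarefree p" shows "card {z. poly p z = 0} = degree p"
proof -
  let ?q = "\<Prod>z|poly p z = 0. [:-z, 1:]"
  have p: "smult (lead_coeff p) ?q = p" by (rule complex_poly_decompose_rsquarefree [OF assms])
  have "p \<noteq> 0" using assms by (simp add: rsquarefree_def)
  then have "degree p = degree ?q" using p by (metis degree_smult_eq leading_coeff_0_iff)
  also have "\<dots> = (\<Sum>z|poly p z = 0. degree [:-z, 1:])" by (rule degree_prod_sum_eq) auto
  finally show ?thesis by simp
qed

context cubic_norm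
begin

lemma roots3_perm: "roots3 x t1 t2 t3 \<Longrightarrow> roots3 x t2 t1 t3" "roots3 x t1 t2 t3 \<Longrightarrow> roots3 x t3 t2 t1"
  by (simp_all only: roots3_def mult_ac)

lemma remainder_zero:
  assumes P: "\<And>x. peval C x = 0 \<Longrightarrow> peval D x = 0 \<Longrightarrow> peval P x = 0"
    and div: "shiftp b (P * Dst) = Ch * k + p" "p = 0 \<or> degree p < degree Ch"
    and x: "peval N x = 0" "peval T x \<noteq> 0"
  shows "peval (coeff p i) x = 0"
proof -
  obtain s1 s2 s3 where s: "roots3 x s1 s2 s3" using roots3_ex by blast
  have "\<exists>t1 t2 t3. roots3 x t1 t2 t3 \<and> peval D (x + t1 *s b) = 0"
    using N_roots(1) [OF s] x(1) roots3_perm s by (metis mult_eq_0_iff)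
  then obtain t1 t2 t3 where r: "roots3 x t1 t2 t3" and D1: "peval D (x + t1 *s b) = 0" by blast
  have D2: "peval D (x + t2 *s b) \<noteq> 0" and D3: "peval D (x + t3 *s b) \<noteq> 0"
    using N_roots(2) [OF r] x(2) D1 by auto
  let ?P = "pev (shiftp b P) x" and ?D = "pev (shiftp b D) x" and ?S = "pev (shiftp b Dst) x" and ?C = "pev Ch x"
  have C: "?C = [:-t1,1:] * ([:-t2,1:] * [:-t3,1:])" using r by (simp add: roots3_def)
  obtain E where E: "N = D * Dst + C * E" using N_eq by blast
  have "[:N:] = shiftp b D * shiftp b Dst + Ch * shiftp b E"
    using shiftp_invariant [of N b, OF N_shift] E by (metis shiftp_add shiftp_mult Ch_def)
  from arg_cong [OF this, of "\<lambda>q. pev q x"] have "0 = ?D * ?S + ?C * pev (shiftp b E) x" using x(1) by simp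
  then have "?D * ?S = - (?C * pev (shiftp b E) x)" by (metis eq_neg_iff_add_eq_0)
  then have DS: "?D * ?S = [:-t2,1:] * ([:-t3,1:] * (- ([:-t1,1:] * pev (shiftp b E) x)))"
    unfolding C by (simp only: mult_minus_right mult_ac)
  have "poly ?S t2 = 0"
    using arg_cong [OF DS, of "\<lambda>q. poly q t2"] D2 by simp
  then obtain u where u: "?S = [:-t2,1:] * u" using poly_eq_0_iff_dvd unfolding dvd_def by blast
  have "[:-t2,1:] * (?D * u) = [:-t2,1:] * ([:-t3,1:] * (- ([:-t1,1:] * pev (shiftp b E) x)))"
    using DS unfolding u by (simp only: mult_ac)
  then have "?D * u = [:-t3,1:] * (- ([:-t1,1:] * pev (shiftp b E) x))"
    by (subst (asm) mult_left_cancel) auto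
  from arg_cong [OF this, of "\<lambda>q. poly q t3"] have "poly u t3 = 0" using D3 by simp
  then obtain v where v: "u = [:-t3,1:] * v" using poly_eq_0_iff_dvd unfolding dvd_def by blast
  have "poly ?P t1 = 0" using P [of "x + t1 *s b"] D1 roots3_peval [OF r, of t1] by simp
  then obtain w where w: "?P = [:-t1,1:] * w" using poly_eq_0_iff_dvd unfolding dvd_def by blast
  have "?P * ?S = ?C * (w * v)" unfolding w u v C by (simp only: mult_ac)
  moreover have "?P * ?S = ?C * pev k x + pev p x"
    using arg_cong [OF div(1), of "\<lambda>q. pev q x"] by (simp add: shiftp_mult)
  ultimately have e: "pev p x = ?C * (w * v - pev k x)" by (simp add: algebra_simps)
  have "pev p x = 0"
  proof (rule ccontr)
    assume "pev p x \<noteq> 0"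
    then have "w * v - pev k x \<noteq> 0" using e by auto
    then have "degree (?C * (w * v - pev k x)) = degree ?C + degree (w * v - pev k x)"
      by (intro degree_mult_eq) (use pev_Ch_monic [of x] in auto)
    then have "degree (pev p x) = 3 + degree (w * v - pev k x)" using e pev_Ch_monic(1) by simp
    moreover have "degree (pev p x) \<le> degree p" by (rule degree_pev)
    ultimately show False using div(2) Ch_monic \<open>pev p x \<noteq> 0\<close> by auto
  qed
  then show ?thesis by (metis coeff_pev coeff_0)
qed

text \<open>On a general line in direction \<open>c\<close> the form \<open>N\<close> has simple zeros, and over such a zero exactly one of the
  three points of \<open>C = 0\<close> lies on \<open>D = 0\<close>. Hence the remainder of \<open>P * Dst\<close> vanishes at twelve points of the
  line, and \<open>N\<close> divides it.\<close>

lemma radical_if_separable: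
  assumes c: "peval N c \<noteq> 0"
    and r1: "r1 \<noteq> 0" "\<And>x t. peval N (x + t *s c) = 0 \<Longrightarrow> dP N (x + t *s c) c = 0 \<Longrightarrow> peval r1 x = 0"
    and r2: "r2 \<noteq> 0" "\<And>x t. peval N (x + t *s c) = 0 \<Longrightarrow> peval T (x + t *s c) = 0 \<Longrightarrow> peval r2 x = 0"
    and P: "\<And>x. peval C x = 0 \<Longrightarrow> peval D x = 0 \<Longrightarrow> peval P x = 0"
  shows "\<exists>\<alpha> \<beta>. P = \<alpha> * C + \<beta> * D"
proof -
  have N0: "N \<noteq> 0" using c by auto
  obtain k p where p: "shiftp b (P * Dst) = Ch * k + p" "p = 0 \<or> degree p < degree Ch"
    by (rule monic_division [OF Ch_monic(2)])
  define c' where "c' = peval N c"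
  define M where "M = pscale (1 / c') N"
  have hM: "homogeneous 12 M" unfolding M_def by (rule homogeneous_pscale [OF hN])
  have M1: "peval M c = 1" using c by (simp add: M_def c'_def)
  have c0: "c' \<noteq> 0" using c by (simp add: c'_def)
  have NM: "N = Poly_Mapping.single 0 c' * M" using c0 by (intro peval_inj) (simp add: M_def)
  have "N dvd M"
    unfolding dvd_def using c0 by (intro exI [of _ "Poly_Mapping.single 0 (1 / c')"] peval_inj) (simp add: M_def)
  then have MN: "N dvd u" if "M dvd u" for u using that dvd_trans by blast
  let ?M = "shiftp c M"
  have Mm: "degree ?M = 12" "lead_coeff ?M = 1" using shiftp_monic [OF hM M1] by auto
  have zero: "pev r x = 0" if q: "shiftp c (coeff p i) = ?M * q + r" "r = 0 \<or> degree r < degree ?M"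
    and x: "peval r1 x \<noteq> 0" "peval r2 x \<noteq> 0" for i q r x
  proof (rule ccontr)
    assume r0: "pev r x \<noteq> 0"
    let ?n = "pev ?M x"
    have "coeff ?n 12 = 1" using Mm by simp
    moreover have "degree ?n \<le> 12" using degree_pev [of ?M x] Mm by simp
    ultimately have dn: "degree ?n = 12" by (metis le_antisym le_degree one_neq_zero)
    have n: "poly ?n t = peval M (x + t *s c)" for t by simp
    have nd: "poly (pderiv ?n) t = dP M (x + t *s c) c" for t
    proof (rule DERIV_unique)
      show "((\<lambda>t. peval M (x + t *s c)) has_field_derivative poly (pderiv ?n) t) (at t)"
        using poly_DERIV [of ?n t] unfolding n .
      show "((\<lambda>t. peval M (x + t *s c)) has_field_derivative dP M (x + t *s c) c) (at t)" by (rule has_deriv_dP)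
    qed
    have Nz: "peval N y = 0" if "peval M y = 0" for y using NM that by simp
    have Nd: "dP N y c = 0" if "peval M y = 0" "dP M y c = 0" for y
      by (subst NM) (simp add: that)
    have sq: "rsquarefree ?n" unfolding rsquarefree_roots
      using n nd Nz Nd r1(2) x(1) by metis
    have "?n \<noteq> 0" using dn by auto
    then have card: "card {t. poly ?n t = 0} = 12" using card_roots_rsquarefree sq dn by metis
    have "{t. poly ?n t = 0} \<subseteq> {t. poly (pev r x) t = 0}"
    proof
      fix t assume "t \<in> {t. poly ?n t = 0}"
      then have t: "poly ?n t = 0" by simp
      then have Nt: "peval N (x + t *s c) = 0" using Nz n by auto
      then have "peval T (x + t *s c) \<noteq> 0" using r2(2) x(2) by blast
      then have "peval (coeff p i) (x + t *s c) = 0" using remainder_zero [OF P p Nt] by blast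
      then have "poly (pev (shiftp c (coeff p i)) x) t = 0" by simp
      then have "poly (pev r x) t = 0" using t unfolding q(1) by simp
      then show "t \<in> {t. poly (pev r x) t = 0}" by simp
    qed
    then have "12 \<le> card {t. poly (pev r x) t = 0}"
      using card card_mono [OF poly_roots_finite [OF r0]] by metis
    also have "\<dots> \<le> degree (pev r x)" by (rule card_poly_roots_bound [OF r0])
    also have "\<dots> \<le> degree r" by (rule degree_pev)
    finally show False using q(2) Mm r0 by auto
  qed
  have "N dvd coeff p i" for i
  proof (rule MN)
    obtain q r where q: "shiftp c (coeff p i) = ?M * q + r" "r = 0 \<or> degree r < degree ?M"
      by (rule monic_division [OF Mm(2)])
    have "coeff r j = 0" for j
    proof -
      have "peval (r1 * r2 * coeff r j) x = 0" for x
      proof (cases "peval r1 x = 0 \<or> peval r2 x = 0")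
        case False
        then have "pev r x = 0" using zero [OF q] by blast
        then have "peval (coeff r j) x = 0" by (metis coeff_pev coeff_0)
        then show ?thesis by simp
      qed auto
      then have "r1 * r2 * coeff r j = 0" by (rule peval_inj_0)
      then show ?thesis using r1(1) r2(1) by simp
    qed
    then have "r = 0" by (simp add: poly_eq_iff)
    then have "coeff (shiftp c (coeff p i)) 0 = M * coeff q 0" using q(1) by (simp add: coeff_mult coeff_shiftp_0)
    then show "M dvd coeff p i" by (simp add: coeff_shiftp_0)
  qed
  then show ?thesis using mem_idealI [OF N0 p(1)] by blast
qed

lemma dN_shift: "dP N (x + s *s b) v = dP N x v"
proof (rule dP_unique)
  have "peval N (x + s *s b + t *s v) = peval N (x + t *s v)" for t
    using N_shift [of "x + t *s v" s] by (simp add: algebra_simps)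
  then show "((\<lambda>t. peval N (x + s *s b + t *s v)) has_field_derivative dP N x v) (at 0)"
    using has_deriv_dP_0 [of N x v] by simp
qed

lemma common_zero_ex:
  assumes "peval N c \<noteq> 0" shows "\<exists>y. y \<noteq> 0 \<and> peval C y = 0 \<and> peval D y = 0"
proof -
  have "card {c, b} \<le> 2" by (simp add: card_insert_if)
  then obtain a where a: "a \<notin> vec.span {c, b}" using not_in_span_ex [of "{c, b}"] by auto
  obtain w where "peval N (a + w *s c) = 0" using line_root [OF hN _ assms] by auto
  then obtain t where t: "peval C (a + w *s c + t *s b) = 0" "peval D (a + w *s c + t *s b) = 0"
    using N_zero_iff by blast
  have "a + w *s c + t *s b \<noteq> 0"
  proof
    assume "a + w *s c + t *s b = 0"
    moreover have "a = (a + w *s c + t *s b) + ((- w) *s c + (- t) *s b)" by (simp add: vector_smult_lneg)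
    ultimately have "a = (- w) *s c + (- t) *s b" by simp
    then show False using a mem_span2 by metis
  qed
  then show ?thesis using t by blast
qed

end

text \<open>The criterion for radicality. Either a suitable projection separates the points of \<open>C = D = 0\<close> and its
  norm has no multiple factor, and then the ideal is radical; or a prime factor of the norm is multiple, and
  over the zeros of this factor alone \<open>C\<close> and \<open>D\<close> touch along an open piece of their intersection.\<close>

lemma radical_or_dependent:
  fixes C D :: "5 mpoly"
  assumes pC: "prime_elem C" and hC: "homogeneous 3 C" and hD: "homogeneous 4 D" and CD: "\<not> C dvd D"
  shows "(\<forall>P. (\<forall>x. peval C x = 0 \<longrightarrow> peval D x = 0 \<longrightarrow> peval P x = 0) \<longrightarrow> (\<exists>\<alpha> \<beta>. P = \<alpha> * C + \<beta> * D)) \<or>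
    (\<exists>y0 \<epsilon>. y0 \<noteq> 0 \<and> peval C y0 = 0 \<and> peval D y0 = 0 \<and> 0 < \<epsilon> \<and>
      (\<forall>y. peval C y = 0 \<longrightarrow> peval D y = 0 \<longrightarrow> dist y y0 < \<epsilon> \<longrightarrow>
        (\<forall>v w. dP C y v * dP D y w = dP C y w * dP D y v)))" (is "?rad \<or> ?dep")
proof (cases ?rad)
  case False
  have C0: "C \<noteq> 0" using pC by (simp add: prime_elem_def)
  define B where "B = {y. peval C y = 0 \<and> peval D y = 0}"
  define B' where "B' = {y\<in>B. \<exists>v. dP C y v \<noteq> 0}"
  obtain Y0 where Y0: "countable Y0" "Y0 \<subseteq> B'" "B' \<subseteq> closure Y0" using separable by metis
  have "\<exists>R::5 mpoly. R \<noteq> 0 \<and> (\<forall>b. peval R b \<noteq> 0 \<longrightarrow> peval C b \<noteq> 0 \<and> dP C y b \<noteq> 0 \<and>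
      (\<forall>t. peval C (b + t *s y) = 0 \<longrightarrow> peval D (b + t *s y) \<noteq> 0))" if y: "y \<in> Y0" for y
  proof -
    obtain r :: "5 mpoly" where r: "r \<noteq> 0" "\<And>x t. peval C (x + t *s y) = 0 \<Longrightarrow> peval D (x + t *s y) = 0 \<Longrightarrow> peval r x = 0"
      using elimination [OF C0, of D y] prime_mpoly_coprime [OF pC CD] by blast
    have "polyfun (\<lambda>b. dP C y b)" unfolding dP_def by (intro polyfun_sum polyfun_mult polyfun_const polyfun_coord)
    then obtain l :: "5 mpoly" where l: "\<And>b. peval l b = dP C y b" unfolding polyfun_def by blast
    obtain v where "dP C y v \<noteq> 0" using y Y0(2) by (auto simp: B'_def)
    then have "l \<noteq> 0" using l by (metis peval_0)
    show ?thesis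
      by (rule exI [of _ "C * l * r"]) (use C0 r \<open>l \<noteq> 0\<close> l in auto)
  qed
  then obtain R :: "complex^5 \<Rightarrow> 5 mpoly" where R: "\<And>y. y \<in> Y0 \<Longrightarrow> R y \<noteq> 0"
    "\<And>y b. y \<in> Y0 \<Longrightarrow> peval (R y) b \<noteq> 0 \<Longrightarrow> peval C b \<noteq> 0 \<and> dP C y b \<noteq> 0 \<and>
      (\<forall>t. peval C (b + t *s y) = 0 \<longrightarrow> peval D (b + t *s y) \<noteq> 0)"
    by metis
  obtain b0 where b0: "\<And>y. y \<in> Y0 \<Longrightarrow> peval (R y) b0 \<noteq> 0" "peval C b0 \<noteq> 0"
  proof -
    have "\<exists>b. \<forall>y\<in>insert None (Some ` Y0). peval (case y of None \<Rightarrow> C | Some y \<Rightarrow> R y) b \<noteq> 0"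
      by (rule nonzero_common) (use Y0(1) R(1) C0 in \<open>auto split: option.splits\<close>)
    then show ?thesis using that by fastforce
  qed
  define \<kappa> where "\<kappa> = exp (Ln (1 / peval C b0) / 3)"
  have k0: "\<kappa> \<noteq> 0" by (simp add: \<kappa>_def)
  have k3: "\<kappa> ^ 3 * peval C b0 = 1"
  proof -
    have "\<kappa> ^ 3 = exp (of_nat 3 * (Ln (1 / peval C b0) / 3))" unfolding \<kappa>_def by (rule exp_of_nat_mult [symmetric])
    also have "\<dots> = 1 / peval C b0" using b0(2) by simp
    finally show ?thesis using b0(2) by simp
  qed
  define b where "b = \<kappa> *s b0"
  have b1: "peval C b = 1" unfolding b_def by (simp add: peval_homogeneous [OF hC] k3)
  interpret cubic_norm C D b by unfold_locales (fact hC hD b1)+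
  obtain c where c: "peval N c \<noteq> 0" using N_nonzero_ex [OF pC CD] by blast
  have N0: "N \<noteq> 0" using c by auto
  have Y0B: "peval C y = 0" "peval D y = 0" if "y \<in> Y0" for y using Y0(2) that by (auto simp: B'_def B_def)
  text \<open>At the points of the dense set, the line in direction \<open>b\<close> is transversal and meets the
    curve \<open>C = D = 0\<close> nowhere else.\<close>
  have good: "peval Dst y \<noteq> 0 \<and> peval T y = peval Dst y" if y: "y \<in> Y0" for y
  proof -
    obtain s1 s2 s3 where s: "roots3 y s1 s2 s3" using roots3_ex by blast
    have "s1 = 0 \<or> s2 = 0 \<or> s3 = 0" using roots3_peval [OF s, of 0] Y0B(1) [OF y] by auto
    then obtain t2 t3 where r: "roots3 y 0 t2 t3" using s roots3_perm by blast
    have "dP C y b = t2 * t3"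
    proof (rule dP_unique)
      have "(\<lambda>t. peval C (y + t *s b)) = (\<lambda>t. t * (t - t2) * (t - t3))" using roots3_peval [OF r] by auto
      moreover have "((\<lambda>t. t * (t - t2) * (t - t3)) has_field_derivative t2 * t3) (at 0)"
        by (auto intro!: derivative_eq_intros)
      ultimately show "((\<lambda>t. peval C (y + t *s b)) has_field_derivative t2 * t3) (at 0)" by simp
    qed
    moreover have "dP C y b \<noteq> 0" using R(2) [OF y b0(1) [OF y]] k0 by (simp add: b_def)
    ultimately have t: "t2 \<noteq> 0" "t3 \<noteq> 0" by auto
    have nz: "peval D (y + t *s b) \<noteq> 0" if t: "t \<noteq> 0" "peval C (y + t *s b) = 0" for t
    proof
      assume D: "peval D (y + t *s b) = 0"
      have e: "b0 + (1 / (t * \<kappa>)) *s y = (1 / (t * \<kappa>)) *s (y + t *s b)"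
        using t(1) k0 by (simp add: b_def vector_add_ldistrib vector_smult_assoc)
      have "peval C (b0 + (1 / (t * \<kappa>)) *s y) = 0" "peval D (b0 + (1 / (t * \<kappa>)) *s y) = 0"
        unfolding e peval_homogeneous [OF hC] peval_homogeneous [OF hD] using D t(2) by simp_all
      then show False using R(2) [OF y b0(1) [OF y]] by blast
    qed
    have "peval Dst y \<noteq> 0" unfolding Dst_roots [OF r]
      using nz [OF t(1)] nz [OF t(2)] roots3_peval [OF r, of t2] roots3_peval [OF r, of t3] by simp
    moreover have "peval T y = peval Dst y" unfolding Dst_roots [OF r] N_roots(2) [OF r] using Y0B(2) [OF y] by simp
    ultimately show ?thesis by simp
  qed
  have "polyfun (\<lambda>x. dP N x c)" by (rule polyfun_dP)
  then obtain Nc :: "5 mpoly" where Nc: "\<And>x. peval Nc x = dP N x c" unfolding polyfun_def by blast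
  have "\<exists>\<sigma>. prime_elem \<sigma> \<and> \<sigma> dvd N \<and> (\<sigma> dvd Nc \<or> \<sigma> dvd T)"
  proof (rule ccontr)
    assume no: "\<nexists>\<sigma>. prime_elem \<sigma> \<and> \<sigma> dvd N \<and> (\<sigma> dvd Nc \<or> \<sigma> dvd T)"
    have cop1: "\<And>\<sigma>. prime_elem \<sigma> \<Longrightarrow> \<sigma> dvd N \<Longrightarrow> \<not> \<sigma> dvd Nc"
      and cop2: "\<And>\<sigma>. prime_elem \<sigma> \<Longrightarrow> \<sigma> dvd N \<Longrightarrow> \<not> \<sigma> dvd T" using no by blast+
    obtain r1 :: "5 mpoly" where r1: "r1 \<noteq> 0" "\<And>x t. peval N (x + t *s c) = 0 \<Longrightarrow> peval Nc (x + t *s c) = 0 \<Longrightarrow> peval r1 x = 0"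
      using elimination [OF N0 cop1, of c] by blast
    obtain r2 :: "5 mpoly" where r2: "r2 \<noteq> 0" "\<And>x t. peval N (x + t *s c) = 0 \<Longrightarrow> peval T (x + t *s c) = 0 \<Longrightarrow> peval r2 x = 0"
      using elimination [OF N0 cop2, of c] by blast
    have "\<exists>\<alpha> \<beta>. P = \<alpha> * C + \<beta> * D" if P: "\<forall>x. peval C x = 0 \<longrightarrow> peval D x = 0 \<longrightarrow> peval P x = 0" for P
    proof (rule radical_if_separable [OF c r1(1) _ r2])
      show "peval r1 x = 0" if "peval N (x + t *s c) = 0" "dP N (x + t *s c) c = 0" for x t
        using r1(2) [of x t] that Nc by simp
    qed (use P in auto)
    then have "?rad" by blast
    then show False using \<open>\<not> ?rad\<close> by blast
  qed
  then obtain \<sigma> where s: "prime_elem \<sigma>" "\<sigma> dvd N" "\<sigma> dvd Nc \<or> \<sigma> dvd T" by blast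
  obtain k \<tau> x0 where kt: "N = \<sigma> ^ Suc k * \<tau>" "\<not> \<sigma> dvd \<tau>" "peval \<sigma> x0 = 0" "peval \<tau> x0 \<noteq> 0"
    using prime_factor_zero [OF N0 hN s(1,2)] by blast
  have s0: "\<sigma> \<noteq> 0" using s(1) by (simp add: prime_elem_def)
  have alt: "\<sigma> ^ 2 dvd N \<or> \<sigma> dvd T"
  proof (cases "\<sigma> dvd Nc")
    case True
    obtain m where m: "N = \<sigma> * m" using s(2) unfolding dvd_def by blast
    have "polyfun (\<lambda>x. dP \<sigma> x c)" "polyfun (\<lambda>x. dP m x c)" by (rule polyfun_dP)+
    then obtain \<sigma>c mc :: "5 mpoly" where sc: "\<And>x. peval \<sigma>c x = dP \<sigma> x c" and mc: "\<And>x. peval mc x = dP m x c"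
      unfolding polyfun_def by blast
    have "Nc = \<sigma>c * m + \<sigma> * mc" by (rule peval_inj) (simp add: Nc sc mc m)
    then have "\<sigma> dvd \<sigma>c * m" using True by (metis dvd_add_left_iff dvd_triv_left)
    then have "\<sigma> dvd \<sigma>c \<or> \<sigma> dvd m" using prime_elem_dvd_multD [OF s(1)] by blast
    moreover have "\<not> \<sigma> dvd \<sigma>c"
    proof
      assume "\<sigma> dvd \<sigma>c"
      then obtain q where q: "\<sigma>c = \<sigma> * q" unfolding dvd_def by blast
      have cst: "peval \<sigma> (x + t *s c) = peval \<sigma> x" for x t
      proof -
        let ?p = "pev (shiftp c \<sigma>) x"
        have "pderiv ?p = ?p * pev (shiftp c q) x"
        proof -
          have "poly (pderiv ?p) t = poly (?p * pev (shiftp c q) x) t" for t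
          proof -
            have "poly (pderiv ?p) t = dP \<sigma> (x + t *s c) c"
            proof (rule DERIV_unique)
              show "((\<lambda>t. peval \<sigma> (x + t *s c)) has_field_derivative poly (pderiv ?p) t) (at t)"
                using poly_DERIV [of ?p t] unfolding poly_shiftp .
            qed (rule has_deriv_dP)
            also have "\<dots> = peval (\<sigma> * q) (x + t *s c)" using sc q by metis
            finally show ?thesis by simp
          qed
          then show ?thesis by (simp add: poly_eq_poly_eq_iff [symmetric] fun_eq_iff)
        qed
        then have pd: "pderiv ?p = ?p * pev (shiftp c q) x" .
        have "pderiv ?p = 0"
        proof (rule ccontr)
          assume nz: "pderiv ?p \<noteq> 0"
          then have "?p \<noteq> 0" "pev (shiftp c q) x \<noteq> 0" using pd by auto
          then have "degree (pderiv ?p) = degree ?p + degree (pev (shiftp c q) x)" using pd degree_mult_eq by metis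
          moreover have "degree ?p \<noteq> 0" using nz by (simp add: pderiv_eq_0_iff)
          ultimately show False by (simp add: degree_pderiv)
        qed
        then have "degree ?p = 0" by (simp add: pderiv_eq_0_iff)
        then obtain z where "?p = [:z:]" by (rule degree_eq_zeroE)
        then have "poly ?p t = poly ?p 0" by simp
        then show ?thesis by simp
      qed
      have "peval N (x0 + t *s c) = 0" for t using kt(3) by (simp add: m cst)
      moreover obtain p where "\<And>t. poly p t = peval N (x0 + t *s c)" "degree p = 12" "lead_coeff p = peval N c"
        using line_poly_top [OF hN c] by metis
      ultimately have "poly p t = 0" for t by simp
      then have "p = 0" using poly_all_0_iff_0 by blast
      then show False using \<open>degree p = 12\<close> by simp
    qed
    ultimately obtain m' where "m = \<sigma> * m'" unfolding dvd_def by blast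
    then have "N = \<sigma> ^ 2 * m'" using m by (simp add: power2_eq_square mult.assoc)
    then show ?thesis by simp
  qed (use s(3) in auto)
  have "peval N x0 = 0" using kt by simp
  then obtain t0 where t0: "peval C (x0 + t0 *s b) = 0" "peval D (x0 + t0 *s b) = 0" using N_zero_iff by blast
  define y0 where "y0 = x0 + t0 *s b"
  have "open {y. peval \<tau> (y - t0 *s b) \<noteq> 0}" by (intro open_nonzero continuous_intros)
  moreover have "y0 \<in> {y. peval \<tau> (y - t0 *s b) \<noteq> 0}" using kt(4) by (simp add: y0_def)
  ultimately obtain \<epsilon> where eps: "0 < \<epsilon>" "ball y0 \<epsilon> \<subseteq> {y. peval \<tau> (y - t0 *s b) \<noteq> 0}"
    by (meson openE)
  have sig: "peval \<sigma> (y - t0 *s b) = 0" if "y \<in> B" "y \<in> ball y0 \<epsilon>" for y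
  proof -
    have "peval N y = 0" using that(1) N_zero_iff [of y] unfolding B_def by (auto intro!: exI [of _ 0])
    then have "peval N (y - t0 *s b) = 0" using N_shift [of "y - t0 *s b" t0] by simp
    then show ?thesis using kt(1) eps(2) that(2) by auto
  qed
  have dep0: "dP C y v * dP D y w = dP C y w * dP D y v" if y: "y \<in> Y0" "y \<in> ball y0 \<epsilon>" for y v w
  proof (cases "\<sigma> ^ 2 dvd N")
    case True
    then obtain m where m: "N = \<sigma> * (\<sigma> * m)" unfolding dvd_def by (auto simp: power2_eq_square mult.assoc)
    have yB: "y \<in> B" using y(1) Y0(2) by (auto simp: B'_def)
    have "dP N (y - t0 *s b) v = 0" for v using sig [OF yB y(2)] by (simp add: m)
    then have dN: "dP N y v = 0" for v using dN_shift [of "y - t0 *s b" t0 v] by simp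
    obtain E where E: "N = D * Dst + C * E" using N_eq by blast
    have "dP D y v * peval Dst y = - dP C y v * peval E y" for v
      using dN [of v] Y0B [OF y(1)] by (simp add: E add_eq_0_iff2)
    then have "dP C y v * (dP D y w * peval Dst y) = dP C y w * (dP D y v * peval Dst y)" by (simp add: mult_ac)
    then show ?thesis using good [OF y(1)] by simp
  next
    case False
    then have "\<sigma> dvd T" using alt by blast
    then obtain m where m: "T = \<sigma> * m" unfolding dvd_def by blast
    have yB: "y \<in> B" using y(1) Y0(2) by (auto simp: B'_def)
    have "peval T (y - t0 *s b) = 0" using sig [OF yB y(2)] by (simp add: m)
    then have "peval T y = 0" using T_shift [of "y - t0 *s b" t0] by simp
    then show ?thesis using good [OF y(1)] by simp
  qed
  have dep: "dP C y v * dP D y w = dP C y w * dP D y v" if y: "y \<in> B" "y \<in> ball y0 \<epsilon>" for y v w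
  proof (cases "y \<in> B'")
    case False
    then have "dP C y u = 0" for u using y(1) by (auto simp: B'_def)
    then show ?thesis by simp
  next
    case True
    then have "y \<in> closure (ball y0 \<epsilon> \<inter> Y0)"
      using y(2) Y0(3) open_Int_closure_subset [OF open_ball] by blast
    moreover have "closed {y. dP C y v * dP D y w = dP C y w * dP D y v}"
      by (intro closed_Collect_eq continuous_intros)
    moreover have "ball y0 \<epsilon> \<inter> Y0 \<subseteq> {y. dP C y v * dP D y w = dP C y w * dP D y v}" using dep0 by blast
    ultimately show ?thesis using closure_minimal by blast
  qed
  have "\<exists>y1 \<in> B. y1 \<noteq> 0 \<and> y1 \<in> ball y0 \<epsilon>"
  proof (cases "y0 = 0")
    case False
    then show ?thesis using t0 eps(1) by (auto simp: B_def y0_def)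
  next
    case True
    obtain z where z: "z \<noteq> 0" "peval C z = 0" "peval D z = 0" using common_zero_ex [OF c] by blast
    let ?s = "of_real (\<epsilon> / (2 * norm z)) :: complex"
    have "norm ?s = \<epsilon> / (2 * norm z)" using eps(1) by (simp only: norm_of_real) simp
    then have "norm (?s *s z) = \<epsilon> / 2" using z(1) by (simp only: norm_smult_vec) simp
    moreover have "?s *s z \<noteq> 0" using calculation eps(1) by auto
    moreover have "?s *s z \<in> B" using z by (simp add: B_def peval_homogeneous [OF hC] peval_homogeneous [OF hD])
    ultimately show ?thesis using True eps(1) by (intro bexI [of _ "?s *s z"]) (auto simp: dist_norm)
  qed
  then obtain y1 where y1: "y1 \<in> B" "y1 \<noteq> 0" "y1 \<in> ball y0 \<epsilon>" by blast
  obtain \<delta> where d: "0 < \<delta>" "ball y1 \<delta> \<subseteq> ball y0 \<epsilon>" using y1(3) open_ball openE by blast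
  have "?dep"
    by (rule exI [of _ y1], rule exI [of _ \<delta>])
      (use y1 d dep in \<open>auto simp: B_def subset_iff dist_commute\<close>)
  then show ?thesis by blast
qed auto

section \<open>Hilbert functions of complete intersections\<close>

lemma mpoly_span_disjoint:
  assumes ind: "mpoly.independent (A \<union> B)" and dis: "A \<inter> B = {}"
    and x: "x \<in> mpoly.span A" "x \<in> mpoly.span B"
  shows "x = 0"
proof -
  let ?S = "A \<union> B"
  have "mpoly.representation ?S x = mpoly.representation A x"
    by (rule mpoly.representation_extend [OF ind x(1)]) auto
  moreover have "mpoly.representation ?S x = mpoly.representation B x"
    by (rule mpoly.representation_extend [OF ind x(2)]) auto
  ultimately have "mpoly.representation ?S x b = 0" for b
    using mpoly.representation_ne_zero dis by (metis disjoint_iff)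
  then have "{b. mpoly.representation ?S x b \<noteq> 0} = {}" by auto
  moreover have "x \<in> mpoly.span ?S" using x(1) mpoly.span_mono [of A ?S] by auto
  ultimately show ?thesis
    using mpoly.sum_nonzero_representation_eq [OF ind, of x] by simp
qed

lemma mpoly_independent_union:
  assumes A: "mpoly.independent A" and B: "mpoly.independent B"
    and int: "\<And>x. x \<in> mpoly.span A \<Longrightarrow> x \<in> mpoly.span B \<Longrightarrow> x = 0" and fin: "finite B"
  shows "mpoly.independent (A \<union> B)" "A \<inter> B = {}"
proof -
  have "mpoly.independent (A \<union> S)" if "finite S" "S \<subseteq> B" for S
    using that
  proof (induction S rule: finite_induct)
    case (insert b S)
    have "b \<notin> mpoly.span (A \<union> S)"
    proof
      assume "b \<in> mpoly.span (A \<union> S)"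
      then obtain x y where xy: "b = x + y" "x \<in> mpoly.span A" "y \<in> mpoly.span S"
        unfolding mpoly.span_Un by blast
      have "y \<in> mpoly.span B" using xy(3) mpoly.span_mono insert.prems by blast
      moreover have "b \<in> mpoly.span B" using insert.prems by (intro mpoly.span_base) auto
      ultimately have "x \<in> mpoly.span B" using xy(1) mpoly.span_diff [of b B y] by simp
      then have "x = 0" using int xy(2) by blast
      then have "b \<in> mpoly.span S" using xy by simp
      moreover have "S \<subseteq> B - {b}" using insert by auto
      ultimately have "b \<in> mpoly.span (B - {b})" using mpoly.span_mono by blast
      then show False using B insert.prems unfolding mpoly.dependent_def by auto
    qed
    then show ?case using insert by (simp add: mpoly.independent_insertI)
  qed (use A in auto)
  then show "mpoly.independent (A \<union> B)" using fin by blast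
  show "A \<inter> B = {}"
  proof (rule ccontr)
    assume "A \<inter> B \<noteq> {}"
    then obtain x where x: "x \<in> A" "x \<in> B" by blast
    then have "x = 0" using int mpoly.span_base by blast
    then show False using A x mpoly.dependent_zero by blast
  qed
qed

lemma mpoly_basis:
  assumes "mpoly.subspace V" "V \<subseteq> mpoly.span S" "finite S"
  obtains B where "B \<subseteq> V" "finite B" "mpoly.independent B" "mpoly.span B = V" "card B = mpoly.dim V"
proof -
  obtain B where B: "B \<subseteq> V" "mpoly.independent B" "V \<subseteq> mpoly.span B"
    using mpoly.maximal_independent_subset by blast
  have "finite B" using mpoly.independent_span_bound [OF assms(3) B(2)] B(1) assms(2) by auto
  moreover have "mpoly.span B = V" using B assms(1) by (metis mpoly.span_mono mpoly.span_subspace)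
  ultimately show ?thesis using B that mpoly.basis_card_eq_dim by metis
qed

lemma mpoly_dim_sum:
  assumes U: "mpoly.subspace U" and V: "mpoly.subspace V" and S: "finite S" "U \<subseteq> mpoly.span S" "V \<subseteq> mpoly.span S"
  shows "mpoly.dim {x + y | x y. x \<in> U \<and> y \<in> V} + mpoly.dim (U \<inter> V) = mpoly.dim U + mpoly.dim V"
proof -
  have UV: "mpoly.subspace (U \<inter> V)" by (rule mpoly.subspace_inter [OF U V])
  obtain B0 where B0: "B0 \<subseteq> U \<inter> V" "finite B0" "mpoly.independent B0" "mpoly.span B0 = U \<inter> V" "card B0 = mpoly.dim (U \<inter> V)"
    using mpoly_basis [OF UV _ S(1)] S by (metis inf.coboundedI1)
  obtain BU where BU: "BU \<subseteq> U" "finite BU" "mpoly.independent BU" "mpoly.span BU = U" "card BU = mpoly.dim U"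
    using mpoly_basis [OF U S(2,1)] by metis
  obtain BV where BV: "B0 \<subseteq> BV" "BV \<subseteq> V" "mpoly.independent BV" "V \<subseteq> mpoly.span BV"
    using mpoly.maximal_independent_subset_extend [of B0 V] B0 by auto
  have finV: "finite BV" using mpoly.independent_span_bound [OF S(1) BV(3)] BV(2) S(3) by auto
  have spV: "mpoly.span BV = V" using BV V by (metis mpoly.span_mono mpoly.span_subspace)
  have cV: "card BV = mpoly.dim V" using BV mpoly.basis_card_eq_dim by blast
  let ?B = "BV - B0"
  have 1: "x = 0" if "x \<in> mpoly.span BU" "x \<in> mpoly.span ?B" for x
  proof (rule mpoly_span_disjoint [of B0 ?B])
    show "mpoly.independent (B0 \<union> ?B)" using BV by (simp add: Un_absorb1)
    have "x \<in> V" using that(2) spV mpoly.span_mono [of ?B BV] by auto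
    then show "x \<in> mpoly.span B0" using that(1) BU(4) B0(4) by simp
  qed (use that in auto)
  have indB: "mpoly.independent ?B" using BV(3) mpoly.independent_mono by blast
  have ind: "mpoly.independent (BU \<union> ?B)" and dis: "BU \<inter> ?B = {}"
    using mpoly_independent_union [OF BU(3) indB 1] finV by auto
  have span: "mpoly.span (BU \<union> ?B) = {x + y | x y. x \<in> U \<and> y \<in> V}"
  proof (intro subset_antisym subsetI)
    fix z assume "z \<in> mpoly.span (BU \<union> ?B)"
    then obtain x y where "z = x + y" "x \<in> U" "y \<in> mpoly.span ?B" unfolding mpoly.span_Un BU(4) by blast
    moreover have "mpoly.span ?B \<subseteq> V" using spV mpoly.span_mono [of ?B BV] by auto
    ultimately show "z \<in> {x + y | x y. x \<in> U \<and> y \<in> V}" by blast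
  next
    fix z assume "z \<in> {x + y | x y. x \<in> U \<and> y \<in> V}"
    then obtain x y where z: "z = x + y" "x \<in> U" "y \<in> V" by blast
    have "BV = B0 \<union> ?B" using BV(1) by auto
    then have "y \<in> mpoly.span (B0 \<union> ?B)" using z(3) spV by simp
    then obtain y1 y2 where y: "y = y1 + y2" "y1 \<in> mpoly.span B0" "y2 \<in> mpoly.span ?B"
      unfolding mpoly.span_Un by blast
    have "x + y1 \<in> mpoly.span BU" using z y B0(4) BU(4) U mpoly.subspace_add by auto
    moreover have "z = (x + y1) + y2" using z y by (simp add: add.assoc)
    ultimately show "z \<in> mpoly.span (BU \<union> ?B)" unfolding mpoly.span_Un using y(3) by blast
  qed
  have "mpoly.dim {x + y | x y. x \<in> U \<and> y \<in> V} = card (BU \<union> ?B)"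
    unfolding span [symmetric] by (rule mpoly.dim_span_eq_card_independent [OF ind])
  also have "\<dots> = card BU + (card BV - card B0)"
    using dis BU(2) finV BV(1) B0(2) by (subst card_Un_disjoint) (auto simp: card_Diff_subset)
  finally show ?thesis using BU(5) cV B0(5) card_mono [OF finV BV(1)] by simp
qed

lemma mpoly_dim_mult:
  fixes C :: "('n::{finite,linorder}) mpoly"
  assumes C: "C \<noteq> 0" and W: "mpoly.subspace W" "W \<subseteq> mpoly.span S" "finite S"
  shows "mpoly.dim ((\<lambda>P. C * P) ` W) = mpoly.dim W" "mpoly.subspace ((\<lambda>P. C * P) ` W)"
    "(\<lambda>P. C * P) ` W \<subseteq> mpoly.span ((\<lambda>P. C * P) ` S)"
proof -
  have lin: "Vector_Spaces.linear pscale pscale (\<lambda>P. C * P)"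
    by unfold_locales (auto simp: pscale_def algebra_simps)
  interpret lin: Vector_Spaces.linear pscale pscale "\<lambda>P. C * P" by (rule lin)
  obtain B where B: "B \<subseteq> W" "finite B" "mpoly.independent B" "mpoly.span B = W" "card B = mpoly.dim W"
    using mpoly_basis [OF W] by metis
  have inj: "inj_on (\<lambda>P. C * P) A" for A using C by (auto simp: inj_on_def)
  have "mpoly.independent ((\<lambda>P. C * P) ` B)"
    using lin.independent_injective_image [OF B(3) inj] .
  then have "mpoly.dim (mpoly.span ((\<lambda>P. C * P) ` B)) = card ((\<lambda>P. C * P) ` B)"
    by (rule mpoly.dim_span_eq_card_independent)
  moreover have sp: "mpoly.span ((\<lambda>P. C * P) ` A) = (\<lambda>P. C * P) ` mpoly.span A" for A by (rule lin.span_image)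
  ultimately show "mpoly.dim ((\<lambda>P. C * P) ` W) = mpoly.dim W" using B(4,5) card_image [OF inj, of B] by simp
  show "mpoly.subspace ((\<lambda>P. C * P) ` W)" using sp [of B] B(4) mpoly.subspace_span by metis
  show "(\<lambda>P. C * P) ` W \<subseteq> mpoly.span ((\<lambda>P. C * P) ` S)" using sp [of S] W(2) by auto
qed

definition Hom :: "nat \<Rightarrow> ('n::finite) mpoly set" where "Hom d = {P. homogeneous d P}"

lemma subspace_Hom: "mpoly.subspace (Hom d)"
  unfolding mpoly.subspace_def Hom_def by (auto intro: homogeneous_add homogeneous_pscale)

lemma bij_monomials_lists:
  obtains g where "bij_betw g {m :: 'n::finite \<Rightarrow>\<^sub>0 nat. mdeg m = d} {l. length l = CARD('n) \<and> sum_list l = d}"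
proof -
  obtain h :: "nat \<Rightarrow> 'n" where h: "bij_betw h {0..<CARD('n)} UNIV"
    using ex_bij_betw_nat_finite [of "UNIV :: 'n set"] by auto
  define g where "g m = map (\<lambda>k. Poly_Mapping.lookup m (h k)) [0..<CARD('n)]" for m :: "'n \<Rightarrow>\<^sub>0 nat"
  have s: "sum_list (g m) = mdeg m" for m
    unfolding g_def mdeg_def using sum.reindex_bij_betw [OF h, of "Poly_Mapping.lookup m"]
    by (simp add: interv_sum_list_conv_sum_set_nat)
  have "bij_betw g {m. mdeg m = d} {l. length l = CARD('n) \<and> sum_list l = d}"
    unfolding bij_betw_def
  proof
    show "inj_on g {m. mdeg m = d}"
    proof (rule inj_onI)
      fix m n assume "g m = g n"
      then have e: "Poly_Mapping.lookup m (h k) = Poly_Mapping.lookup n (h k)" if "k < CARD('n)" for k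
        using that unfolding g_def by (metis (no_types, lifting) add_0 diff_zero length_upt nth_map nth_upt)
      show "m = n"
      proof (rule poly_mapping_eqI)
        fix i
        obtain k where "k < CARD('n)" "h k = i" using h unfolding bij_betw_def
          by (metis UNIV_I atLeastLessThan_iff imageE)
        then show "Poly_Mapping.lookup m i = Poly_Mapping.lookup n i" using e by blast
      qed
    qed
    show "g ` {m. mdeg m = d} = {l. length l = CARD('n) \<and> sum_list l = d}"
    proof (intro subset_antisym subsetI)
      fix l assume "l \<in> g ` {m. mdeg m = d}"
      then show "l \<in> {l. length l = CARD('n) \<and> sum_list l = d}" using s by (auto simp: g_def)
    next
      fix l :: "nat list" assume l: "l \<in> {l. length l = CARD('n) \<and> sum_list l = d}"
      define m where "m = Abs_poly_mapping (\<lambda>i. l ! inv_into {0..<CARD('n)} h i)"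
      have "Poly_Mapping.lookup m i = l ! inv_into {0..<CARD('n)} h i" for i
        unfolding m_def by (simp add: Abs_poly_mapping_inverse)
      then have "g m = l"
        unfolding g_def using h l by (intro nth_equalityI) (auto simp: bij_betw_def inv_into_f_f)
      then show "l \<in> g ` {m. mdeg m = d}" using s [of m] l by auto
    qed
  qed
  then show ?thesis by (rule that)
qed

lemma card_monomials: "card {m :: 'n::finite \<Rightarrow>\<^sub>0 nat. mdeg m = d} = (d + CARD('n) - 1) choose d"
proof -
  obtain g where g: "bij_betw g {m :: 'n \<Rightarrow>\<^sub>0 nat. mdeg m = d} {l. length l = CARD('n) \<and> sum_list l = d}"
    by (rule bij_monomials_lists)
  show ?thesis unfolding bij_betw_same_card [OF g] by (rule card_length_sum_list)
qed

lemma finite_monomials: "finite {m :: 'n::finite \<Rightarrow>\<^sub>0 nat. mdeg m = d}"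
proof (rule card_ge_0_finite)
  have "0 < CARD('n)" by simp
  then have "d \<le> d + CARD('n) - 1" by linarith
  then show "0 < card {m :: 'n \<Rightarrow>\<^sub>0 nat. mdeg m = d}" unfolding card_monomials by (rule zero_less_binomial)
qed

definition mons :: "nat \<Rightarrow> ('n::finite) mpoly set" where
  "mons d = (\<lambda>m. Poly_Mapping.single m 1) ` {m. mdeg m = d}"

lemma finite_mons: "finite (mons d)"
  unfolding mons_def by (intro finite_imageI finite_monomials)

lemma span_mons: "mpoly.span (mons d) = Hom d"
proof (intro subset_antisym subsetI)
  fix P :: "'a mpoly" assume "P \<in> mpoly.span (mons d)"
  moreover have "mons d \<subseteq> (Hom d :: 'a mpoly set)" by (auto simp: mons_def Hom_def homogeneous_def)
  ultimately show "P \<in> Hom d" using mpoly.span_minimal [OF _ subspace_Hom] by blast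
next
  fix P :: "'a mpoly" assume P: "P \<in> Hom d"
  have "P = (\<Sum>m\<in>Poly_Mapping.keys P. pscale (Poly_Mapping.lookup P m) (Poly_Mapping.single m 1))"
    by (subst mpoly_decomp) (simp add: pscale_def mult_single)
  moreover have "Poly_Mapping.single m 1 \<in> mons d" if "m \<in> Poly_Mapping.keys P" for m
    using P that by (auto simp: mons_def Hom_def homogeneous_def)
  ultimately show "P \<in> mpoly.span (mons d)" by (metis (no_types, lifting) mpoly.span_base mpoly.span_scale mpoly.span_sum)
qed

lemma dim_Hom: "mpoly.dim (Hom d :: ('n::finite) mpoly set) = (d + CARD('n) - 1) choose d"
proof -
  have inj: "inj_on (\<lambda>m. Poly_Mapping.single m (1::complex)) A" for A :: "('n \<Rightarrow>\<^sub>0 nat) set"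
    by (auto simp: inj_on_def) (metis lookup_single_eq lookup_single_not_eq one_neq_zero)
  have "mpoly.independent (mons d :: 'n mpoly set)"
    unfolding mpoly.independent_explicit_finite_subsets
  proof (intro allI impI ballI)
    fix S :: "'n mpoly set" and u v assume S: "S \<subseteq> mons d" "finite S" and z: "(\<Sum>v\<in>S. pscale (u v) v) = 0" and v: "v \<in> S"
    obtain m where m: "v = Poly_Mapping.single m 1" using v S by (auto simp: mons_def)
    have "Poly_Mapping.lookup (pscale (u w) w) m = (if w = v then u v else 0)" if wS: "w \<in> S" for w
    proof -
      obtain n where n: "w = Poly_Mapping.single n 1" using wS S(1) unfolding mons_def by blast
      have "w = v \<longleftrightarrow> n = m" unfolding n m using inj_onD [OF inj [of UNIV], of n m] by blast
      moreover have "Poly_Mapping.lookup (pscale (u w) w) m = (if n = m then u w else 0)"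
        unfolding n by (simp add: pscale_def mult_single lookup_single when_def)
      ultimately show ?thesis by auto
    qed
    then have "(\<Sum>w\<in>S. Poly_Mapping.lookup (pscale (u w) w) m) = u v" using v S(2) by (simp add: sum.delta')
    then have "Poly_Mapping.lookup (\<Sum>w\<in>S. pscale (u w) w) m = u v" by (simp only: lookup_sum)
    then show "u v = 0" unfolding z by simp
  qed
  then have "mpoly.dim (mpoly.span (mons d) :: 'n mpoly set) = card (mons d :: 'n mpoly set)"
    by (rule mpoly.dim_span_eq_card_independent)
  then show ?thesis unfolding span_mons unfolding mons_def card_image [OF inj] card_monomials .
qed

lemma Hom_sub_span: "Hom d \<subseteq> mpoly.span (mons d)"
  by (simp add: span_mons)

text \<open>The dimension formulas say that \<open>C\<close> and \<open>E\<close> form a regular sequence: the multiples of \<open>C\<close> and the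
  multiples of \<open>E\<close> meet in the multiples of \<open>C * E\<close>.\<close>

lemma principal_ideal_Hom:
  fixes C :: "('n::{finite,linorder}) mpoly"
  assumes hC: "homogeneous k C" and C: "C \<noteq> 0"
  shows "{P. (\<exists>\<alpha>. P = \<alpha> * C) \<and> homogeneous (k + d) P} = (\<lambda>P. C * P) ` Hom d"
proof (intro subset_antisym subsetI)
  fix P assume "P \<in> {P. (\<exists>\<alpha>. P = \<alpha> * C) \<and> homogeneous (k + d) P}"
  then obtain \<alpha> where a: "P = \<alpha> * C" "homogeneous (k + d) P" by blast
  have "P = hom_part (k + d) P" using hom_part_homogeneous [OF a(2), of "k + d"] by simp
  also have "\<dots> = hom_part d \<alpha> * C" unfolding a(1) by (simp add: hom_part_mult [OF hC])
  finally show "P \<in> (\<lambda>P. C * P) ` Hom d" by (auto simp: Hom_def mult.commute)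
next
  fix P assume "P \<in> (\<lambda>P. C * P) ` Hom d"
  then obtain \<alpha> where a: "P = C * \<alpha>" "homogeneous d \<alpha>" unfolding Hom_def by blast
  show "P \<in> {P. (\<exists>\<alpha>. P = \<alpha> * C) \<and> homogeneous (k + d) P}"
  proof (intro CollectI conjI exI)
    show "P = \<alpha> * C" unfolding a(1) by (rule mult.commute)
    show "homogeneous (k + d) P" unfolding a(1) by (rule homogeneous_mult [OF hC a(2)])
  qed
qed

lemma dim_principal_ideal:
  fixes C :: "('n::{finite,linorder}) mpoly"
  assumes hC: "homogeneous k C" and C: "C \<noteq> 0"
  shows "mpoly.dim {P. (\<exists>\<alpha>. P = \<alpha> * C) \<and> homogeneous (k + d) P} = (d + CARD('n) - 1) choose d"
  unfolding principal_ideal_Hom [OF hC C] mpoly_dim_mult(1) [OF C subspace_Hom Hom_sub_span finite_mons] dim_Hom ..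

lemma dim_ci_ideal:
  fixes C E :: "5 mpoly"
  assumes pC: "prime_elem C" and hC: "homogeneous k C" and hE: "homogeneous g E" and CE: "\<not> C dvd E"
  shows "mpoly.dim {P. (\<exists>\<alpha> \<beta>. P = \<alpha> * C + \<beta> * E) \<and> homogeneous (k + g + d) P} + (d + 4 choose d) =
    (g + d + 4 choose (g + d)) + (k + d + 4 choose (k + d))"
proof -
  have C0: "C \<noteq> 0" using pC by (simp add: prime_elem_def)
  have E0: "E \<noteq> 0" using CE by auto
  let ?U = "(\<lambda>P. C * P) ` Hom (g + d)" and ?V = "(\<lambda>P. E * P) ` Hom (k + d)"
  let ?S = "(\<lambda>P. C * P) ` mons (g + d) \<union> (\<lambda>P. E * P) ` mons (k + d)"
  note U = mpoly_dim_mult [OF C0 subspace_Hom Hom_sub_span finite_mons, of "g + d"]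
  note V = mpoly_dim_mult [OF E0 subspace_Hom Hom_sub_span finite_mons, of "k + d"]
  have "finite ?S" by (simp add: finite_mons)
  moreover have "?U \<subseteq> mpoly.span ?S" using U(3) mpoly.span_mono [of _ ?S] by blast
  moreover have "?V \<subseteq> mpoly.span ?S" using V(3) mpoly.span_mono [of _ ?S] by blast
  ultimately have "mpoly.dim {x + y | x y. x \<in> ?U \<and> y \<in> ?V} + mpoly.dim (?U \<inter> ?V) = mpoly.dim ?U + mpoly.dim ?V"
    by (rule mpoly_dim_sum [OF U(2) V(2)])
  moreover have "{x + y | x y. x \<in> ?U \<and> y \<in> ?V} = {P. (\<exists>\<alpha> \<beta>. P = \<alpha> * C + \<beta> * E) \<and> homogeneous (k + g + d) P}"
  proof (intro subset_antisym subsetI)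
    fix P assume "P \<in> {x + y | x y. x \<in> ?U \<and> y \<in> ?V}"
    then obtain \<alpha> \<beta> where "P = C * \<alpha> + E * \<beta>" "homogeneous (g + d) \<alpha>" "homogeneous (k + d) \<beta>" by (auto simp: Hom_def)
    moreover from this have "homogeneous (k + (g + d)) (C * \<alpha>)" "homogeneous (g + (k + d)) (E * \<beta>)"
      using hC hE homogeneous_mult by blast+
    ultimately show "P \<in> {P. (\<exists>\<alpha> \<beta>. P = \<alpha> * C + \<beta> * E) \<and> homogeneous (k + g + d) P}"
      by (auto simp: ac_simps intro: homogeneous_add) (metis mult.commute)
  next
    fix P assume "P \<in> {P. (\<exists>\<alpha> \<beta>. P = \<alpha> * C + \<beta> * E) \<and> homogeneous (k + g + d) P}"
    then obtain \<alpha> \<beta> where a: "P = \<alpha> * C + \<beta> * E" "homogeneous (k + g + d) P" by blast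
    have "P = hom_part (k + g + d) P" using hom_part_homogeneous [OF a(2), of "k + g + d"] by simp
    also have "\<dots> = C * hom_part (g + d) \<alpha> + E * hom_part (k + d) \<beta>"
      unfolding a(1) hom_part_add hom_part_mult [OF hC] hom_part_mult [OF hE] by (simp add: mult.commute add.commute add.left_commute)
    finally show "P \<in> {x + y | x y. x \<in> ?U \<and> y \<in> ?V}" by (force simp: Hom_def)
  qed
  moreover have "?U \<inter> ?V = (\<lambda>P. (C * E) * P) ` Hom d"
  proof (intro subset_antisym subsetI)
    fix P assume "P \<in> ?U \<inter> ?V"
    from IntD2 [OF this] obtain \<beta> where b: "P = E * \<beta>" "homogeneous (k + d) \<beta>" unfolding Hom_def by blast
    from \<open>P \<in> ?U \<inter> ?V\<close> obtain \<alpha> where "P = C * \<alpha>" by blast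
    note a = this b
    then have "C dvd E * \<beta>" by (metis dvd_triv_left)
    then have "C dvd \<beta>" using prime_elem_dvd_multD [OF pC] CE by blast
    then obtain \<gamma> where g: "\<beta> = \<gamma> * C" unfolding dvd_def by (metis mult.commute)
    have "\<beta> \<in> (\<lambda>P. C * P) ` Hom d" using principal_ideal_Hom [OF hC C0, of d] g a(3) by blast
    then show "P \<in> (\<lambda>P. (C * E) * P) ` Hom d" using a(2) by (auto simp: mult_ac)
  next
    fix P assume "P \<in> (\<lambda>P. (C * E) * P) ` Hom d"
    then obtain \<gamma> where g: "P = C * E * \<gamma>" "homogeneous d \<gamma>" by (auto simp: Hom_def)
    have "E * \<gamma> \<in> Hom (g + d)" "C * \<gamma> \<in> Hom (k + d)" using g hC hE homogeneous_mult by (auto simp: Hom_def)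
    moreover have "P = C * (E * \<gamma>)" "P = E * (C * \<gamma>)" using g by (simp_all add: mult_ac)
    ultimately show "P \<in> ?U \<inter> ?V" by blast
  qed
  moreover have "mpoly.dim ((\<lambda>P. (C * E) * P) ` Hom d) = mpoly.dim (Hom d :: 5 mpoly set)"
    by (rule mpoly_dim_mult(1) [OF _ subspace_Hom Hom_sub_span finite_mons]) (use C0 E0 in simp)
  ultimately show ?thesis by (simp add: U(1) V(1) dim_Hom add.commute [of _ 4])
qed

lemma choose4: "real (d + 4 choose d) = (real d + 1) * (real d + 2) * (real d + 3) * (real d + 4) / 24"
proof -
  have "(d + 4 choose d) = (d + 4 choose 4)" using binomial_symmetric [of d "d + 4"] by simp
  then have "real (d + 4 choose d) = (real (d + 4)) gchoose 4" by (simp add: binomial_gbinomial)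
  also have "\<dots> = (real d + 4) * (real d + 3) * (real d + 2) * (real d + 1) / 24"
    by (simp add: gbinomial_prod_rev numeral_eq_Suc prod.atLeast0_lessThan_Suc fact_Suc) (simp add: add_ac mult_ac)
  finally show ?thesis by (simp add: mult_ac)
qed

lemma choose5: "real (d + 5 choose d) = (real d + 1) * (real d + 2) * (real d + 3) * (real d + 4) * (real d + 5) / 120"
proof -
  have "(d + 5 choose d) = (d + 5 choose 5)" using binomial_symmetric [of d "d + 5"] by simp
  then have "real (d + 5 choose d) = (real (d + 5)) gchoose 5" by (simp add: binomial_gbinomial)
  also have "\<dots> = (real d + 5) * (real d + 4) * (real d + 3) * (real d + 2) * (real d + 1) / 120"
    by (simp add: gbinomial_prod_rev numeral_eq_Suc prod.atLeast0_lessThan_Suc fact_Suc) (simp add: add_ac mult_ac)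
  finally show ?thesis by (simp add: mult_ac)
qed

lemma hilbert_poly_unique:
  assumes "is_hilbert_poly Z h1" "is_hilbert_poly Z h2" shows "h1 = h2"
proof -
  have "\<forall>\<^sub>F d in sequentially. poly (h1 - h2) (real d) = 0"
    using assms unfolding is_hilbert_poly_def by eventually_elim simp
  then obtain n where n: "\<And>d. n \<le> d \<Longrightarrow> poly (h1 - h2) (real d) = 0" unfolding eventually_sequentially by blast
  have "infinite (real ` {n..})" by (simp add: finite_image_iff infinite_Ici)
  moreover have "real ` {n..} \<subseteq> {x. poly (h1 - h2) x = 0}" using n by auto
  ultimately have "infinite {x. poly (h1 - h2) x = 0}" using finite_subset by blast
  then show ?thesis using poly_roots_finite [of "h1 - h2"] by auto
qed

definition ci_poly :: "nat \<Rightarrow> real poly" where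
  "ci_poly g = [:real g ^ 3 / 2 - 3 * real g ^ 2 / 2 + 2 * real g, 3 * real g - 3 * real g ^ 2 / 2, 3 * real g / 2:]"

lemma ci_poly_identity:
  fixes x y :: real
  shows "y^3/2 - 3*y^2/2 + 2*y + (3+y+x) * ((3*y - 3*y^2/2) + (3+y+x) * (3*y/2)) =
    (3+y+x+1)*(3+y+x+2)*(3+y+x+3)*(3+y+x+4)/24 - ((y+x+1)*(y+x+2)*(y+x+3)*(y+x+4)/24
      + (3+x+1)*(3+x+2)*(3+x+3)*(3+x+4)/24 - (x+1)*(x+2)*(x+3)*(x+4)/24)"
  by (simp add: field_simps power2_eq_square power3_eq_cube)

lemma hilbert_ci:
  fixes C E :: "5 mpoly" and Z :: "5 pspace set"
  assumes pC: "prime_elem C" and hC: "homogeneous 3 C" and hE: "homogeneous g E" and CE: "\<not> C dvd E"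
    and Z: "vanishing_ideal Z = {P. \<exists>\<alpha> \<beta>. P = \<alpha> * C + \<beta> * E}"
  shows "is_hilbert_poly Z (ci_poly g)"
  unfolding is_hilbert_poly_def eventually_sequentially
proof (intro exI allI impI)
  fix n :: nat assume "3 + g \<le> n"
  then obtain d where n: "n = 3 + g + d" using le_Suc_ex by blast
  let ?I = "{P \<in> vanishing_ideal Z. homogeneous n P}"
  have I: "real (mpoly.dim ?I) = real (g + d + 4 choose (g + d)) + real (3 + d + 4 choose (3 + d)) - real (d + 4 choose d)"
    using dim_ci_ideal [OF pC hC hE CE, of d] unfolding Z n by simp
  have H: "mpoly.dim {P :: 5 mpoly. homogeneous n P} = (n + 4 choose n)"
    using dim_Hom [of n, where 'n = 5] by (simp add: Hom_def add.commute [of 4])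
  obtain B where B: "B \<subseteq> ?I" "mpoly.independent B" "?I \<subseteq> mpoly.span B" "card B = mpoly.dim ?I"
    using mpoly.basis_exists by blast
  have "mpoly.dim ?I \<le> mpoly.dim {P :: 5 mpoly. homogeneous n P}"
  proof -
    have "B \<subseteq> mpoly.span (mons n)" using B(1) by (auto simp: span_mons Hom_def)
    then have "finite B \<and> card B \<le> card (mons n :: 5 mpoly set)"
      by (intro mpoly.independent_span_bound finite_mons B(2))
    moreover have "card (mons n :: 5 mpoly set) \<le> card {m :: 5 \<Rightarrow>\<^sub>0 nat. mdeg m = n}"
      unfolding mons_def by (rule card_image_le [OF finite_monomials])
    ultimately show ?thesis using B(4) H by (simp add: card_monomials add.commute [of 4])
  qed
  then have "real (hilbert_function Z n) = real (n + 4 choose n) - real (mpoly.dim ?I)"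
    unfolding hilbert_function_def H by (simp add: of_nat_diff)
  also have "\<dots> = poly (ci_poly g) (real n)"
  proof -
    define x y where "x = real d" and "y = real g"
    have r: "real n = 3 + y + x" "real (g + d) = y + x" "real (3 + d) = 3 + x" "real d = x" "real g = y"
      by (simp_all add: n x_def y_def)
    have "poly (ci_poly g) (real n) = y^3/2 - 3*y^2/2 + 2*y + (3+y+x) * ((3*y - 3*y^2/2) + (3+y+x) * (3*y/2))"
      unfolding ci_poly_def r by simp
    then show ?thesis unfolding I choose4 r ci_poly_identity by simp
  qed
  finally show "poly (ci_poly g) (real n) = real (hilbert_function Z n)" by simp
qed

lemma ci_poly_degree: "0 < g \<Longrightarrow> degree (ci_poly g) = 2" "0 < g \<Longrightarrow> lead_coeff (ci_poly g) = 3 * real g / 2"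
  by (auto simp: ci_poly_def)

lemma hypersurface_poly_identity:
  fixes x k :: real
  assumes "120 * k = 1"
  shows "1 + (3+x) * (270*k + (3+x) * (225*k + (3+x) * (90*k + (3+x) * (15*k)))) =
    (3+x+1)*(3+x+2)*(3+x+3)*(3+x+4)*(3+x+5)*k - (x+1)*(x+2)*(x+3)*(x+4)*(x+5)*k"
proof -
  have e: "120 + (3+x) * (270 + (3+x) * (225 + (3+x) * (90 + (3+x) * 15))) =
    (3+x+1)*(3+x+2)*(3+x+3)*(3+x+4)*(3+x+5) - (x+1)*(x+2)*(x+3)*(x+4)*(x+5)"
    by algebra
  have "1 + (3+x) * (270*k + (3+x) * (225*k + (3+x) * (90*k + (3+x) * (15*k)))) =
      1 - 120 * k + (120 + (3+x) * (270 + (3+x) * (225 + (3+x) * (90 + (3+x) * 15)))) * k"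
    by algebra
  then show ?thesis unfolding e assms by (simp add: left_diff_distrib)
qed

text \<open>A cubic hypersurface of projective 5-space has dimension four. This is why the second cubic cannot be a
  multiple of the first.\<close>

lemma hilbert_hypersurface6:
  fixes C :: "6 mpoly" and Z :: "6 pspace set"
  assumes hC: "homogeneous 3 C" and C0: "C \<noteq> 0"
    and Z: "vanishing_ideal Z = {P. \<exists>\<alpha>. P = \<alpha> * C}"
  shows "\<not> has_dim Z 3"
proof
  let ?k = "1 / 120 :: real"
  let ?h = "[:1, 270 * ?k, 225 * ?k, 90 * ?k, 15 * ?k:] :: real poly"
  have "is_hilbert_poly Z ?h"
    unfolding is_hilbert_poly_def eventually_sequentially
  proof (intro exI allI impI)
    fix n :: nat assume "3 \<le> n"
    then obtain d where n: "n = 3 + d" using le_Suc_ex by blast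
    have I: "mpoly.dim {P \<in> vanishing_ideal Z. homogeneous n P} = (d + 5 choose d)"
      using dim_principal_ideal [OF hC C0, of d] unfolding Z n by (simp add: add.commute [of 5])
    have H: "mpoly.dim {P :: 6 mpoly. homogeneous n P} = (n + 5 choose n)"
      using dim_Hom [of n, where 'n = 6] by (simp add: Hom_def add.commute [of 5])
    have le: "(d + 5 choose d) \<le> (n + 5 choose n)"
    proof -
      have "real (d + 5 choose d) \<le> real (n + 5 choose n)"
        unfolding choose5 n by (intro divide_right_mono mult_mono) auto
      then show ?thesis by simp
    qed
    have "real (hilbert_function Z n) = real (n + 5 choose n) - real (d + 5 choose d)"
      unfolding hilbert_function_def H I using le by (simp add: of_nat_diff)
    also have "\<dots> = poly ?h (real n)"
    proof -
      define x where "x = real d"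
      have r: "real n = 3 + x" "real d = x" by (simp_all add: n x_def)
      have "poly ?h (3 + x) = 1 + (3+x) * (270*?k + (3+x) * (225*?k + (3+x) * (90*?k + (3+x) * (15*?k))))"
        by (simp only: poly_pCons poly_0) simp
      also have "\<dots> = (3+x+1)*(3+x+2)*(3+x+3)*(3+x+4)*(3+x+5)*?k - (x+1)*(x+2)*(x+3)*(x+4)*(x+5)*?k"
        by (rule hypersurface_poly_identity) simp
      finally show ?thesis unfolding choose5 r by simp
    qed
    finally show "poly ?h (real n) = real (hilbert_function Z n)" by simp
  qed
  moreover assume "has_dim Z 3"
  then obtain h where "is_hilbert_poly Z h" "degree h = 3" unfolding has_dim_def by blast
  ultimately have "degree ?h = 3" using hilbert_poly_unique by metis
  then show False by simp
qed

section \<open>Existence of Hilbert polynomials\<close>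

definition evpoly :: "(nat \<Rightarrow> real) \<Rightarrow> bool" where
  "evpoly f \<longleftrightarrow> (\<exists>h. \<forall>\<^sub>F d in sequentially. poly h (real d) = f d)"

lemma evpoly_cong: "\<forall>\<^sub>F d in sequentially. f d = g d \<Longrightarrow> evpoly f \<Longrightarrow> evpoly g"
proof -
  assume fg: "\<forall>\<^sub>F d in sequentially. f d = g d" and "evpoly f"
  then obtain h where "\<forall>\<^sub>F d in sequentially. poly h (real d) = f d" unfolding evpoly_def by blast
  with fg have "\<forall>\<^sub>F d in sequentially. poly h (real d) = g d" by eventually_elim simp
  then show ?thesis unfolding evpoly_def by blast
qed

lemma evpoly_0: "evpoly (\<lambda>d. 0)"
  unfolding evpoly_def by (rule exI [of _ 0]) simp

lemma evpoly_add:
  assumes "evpoly f" "evpoly g" shows "evpoly (\<lambda>d. f d + g d)"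
proof -
  obtain h k where "\<forall>\<^sub>F d in sequentially. poly h (real d) = f d" "\<forall>\<^sub>F d in sequentially. poly k (real d) = g d"
    using assms unfolding evpoly_def by blast
  then have "\<forall>\<^sub>F d in sequentially. poly (h + k) (real d) = f d + g d" by eventually_elim simp
  then show ?thesis unfolding evpoly_def by blast
qed

lemma evpoly_sum: "(\<And>k. k \<in> A \<Longrightarrow> evpoly (f k)) \<Longrightarrow> evpoly (\<lambda>d. \<Sum>k\<in>A. f k d)"
  by (induction A rule: infinite_finite_induct) (auto simp: evpoly_0 evpoly_add)

lemma evpoly_shift:
  assumes "evpoly f" shows "evpoly (\<lambda>d. f (d - k))"
proof -
  obtain h n where h: "\<And>d. n \<le> d \<Longrightarrow> poly h (real d) = f d" using assms unfolding evpoly_def eventually_sequentially by blast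
  have "poly (pcompose h [:- real k, 1:]) (real d) = f (d - k)" if "n + k \<le> d" for d
    using h [of "d - k"] that by (simp add: poly_pcompose of_nat_diff)
  then show ?thesis unfolding evpoly_def eventually_sequentially by blast
qed

lemma antidifference: "\<exists>g::real poly. \<forall>x. poly g x - poly g (x - 1) = poly h x"
proof (induction "if h = 0 then 0 else Suc (degree h)" arbitrary: h rule: less_induct)
  case less
  show ?case
  proof (cases "h = 0")
    case True then show ?thesis by (intro exI [of _ 0]) simp
  next
    case False
    define k where "k = degree h"
    define B where "B n = (\<Prod>i<n. [:real i, 1:])" for n
    have dB: "degree (B n) = n" for n unfolding B_def by (simp add: degree_prod_sum_eq)
    have "lead_coeff (B n) = 1" for n unfolding B_def lead_coeff_prod by simp
    then have B: "degree (B n) = n \<and> coeff (B n) n = 1" for n using dB by metis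
    define h' where "h' = h - smult (lead_coeff h) (B k)"
    have "coeff h' k = 0" using B [of k] by (simp add: h'_def k_def)
    moreover have "degree h' \<le> k" unfolding h'_def
      by (rule degree_diff_le) (use B [of k] in \<open>auto simp: k_def intro: order.trans [OF degree_smult_le]\<close>)
    ultimately have "h' = 0 \<or> degree h' < k"
      by (metis le_neq_implies_less leading_coeff_0_iff)
    then have "(if h' = 0 then 0 else Suc (degree h')) < (if h = 0 then 0 else Suc (degree h))"
      using False by (auto simp: k_def)
    then obtain g where g: "\<And>x. poly g x - poly g (x - 1) = poly h' x" using less by blast
    have bd: "poly (B (Suc k)) x - poly (B (Suc k)) (x - 1) = real (Suc k) * poly (B k) x" for x
    proof -
      have "poly (B (Suc k)) (x - 1) = (x - 1) * poly (B k) x"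
        unfolding B_def poly_prod by (subst prod.lessThan_Suc_shift) (simp add: algebra_simps)
      then show ?thesis by (simp add: B_def poly_prod algebra_simps)
    qed
    define c where "c = lead_coeff h / real (Suc k)"
    have ck: "c * real (Suc k) = lead_coeff h" unfolding c_def by simp
    have cB: "c * (poly (B (Suc k)) x - poly (B (Suc k)) (x - 1)) = lead_coeff h * poly (B k) x" for x
      unfolding bd ck [symmetric] by (simp only: mult.assoc)
    have "poly (g + smult c (B (Suc k))) x - poly (g + smult c (B (Suc k))) (x - 1) = poly h x" for x
      using g [of x] cB [of x] unfolding h'_def poly_add poly_smult poly_diff right_diff_distrib by linarith
    then show ?thesis by blast
  qed
qed

lemma evpoly_partial_sums:
  assumes "evpoly f" shows "evpoly (\<lambda>n. \<Sum>j\<le>n. f j)"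
proof -
  obtain h n where h: "\<And>d. n \<le> d \<Longrightarrow> poly h (real d) = f d" using assms unfolding evpoly_def eventually_sequentially by blast
  obtain g where g: "\<And>x. poly g x - poly g (x - 1) = poly h x" using antidifference by blast
  define c where "c = (\<Sum>j\<le>n. f j) - poly g (real n)"
  have "poly (g + [:c:]) (real m) = (\<Sum>j\<le>m. f j)" if "n \<le> m" for m
    using that
  proof (induction m rule: dec_induct)
    case base show ?case by (simp add: c_def)
  next
    case (step m)
    then show ?case using g [of "real (Suc m)"] h [of "Suc m"] by simp
  qed
  then show ?thesis unfolding evpoly_def eventually_sequentially by blast
qed

text \<open>Dickson's lemma and the ascending chain condition for sets of exponents that are closed
  upwards.\<close>

lemma nat_mono_subseq:
  fixes s :: "nat \<Rightarrow> nat"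
  shows "\<exists>r::nat \<Rightarrow> nat. strict_mono r \<and> mono (s \<circ> r)"
proof -
  obtain f where f: "strict_mono f" "monoseq (\<lambda>n. s (f n))" using seq_monosub [of s] by blast
  then consider "mono (\<lambda>n. s (f n))" | "antimono (\<lambda>n. s (f n))" by (auto simp: monoseq_iff)
  then show ?thesis
  proof cases
    case 1 then show ?thesis using f(1) by (intro exI [of _ f]) (simp add: comp_def)
  next
    case 2
    obtain N where N: "\<And>n. s (f N) \<le> s (f n)" using ex_has_least_nat [of "\<lambda>_. True" _ "\<lambda>n. s (f n)"] by blast
    have "s (f (N + n)) = s (f N)" for n using N [of "N + n"] antimonoD [OF 2, of N "N + n"] by simp
    moreover have "strict_mono (\<lambda>n. f (N + n))" using f(1) by (simp add: strict_mono_def)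
    ultimately show ?thesis by (intro exI [of _ "\<lambda>n. f (N + n)"]) (simp add: comp_def mono_def)
  qed
qed

lemma dickson_subseq:
  fixes f :: "nat \<Rightarrow> 'a \<Rightarrow> nat"
  assumes "finite V" shows "\<exists>r::nat \<Rightarrow> nat. strict_mono r \<and> (\<forall>i\<in>V. mono (\<lambda>n. f (r n) i))"
  using assms
proof (induction V rule: finite_induct)
  case empty show ?case by (rule exI [of _ id]) (simp add: strict_mono_def)
next
  case (insert v V)
  then obtain r :: "nat \<Rightarrow> nat" where r: "strict_mono r" "\<forall>i\<in>V. mono (\<lambda>n. f (r n) i)" by blast
  obtain q :: "nat \<Rightarrow> nat" where q: "strict_mono q" "mono ((\<lambda>n. f (r n) v) \<circ> q)" using nat_mono_subseq by blast
  have "strict_mono (r \<circ> q)" using r(1) q(1) by (simp add: strict_mono_def)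
  moreover have "mono (\<lambda>n. f ((r \<circ> q) n) i)" if "i \<in> insert v V" for i
    using that q r(2) by (auto simp: comp_def mono_def strict_mono_less_eq)
  ultimately show ?case by blast
qed

lemma dickson:
  fixes f :: "nat \<Rightarrow> 'a::finite \<Rightarrow> nat"
  shows "\<exists>i j. i < j \<and> f i \<le> f j"
proof -
  obtain r :: "nat \<Rightarrow> nat" where r: "strict_mono r" "\<forall>i\<in>UNIV. mono (\<lambda>n. f (r n) i)" using dickson_subseq [of "UNIV::'a set" f] by auto
  have "r 0 < r 1" using r(1) by (simp add: strict_mono_def)
  moreover have "f (r 0) \<le> f (r 1)" using r(2) by (auto simp: le_fun_def mono_def)
  ultimately show ?thesis by blast
qed

definition upset :: "('a \<Rightarrow> nat) set \<Rightarrow> bool" where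
  "upset U \<longleftrightarrow> (\<forall>f\<in>U. \<forall>g. f \<le> g \<longrightarrow> g \<in> U)"

lemma upset_chain_stable:
  fixes A :: "nat \<Rightarrow> ('a::finite \<Rightarrow> nat) set"
  assumes up: "\<And>k. upset (A k)" and inc: "\<And>k. A k \<subseteq> A (Suc k)"
  shows "\<exists>K. \<forall>k\<ge>K. A k = A K"
proof (rule ccontr)
  have mono: "A i \<subseteq> A j" if ij: "i \<le> j" for i j by (rule lift_Suc_mono_le [of A, OF inc ij])
  assume "\<nexists>K. \<forall>k\<ge>K. A k = A K"
  then have "\<forall>K. \<exists>k x. K \<le> k \<and> x \<in> A k \<and> x \<notin> A K" using mono by (metis subset_antisym subsetI)
  then obtain k x where kx: "\<And>K. K \<le> k K \<and> x K \<in> A (k K) \<and> x K \<notin> A K" by metis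
  define n where "n j = (k ^^ j) 0" for j
  have ns: "n (Suc j) = k (n j)" for j by (simp add: n_def)
  have nm: "n i \<le> n j" if ij: "i \<le> j" for i j by (rule lift_Suc_mono_le [of n, OF _ ij]) (simp add: ns kx)
  obtain i j where ij: "i < j" "x (n i) \<le> x (n j)" using dickson [of "\<lambda>j. x (n j)"] by blast
  have "x (n i) \<in> A (n (Suc i))" using kx [of "n i"] ns [of i] by simp
  also have "A (n (Suc i)) \<subseteq> A (n j)" using mono nm ij(1) by (simp add: Suc_leI)
  finally have "x (n j) \<in> A (n j)" using up [of "n j"] ij(2) unfolding upset_def by blast
  then show False using kx [of "n j"] by blast
qed

definition supported :: "'a set \<Rightarrow> ('a \<Rightarrow> nat) set" where
  "supported V = {f. \<forall>i. i \<notin> V \<longrightarrow> f i = 0}"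

lemma finite_supported: "finite V \<Longrightarrow> finite {f \<in> supported V. sum f V = d}"
proof -
  assume V: "finite V"
  have "{f \<in> supported V. sum f V = d} \<subseteq> {f. (\<forall>i\<in>V. f i \<in> {..d}) \<and> (\<forall>i. i \<notin> V \<longrightarrow> f i = 0)}"
    using V by (auto simp: supported_def intro: member_le_sum)
  moreover have "finite {f. (\<forall>i\<in>V. f i \<in> {..d}) \<and> (\<forall>i. i \<notin> V \<longrightarrow> f i = 0)}"
    using finite_set_of_finite_funs [OF V, of "{..d}" 0] by (rule finite_subset [rotated]) auto
  ultimately show ?thesis by (rule finite_subset)
qed

lemma evpoly_count:
  fixes U :: "('a::finite \<Rightarrow> nat) set"
  assumes "upset U" shows "evpoly (\<lambda>d. real (card {f \<in> supported V. sum f V = d \<and> f \<notin> U}))"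
proof -
  have "finite V" by simp
  then show ?thesis using assms
  proof (induction V arbitrary: U rule: finite_induct)
    case empty
    have "\<forall>\<^sub>F d in sequentially. 0 = real (card {f \<in> supported {}. sum f {} = d \<and> f \<notin> U})"
      unfolding eventually_sequentially by (rule exI [of _ 1]) auto
    then show ?case by (rule evpoly_cong [OF _ evpoly_0])
  next
    case (insert v V)
    define A where "A k = {f. f(v := k) \<in> U}" for k
    define c where "c k d = real (card {f \<in> supported V. sum f V = d \<and> f \<notin> A k})" for k d
    have upA: "upset (A k)" for k
      unfolding upset_def
    proof (intro ballI allI impI)
      fix f g :: "'a \<Rightarrow> nat" assume "f \<in> A k" "f \<le> g"
      then have "f(v := k) \<in> U" "f(v := k) \<le> g(v := k)" by (auto simp: A_def le_fun_def)
      then show "g \<in> A k" using insert.prems by (auto simp: A_def upset_def)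
    qed
    have incA: "A k \<subseteq> A (Suc k)" for k
    proof
      fix f assume "f \<in> A k"
      moreover have "f(v := k) \<le> f(v := Suc k)" by (auto simp: le_fun_def)
      ultimately show "f \<in> A (Suc k)" using insert.prems by (auto simp: A_def upset_def)
    qed
    obtain K where K: "\<And>k. K \<le> k \<Longrightarrow> A k = A K" using upset_chain_stable [of A, OF upA incA] by blast
    have ev: "evpoly (c k)" for k unfolding c_def by (rule insert.IH [OF upA])
    have split: "real (card {f \<in> supported (insert v V). sum f (insert v V) = d \<and> f \<notin> U}) = (\<Sum>k\<le>d. c k (d - k))" for d
    proof -
      define S where "S k = {f \<in> supported V. sum f V = d - k \<and> f \<notin> A k}" for k
      have finS: "finite (S k)" for k
        using finite_supported [OF insert.hyps(1), of "d - k"] by (rule finite_subset [rotated]) (auto simp: S_def)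
      have sup: "f v = 0" if "f \<in> supported V" for f using that insert.hyps(2) by (auto simp: supported_def)
      have sumv: "sum (f(v := k)) V = sum f V" for f k using insert.hyps(2) by (intro sum.cong) auto
      have "{f \<in> supported (insert v V). sum f (insert v V) = d \<and> f \<notin> U} = (\<Union>k\<le>d. (\<lambda>f. f(v := k)) ` S k)"
      proof (intro subset_antisym subsetI)
        fix f assume f: "f \<in> {f \<in> supported (insert v V). sum f (insert v V) = d \<and> f \<notin> U}"
        have d: "f v + sum f V = d" using f insert.hyps by simp
        have "f(v := 0) \<in> S (f v)" using f d sumv [of f 0] by (auto simp: S_def supported_def A_def)
        moreover have "f = (f(v := 0))(v := f v)" by simp
        ultimately show "f \<in> (\<Union>k\<le>d. (\<lambda>f. f(v := k)) ` S k)" using d by (intro UN_I [of "f v"] image_eqI [of _ _ "f(v := 0)"]) auto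
      next
        fix f assume "f \<in> (\<Union>k\<le>d. (\<lambda>f. f(v := k)) ` S k)"
        then obtain k g where kg: "k \<le> d" "g \<in> S k" "f = g(v := k)" by blast
        then show "f \<in> {f \<in> supported (insert v V). sum f (insert v V) = d \<and> f \<notin> U}"
          using insert.hyps sumv [of g k] by (auto simp: S_def supported_def A_def)
      qed
      moreover have "card (\<Union>k\<le>d. (\<lambda>f. f(v := k)) ` S k) = (\<Sum>k\<le>d. card ((\<lambda>f. f(v := k)) ` S k))"
      proof (rule card_UN_disjoint)
        show "\<forall>i\<in>{..d}. \<forall>j\<in>{..d}. i \<noteq> j \<longrightarrow> (\<lambda>f. f(v := i)) ` S i \<inter> (\<lambda>f. f(v := j)) ` S j = {}"
          by (auto simp: fun_eq_iff) (metis fun_upd_same)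
      qed (use finS in auto)
      moreover have "card ((\<lambda>f. f(v := k)) ` S k) = card (S k)" for k
      proof (rule card_image, rule inj_onI)
        fix f g assume fg: "f \<in> S k" "g \<in> S k" "f(v := k) = g(v := k)"
        have "f v = 0" "g v = 0" using fg(1,2) sup [of f] sup [of g] by (simp_all add: S_def)
        then show "f = g" using fg(3) by (metis fun_upd_triv fun_upd_upd)
      qed
      ultimately show ?thesis by (simp add: c_def S_def)
    qed
    have "evpoly (\<lambda>d. (\<Sum>k<K. c k (d - k)) + (\<lambda>m. \<Sum>j\<le>m. c K j) (d - K))"
      by (intro evpoly_add evpoly_sum evpoly_shift [OF ev] evpoly_shift [of "\<lambda>m. \<Sum>j\<le>m. c K j"] evpoly_partial_sums ev)
    moreover have "\<forall>\<^sub>F d in sequentially. (\<Sum>k<K. c k (d - k)) + (\<lambda>m. \<Sum>j\<le>m. c K j) (d - K) =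
        real (card {f \<in> supported (insert v V). sum f (insert v V) = d \<and> f \<notin> U})"
      unfolding eventually_sequentially
    proof (intro exI allI impI)
      fix d assume Kd: "K \<le> d"
      have dis: "{..<K} \<inter> {K..d} = {}" by auto
      have un: "{..d} = {..<K} \<union> {K..d}" using Kd by auto
      have "(\<Sum>k\<le>d. c k (d - k)) = (\<Sum>k<K. c k (d - k)) + (\<Sum>k\<in>{K..d}. c k (d - k))"
        unfolding un by (rule sum.union_disjoint [OF finite_lessThan finite_atLeastAtMost dis])
      also have "(\<Sum>k\<in>{K..d}. c k (d - k)) = (\<Sum>k\<in>{K..d}. c K (d - k))"
      proof (rule sum.cong [OF refl])
        fix k assume "k \<in> {K..d}"
        then have "A k = A K" by (intro K) simp
        then show "c k (d - k) = c K (d - k)" by (simp only: c_def)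
      qed
      also have "\<dots> = (\<Sum>j\<le>d - K. c K j)"
        by (rule sum.reindex_bij_witness [of _ "\<lambda>j. d - j" "\<lambda>k. d - k"]) (use Kd in auto)
      finally show "(\<Sum>k<K. c k (d - k)) + (\<lambda>m. \<Sum>j\<le>m. c K j) (d - K) =
        real (card {f \<in> supported (insert v V). sum f (insert v V) = d \<and> f \<notin> U})" unfolding split by simp
    qed
    ultimately show ?case by (rule evpoly_cong [rotated])
  qed
qed

text \<open>A space of homogeneous polynomials has as many dimensions as leading monomials; this turns the Hilbert
  function into a count of exponents outside an upward closed set.\<close>

definition lmon :: "('n::{finite,linorder}) mpoly \<Rightarrow> 'n \<Rightarrow>\<^sub>0 nat" where
  "lmon P = Max (Poly_Mapping.keys P)"

lemma lmon_key: "P \<noteq> 0 \<Longrightarrow> lmon P \<in> Poly_Mapping.keys P"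
  unfolding lmon_def by (intro Max_in) auto

lemma lmon_lookup: "P \<noteq> 0 \<Longrightarrow> Poly_Mapping.lookup P (lmon P) \<noteq> 0"
  using lmon_key by (auto simp: in_keys_iff)

lemma lmon_ge: "Poly_Mapping.lookup P m \<noteq> 0 \<Longrightarrow> m \<le> lmon P"
  unfolding lmon_def by (intro Max_ge) (auto simp: in_keys_iff)

lemma lmon_less: "P \<noteq> 0 \<Longrightarrow> (\<And>m. Poly_Mapping.lookup P m \<noteq> 0 \<Longrightarrow> m < n) \<Longrightarrow> lmon P < n"
  using lmon_lookup by blast

lemma lookup_monomial_mult: "Poly_Mapping.lookup (Poly_Mapping.single n 1 * P) (n + m) = Poly_Mapping.lookup (P::('n::finite) mpoly) m"
proof (induction P rule: mpoly_induct)
  case (single k c)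
  then show ?case by (simp add: mult_single lookup_single when_def)
next
  case (add P Q)
  then show ?case by (simp add: distrib_left lookup_add)
qed

lemma lmon_monomial_mult:
  fixes P :: "('n::{finite,linorder}) mpoly"
  assumes "P \<noteq> 0" shows "lmon (Poly_Mapping.single n 1 * P) = n + lmon P"
proof (rule antisym)
  let ?Q = "Poly_Mapping.single n 1 * P"
  have "Poly_Mapping.lookup ?Q (n + lmon P) \<noteq> 0" using lmon_lookup [OF assms] by (simp add: lookup_monomial_mult)
  then show "n + lmon P \<le> lmon ?Q" by (rule lmon_ge)
  have "?Q \<noteq> 0" using \<open>Poly_Mapping.lookup ?Q (n + lmon P) \<noteq> 0\<close> by auto
  then have "lmon ?Q \<in> Poly_Mapping.keys ?Q" by (rule lmon_key)
  then obtain k m where km: "lmon ?Q = k + m" "k \<in> Poly_Mapping.keys (Poly_Mapping.single n (1::complex))" "m \<in> Poly_Mapping.keys P"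
    using keys_mult [of "Poly_Mapping.single n 1" P] by blast
  then have "k = n" by simp
  moreover have "m \<le> lmon P" using km(3) lmon_ge by (auto simp: in_keys_iff)
  ultimately show "lmon ?Q \<le> n + lmon P" using km(1) by (simp add: add_left_mono)
qed

lemma lookup_pscale: "Poly_Mapping.lookup (pscale c q) m = c * Poly_Mapping.lookup q m"
  unfolding pscale_def mult_map_scale_conv_mult [symmetric] by (simp add: Poly_Mapping.map.rep_eq when_def)

lemma lmon_span:
  fixes V :: "('n::{finite,linorder}) mpoly set"
  assumes V: "mpoly.subspace V" "V \<subseteq> Hom d"
    and p: "\<And>P. P \<in> V \<Longrightarrow> P \<noteq> 0 \<Longrightarrow> p (lmon P) \<in> V \<and> p (lmon P) \<noteq> 0 \<and> lmon (p (lmon P)) = lmon P"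
  shows "V \<subseteq> mpoly.span (p ` lmon ` (V - {0}))"
proof
  fix P assume "P \<in> V"
  then show "P \<in> mpoly.span (p ` lmon ` (V - {0}))"
  proof (induction "card {m. mdeg m = d \<and> m < lmon P}" arbitrary: P rule: less_induct)
    case less
    show ?case
    proof (cases "P = 0")
      case True then show ?thesis by (simp add: mpoly.span_zero)
    next
      case False
      let ?q = "p (lmon P)"
      have q: "?q \<in> V" "?q \<noteq> 0" "lmon ?q = lmon P" using p less.prems False by auto
      have qs: "?q \<in> mpoly.span (p ` lmon ` (V - {0}))" using less.prems False by (intro mpoly.span_base) auto
      define c where "c = Poly_Mapping.lookup P (lmon P) / Poly_Mapping.lookup ?q (lmon P)"
      define R where "R = P - pscale c ?q"
      have lk: "Poly_Mapping.lookup R m = Poly_Mapping.lookup P m - c * Poly_Mapping.lookup ?q m" for m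
        unfolding R_def by (simp add: lookup_minus lookup_pscale)
      have RV: "R \<in> V" unfolding R_def using less.prems q(1) V(1) by (intro mpoly.subspace_diff mpoly.subspace_scale)
      have "R \<in> mpoly.span (p ` lmon ` (V - {0}))"
      proof (cases "R = 0")
        case True then show ?thesis by (simp add: mpoly.span_zero)
      next
        case R0: False
        have "lmon R < lmon P"
        proof (rule lmon_less [OF R0])
          fix m assume m: "Poly_Mapping.lookup R m \<noteq> 0"
          have "Poly_Mapping.lookup R (lmon P) = 0" unfolding lk c_def using lmon_lookup [OF q(2)] q(3) by simp
          then have "m \<noteq> lmon P" using m by auto
          moreover have "m \<le> lmon P"
          proof (cases "Poly_Mapping.lookup P m = 0")
            case True
            then have "Poly_Mapping.lookup ?q m \<noteq> 0" using m lk [of m] by auto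
            then show ?thesis using lmon_ge q(3) by metis
          qed (rule lmon_ge)
          ultimately show "m < lmon P" by simp
        qed
        moreover have "mdeg (lmon R) = d" using RV R0 V(2) lmon_key [of R] by (auto simp: Hom_def homogeneous_def)
        ultimately have "{m. mdeg m = d \<and> m < lmon R} \<subset> {m. mdeg m = d \<and> m < lmon P}" by auto
        moreover have "finite {m. mdeg m = d \<and> m < lmon P}" using finite_monomials [of d] by (rule finite_subset [rotated]) auto
        ultimately have "card {m. mdeg m = d \<and> m < lmon R} < card {m. mdeg m = d \<and> m < lmon P}" by (rule psubset_card_mono [rotated])
        then show ?thesis using less.hyps RV by blast
      qed
      then have "R + pscale c ?q \<in> mpoly.span (p ` lmon ` (V - {0}))" using qs by (intro mpoly.span_add mpoly.span_scale)
      then show ?thesis by (simp add: R_def)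
    qed
  qed
qed

lemma lmon_dim:
  fixes V :: "('n::{finite,linorder}) mpoly set"
  assumes V: "mpoly.subspace V" "V \<subseteq> Hom d"
  shows "mpoly.dim V = card (lmon ` (V - {0}))"
proof -
  define L where "L = lmon ` (V - {0})"
  have "\<forall>\<mu>\<in>L. \<exists>P. P \<in> V \<and> P \<noteq> 0 \<and> lmon P = \<mu>" by (auto simp: L_def)
  then obtain p where p: "\<And>\<mu>. \<mu> \<in> L \<Longrightarrow> p \<mu> \<in> V \<and> p \<mu> \<noteq> 0 \<and> lmon (p \<mu>) = \<mu>" by metis
  have inj: "inj_on p L" by (rule inj_onI) (metis p)
  have span: "V \<subseteq> mpoly.span (p ` L)" unfolding L_def by (rule lmon_span [OF V]) (use p in \<open>auto simp: L_def\<close>)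
  have ind: "mpoly.independent (p ` L)"
    unfolding mpoly.independent_explicit_finite_subsets
  proof (intro allI impI ballI)
    fix S u v assume S: "S \<subseteq> p ` L" "finite S" and z: "(\<Sum>v\<in>S. pscale (u v) v) = 0" and v: "v \<in> S"
    show "u v = 0"
    proof (rule ccontr)
      assume "u v \<noteq> 0"
      define M where "M = lmon ` {w\<in>S. u w \<noteq> 0}"
      have M: "finite M" "M \<noteq> {}" using S(2) v \<open>u v \<noteq> 0\<close> by (auto simp: M_def)
      have "\<exists>w\<in>{w\<in>S. u w \<noteq> 0}. lmon w = m" if "m \<in> M" for m using that unfolding M_def by blast
      from this [OF Max_in [OF M]] obtain w where w': "w \<in> {w\<in>S. u w \<noteq> 0}" "lmon w = Max M" by blast
      then have w: "w \<in> S" "u w \<noteq> 0" "lmon w = Max M" by auto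
      note lk = lookup_pscale
      have "Poly_Mapping.lookup (pscale (u x) x) (lmon w) = (if x = w then u w * Poly_Mapping.lookup w (lmon w) else 0)"
        if xS: "x \<in> S" for x
      proof (cases "x = w \<or> u x = 0")
        case True then show ?thesis using w by (auto simp: lk)
      next
        case False
        obtain \<mu> \<nu> where mn: "\<mu> \<in> L" "x = p \<mu>" "\<nu> \<in> L" "w = p \<nu>" using xS w(1) S(1) by blast
        have "lmon x \<noteq> lmon w" using p [OF mn(1)] p [OF mn(3)] mn(2,4) False by auto
        moreover have "lmon x \<le> lmon w" unfolding w(3) using M(1) xS False by (intro Max_ge) (auto simp: M_def)
        ultimately have "Poly_Mapping.lookup x (lmon w) = 0" using lmon_ge [of x "lmon w"] by fastforce
        then show ?thesis using False by (simp add: lk)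
      qed
      then have "(\<Sum>x\<in>S. Poly_Mapping.lookup (pscale (u x) x) (lmon w)) = u w * Poly_Mapping.lookup w (lmon w)"
        using w(1) S(2) by (simp add: sum.delta')
      then have "Poly_Mapping.lookup (\<Sum>x\<in>S. pscale (u x) x) (lmon w) = u w * Poly_Mapping.lookup w (lmon w)"
        by (simp only: lookup_sum)
      moreover have "w \<noteq> 0" using w(1) S(1) p by auto
      ultimately show False unfolding z using w(2) lmon_lookup [of w] by simp
    qed
  qed
  have "p ` L \<subseteq> V" using p by blast
  then have "mpoly.dim V = card (p ` L)"
    using mpoly.basis_card_eq_dim [OF _ span ind] by simp
  then show ?thesis using card_image [OF inj] by (simp add: L_def)
qed

definition vdeg :: "('n::finite) pspace set \<Rightarrow> nat \<Rightarrow> 'n mpoly set" where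
  "vdeg Z d = {P \<in> vanishing_ideal Z. homogeneous d P}"

lemma vdeg_subspace: "mpoly.subspace (vdeg Z d)" "vdeg Z d \<subseteq> Hom d"
  unfolding mpoly.subspace_def vdeg_def Hom_def vanishing_ideal_def
  by (auto intro: homogeneous_add homogeneous_pscale)

definition inexps :: "('n::{finite,linorder}) pspace set \<Rightarrow> ('n \<Rightarrow> nat) set" where
  "inexps Z = {Poly_Mapping.lookup (lmon P) | P d. P \<in> vdeg Z d \<and> P \<noteq> 0}"

lemma lmon_vdeg: "P \<in> vdeg Z d \<Longrightarrow> P \<noteq> 0 \<Longrightarrow> mdeg (lmon P) = d"
  using lmon_key [of P] by (auto simp: vdeg_def homogeneous_def)

lemma upset_inexps: "upset (inexps Z)"
  unfolding upset_def
proof (intro ballI allI impI)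
  fix f g :: "'a \<Rightarrow> nat" assume f: "f \<in> inexps Z" and le: "f \<le> g"
  then obtain P d where P: "f = Poly_Mapping.lookup (lmon P)" "P \<in> vdeg Z d" "P \<noteq> 0" by (auto simp: inexps_def)
  define n where "n = Abs_poly_mapping (\<lambda>i. g i - f i)"
  have n: "Poly_Mapping.lookup n i = g i - f i" for i unfolding n_def by (simp add: Abs_poly_mapping_inverse)
  let ?Q = "Poly_Mapping.single n 1 * P"
  have "?Q \<noteq> 0" using lmon_lookup [OF P(3)] lookup_monomial_mult [of n P "lmon P"] by auto
  moreover have "?Q \<in> vdeg Z (mdeg n + d)"
    using P(2) by (auto simp: vdeg_def vanishing_ideal_def intro!: homogeneous_mult) (auto simp: homogeneous_def)
  moreover have "Poly_Mapping.lookup (lmon ?Q) = g"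
  proof
    fix i show "Poly_Mapping.lookup (lmon ?Q) i = g i"
      using le n [of i] P(1) by (simp add: lmon_monomial_mult [OF P(3)] lookup_add le_fun_def)
  qed
  ultimately show "g \<in> inexps Z" unfolding inexps_def by blast
qed

lemma inexpsI: "P \<in> vdeg Z d \<Longrightarrow> P \<noteq> 0 \<Longrightarrow> Poly_Mapping.lookup (lmon P) \<in> inexps Z"
  unfolding inexps_def by blast

lemma inj_lookup: "inj_on Poly_Mapping.lookup A"
  by (rule inj_onI) (simp only: poly_mapping_eq_iff)

lemma lookup_inject: "Poly_Mapping.lookup a = Poly_Mapping.lookup b \<Longrightarrow> a = b"
  by (simp only: poly_mapping_eq_iff)

lemma hilbert_function_inexps:
  fixes Z :: "('n::{finite,linorder}) pspace set"
  shows "hilbert_function Z d = card {f \<in> supported UNIV. sum f UNIV = d \<and> f \<notin> inexps Z}"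
proof -
  let ?L = "lmon ` (vdeg Z d - {0})"
  have sub: "?L \<subseteq> {m. mdeg m = d}" using lmon_vdeg by auto
  have H: "mpoly.dim {P :: 'n mpoly. homogeneous d P} = card {m :: 'n \<Rightarrow>\<^sub>0 nat. mdeg m = d}"
    using dim_Hom [of d] unfolding card_monomials by (simp add: Hom_def)
  have "hilbert_function Z d = card {m :: 'n \<Rightarrow>\<^sub>0 nat. mdeg m = d} - card ?L"
    unfolding hilbert_function_def H using lmon_dim [OF vdeg_subspace, of Z d] by (simp add: vdeg_def)
  also have "\<dots> = card ({m. mdeg m = d} - ?L)"
    by (rule card_Diff_subset [symmetric, OF finite_subset [OF sub finite_monomials] sub])
  also have "\<dots> = card (Poly_Mapping.lookup ` ({m. mdeg m = d} - ?L))"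
    by (simp only: card_image [OF inj_lookup])
  also have "Poly_Mapping.lookup ` ({m. mdeg m = d} - ?L) = {f \<in> supported UNIV. sum f UNIV = d \<and> f \<notin> inexps Z}"
  proof (intro subset_antisym subsetI)
    fix f assume "f \<in> Poly_Mapping.lookup ` ({m. mdeg m = d} - ?L)"
    then obtain m where m: "f = Poly_Mapping.lookup m" "mdeg m = d" "m \<notin> ?L" by blast
    have "f \<notin> inexps Z"
    proof
      assume "f \<in> inexps Z"
      then have "Poly_Mapping.lookup m \<in> inexps Z" unfolding m(1) .
      then obtain P e where P: "Poly_Mapping.lookup m = Poly_Mapping.lookup (lmon P)" "P \<in> vdeg Z e" "P \<noteq> 0"
        unfolding inexps_def by blast
      have "m = lmon P" by (rule lookup_inject [OF P(1)])
      then have "e = d" using lmon_vdeg [OF P(2,3)] m(2) by simp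
      have "P \<in> vdeg Z d - {0}" using P(2,3) unfolding \<open>e = d\<close> by simp
      then have "lmon P \<in> ?L" by (rule imageI)
      then show False using m(3) unfolding \<open>m = lmon P\<close> by contradiction
    qed
    moreover have "sum f UNIV = d" using m(2) unfolding m(1) mdeg_def .
    ultimately show "f \<in> {f \<in> supported UNIV. sum f UNIV = d \<and> f \<notin> inexps Z}" by (simp add: supported_def)
  next
    fix f assume f: "f \<in> {f \<in> supported UNIV. sum f UNIV = d \<and> f \<notin> inexps Z}"
    define m where "m = Abs_poly_mapping f"
    have lm: "Poly_Mapping.lookup m = f" unfolding m_def by (simp add: Abs_poly_mapping_inverse)
    then have "mdeg m = d" using f by (simp add: mdeg_def)
    moreover have "m \<notin> ?L"
    proof
      assume "m \<in> ?L"
      then obtain P where P: "P \<in> vdeg Z d" "P \<noteq> 0" "m = lmon P" by blast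
      have "f \<in> inexps Z" using inexpsI [OF P(1,2)] lm P(3) by simp
      then show False using f by simp
    qed
    ultimately have "Poly_Mapping.lookup m \<in> Poly_Mapping.lookup ` ({m. mdeg m = d} - ?L)" by (intro imageI DiffI CollectI)
    then show "f \<in> Poly_Mapping.lookup ` ({m. mdeg m = d} - ?L)" unfolding lm .
  qed
  finally show ?thesis .
qed

lemma hilbert_poly_exists:
  fixes Z :: "('n::{finite,linorder}) pspace set"
  shows "\<exists>h. is_hilbert_poly Z h"
  using evpoly_count [OF upset_inexps [of Z], of UNIV]
  unfolding evpoly_def is_hilbert_poly_def hilbert_function_inexps .

lemma vdeg_eqI:
  fixes Z Z' :: "('n::{finite,linorder}) pspace set"
  assumes eq: "inexps Z = inexps Z'" and sub: "\<And>d. vdeg Z d \<subseteq> vdeg Z' d"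
  shows "vdeg Z d = vdeg Z' d"
proof (rule subset_antisym [OF sub])
  have ex: "\<exists>Q. Q \<in> vdeg Z d \<and> Q \<noteq> 0 \<and> lmon Q = lmon P" if P: "P \<in> vdeg Z' d" "P \<noteq> 0" for P
  proof -
    have "Poly_Mapping.lookup (lmon P) \<in> inexps Z" unfolding eq by (rule inexpsI [OF P])
    then obtain Q e where Q: "Poly_Mapping.lookup (lmon P) = Poly_Mapping.lookup (lmon Q)" "Q \<in> vdeg Z e" "Q \<noteq> 0"
      unfolding inexps_def by blast
    have "lmon P = lmon Q" by (rule lookup_inject [OF Q(1)])
    then have "e = d" using lmon_vdeg [OF P] lmon_vdeg [OF Q(2,3)] by simp
    then show ?thesis using Q(2,3) \<open>lmon P = lmon Q\<close> by (intro exI [of _ Q]) simp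
  qed
  define p where "p \<mu> = (SOME Q. Q \<in> vdeg Z d \<and> Q \<noteq> 0 \<and> lmon Q = \<mu>)" for \<mu>
  have p: "p (lmon P) \<in> vdeg Z d \<and> p (lmon P) \<noteq> 0 \<and> lmon (p (lmon P)) = lmon P" if "P \<in> vdeg Z' d" "P \<noteq> 0" for P
    unfolding p_def by (rule someI_ex [OF ex [OF that]])
  have "vdeg Z' d \<subseteq> mpoly.span (p ` lmon ` (vdeg Z' d - {0}))"
  proof (rule lmon_span [OF vdeg_subspace])
    fix P assume P: "P \<in> vdeg Z' d" "P \<noteq> 0"
    note q = p [OF P]
    show "p (lmon P) \<in> vdeg Z' d \<and> p (lmon P) \<noteq> 0 \<and> lmon (p (lmon P)) = lmon P"
      using subsetD [OF sub conjunct1 [OF q]] conjunct2 [OF q] by (rule conjI)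
  qed
  also have "\<dots> \<subseteq> vdeg Z d"
  proof (rule mpoly.span_minimal [OF _ vdeg_subspace(1)])
    show "p ` lmon ` (vdeg Z' d - {0}) \<subseteq> vdeg Z d"
    proof
      fix Q assume "Q \<in> p ` lmon ` (vdeg Z' d - {0})"
      then obtain P where P: "P \<in> vdeg Z' d" "P \<noteq> 0" "Q = p (lmon P)" by blast
      then show "Q \<in> vdeg Z d" using p [OF P(1,2)] by simp
    qed
  qed
  finally show "vdeg Z' d \<subseteq> vdeg Z d" .
qed

section \<open>Projective sets and their irreducible components\<close>

lemma hcoords_nonempty: "\<exists>x. x \<in> hcoords q"
proof -
  obtain x where x: "x \<noteq> 0" "line_of q = range (\<lambda>c. c *s x)" using line_of [of q] by blast
  have "x \<in> line_of q" unfolding x(2) by (rule range_eqI [of _ _ 1]) simp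
  then show ?thesis using x(1) by (auto simp: hcoords_def)
qed

lemma pt_cases: obtains x where "x \<noteq> 0" "q = pt x"
  using hcoords_nonempty [of q] hcoords_iff that by metis

lemma hcoords_pt: "x \<noteq> 0 \<Longrightarrow> y \<in> hcoords (pt x) \<longleftrightarrow> (\<exists>c. c \<noteq> 0 \<and> y = c *s x)"
  by (auto simp: hcoords_def line_of_pt)

lemma pt_in_hcoords: "x \<noteq> 0 \<Longrightarrow> x \<in> hcoords (pt x)"
  by (simp add: hcoords_iff)

lemma pt_eq_iff: "x \<noteq> 0 \<Longrightarrow> y \<noteq> 0 \<Longrightarrow> pt x = pt y \<longleftrightarrow> (\<exists>c. c \<noteq> 0 \<and> x = c *s y)"
  using hcoords_pt [of y x] hcoords_iff [of x "pt y"] by auto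

lemma pt_scale: "c \<noteq> 0 \<Longrightarrow> x \<noteq> 0 \<Longrightarrow> pt (c *s x) = pt x"
  by (subst pt_eq_iff) auto

lemma vanish_hcoords:
  assumes "homogeneous d P" "x \<noteq> 0"
  shows "(\<forall>y\<in>hcoords (pt x). peval P y = 0) \<longleftrightarrow> peval P x = 0"
proof
  show "\<forall>y\<in>hcoords (pt x). peval P y = 0 \<Longrightarrow> peval P x = 0" using pt_in_hcoords [OF assms(2)] by blast
  show "peval P x = 0 \<Longrightarrow> \<forall>y\<in>hcoords (pt x). peval P y = 0"
    using assms by (auto simp: hcoords_pt peval_homogeneous)
qed

lemma pt_in_zeros:
  assumes "\<And>P. P \<in> S \<Longrightarrow> \<exists>d. homogeneous d P" "x \<noteq> 0"
  shows "pt x \<in> zeros S \<longleftrightarrow> (\<forall>P\<in>S. peval P x = 0)"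
  unfolding zeros_def using vanish_hcoords assms by blast

lemma vanishing_idealI:
  assumes h: "homogeneous d P" and z: "\<And>q x. q \<in> Z \<Longrightarrow> x \<in> hcoords q \<Longrightarrow> peval P x = 0"
  shows "P \<in> vanishing_ideal Z"
  unfolding vanishing_ideal_def
proof (intro CollectI ballI)
  fix q x assume q: "q \<in> Z" "x \<in> line_of q"
  show "peval P x = 0"
  proof (cases "x = 0")
    case True
    obtain y where y: "y \<in> hcoords q" using hcoords_nonempty by blast
    have "peval P (0 *s y) = 0 ^ d * peval P y" by (rule peval_homogeneous [OF h])
    then show ?thesis using True z [OF q(1) y] by simp
  next
    case False
    then show ?thesis using z [OF q(1)] q(2) by (simp add: hcoords_def)
  qed
qed

lemma vanishing_idealD: "P \<in> vanishing_ideal Z \<Longrightarrow> q \<in> Z \<Longrightarrow> x \<in> hcoords q \<Longrightarrow> peval P x = 0"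
  unfolding vanishing_ideal_def hcoords_def by blast

lemma vanishing_ideal_antimono: "Z \<subseteq> Z' \<Longrightarrow> vanishing_ideal Z' \<subseteq> vanishing_ideal Z"
  unfolding vanishing_ideal_def by blast

lemma zclosed_separate:
  assumes "zclosed Z" "q \<notin> Z"
  obtains P d where "homogeneous d P" "P \<in> vanishing_ideal Z" "\<exists>x\<in>hcoords q. peval P x \<noteq> 0"
proof -
  obtain S where S: "\<forall>P\<in>S. \<exists>d. homogeneous d P" "Z = zeros S" using assms(1) unfolding zclosed_def by blast
  then obtain P x where P: "P \<in> S" "x \<in> hcoords q" "peval P x \<noteq> 0" using assms(2) unfolding zeros_def by blast
  obtain d where d: "homogeneous d P" using S(1) P(1) by blast
  have "P \<in> vanishing_ideal Z" by (rule vanishing_idealI [OF d]) (use S(2) P(1) in \<open>auto simp: zeros_def\<close>)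
  then show ?thesis using that d P by blast
qed

lemma zclosed_zeros: "(\<And>P. P \<in> S \<Longrightarrow> \<exists>d. homogeneous d P) \<Longrightarrow> zclosed (zeros S)"
  unfolding zclosed_def by blast

lemma zclosed_empty: "zclosed {}"
proof -
  have "zeros {1} = ({} :: 'a pspace set)" using hcoords_nonempty by (auto simp: zeros_def)
  moreover have "homogeneous 0 (1 :: 'a mpoly)" by (rule homogeneousI) simp
  ultimately show ?thesis using zclosed_zeros [of "{1 :: 'a mpoly}"] by auto
qed

lemma zclosed_Int: "zclosed A \<Longrightarrow> zclosed B \<Longrightarrow> zclosed (A \<inter> B)"
proof -
  assume "zclosed A" "zclosed B"
  then obtain S S' where "\<forall>P\<in>S. \<exists>d. homogeneous d P" "A = zeros S" "\<forall>P\<in>S'. \<exists>d. homogeneous d P" "B = zeros S'"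
    unfolding zclosed_def by blast
  moreover have "zeros S \<inter> zeros S' = zeros (S \<union> S')" by (auto simp: zeros_def)
  ultimately show ?thesis unfolding zclosed_def by (intro exI [of _ "S \<union> S'"]) auto
qed

lemma zclosed_Un: "zclosed A \<Longrightarrow> zclosed B \<Longrightarrow> zclosed (A \<union> B)"
proof -
  assume A: "zclosed A" and B: "zclosed B"
  define S where "S = {P * Q | P Q d e. homogeneous d P \<and> homogeneous e Q \<and> P \<in> vanishing_ideal A \<and> Q \<in> vanishing_ideal B}"
  have "A \<union> B = zeros S"
  proof (intro subset_antisym subsetI)
    fix q assume "q \<in> A \<union> B"
    then show "q \<in> zeros S" by (auto simp: zeros_def S_def dest: vanishing_idealD)
  next
    fix q assume q: "q \<in> zeros S"
    show "q \<in> A \<union> B"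
    proof (rule ccontr)
      assume "q \<notin> A \<union> B"
      then have "q \<notin> A" "q \<notin> B" by auto
      obtain P d where P: "homogeneous d P" "P \<in> vanishing_ideal A" "\<exists>x\<in>hcoords q. peval P x \<noteq> 0"
        by (rule zclosed_separate [OF A \<open>q \<notin> A\<close>])
      obtain Q e where Q: "homogeneous e Q" "Q \<in> vanishing_ideal B" "\<exists>x\<in>hcoords q. peval Q x \<noteq> 0"
        by (rule zclosed_separate [OF B \<open>q \<notin> B\<close>])
      obtain x where x: "x \<noteq> 0" "q = pt x" by (rule pt_cases)
      have "peval P x \<noteq> 0" "peval Q x \<noteq> 0" using P(1,3) Q(1,3) vanish_hcoords x by blast+
      moreover have "P * Q \<in> S" using P Q unfolding S_def by blast
      moreover have "peval (P * Q) x = 0"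
        using q \<open>P * Q \<in> S\<close> pt_in_hcoords [OF x(1)] x(2) unfolding zeros_def by blast
      ultimately show False by simp
    qed
  qed
  moreover have "\<forall>P\<in>S. \<exists>d. homogeneous d P" unfolding S_def using homogeneous_mult by blast
  ultimately show ?thesis unfolding zclosed_def by blast
qed

lemma zclosed_Union: "finite F \<Longrightarrow> (\<And>T. T \<in> F \<Longrightarrow> zclosed T) \<Longrightarrow> zclosed (\<Union>F)"
  by (induction F rule: finite_induct) (auto simp: zclosed_empty zclosed_Un)

text \<open>The zero sets of \<open>P\<close> and \<open>Q\<close> cut out two closed subsets that cover \<open>T\<close>.\<close>

lemma irreducible_prime:
  assumes T: "zirreducible T" and P: "homogeneous d P" and Q: "homogeneous e Q" and PQ: "P * Q \<in> vanishing_ideal T"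
  shows "P \<in> vanishing_ideal T \<or> Q \<in> vanishing_ideal T"
proof -
  have zP: "zclosed (zeros {P})" by (rule zclosed_zeros) (use P in auto)
  have zQ: "zclosed (zeros {Q})" by (rule zclosed_zeros) (use Q in auto)
  have "T = (T \<inter> zeros {P}) \<union> (T \<inter> zeros {Q})"
  proof (intro subset_antisym subsetI)
    fix q assume q: "q \<in> T"
    obtain x where x: "x \<noteq> 0" "q = pt x" by (rule pt_cases)
    have "peval (P * Q) x = 0" using vanishing_idealD [OF PQ q] pt_in_hcoords [OF x(1)] x(2) by blast
    then have "peval P x = 0 \<or> peval Q x = 0" by simp
    then show "q \<in> (T \<inter> zeros {P}) \<union> (T \<inter> zeros {Q})"
      using q x(2) pt_in_zeros [of "{P}" x] pt_in_zeros [of "{Q}" x] P Q x(1) by auto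
  qed auto
  moreover have "zclosed (T \<inter> zeros {P})" "zclosed (T \<inter> zeros {Q})"
    using T zP zQ by (auto simp: zirreducible_def zclosed_Int)
  ultimately have "T = T \<inter> zeros {P} \<or> T = T \<inter> zeros {Q}" using T unfolding zirreducible_def by blast
  then show ?thesis
  proof
    assume "T = T \<inter> zeros {P}"
    then have "P \<in> vanishing_ideal T" by (intro vanishing_idealI [OF P]) (auto simp: zeros_def)
    then show ?thesis ..
  next
    assume "T = T \<inter> zeros {Q}"
    then have "Q \<in> vanishing_ideal T" by (intro vanishing_idealI [OF Q]) (auto simp: zeros_def)
    then show ?thesis ..
  qed
qed

text \<open>Leading monomials also give the descending chain condition: if the ideal grows while the set of
  leading exponents stays the same, then it does not grow at all.\<close>

lemma zclosed_eqI:
  assumes "zclosed A" "B \<subseteq> A" "zclosed B" "\<And>d. vdeg A d = vdeg B d"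
  shows "A = B"
proof (rule ccontr)
  assume "A \<noteq> B"
  then obtain q where q: "q \<in> A" "q \<notin> B" using assms(2) by blast
  obtain P d where P: "homogeneous d P" "P \<in> vanishing_ideal B" "\<exists>x\<in>hcoords q. peval P x \<noteq> 0"
    by (rule zclosed_separate [OF assms(3) q(2)])
  then have "P \<in> vdeg A d" using assms(4) by (simp add: vdeg_def)
  then have "P \<in> vanishing_ideal A" by (simp add: vdeg_def)
  then show False using P(3) q(1) vanishing_idealD by blast
qed

lemma no_descending_chain:
  fixes A :: "nat \<Rightarrow> ('n::{finite,linorder}) pspace set"
  assumes cl: "\<And>n. zclosed (A n)" and dec: "\<And>n. A (Suc n) \<subset> A n"
  shows False
proof -
  have sub: "vdeg (A n) d \<subseteq> vdeg (A (Suc n)) d" for n d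
    using vanishing_ideal_antimono [of "A (Suc n)" "A n"] dec [of n] unfolding vdeg_def by blast
  have inc: "inexps (A n) \<subseteq> inexps (A (Suc n))" for n
    using sub [of n] unfolding inexps_def by blast
  obtain K where K: "\<forall>k\<ge>K. inexps (A k) = inexps (A K)"
    using upset_chain_stable [of "\<lambda>n. inexps (A n)", OF upset_inexps inc] by blast
  then have "inexps (A K) = inexps (A (Suc K))" by (metis le_SucI order_refl)
  then have "vdeg (A K) d = vdeg (A (Suc K)) d" for d by (rule vdeg_eqI [OF _ sub])
  moreover have "A (Suc K) \<subseteq> A K" using dec [of K] by blast
  ultimately have "A K = A (Suc K)" by (intro zclosed_eqI cl)
  then show False using dec [of K] by blast
qed

lemma zclosed_decomposition:
  fixes Z :: "('n::{finite,linorder}) pspace set"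
  assumes "zclosed Z" shows "\<exists>F. finite F \<and> (\<forall>T\<in>F. zirreducible T) \<and> Z = \<Union>F"
proof -
  define R :: "('n pspace set \<times> 'n pspace set) set" where "R = {(A, B). zclosed A \<and> zclosed B \<and> A \<subset> B}"
  have "wf R"
    unfolding wf_iff_no_infinite_down_chain
  proof
    assume "\<exists>f. \<forall>i. (f (Suc i), f i) \<in> R"
    then obtain f where f: "\<forall>i. (f (Suc i), f i) \<in> R" by blast
    then have "\<And>n. zclosed (f n)" "\<And>n. f (Suc n) \<subset> f n" by (auto simp: R_def)
    then show False by (rule no_descending_chain)
  qed
  then show ?thesis using assms
  proof (induction Z rule: wf_induct_rule)
    case (less Z)
    show ?case
    proof (cases "Z = {}")
      case True then show ?thesis by (intro exI [of _ "{}"]) simp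
    next
      case nonempty: False
      show ?thesis
      proof (cases "zirreducible Z")
        case True then show ?thesis by (intro exI [of _ "{Z}"]) simp
      next
        case False
        then obtain A B where AB: "zclosed A" "zclosed B" "Z = A \<union> B" "Z \<noteq> A" "Z \<noteq> B"
          using less.prems nonempty unfolding zirreducible_def by blast
        then have "(A, Z) \<in> R" "(B, Z) \<in> R" using less.prems by (auto simp: R_def)
        then obtain F G where FG: "finite F" "\<forall>T\<in>F. zirreducible T" "A = \<Union>F" "finite G" "\<forall>T\<in>G. zirreducible T" "B = \<Union>G"
          using less.IH AB(1,2) by metis
        show ?thesis by (rule exI [of _ "F \<union> G"]) (use FG AB(3) in auto)
      qed
    qed
  qed
qed

lemma irreducible_in_Union:
  assumes T: "zirreducible T" and F: "finite F" "\<And>S. S \<in> F \<Longrightarrow> zclosed S" and sub: "T \<subseteq> \<Union>F"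
  shows "\<exists>S\<in>F. T \<subseteq> S"
  using F sub
proof (induction F rule: finite_induct)
  case empty then show ?case using T by (auto simp: zirreducible_def)
next
  case (insert S F)
  have "T = (T \<inter> S) \<union> (T \<inter> \<Union>F)" using insert.prems(2) by blast
  moreover have "zclosed T" using T by (simp add: zirreducible_def)
  moreover have "zclosed (\<Union>F)" by (rule zclosed_Union) (use insert in auto)
  ultimately have "T = T \<inter> S \<or> T = T \<inter> \<Union>F"
    using T insert.prems(1) zclosed_Int unfolding zirreducible_def by (metis insertI1)
  then show ?case
  proof
    assume "T = T \<inter> S" then show ?thesis by blast
  next
    assume "T = T \<inter> \<Union>F"
    then have "T \<subseteq> \<Union>F" by blast
    then show ?thesis using insert by blast
  qed
qed

lemma component_split:
  fixes B :: "('n::{finite,linorder}) pspace set"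
  assumes "zclosed B" and T: "T \<in> components B"
  obtains Z where "zclosed Z" "B = T \<union> Z" "\<not> T \<subseteq> Z"
proof -
  obtain F where F: "finite F" "\<forall>S\<in>F. zirreducible S" "B = \<Union>F" using zclosed_decomposition [OF assms(1)] by blast
  have Tirr: "zirreducible T" and TB: "T \<subseteq> B" and max: "\<And>S. zirreducible S \<Longrightarrow> T \<subseteq> S \<Longrightarrow> S \<subseteq> B \<Longrightarrow> S = T"
    using T unfolding components_def by auto
  have cl: "zclosed S" if "S \<in> F" for S using F(2) that by (auto simp: zirreducible_def)
  have eq: "S = T" if "S \<in> F" "T \<subseteq> S" for S using max [of S] that F(2,3) by blast
  obtain S where S: "S \<in> F" "T \<subseteq> S" using irreducible_in_Union [OF Tirr F(1) cl] TB F(3) by blast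
  then have TF: "T \<in> F" using eq by blast
  show ?thesis
  proof
    show "zclosed (\<Union>(F - {T}))" by (rule zclosed_Union) (use F(1) cl in auto)
    show "B = T \<union> \<Union>(F - {T})" using F(3) TF by blast
    show "\<not> T \<subseteq> \<Union>(F - {T})"
    proof
      assume "T \<subseteq> \<Union>(F - {T})"
      then obtain S where "S \<in> F - {T}" "T \<subseteq> S" using irreducible_in_Union [OF Tirr, of "F - {T}"] F(1) cl by blast
      then show False using eq by blast
    qed
  qed
qed

lemma poly_degree_le:
  fixes p q :: "real poly"
  assumes "\<forall>\<^sub>F d in sequentially. 0 \<le> poly p (real d) \<and> poly p (real d) \<le> poly q (real d)"
  shows "degree p \<le> degree q"
proof (rule ccontr)
  assume "\<not> degree p \<le> degree q"
  then have lt: "degree q < degree p" by simp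
  have inf: "filterlim real at_infinity sequentially"
    by (rule filterlim_mono [OF filterlim_real_sequentially at_top_le_at_infinity order_refl])
  have p: "((\<lambda>d. poly p (real d) / real d ^ degree p) \<longlongrightarrow> lead_coeff p) sequentially"
    by (rule filterlim_compose [OF poly_divide_tendsto_aux inf])
  have q: "((\<lambda>d. poly q (real d) / real d ^ degree q) \<longlongrightarrow> lead_coeff q) sequentially"
    by (rule filterlim_compose [OF poly_divide_tendsto_aux inf])
  have "((\<lambda>d. 1 / real d) \<longlongrightarrow> 0) sequentially" by (rule lim_1_over_n)
  then have "((\<lambda>d. (1 / real d) ^ (degree p - degree q)) \<longlongrightarrow> 0 ^ (degree p - degree q)) sequentially" by (rule tendsto_power)
  then have "((\<lambda>d. (1 / real d) ^ (degree p - degree q)) \<longlongrightarrow> 0) sequentially" using lt by (simp add: zero_power)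
  from tendsto_mult [OF q this]
  have "((\<lambda>d. poly q (real d) / real d ^ degree q * (1 / real d) ^ (degree p - degree q)) \<longlongrightarrow> 0) sequentially" by simp
  moreover have "\<forall>\<^sub>F d in sequentially. poly q (real d) / real d ^ degree q * (1 / real d) ^ (degree p - degree q) = poly q (real d) / real d ^ degree p"
    using eventually_gt_at_top [of 0]
  proof eventually_elim
    case (elim d)
    have "real d ^ degree p = real d ^ degree q * real d ^ (degree p - degree q)" using lt by (simp flip: power_add)
    then show ?case by (simp add: power_one_over)
  qed
  ultimately have q': "((\<lambda>d. poly q (real d) / real d ^ degree p) \<longlongrightarrow> 0) sequentially" by (rule Lim_transform_eventually)
  have "((\<lambda>d. poly p (real d) / real d ^ degree p) \<longlongrightarrow> 0) sequentially"
  proof (rule tendsto_sandwich [OF _ _ tendsto_const q'])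
    show "\<forall>\<^sub>F d in sequentially. 0 \<le> poly p (real d) / real d ^ degree p"
      using assms by eventually_elim simp
    show "\<forall>\<^sub>F d in sequentially. poly p (real d) / real d ^ degree p \<le> poly q (real d) / real d ^ degree p"
      using assms by eventually_elim (simp add: divide_right_mono)
  qed
  then have "lead_coeff p = 0" using p LIMSEQ_unique by blast
  then show False using lt by auto
qed

lemma unit_value:
  fixes C :: "('n::finite) mpoly"
  assumes hC: "homogeneous 3 C" and b0: "peval C b0 \<noteq> 0"
  shows "\<exists>\<kappa>. \<kappa> \<noteq> 0 \<and> peval C (\<kappa> *s b0) = 1"
proof -
  define \<kappa> where "\<kappa> = exp (Ln (1 / peval C b0) / 3)"
  have "\<kappa> ^ 3 = exp (of_nat 3 * (Ln (1 / peval C b0) / 3))" unfolding \<kappa>_def by (rule exp_of_nat_mult [symmetric])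
  also have "\<dots> = 1 / peval C b0" using b0 by simp
  finally have "peval C (\<kappa> *s b0) = 1" using b0 by (simp add: peval_homogeneous [OF hC])
  moreover have "\<kappa> \<noteq> 0" by (simp add: \<kappa>_def)
  ultimately show ?thesis by blast
qed

lemma mpoly_dim_mono:
  fixes V W :: "('n::finite) mpoly set"
  assumes "V \<subseteq> W" "mpoly.subspace W" "W \<subseteq> mpoly.span S" "finite S"
  shows "mpoly.dim V \<le> mpoly.dim W"
proof -
  obtain B where B: "finite B" "mpoly.span B = W" "card B = mpoly.dim W" using mpoly_basis [OF assms(2-4)] by metis
  show ?thesis using mpoly.dim_le_card [of V B] B assms(1) by simp
qed

lemma hilbert_function_vdeg:
  fixes Z :: "('n::finite) pspace set"
  shows "real (hilbert_function Z d) = real (mpoly.dim (Hom d :: 'n mpoly set)) - real (mpoly.dim (vdeg Z d))"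
proof -
  have "mpoly.dim (vdeg Z d) \<le> mpoly.dim (Hom d :: 'n mpoly set)"
    by (rule mpoly_dim_mono [OF vdeg_subspace(2) subspace_Hom Hom_sub_span finite_mons])
  then show ?thesis unfolding hilbert_function_def vdeg_def [symmetric] Hom_def [symmetric] by (simp add: of_nat_diff)
qed

section \<open>The dimension of the components of the branch surface\<close>

lemma quotient_map_ex:
  fixes b c :: "complex^5"
  shows "\<exists>U :: complex^5^3. U *v b = 0 \<and> U *v c = 0 \<and> surj (\<lambda>x. U *v x)"
proof -
  obtain B0 where B0: "B0 \<subseteq> {b, c}" "vec.independent B0" "{b, c} \<subseteq> vec.span B0"
    by (rule vec.maximal_independent_subset [of "{b, c}"])
  obtain B where B: "B0 \<subseteq> B" "vec.independent B" "vec.span B = (UNIV :: (complex^5) set)"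
    by (rule vec.maximal_independent_subset_extend [OF subset_UNIV B0(2)]) auto
  have finB: "finite B" using B(2) vec.finiteI_independent by blast
  have cardB: "card B = 5" using B vec.basis_card_eq_dim [of B UNIV] by (simp add: card_cart_basis)
  have "card B0 \<le> 2" using card_mono [OF _ B0(1)] by (simp add: card_insert_if split: if_splits)
  then have "card (UNIV :: 3 set) \<le> card (B - B0)" using cardB B(1) finB by (simp add: card_Diff_subset finite_subset)
  then obtain h :: "3 \<Rightarrow> complex^5" where h: "inj h" "range h \<subseteq> B - B0"
    using card_le_inj [of "UNIV :: 3 set" "B - B0"] finB by auto
  define f :: "complex^5 \<Rightarrow> complex^3" where "f x = (if x \<in> range h then axis (inv h x) 1 else 0)" for x
  obtain g where g: "Vector_Spaces.linear (*s) (*s) g" "\<forall>x\<in>B. g x = f x"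
    using vec.linear_independent_extend [OF B(2)] by blast
  interpret g: Vector_Spaces.linear "(*s)" "(*s)" g by (rule g(1))
  have M: "matrix g *v x = g x" for x by (rule matrix_works [OF g(1)])
  have "g x = 0" if "x \<in> B0" for x
  proof -
    have "x \<notin> range h" "x \<in> B" using that h(2) B(1) by blast+
    then show ?thesis using g(2) by (simp add: f_def)
  qed
  then have z: "g x = 0" if "x \<in> vec.span B0" for x using g.eq_0_on_span that by blast
  have hx: "g (h i) = axis i 1" for i
  proof -
    have "h i \<in> B" using h(2) by blast
    then show ?thesis using g(2) h(1) by (simp add: f_def)
  qed
  have "y \<in> range g" for y
  proof
    have "g (\<Sum>i\<in>UNIV. (y $ i) *s h i) = (\<Sum>i\<in>UNIV. (y $ i) *s axis i 1)" by (simp add: g.sum g.scale hx)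
    also have "\<dots> = y" by (rule basis_expansion)
    finally show "y = g (\<Sum>i\<in>UNIV. (y $ i) *s h i)" ..
  qed auto
  then have "surj (\<lambda>x. matrix g *v x)" unfolding M by (auto simp: surj_def)
  then show ?thesis using z B0(3) M by (intro exI [of _ "matrix g"]) auto
qed

text \<open>Let \<open>b\<close> and \<open>c\<close> span a plane missing \<open>C = D = 0\<close>. The projection along this plane is finite, so the
  Hilbert function of a component is at most that of the surface, of degree two. For the lower bound, no nonzero
  polynomial \<open>a\<close> in the three remaining coordinates vanishes on a component: a product of \<open>a\<close> with an equation
  of the other components would vanish everywhere, and \<open>torsion_free\<close> cancels \<open>a\<close>.\<close>

lemma component_dim:
  fixes C D :: "5 mpoly" and B :: "5 pspace set"
  assumes pC: "prime_elem C" and hC: "homogeneous 3 C" and hD: "homogeneous 4 D" and CD: "\<not> C dvd D"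
    and B: "zclosed B" and I: "vanishing_ideal B = {P. \<exists>\<alpha> \<beta>. P = \<alpha> * C + \<beta> * D}"
    and T: "T \<in> components B"
  shows "has_dim T 2"
proof -
  have C0: "C \<noteq> 0" using pC by (simp add: prime_elem_def)
  obtain b0 where "peval C b0 \<noteq> 0" using peval_nonzero_ex [OF C0] by blast
  then obtain b where b1: "peval C b = 1" using unit_value [OF hC] by blast
  interpret cubic_norm C D b by unfold_locales (fact hC hD b1)+
  obtain c where c: "peval N c \<noteq> 0" using N_nonzero_ex [OF pC CD] by blast
  obtain U :: "complex^5^3" where U: "U *v b = 0" "U *v c = 0" "surj (\<lambda>x. U *v x)" using quotient_map_ex by blast
  obtain Z where Z: "zclosed Z" "B = T \<union> Z" "\<not> T \<subseteq> Z" using component_split [OF B T] by metis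
  have irrT: "zirreducible T" using T by (simp add: components_def)
  obtain q where q: "q \<in> T" "q \<notin> Z" using Z(3) by blast
  obtain g e where g: "homogeneous e g" "g \<in> vanishing_ideal Z" "\<exists>x\<in>hcoords q. peval g x \<noteq> 0"
    by (rule zclosed_separate [OF Z(1) q(2)])
  have gT: "g \<notin> vanishing_ideal T" using g(3) q(1) vanishing_idealD by blast
  have "\<exists>Q::5 mpoly. \<forall>x. peval Q x = peval P (U *v x)" for P :: "3 mpoly"
    using polyfun_comp [of "\<lambda>x. U *v x" P] polyfun_linear unfolding polyfun_def by blast
  then obtain \<sigma> :: "3 mpoly \<Rightarrow> 5 mpoly" where s: "\<And>P x. peval (\<sigma> P) x = peval P (U *v x)" by metis
  have U_add: "U *v (x + t *s y) = U *v x + t *s (U *v y)" for x y t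
    by (simp add: matrix_vector_right_distrib vector_scalar_commute)
  have shom: "homogeneous d (\<sigma> P)" if "homogeneous d P" for P d
    by (rule homogeneousI) (simp add: s vector_scalar_commute peval_homogeneous [OF that])
  have sinj: "inj \<sigma>"
  proof (rule injI)
    fix P Q assume "\<sigma> P = \<sigma> Q"
    then have "peval P (U *v x) = peval Q (U *v x)" for x using s by metis
    then show "P = Q" using U(3) by (intro peval_inj) (metis surjD)
  qed
  have slin: "Vector_Spaces.linear pscale pscale \<sigma>"
    by unfold_locales (auto intro!: peval_inj simp: s)
  interpret lin: Vector_Spaces.linear pscale pscale \<sigma> by (rule slin)
  have notT: "\<sigma> P \<notin> vanishing_ideal T" if P: "P \<noteq> 0" "homogeneous d P" for P d
  proof
    assume "\<sigma> P \<in> vanishing_ideal T"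
    then have "\<sigma> P * g \<in> vanishing_ideal B" using g(2) Z(2) by (auto simp: vanishing_ideal_def)
    then obtain \<alpha> \<beta> where ab: "\<sigma> P * g = \<alpha> * C + \<beta> * D" unfolding I by blast
    have "\<sigma> P \<noteq> 0" using sinj P(1) lin.zero by (metis injD)
    then have "\<exists>\<alpha> \<beta>. g = \<alpha> * C + \<beta> * D"
      by (rule torsion_free [OF c _ _ _ ab]) (simp_all add: s U_add U)
    then have "g \<in> vanishing_ideal B" unfolding I by blast
    then have "g \<in> vanishing_ideal T" using vanishing_ideal_antimono [of T B] Z(2) by blast
    then show False using gT by blast
  qed
  have lower: "real (d + 2 choose d) \<le> real (hilbert_function T d)" for d
  proof -
    let ?A = "\<sigma> ` Hom d" and ?V = "vdeg T d"
    obtain W :: "3 mpoly set" where W: "finite W" "mpoly.independent W" "mpoly.span W = Hom d" "card W = mpoly.dim (Hom d :: 3 mpoly set)"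
      using mpoly_basis [OF subspace_Hom Hom_sub_span finite_mons] by metis
    have A: "?A = mpoly.span (\<sigma> ` W)" using lin.span_image [of W] W(3) by simp
    have "mpoly.independent (\<sigma> ` W)"
      by (rule lin.independent_injective_image [OF W(2)]) (rule inj_on_subset [OF sinj subset_UNIV])
    then have "mpoly.dim ?A = card (\<sigma> ` W)" unfolding A by (rule mpoly.dim_span_eq_card_independent)
    also have "\<dots> = (d + 2 choose d)"
      using card_image [OF inj_on_subset [OF sinj subset_UNIV], of W] W(4) dim_Hom [of d, where 'n = 3] by (simp add: add.commute [of 2])
    finally have dA: "mpoly.dim ?A = (d + 2 choose d)" .
    have subA: "mpoly.subspace ?A" unfolding A by (rule mpoly.subspace_span)
    have AH: "?A \<subseteq> Hom d" using shom by (auto simp: Hom_def)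
    have int: "?A \<inter> ?V = {0}"
    proof (intro subset_antisym subsetI)
      fix x assume x: "x \<in> ?A \<inter> ?V"
      then obtain P where P: "x = \<sigma> P" "homogeneous d P" by (auto simp: Hom_def)
      have "P = 0" using notT [of P d] P x by (auto simp: vdeg_def)
      then show "x \<in> {0}" using P(1) lin.zero by simp
    next
      fix x :: "5 mpoly" assume "x \<in> {0}"
      then show "x \<in> ?A \<inter> ?V" using mpoly.subspace_0 [OF subA] mpoly.subspace_0 [OF vdeg_subspace(1)] by simp
    qed
    have VH: "?V \<subseteq> Hom d" by (rule vdeg_subspace(2))
    have sp: "?A \<subseteq> mpoly.span (mons d)" "?V \<subseteq> mpoly.span (mons d)" unfolding span_mons by (rule AH, rule VH)
    have "mpoly.dim {x + y | x y. x \<in> ?A \<and> y \<in> ?V} + mpoly.dim (?A \<inter> ?V) = mpoly.dim ?A + mpoly.dim ?V"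
      by (rule mpoly_dim_sum [OF subA vdeg_subspace(1) finite_mons [of d] sp])
    moreover have "mpoly.dim {x + y | x y. x \<in> ?A \<and> y \<in> ?V} \<le> mpoly.dim (Hom d :: 5 mpoly set)"
    proof (rule mpoly_dim_mono [OF _ subspace_Hom Hom_sub_span finite_mons])
      show "{x + y | x y. x \<in> ?A \<and> y \<in> ?V} \<subseteq> Hom d"
      proof
        fix z assume "z \<in> {x + y | x y. x \<in> ?A \<and> y \<in> ?V}"
        then obtain x y where z: "z = x + y" "x \<in> ?A" "y \<in> ?V" by blast
        show "z \<in> Hom d" unfolding z(1)
          by (rule mpoly.subspace_add [OF subspace_Hom subsetD [OF AH z(2)] subsetD [OF VH z(3)]])
      qed
    qed
    moreover have "mpoly.dim ({0} :: 5 mpoly set) = 0" using mpoly.dim_le_card [of "{0}" "{}"] by simp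
    ultimately have "mpoly.dim ?A + mpoly.dim ?V \<le> mpoly.dim (Hom d :: 5 mpoly set)" unfolding int by simp
    then show ?thesis unfolding hilbert_function_vdeg dA by simp
  qed
  have upper: "real (hilbert_function T d) \<le> real (hilbert_function B d)" for d
  proof -
    have "vdeg B d \<subseteq> vdeg T d" using vanishing_ideal_antimono [of T B] Z(2) unfolding vdeg_def by blast
    then have "mpoly.dim (vdeg B d) \<le> mpoly.dim (vdeg T d)"
    proof (rule mpoly_dim_mono [OF _ vdeg_subspace(1) _ finite_mons [of d]])
      show "vdeg T d \<subseteq> mpoly.span (mons d)" unfolding span_mons by (rule vdeg_subspace(2))
    qed
    then show ?thesis unfolding hilbert_function_vdeg by simp
  qed
  obtain h where h: "is_hilbert_poly T h" using hilbert_poly_exists by blast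
  have hB: "is_hilbert_poly B (ci_poly 4)" by (rule hilbert_ci [OF pC hC hD CD I])
  define l where "l = ([:1, 3 / 2, 1 / 2:] :: real poly)"
  have l: "poly l (real d) = real (d + 2 choose d)" for d
  proof -
    have "(d + 2 choose d) = (d + 2 choose 2)" using binomial_symmetric [of d "d + 2"] by simp
    then have "real (d + 2 choose d) = (real (d + 2)) gchoose 2" by (simp add: binomial_gbinomial)
    also have "\<dots> = (real d + 2) * (real d + 1) / 2"
      by (simp add: gbinomial_prod_rev numeral_eq_Suc prod.atLeast0_lessThan_Suc fact_Suc add.commute)
    also have "\<dots> = poly l (real d)" by (simp add: l_def field_simps)
    finally show ?thesis by simp
  qed
  have dl: "degree l = 2" by (simp add: l_def)
  have "\<forall>\<^sub>F d in sequentially. 0 \<le> poly l (real d) \<and> poly l (real d) \<le> poly h (real d)"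
    using h unfolding is_hilbert_poly_def by eventually_elim (use lower l in auto)
  then have 1: "2 \<le> degree h" using poly_degree_le dl by metis
  have "\<forall>\<^sub>F d in sequentially. 0 \<le> poly h (real d) \<and> poly h (real d) \<le> poly (ci_poly 4) (real d)"
    using h hB unfolding is_hilbert_poly_def by eventually_elim (use upper in auto)
  then have "degree h \<le> degree (ci_poly 4)" by (rule poly_degree_le)
  then have 2: "degree h \<le> 2" using ci_poly_degree(1) [of 4] by simp
  have "degree h = 2" using 1 2 by simp
  moreover have "h \<noteq> 0" using calculation by auto
  ultimately show ?thesis using h unfolding has_dim_def by blast
qed

section \<open>Singular points, charts and initial forms\<close>

lemma functional_kernel_dim:
  fixes w :: "complex^'n"
  shows "CARD('n) - 1 \<le> vec.dim {v. (\<Sum>i\<in>UNIV. w $ i * v $ i) = 0}"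
proof (rule ccontr)
  define \<phi> where "\<phi> v = (\<Sum>i\<in>UNIV. w $ i * v $ i)" for v
  have lin: "\<phi> (u + c *s v) = \<phi> u + c * \<phi> v" for u v c
    by (simp add: \<phi>_def sum.distrib sum_distrib_left algebra_simps)
  let ?V = "{v. \<phi> v = 0}"
  assume "\<not> CARD('n) - 1 \<le> vec.dim {v. (\<Sum>i\<in>UNIV. w $ i * v $ i) = 0}"
  then have small: "vec.dim ?V < CARD('n) - 1" unfolding \<phi>_def by simp
  obtain B where B: "B \<subseteq> ?V" "vec.independent B" "?V \<subseteq> vec.span B" "card B = vec.dim ?V"
    by (rule vec.basis_exists [of ?V])
  have finB: "finite B" using B(2) vec.finiteI_independent by blast
  have cB: "card B < CARD('n)" using small B(4) by linarith
  obtain a where a: "a \<notin> vec.span B" using not_in_span_ex [OF finB cB] by blast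
  then have \<phi>a: "\<phi> a \<noteq> 0" using B(3) by auto
  have "card (insert a B) \<le> Suc (card B)" by (rule card_insert_le_m1) simp_all
  then have "card (insert a B) < CARD('n)" using small B(4) by linarith
  then obtain a' where a': "a' \<notin> vec.span (insert a B)" using not_in_span_ex [of "insert a B"] finB by blast
  have "\<phi> (a' + (- \<phi> a' / \<phi> a) *s a) = 0" unfolding lin using \<phi>a by simp
  then have "a' + (- \<phi> a' / \<phi> a) *s a \<in> vec.span B" using B(3) by auto
  then have 1: "a' + (- \<phi> a' / \<phi> a) *s a \<in> vec.span (insert a B)" using vec.span_mono [of B "insert a B"] by auto
  have "(\<phi> a' / \<phi> a) *s a \<in> vec.span (insert a B)" by (intro vec.span_scale vec.span_base) simp
  from vec.span_add [OF 1 this] have "a' \<in> vec.span (insert a B)" by (simp add: add.assoc flip: vec.scale_left_distrib)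
  then show False using a' by blast
qed

lemma minors_kernel_dim:
  fixes P Q :: "('n::finite) mpoly"
  assumes "\<And>v w. dP P x v * dP Q x w = dP P x w * dP Q x v"
  shows "CARD('n) - 1 \<le> vec.dim {v. dP P x v = 0 \<and> dP Q x v = 0}"
proof (cases "\<forall>v. dP P x v = 0")
  case True
  then have "\<And>v. dP P x v = 0" by blast
  then have "{v. dP P x v = 0 \<and> dP Q x v = 0} = {v. (\<Sum>i\<in>UNIV. (\<chi> i. peval (pderivs Q i) x) $ i * v $ i) = 0}"
    unfolding dP_def vec_lambda_beta by simp
  then show ?thesis by (simp only:) (rule functional_kernel_dim)
next
  case False
  then obtain w where w: "dP P x w \<noteq> 0" by blast
  have "dP Q x v = 0" if "dP P x v = 0" for v using assms [of v w] that w by simp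
  then have "{v. dP P x v = 0 \<and> dP Q x v = 0} = {v. (\<Sum>i\<in>UNIV. (\<chi> i. peval (pderivs P i) x) $ i * v $ i) = 0}"
    unfolding dP_def vec_lambda_beta by blast
  then show ?thesis by (simp only:) (rule functional_kernel_dim)
qed

text \<open>The tangent space contains the common kernel of two dependent linear forms, which has codimension at
  most one; a smooth point needs codimension two or more here.\<close>

lemma singular_pointI:
  fixes P Q :: "('n::finite) mpoly"
  assumes I: "vanishing_ideal Z = {f. \<exists>\<alpha> \<beta>. f = \<alpha> * P + \<beta> * Q}"
    and P: "homogeneous (Suc d) P" and Q: "homogeneous (Suc e) Q" and y: "y \<noteq> 0" "pt y \<in> Z"
    and min: "\<And>v w. dP P y v * dP Q y w = dP P y w * dP Q y v"
    and r: "has_dim Z r" "r + 2 < CARD('n)"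
  shows "pt y \<in> singular_points Z"
proof -
  have "P \<in> vanishing_ideal Z" unfolding I by (intro CollectI exI [of _ 1] exI [of _ 0]) simp
  moreover have "Q \<in> vanishing_ideal Z" unfolding I by (intro CollectI exI [of _ 0] exI [of _ 1]) simp
  ultimately have z: "peval P x = 0" "peval Q x = 0" if "x \<in> hcoords (pt y)" for x
    using vanishing_idealD y(2) that by blast+
  have "{v. dP P y v = 0 \<and> dP Q y v = 0} \<subseteq> tangent_space Z (pt y)"
  proof
    fix v assume v: "v \<in> {v. dP P y v = 0 \<and> dP Q y v = 0}"
    have "dP f x v = 0" if f: "f \<in> vanishing_ideal Z" and x: "x \<in> hcoords (pt y)" for f x
    proof -
      obtain \<alpha> \<beta> where ab: "f = \<alpha> * P + \<beta> * Q" using f unfolding I by blast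
      obtain c where "c \<noteq> 0" "x = c *s y" using x hcoords_pt [OF y(1)] by blast
      then have "dP P x v = 0" "dP Q x v = 0" using v by (simp_all add: dP_homogeneous [OF P] dP_homogeneous [OF Q])
      then show ?thesis using z [OF x] by (simp add: ab)
    qed
    then show "v \<in> tangent_space Z (pt y)" unfolding tangent_space_def deriv_peval by blast
  qed
  then have "vec.dim {v. dP P y v = 0 \<and> dP Q y v = 0} \<le> vec.dim (tangent_space Z (pt y))" by (rule vec.dim_subset)
  then have "CARD('n) - 1 \<le> vec.dim (tangent_space Z (pt y))" using minors_kernel_dim [OF min] by linarith
  then have "vec.dim (tangent_space Z (pt y)) \<noteq> r + 1" using r(2) by linarith
  then show ?thesis unfolding singular_points_def using y(2) r(1) by blast
qed

lemma homogeneous_coeff_shiftp: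
  assumes P: "homogeneous d P" and k: "k \<le> d"
  shows "homogeneous (d - k) (coeff (shiftp e P) k)"
proof (rule homogeneousI)
  fix s :: complex and x assume s: "s \<noteq> 0"
  let ?p = "pev (shiftp e P) x" and ?q = "pev (shiftp e P) (s *s x)"
  have "pcompose ?q [:0, s:] = smult (s ^ d) ?p"
  proof -
    have "poly (pcompose ?q [:0, s:]) t = poly (smult (s ^ d) ?p) t" for t
    proof -
      have "s *s x + (t * s) *s e = s *s (x + t *s e)" by (simp add: vector_add_ldistrib vector_smult_assoc mult.commute)
      then have "peval P (s *s x + (t * s) *s e) = s ^ d * peval P (x + t *s e)" by (simp only: peval_homogeneous [OF P])
      then show ?thesis by (simp add: poly_pcompose poly_shiftp)
    qed
    then show ?thesis by (simp add: poly_eq_poly_eq_iff [symmetric] fun_eq_iff)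
  qed
  from arg_cong [OF this, of "\<lambda>p. coeff p k"]
  have "s ^ k * peval (coeff (shiftp e P) k) (s *s x) = s ^ d * peval (coeff (shiftp e P) k) x"
    by (simp add: coeff_pcompose_linear)
  moreover have "s ^ d = s ^ k * s ^ (d - k)" using k by (simp flip: power_add)
  ultimately show "peval (coeff (shiftp e P) k) (s *s x) = s ^ (d - k) * peval (coeff (shiftp e P) k) x"
    using s by (simp add: mult.assoc)
qed

lemma poly_3:
  fixes p :: "complex poly"
  assumes "degree p \<le> 3"
  shows "poly p t = coeff p 0 + coeff p 1 * t + coeff p 2 * t ^ 2 + coeff p 3 * t ^ 3"
proof -
  have "poly p t = (\<Sum>i\<le>3. coeff p i * t ^ i)"
    unfolding poly_altdef by (rule sum.mono_neutral_left) (use assms in \<open>auto simp: coeff_eq_0\<close>)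
  then show ?thesis by (simp add: numeral_2_eq_2 numeral_3_eq_3)
qed

text \<open>The coordinates \<open>c\<close> and \<open>v\<close> of a chart are linear functions on the ambient space; making them
  explicit by a vector and a matrix keeps everything polynomial.\<close>

lemma chart_coordinates:
  fixes x0 :: "complex^'n" and M :: "complex^'m^'n"
  assumes bij: "bij (\<lambda>(c, v). c *s x0 + M *v v)"
  shows "\<exists>(l :: complex^'n) (R :: complex^'n^'m). (\<forall>c v. (\<Sum>i\<in>UNIV. l $ i * (c *s x0 + M *v v) $ i) = c) \<and>
     (\<forall>c v. R *v (c *s x0 + M *v v) = v) \<and> (\<forall>x. x = (\<Sum>i\<in>UNIV. l $ i * x $ i) *s x0 + M *v (R *v x))"
proof -
  define f where "f = (\<lambda>(c, v). c *s x0 + M *v v)"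
  have bf: "bij f" using bij by (simp add: f_def)
  define g where "g = inv f"
  have gf: "g (c *s x0 + M *v v) = (c, v)" for c v
    using inv_f_f [OF bij_is_inj [OF bf], of "(c, v)"] by (simp add: g_def f_def)
  define lc where "lc x = fst (g x)" for x
  define rv where "rv x = snd (g x)" for x
  have dec: "x = lc x *s x0 + M *v rv x" for x
  proof -
    have "f (g x) = x" unfolding g_def by (rule surj_f_inv_f [OF bij_is_surj [OF bf]])
    then show ?thesis by (simp add: f_def lc_def rv_def case_prod_unfold)
  qed
  have add: "g (x + y) = (lc x + lc y, rv x + rv y)" for x y
  proof -
    have "x + y = (lc x + lc y) *s x0 + M *v (rv x + rv y)"
    proof -
      have "x + y = (lc x *s x0 + M *v rv x) + (lc y *s x0 + M *v rv y)" by (simp flip: dec)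
      then show ?thesis by (simp add: vector_sadd_rdistrib matrix_vector_right_distrib algebra_simps)
    qed
    then show ?thesis using gf by metis
  qed
  have scale: "g (a *s x) = (a * lc x, a *s rv x)" for a x
  proof -
    have "a *s x = (a * lc x) *s x0 + M *v (a *s rv x)"
    proof -
      have "a *s x = a *s (lc x *s x0 + M *v rv x)" by (simp flip: dec)
      then show ?thesis by (simp add: vector_add_ldistrib vector_smult_assoc vector_scalar_commute)
    qed
    then show ?thesis using gf by metis
  qed
  have "Vector_Spaces.linear (*s) (*s) rv"
    by unfold_locales (simp_all add: add scale vec.scale_right_distrib vec.scale_left_distrib rv_def)
  then have R: "matrix rv *v x = rv x" for x by (rule matrix_works)
  define l where "l = (\<chi> i. lc (axis i 1))"
  have l: "(\<Sum>i\<in>UNIV. l $ i * x $ i) = lc x" for x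
  proof -
    have "lc (\<Sum>i\<in>S. (x $ i) *s axis i 1) = (\<Sum>i\<in>S. l $ i * x $ i)" for S
    proof (induction S rule: infinite_finite_induct)
      case (insert i S)
      then show ?case using add [of "(x $ i) *s axis i 1" "\<Sum>i\<in>S. (x $ i) *s axis i 1"] scale [of "x $ i" "axis i 1"]
        by (simp add: lc_def l_def)
    qed (use scale [of 0 0] in \<open>simp_all add: lc_def\<close>)
    then show ?thesis using basis_expansion [of x] by metis
  qed
  show ?thesis
    by (rule exI [of _ l], rule exI [of _ "matrix rv"], unfold l R) (use dec gf in \<open>auto simp: lc_def rv_def\<close>)
qed

text \<open>If \<open>\<alpha> * C + \<beta> * g\<close> has smaller order than expected, then the lowest forms of the two terms cancel, and this
  is a syzygy of the coprime forms \<open>C\<close> and \<open>E\<close>, hence a multiple \<open>\<gamma>\<close> of the trivial one. Subtracting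
  \<open>\<gamma>\<close> times the trivial syzygy of \<open>C\<close> and \<open>g\<close> raises the orders of the coefficients; after finitely
  many corrections nothing cancels, and the initial form is read off.\<close>

lemma initial_form_in_ideal:
  fixes C E g :: "5 mpoly"
  assumes pC: "prime_elem C" and hC: "homogeneous 3 C" and CE: "\<not> C dvd E"
    and gE: "hom_part e g = E" and glow: "\<And>k. k < e \<Longrightarrow> hom_part k g = 0"
  shows "\<exists>\<alpha>' \<beta>'. initial_form (\<alpha> * C + \<beta> * g) = \<alpha>' * C + \<beta>' * E"
proof -
  define f where "f = \<alpha> * C + \<beta> * g"
  have E0: "E \<noteq> 0" using CE by auto
  have C0: "C \<noteq> 0" using pC by (simp add: prime_elem_def)
  have hE: "homogeneous e E" using gE homogeneous_hom_part by metis
  define ord where "ord = order_at_0 f"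
  have low: "hom_part k f = 0" if "k < ord" for k
    using not_less_Least that unfolding ord_def order_at_0_def by blast
  have prod: "hom_part n (\<beta> * g) = (if e \<le> n then hom_part (n - e) \<beta> * E else 0)"
    if b: "\<And>j. j + e < n \<Longrightarrow> hom_part j \<beta> = 0" for \<beta> n
  proof -
    let ?B = "insert e (mdeg ` Poly_Mapping.keys g)"
    have "hom_part n (\<beta> * g) = (\<Sum>j\<in>?B. if j \<le> n then hom_part (n - j) \<beta> * hom_part j g else 0)"
      by (rule hom_part_mult_general) auto
    also have "\<dots> = (\<Sum>j\<in>{e}. if j \<le> n then hom_part (n - j) \<beta> * hom_part j g else 0)"
    proof (rule sum.mono_neutral_right)
      show "\<forall>j\<in>?B - {e}. (if j \<le> n then hom_part (n - j) \<beta> * hom_part j g else 0) = 0"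
      proof
        fix j assume j: "j \<in> ?B - {e}"
        show "(if j \<le> n then hom_part (n - j) \<beta> * hom_part j g else 0) = 0"
        proof (cases "j < e")
          case True then show ?thesis by (simp add: glow)
        next
          case False
          then show ?thesis using j b [of "n - j"] by auto
        qed
      qed
    qed auto
    finally show ?thesis by (simp add: gE)
  qed
  have "\<exists>\<alpha> \<beta>. f = \<alpha> * C + \<beta> * g \<and> (\<forall>j. j + 3 < n \<longrightarrow> hom_part j \<alpha> = 0) \<and> (\<forall>j. j + e < n \<longrightarrow> hom_part j \<beta> = 0)"
    if "n \<le> ord" for n
    using that
  proof (induction n)
    case 0 then show ?case using f_def by auto
  next
    case (Suc n)
    then obtain \<alpha> \<beta> where ab: "f = \<alpha> * C + \<beta> * g" "\<And>j. j + 3 < n \<Longrightarrow> hom_part j \<alpha> = 0" "\<And>j. j + e < n \<Longrightarrow> hom_part j \<beta> = 0"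
      by auto
    have z: "(if 3 \<le> n then hom_part (n - 3) \<alpha> * C else 0) + (if e \<le> n then hom_part (n - e) \<beta> * E else 0) = 0"
    proof -
      have pr: "hom_part n (\<beta> * g) = (if e \<le> n then hom_part (n - e) \<beta> * E else 0)" by (rule prod) (rule ab(3))
      have "hom_part n (\<alpha> * C + \<beta> * g) = 0" using low [of n] Suc.prems ab(1) by simp
      then show ?thesis by (simp add: hom_part_add hom_part_mult [OF hC] pr)
    qed
    have "\<exists>\<gamma> d. homogeneous d \<gamma> \<and> (\<gamma> \<noteq> 0 \<longrightarrow> n = d + e + 3) \<and> (e \<le> n \<longrightarrow> hom_part (n - e) \<beta> = \<gamma> * C) \<and> (3 \<le> n \<longrightarrow> hom_part (n - 3) \<alpha> = - \<gamma> * E)"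
    proof (cases "e \<le> n \<and> hom_part (n - e) \<beta> \<noteq> 0")
      case False
      then have "(if e \<le> n then hom_part (n - e) \<beta> * E else 0) = 0" by auto
      then have "3 \<le> n \<longrightarrow> hom_part (n - 3) \<alpha> = 0" using z C0 by (cases "3 \<le> n") simp_all
      then show ?thesis using False by (intro exI [of _ 0] exI [of _ 0]) auto
    next
      case True
      have "C dvd hom_part (n - e) \<beta> * E"
      proof (cases "3 \<le> n")
        case True
        then have "hom_part (n - e) \<beta> * E = (- hom_part (n - 3) \<alpha>) * C"
          using z \<open>e \<le> n \<and> _\<close> by (simp add: add_eq_0_iff)
        then show ?thesis by simp
      next
        case False then show ?thesis using z True E0 by simp
      qed
      then have "C dvd hom_part (n - e) \<beta>" using prime_elem_dvd_multD [OF pC] CE by blast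
      then obtain \<gamma> where g: "hom_part (n - e) \<beta> = \<gamma> * C" unfolding dvd_def by (metis mult.commute)
      then have g0: "\<gamma> \<noteq> 0" using True by auto
      have "homogeneous (n - e) (\<gamma> * C)" using g homogeneous_hom_part by metis
      then obtain d j where d: "homogeneous d \<gamma>" "homogeneous j C" "d + j = n - e" using homogeneous_factor g0 C0 by blast
      have "j = 3" using homogeneous_unique [OF d(2) hC C0] .
      then have n: "n = d + e + 3" using d(3) True by linarith
      then have "hom_part (n - 3) \<alpha> * C + \<gamma> * C * E = 0" using z g True by simp
      then have "(hom_part (n - 3) \<alpha> + \<gamma> * E) * C = 0" by (simp add: algebra_simps)
      then have "hom_part (n - 3) \<alpha> = - \<gamma> * E" using C0 by (simp add: add_eq_0_iff)
      then show ?thesis using d(1) n g by blast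
    qed
    then obtain \<gamma> d where g: "homogeneous d \<gamma>" "\<gamma> \<noteq> 0 \<Longrightarrow> n = d + e + 3" "e \<le> n \<Longrightarrow> hom_part (n - e) \<beta> = \<gamma> * C"
      "3 \<le> n \<Longrightarrow> hom_part (n - 3) \<alpha> = - \<gamma> * E" by blast
    define \<alpha>' \<beta>' where "\<alpha>' = \<alpha> + g * \<gamma>" and "\<beta>' = \<beta> - C * \<gamma>"
    have "f = \<alpha>' * C + \<beta>' * g" unfolding ab(1) \<alpha>'_def \<beta>'_def by (simp add: algebra_simps)
    moreover have "hom_part j \<alpha>' = 0" if j: "j + 3 < Suc n" for j
    proof (cases "\<gamma> = 0")
      case True
      show ?thesis using ab(2) [of j] g(4) j True unfolding \<alpha>'_def by (cases "j + 3 < n") (auto simp: less_Suc_eq)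
    next
      case False
      have n: "n = d + e + 3" by (rule g(2) [OF False])
      show ?thesis
      proof (cases "j + 3 < n")
        case True
        then have "hom_part j (g * \<gamma>) = 0" using n glow by (simp add: hom_part_mult [OF g(1)])
        then show ?thesis using ab(2) [OF True] by (simp add: \<alpha>'_def hom_part_add)
      next
        case False
        then have jn: "j = n - 3" using j by linarith
        have "hom_part j (g * \<gamma>) = E * \<gamma>" using n jn gE by (simp add: hom_part_mult [OF g(1)])
        moreover have "hom_part j \<alpha> = - \<gamma> * E" using g(4) n jn by simp
        ultimately show ?thesis by (simp add: \<alpha>'_def hom_part_add mult.commute)
      qed
    qed
    moreover have "hom_part j \<beta>' = 0" if j: "j + e < Suc n" for j
    proof (cases "\<gamma> = 0")
      case True
      show ?thesis using ab(3) [of j] g(3) j True unfolding \<beta>'_def by (cases "j + e < n") (auto simp: less_Suc_eq)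
    next
      case False
      have n: "n = d + e + 3" by (rule g(2) [OF False])
      have hm: "homogeneous (3 + d) (C * \<gamma>)" by (rule homogeneous_mult [OF hC g(1)])
      have sub: "hom_part j (\<beta> - C * \<gamma>) = hom_part j \<beta> - hom_part j (C * \<gamma>)"
        using hom_part_add [of j "\<beta> - C * \<gamma>" "C * \<gamma>"] by simp
      show ?thesis
      proof (cases "j + e < n")
        case True
        then have "hom_part j (C * \<gamma>) = 0" using n hom_part_homogeneous [OF hm, of j] by simp
        then show ?thesis using ab(3) [OF True] sub by (simp add: \<beta>'_def)
      next
        case False
        then have jn: "j = n - e" using j by linarith
        then have "hom_part j (C * \<gamma>) = C * \<gamma>" using n hom_part_homogeneous [OF hm, of j] by simp
        moreover have "hom_part j \<beta> = \<gamma> * C" using g(3) n jn by simp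
        ultimately show ?thesis using sub by (simp add: \<beta>'_def mult.commute)
      qed
    qed
    ultimately show ?case by blast
  qed
  then obtain \<alpha> \<beta> where ab: "f = \<alpha> * C + \<beta> * g" "\<And>j. j + 3 < ord \<Longrightarrow> hom_part j \<alpha> = 0" "\<And>j. j + e < ord \<Longrightarrow> hom_part j \<beta> = 0"
    by (metis order_refl)
  have "initial_form f = (if 3 \<le> ord then hom_part (ord - 3) \<alpha> else 0) * C + (if e \<le> ord then hom_part (ord - e) \<beta> else 0) * E"
    unfolding initial_form_def ord_def [symmetric]
  proof -
    have pr: "hom_part ord (\<beta> * g) = (if e \<le> ord then hom_part (ord - e) \<beta> * E else 0)" by (rule prod) (rule ab(3))
    have "hom_part ord f = hom_part ord (\<alpha> * C + \<beta> * g)" by (simp only: ab(1))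
    then show "hom_part ord f = (if 3 \<le> ord then hom_part (ord - 3) \<alpha> else 0) * C + (if e \<le> ord then hom_part (ord - e) \<beta> else 0) * E"
      by (simp add: hom_part_add hom_part_mult [OF hC] pr)
  qed
  then show ?thesis unfolding f_def by blast
qed

lemma polyfun_ex:
  assumes "polyfun f" shows "\<exists>P. \<forall>x. peval P x = f x"
  using assms unfolding polyfun_def by metis

section \<open>A cone and a second cubic through its vertex\<close>

text \<open>\<open>H\<close> is the cone with vertex \<open>x0\<close>, \<open>G\<close> another cubic of the pencil. In the coordinates \<open>(c, v)\<close> of the chart,
  \<open>H\<close> is a cubic form \<open>C(v)\<close> and \<open>G\<close> is \<open>c\<^sup>2 L(v) + c Q(v) + K(v)\<close>.\<close>

locale cone_chart =
  fixes H G :: "6 mpoly" and X :: "6 pspace set" and x0 :: "complex^6" and M :: "complex^5^6"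
    and l :: "complex^6" and R :: "complex^6^5"
  assumes hH: "homogeneous 3 H" and hG: "homogeneous 3 G" and XZ: "X = zeros {H, G}"
    and irrX: "zirreducible X" and dimX: "has_dim X 3"
    and IX: "vanishing_ideal X = {f. \<exists>\<alpha> \<beta>. f = \<alpha> * H + \<beta> * G}"
    and l_chart: "\<And>c v. (\<Sum>i\<in>UNIV. l $ i * (c *s x0 + M *v v) $ i) = c"
    and R_chart: "\<And>c v. R *v (c *s x0 + M *v v) = v"
    and chart_decomp: "\<And>x. x = (\<Sum>i\<in>UNIV. l $ i * x $ i) *s x0 + M *v (R *v x)"
    and cone: "\<And>c v. peval H (c *s x0 + M *v v) = peval H (M *v v)"
    and H0: "H \<noteq> 0" and Gx0: "peval G x0 = 0"
begin

definition emb :: "complex \<Rightarrow> complex^5 \<Rightarrow> complex^6" where "emb c v = c *s x0 + M *v v"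
definition lc :: "complex^6 \<Rightarrow> complex" where "lc x = (\<Sum>i\<in>UNIV. l $ i * x $ i)"

lemma lc_emb [simp]: "lc (emb c v) = c" and R_emb [simp]: "R *v emb c v = v"
  and emb_decomp: "emb (lc x) (R *v x) = x"
  unfolding lc_def emb_def using l_chart R_chart chart_decomp by simp_all

lemma emb_scale: "a *s emb c v = emb (a * c) (a *s v)"
  by (simp add: emb_def vector_add_ldistrib vector_smult_assoc vector_scalar_commute)

lemma emb_add: "emb c v + emb d w = emb (c + d) (v + w)"
  by (simp add: emb_def vector_sadd_rdistrib matrix_vector_right_distrib)

lemma emb_00 [simp]: "emb 0 0 = 0" by (simp add: emb_def)

lemma emb_inj: "emb c v = emb d w \<longleftrightarrow> c = d \<and> v = w"
  using lc_emb R_emb by metis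

lemma emb_eq_0 [simp]: "emb c v = 0 \<longleftrightarrow> c = 0 \<and> v = 0"
  using emb_inj [of c v 0 0] by simp

lemma polyfun_emb: "polyfun (\<lambda>v. peval P (emb c v))"
  unfolding emb_def by (rule polyfun_affine)

definition C :: "5 mpoly" where "C = (SOME P. \<forall>v. peval P v = peval H (emb 0 v))"

lemma peval_C: "peval C v = peval H (emb 0 v)"
  unfolding C_def using someI_ex [OF polyfun_ex [OF polyfun_emb]] by blast

lemma H_emb: "peval H (emb c v) = peval C v"
  using cone [of c v] by (simp add: peval_C emb_def)

definition lift :: "5 mpoly \<Rightarrow> 6 mpoly" where "lift P = (SOME P'. \<forall>x. peval P' x = peval P (R *v x))"

lemma peval_lift [simp]: "peval (lift P) x = peval P (R *v x)"
  unfolding lift_def using someI_ex [OF polyfun_ex [OF polyfun_comp [OF polyfun_linear]]] by blast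

lemma lift_hom: "homogeneous d P \<Longrightarrow> homogeneous d (lift P)"
  by (rule homogeneousI) (simp add: vector_scalar_commute peval_homogeneous)

lemma lift_eq_0: "lift P = 0 \<Longrightarrow> P = 0"
  by (rule peval_inj_0) (metis R_emb peval_0 peval_lift)

lemma peval_H: "peval H x = peval C (R *v x)"
  by (metis H_emb emb_decomp)

lemma hC: "homogeneous 3 C"
proof (rule homogeneousI)
  fix c :: complex and x
  show "peval C (c *s x) = c ^ 3 * peval C x"
    using peval_homogeneous [OF hH, of c "emb 0 x"] by (simp add: peval_C emb_scale)
qed

lemma C0: "C \<noteq> 0"
proof
  assume "C = 0"
  then have "peval H x = 0" for x by (simp add: peval_H)
  then show False using H0 peval_inj_0 by blast
qed

text \<open>The ideal of \<open>X\<close> is generated in degree three. Together with its primality this gives the irreducibility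
  statements below.\<close>

lemma low_degree:
  assumes P: "P \<in> vanishing_ideal X" "homogeneous d P" and d: "d < 3" shows "P = 0"
proof -
  obtain \<alpha> \<beta> where "P = \<alpha> * H + \<beta> * G" using P(1) unfolding IX by blast
  then have "hom_part d P = 0" using d by (simp add: hom_part_add hom_part_mult [OF hH] hom_part_mult [OF hG])
  then show ?thesis using hom_part_homogeneous [OF P(2), of d] by simp
qed

lemma lift_low:
  assumes "lift P \<in> vanishing_ideal X" "homogeneous d P" "d < 3" shows "P = 0"
  using low_degree [OF assms(1) lift_hom [OF assms(2)] assms(3)] lift_eq_0 by blast

lemma H_in: "H \<in> vanishing_ideal X" and G_in: "G \<in> vanishing_ideal X"
  unfolding IX by (intro CollectI exI [of _ 1] exI [of _ 0], simp) (intro CollectI exI [of _ 0] exI [of _ 1], simp)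

lemma const_dvd_1:
  fixes A :: "5 mpoly"
  assumes "homogeneous 0 A" "A \<noteq> 0" shows "A dvd 1"
proof -
  obtain c where c: "A = Poly_Mapping.single 0 c" using homogeneous_degree_0 [OF assms(1)] by blast
  then have "c \<noteq> 0" using assms(2) by auto
  then have "A * Poly_Mapping.single 0 (1 / c) = 1" by (simp add: c Poly_Mapping.mult_single)
  then show ?thesis by (metis dvd_triv_left)
qed

lemma irreducible_C: "irreducible C"
proof (rule irreducibleI)
  show "C \<noteq> 0" by (rule C0)
  show "\<not> C dvd 1"
  proof
    assume "C dvd 1"
    then obtain B where "1 = C * B" unfolding dvd_def by blast
    then have "peval C 0 * peval B 0 = 1" by (metis peval_1 peval_mult)
    then show False using homogeneous_nonzero_at_0 [OF hC] by simp
  qed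
  fix A B assume AB: "C = A * B"
  then have nz: "A \<noteq> 0" "B \<noteq> 0" using C0 by auto
  obtain i j where ij: "homogeneous i A" "homogeneous j B" "i + j = 3"
    using homogeneous_factor [of 3 A B] hC AB nz by metis
  have "lift A * lift B = H" by (rule peval_inj) (simp add: peval_H AB)
  then have "lift A * lift B \<in> vanishing_ideal X" using H_in by simp
  then have "lift A \<in> vanishing_ideal X \<or> lift B \<in> vanishing_ideal X"
    using irreducible_prime [OF irrX lift_hom [OF ij(1)] lift_hom [OF ij(2)]] by blast
  then have "\<not> i < 3 \<or> \<not> j < 3" using lift_low nz ij by blast
  then have "i = 0 \<or> j = 0" using ij(3) by linarith
  then show "A dvd 1 \<or> B dvd 1" using const_dvd_1 ij nz by blast
qed

lemma prime_C: "prime_elem C"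
  by (rule irreducible_imp_prime_mpoly [OF irreducible_C])

lemma C_not_dvd_low:
  assumes "homogeneous d P" "P \<noteq> 0" "d < 3" shows "\<not> C dvd P"
proof
  assume "C dvd P"
  then obtain B where B: "P = C * B" unfolding dvd_def by blast
  then have "B \<noteq> 0" using assms by auto
  then obtain i j where "homogeneous i C" "i + j = d" using homogeneous_factor [of d C B] assms B C0 by metis
  then show False using homogeneous_unique [OF _ hC C0] assms(3) by fastforce
qed

subsection \<open>The second cubic\<close>

definition coef :: "nat \<Rightarrow> 5 mpoly" where
  "coef k = (SOME P. \<forall>v. peval P v = peval (coeff (shiftp x0 G) k) (emb 0 v))"
definition "L = coef 2"
definition "Q = coef 1"
definition "K = coef 0"

lemma peval_coef: "peval (coef k) v = peval (coeff (shiftp x0 G) k) (emb 0 v)"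
  unfolding coef_def using someI_ex [OF polyfun_ex [OF polyfun_emb]] by blast

lemma coef_hom: "k \<le> 3 \<Longrightarrow> homogeneous (3 - k) (coef k)"
proof (rule homogeneousI)
  fix c :: complex and x assume "k \<le> 3"
  then show "peval (coef k) (c *s x) = c ^ (3 - k) * peval (coef k) x"
    using peval_homogeneous [OF homogeneous_coeff_shiftp [OF hG, of k x0], of c "emb 0 x"]
    by (simp add: peval_coef emb_scale)
qed

lemma hL: "homogeneous 1 L" and hQ: "homogeneous 2 Q" and hK: "homogeneous 3 K"
  using coef_hom [of 2] coef_hom [of 1] coef_hom [of 0] by (simp_all add: L_def Q_def K_def)

lemma G_emb: "peval G (emb c v) = c ^ 2 * peval L v + c * peval Q v + peval K v"
proof -
  obtain p where p: "\<And>t. poly p t = peval G (emb 0 v + t *s x0)" "degree p \<le> 3" "coeff p 3 = peval G x0"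
    by (rule line_poly [OF hG, where x = "emb 0 v" and e = x0]) blast
  have "p = pev (shiftp x0 G) (emb 0 v)" by (simp add: poly_eq_poly_eq_iff [symmetric] fun_eq_iff p(1))
  then have co: "coeff p k = peval (coef k) v" for k by (simp add: peval_coef)
  have "emb c v = emb 0 v + c *s x0" by (simp add: emb_def add.commute)
  then have "peval G (emb c v) = poly p c" by (simp add: p(1))
  also have "\<dots> = c ^ 2 * peval L v + c * peval Q v + peval K v"
  proof -
    have "coeff p 3 = 0" using p(3) Gx0 by simp
    then show ?thesis unfolding poly_3 [OF p(2)] L_def Q_def K_def using co [of 0] co [of 1] co [of 2] by simp
  qed
  finally show ?thesis .
qed

lemma G_lift:
  assumes "L = 0" "Q = 0" shows "G = lift K"
  by (rule peval_inj) (metis G_emb assms emb_decomp peval_lift peval_0 mult_zero_right add_0)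

lemma K_not_dvd: "L = 0 \<Longrightarrow> Q = 0 \<Longrightarrow> \<not> C dvd K"
proof
  assume 0: "L = 0" "Q = 0" and "C dvd K"
  then obtain B where B: "K = C * B" unfolding dvd_def by blast
  have G: "G = lift B * H"
  proof (rule peval_inj)
    fix x
    have "peval G x = peval K (R *v x)" by (subst G_lift [OF 0]) simp
    then show "peval G x = peval (lift B * H) x" by (simp add: B peval_H)
  qed
  have "vanishing_ideal X = {P. \<exists>\<alpha>. P = \<alpha> * H}"
  proof -
    have "\<alpha> * H + \<beta> * G = (\<alpha> + \<beta> * lift B) * H" for \<alpha> \<beta> by (simp add: G algebra_simps)
    moreover have "\<alpha> * H = \<alpha> * H + 0 * G" for \<alpha> by simp
    ultimately show ?thesis unfolding IX by blast
  qed
  then show False using hilbert_hypersurface6 [OF hH H0] dimX by blast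
qed

text \<open>Otherwise \<open>G\<close> would be, modulo \<open>H\<close>, the product of \<open>L\<close> with a quadratic form, and one of these two would
  belong to the prime ideal of \<open>X\<close>.\<close>

lemma irreducible_residual:
  assumes L0: "L \<noteq> 0" and Q: "Q = L * N" and K: "K = L * \<beta> + C * \<alpha>"
  shows False
proof -
  define n where "n = hom_part 1 N"
  define b where "b = hom_part 2 \<beta>"
  define a where "a = hom_part 0 \<alpha>"
  have Qn: "Q = L * n"
    using arg_cong [OF Q, of "hom_part 2"] hom_part_mult [OF hL, of 2 N]
    by (simp add: hom_part_homogeneous [OF hQ] n_def mult.commute)
  have Kn: "K = L * b + C * a"
    using arg_cong [OF K, of "hom_part 3"] hom_part_mult [OF hL, of 3 \<beta>] hom_part_mult [OF hC, of 3 \<alpha>]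
    by (simp add: hom_part_homogeneous [OF hK] hom_part_add b_def a_def mult.commute)
  have hn: "homogeneous 1 n" "homogeneous 2 b" by (simp_all add: n_def b_def)
  obtain S :: "6 mpoly" where S: "\<And>x. peval S x = lc x ^ 2 + lc x * peval n (R *v x) + peval b (R *v x)"
  proof -
    have "polyfun (\<lambda>x. lc x ^ 2 + lc x * peval (lift n) x + peval (lift b) x)"
      unfolding lc_def by (intro polyfun_add polyfun_mult polyfun_power polyfun_sum polyfun_peval polyfun_const polyfun_coord)
    from polyfun_ex [OF this] obtain S where "\<forall>x. peval S x = lc x ^ 2 + lc x * peval (lift n) x + peval (lift b) x" by blast
    then show ?thesis by (intro that [of S]) simp
  qed
  have lcs: "lc (c *s x) = c * lc x" for c x by (simp add: lc_def sum_distrib_left mult_ac)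
  have hS: "homogeneous 2 S"
    by (rule homogeneousI)
      (simp add: S lcs vector_scalar_commute peval_homogeneous [OF hn(1)] peval_homogeneous [OF hn(2)] algebra_simps power2_eq_square)
  have "lift L * S = - lift a * H + 1 * G"
  proof (rule peval_inj)
    fix x
    have "peval G x = peval G (emb (lc x) (R *v x))" "peval H x = peval H (emb (lc x) (R *v x))" by (simp_all add: emb_decomp)
    then show "peval (lift L * S) x = peval (- lift a * H + 1 * G) x"
      by (simp add: S G_emb H_emb Qn Kn algebra_simps)
  qed
  then have "lift L * S \<in> vanishing_ideal X" unfolding IX by blast
  then have "lift L \<in> vanishing_ideal X \<or> S \<in> vanishing_ideal X" by (rule irreducible_prime [OF irrX lift_hom [OF hL] hS])
  then have "S = 0" using lift_low [OF _ hL] low_degree [OF _ hS] L0 by auto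
  then have "peval S (emb 1 0) = 0" by simp
  then show False unfolding S lc_emb R_emb using hn by (simp add: homogeneous_nonzero_at_0)
qed

subsection \<open>The tangent cone\<close>

definition "g = L + Q + K"

lemma hom_part_g: "hom_part k g = (if k = 1 then L else if k = 2 then Q else if k = 3 then K else 0)"
  by (auto simp: g_def hom_part_add hom_part_homogeneous [OF hL] hom_part_homogeneous [OF hQ] hom_part_homogeneous [OF hK])

lemma initial_formI:
  fixes f :: "5 mpoly"
  assumes "hom_part e f = E" "E \<noteq> 0" "\<And>k. k < e \<Longrightarrow> hom_part k f = 0"
  shows "initial_form f = E"
proof -
  have "order_at_0 f = e" unfolding order_at_0_def using assms by (intro Least_equality) (auto simp: not_less [symmetric])
  then show ?thesis using assms by (simp add: initial_form_def)
qed

lemma lowest_form: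
  obtains e E where "0 < e" "homogeneous e E" "\<not> C dvd E" "hom_part e g = E" "\<And>k. k < e \<Longrightarrow> hom_part k g = 0"
    "e = 1 \<Longrightarrow> E = L"
proof (cases "L = 0")
  case False
  show ?thesis by (rule that [of 1 L]) (use C_not_dvd_low [OF hL False] hL hom_part_g in auto)
next
  case L: True
  show ?thesis
  proof (cases "Q = 0")
    case False
    show ?thesis by (rule that [of 2 Q]) (use C_not_dvd_low [OF hQ False] hQ hom_part_g L in auto)
  next
    case True
    show ?thesis by (rule that [of 3 K]) (use K_not_dvd [OF L True] hK hom_part_g L True in auto)
  qed
qed

text \<open>The dehomogenised generators are \<open>C\<close> and \<open>g = L + Q + K\<close>, so the tangent cone is cut out by \<open>C\<close> and the
  lowest form of \<open>g\<close>.\<close>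

lemma tangent_cone_eq:
  assumes e: "homogeneous e E" "\<not> C dvd E" "hom_part e g = E" "\<And>k. k < e \<Longrightarrow> hom_part k g = 0"
  shows "tangent_cone_ideal x0 M X = {f. \<exists>\<alpha> \<beta>. f = \<alpha> * C + \<beta> * E}"
proof -
  let ?A = "{initial_form f | f. \<exists>P\<in>vanishing_ideal X. local_equation x0 M P f}"
  let ?J = "{f. \<exists>\<alpha> \<beta>. f = \<alpha> * C + \<beta> * E}"
  have loc: "local_equation x0 M P f \<longleftrightarrow> (\<forall>v. peval f v = peval P (emb 1 v))" for P f
    by (simp add: local_equation_def emb_def)
  have A: "?A \<subseteq> ?J"
  proof
    fix f assume "f \<in> ?A"
    then obtain h P where h: "f = initial_form h" "P \<in> vanishing_ideal X" "local_equation x0 M P h" by blast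
    then obtain \<alpha> \<beta> where P: "P = \<alpha> * H + \<beta> * G" unfolding IX by blast
    obtain \<alpha>' where a: "\<And>v. peval \<alpha>' v = peval \<alpha> (emb 1 v)" using polyfun_ex [OF polyfun_emb] by metis
    obtain \<beta>' where b: "\<And>v. peval \<beta>' v = peval \<beta> (emb 1 v)" using polyfun_ex [OF polyfun_emb] by metis
    have "h = \<alpha>' * C + \<beta>' * g"
      by (rule peval_inj) (use h(3) in \<open>simp add: loc P a b H_emb G_emb g_def\<close>)
    then show "f \<in> ?J" using initial_form_in_ideal [OF prime_C hC e(2,3,4), of \<alpha>' \<beta>'] h(1) by blast
  qed
  have J0: "0 \<in> ?J" by (intro CollectI exI [of _ 0]) simp
  have Jadd: "x + y \<in> ?J" if xy: "x \<in> ?J" "y \<in> ?J" for x y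
  proof -
    obtain a b a' b' where "x = a * C + b * E" "y = a' * C + b' * E" using xy by blast
    then have "x + y = (a + a') * C + (b + b') * E" by (simp add: algebra_simps)
    then show ?thesis by blast
  qed
  have Jmul: "c * x \<in> ?J" if x: "x \<in> ?J" for c x
  proof -
    obtain a b where "x = a * C + b * E" using x by blast
    then have "c * x = (c * a) * C + (c * b) * E" by (simp add: algebra_simps)
    then show ?thesis by blast
  qed
  have "ideal_of ?A \<subseteq> ?J"
  proof
    fix f assume "f \<in> ideal_of ?A"
    then obtain T c where T: "finite T" "T \<subseteq> ?A" and f: "f = (\<Sum>a\<in>T. c a * a)" unfolding ideal_of_def by blast
    have "(\<Sum>a\<in>T. c a * a) \<in> ?J" using T(1) T(2)
    proof (induction T)
      case empty
      show ?case unfolding sum.empty by (rule J0)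
    next
      case (insert a T)
      have a: "a \<in> ?J" by (rule subsetD [OF A]) (rule subsetD [OF insert.prems insertI1])
      have "(\<Sum>a\<in>T. c a * a) \<in> ?J" by (rule insert.IH) (rule subset_trans [OF subset_insertI insert.prems])
      then show ?case unfolding sum.insert [OF insert.hyps] by (rule Jadd [OF Jmul [OF a]])
    qed
    then show "f \<in> ?J" by (simp only: f)
  qed
  moreover have "?J \<subseteq> ideal_of ?A"
  proof
    fix f assume "f \<in> ?J"
    then obtain \<alpha> \<beta> where f: "f = \<alpha> * C + \<beta> * E" by blast
    have CE: "C \<noteq> E" "E \<noteq> 0" using e(2) by auto
    have "initial_form C = C" by (rule initial_formI [of 3]) (use hom_part_homogeneous [OF hC] C0 in auto)
    then have CA: "C \<in> ?A" using H_in by (intro CollectI exI [of _ C] conjI bexI [of _ H]) (simp_all add: loc H_emb)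
    have "initial_form g = E" by (rule initial_formI [of e]) (use e CE in auto)
    then have EA: "E \<in> ?A" using G_in by (intro CollectI exI [of _ g] conjI bexI [of _ G]) (simp_all add: loc G_emb g_def)
    have "f = (\<Sum>a\<in>{C, E}. (if a = C then \<alpha> else \<beta>) * a)" using CE by (simp add: f)
    then show "f \<in> ideal_of ?A" unfolding ideal_of_def using CA EA
      by (intro CollectI exI [of _ "{C, E}"] exI [of _ "\<lambda>a. if a = C then \<alpha> else \<beta>"]) simp
  qed
  ultimately show ?thesis unfolding tangent_cone_ideal_def by (rule subset_antisym)
qed

end

section \<open>Limits and nearby points of the branch surface\<close>

lemma tendsto_smult_vec [tendsto_intros]:
  fixes g :: "'b \<Rightarrow> complex^'n"
  assumes "(f \<longlongrightarrow> a) F" "(g \<longlongrightarrow> x) F" shows "((\<lambda>n. f n *s g n) \<longlongrightarrow> a *s x) F"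
proof (rule vec_tendstoI)
  fix i
  show "((\<lambda>n. (f n *s g n) $ i) \<longlongrightarrow> (a *s x) $ i) F"
    unfolding vector_smult_component by (intro tendsto_mult assms tendsto_vec_nth)
qed

lemma tendsto_matrix_mult [tendsto_intros]:
  fixes g :: "'b \<Rightarrow> complex^'n" and A :: "complex^'n^'m"
  assumes "(g \<longlongrightarrow> x) F" shows "((\<lambda>n. A *v g n) \<longlongrightarrow> A *v x) F"
proof (rule vec_tendstoI)
  fix i
  show "((\<lambda>n. (A *v g n) $ i) \<longlongrightarrow> (A *v x) $ i) F"
    unfolding matrix_vector_mult_def vec_lambda_beta by (intro tendsto_sum tendsto_mult tendsto_const assms tendsto_vec_nth)
qed

lemma peval_limit_zero:
  assumes "f \<longlonglongrightarrow> a" "\<And>n. peval P (f n) = 0" shows "peval P a = 0"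
proof -
  have "(\<lambda>n. peval P (f n)) \<longlonglongrightarrow> peval P a" by (rule tendsto_peval [OF assms(1)])
  then show ?thesis using assms(2) by (simp add: LIMSEQ_const_iff)
qed

text \<open>A Zariski closed set is closed in the usual topology; a sequence of singular points cannot converge to
  an isolated one.\<close>

lemma isolated_no_accumulation:
  assumes iso: "isolated_singularity Z (pt x)" and x: "x \<noteq> 0" "xs \<longlonglongrightarrow> x"
    and sing: "\<And>n. xs n \<noteq> 0" "\<And>n. pt (xs n) \<in> singular_points Z"
  shows "\<exists>n. pt (xs n) = pt x"
proof (rule ccontr)
  assume neq: "\<nexists>n. pt (xs n) = pt x"
  obtain A where A: "zclosed A" "pt x \<notin> A" "singular_points Z \<subseteq> insert (pt x) A"
    using iso unfolding isolated_singularity_def by blast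
  obtain P d where P: "homogeneous d P" "P \<in> vanishing_ideal A" "\<exists>x'\<in>hcoords (pt x). peval P x' \<noteq> 0"
    using zclosed_separate [OF A(1,2)] by metis
  have "peval P (xs n) = 0" for n
  proof -
    have "pt (xs n) \<in> A" using A(3) sing(2) [of n] neq by blast
    then show ?thesis using vanishing_idealD [OF P(2)] pt_in_hcoords [OF sing(1)] by blast
  qed
  then have "peval P x = 0" by (rule peval_limit_zero [OF x(2)])
  then show False using P(3) vanish_hcoords [OF P(1) x(1)] by blast
qed

text \<open>A cone over the common zeros with vertex \<open>y\<close> lies in a hypersurface \<open>r = 0\<close>; directions outside it lead away
  from the common zeros.\<close>

lemma avoid_direction:
  fixes f h :: "5 mpoly"
  assumes f: "prime_elem f" "homogeneous d f" and h: "homogeneous e h" and fh: "\<not> f dvd h"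
  shows "\<exists>r::5 mpoly. r \<noteq> 0 \<and> (\<forall>b t. peval r b \<noteq> 0 \<longrightarrow> peval f (y + t *s b) = 0 \<longrightarrow> peval h (y + t *s b) = 0 \<longrightarrow> t = 0)"
proof -
  have "\<And>\<sigma>. prime_elem \<sigma> \<Longrightarrow> \<sigma> dvd f \<Longrightarrow> \<not> \<sigma> dvd h" by (rule prime_mpoly_coprime [OF f(1) fh])
  moreover have "f \<noteq> 0" using f(1) by (simp add: prime_elem_def)
  ultimately obtain r :: "5 mpoly" where r: "r \<noteq> 0"
    "\<And>x t. peval f (x + t *s y) = 0 \<Longrightarrow> peval h (x + t *s y) = 0 \<Longrightarrow> peval r x = 0"
    using elimination [of f h y] by metis
  have "t = 0" if b: "peval r b \<noteq> 0" and z: "peval f (y + t *s b) = 0" "peval h (y + t *s b) = 0" for b t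
  proof (rule ccontr)
    assume t: "t \<noteq> 0"
    have eq: "b + (1 / t) *s y = (1 / t) *s (y + t *s b)" using t by (simp add: vector_add_ldistrib vector_smult_assoc add.commute)
    have "peval f (b + (1 / t) *s y) = 0" "peval h (b + (1 / t) *s y) = 0"
      unfolding eq using z by (simp_all only: peval_homogeneous [OF f(2)] peval_homogeneous [OF h] mult_zero_right)
    then show False using r(2) b by blast
  qed
  then show ?thesis using r(1) by blast
qed

text \<open>The equations \<open>C = D = 0\<close> can be solved near a solution \<open>y1\<close> after moving the other coordinates: move along
  \<open>c\<close> to a zero of the norm and then along \<open>b\<close>. Both displacements are small, the first because a form with a small
  value has a small root on the line, the second because otherwise the points would accumulate at a second
  solution on the line through \<open>y1\<close>, or at \<open>b\<close> itself.\<close>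

lemma (in cubic_norm) nearby_zero:
  assumes y1: "peval C y1 = 0" "peval D y1 = 0"
    and line: "\<And>t. peval C (y1 + t *s b) = 0 \<Longrightarrow> peval D (y1 + t *s b) = 0 \<Longrightarrow> t = 0"
    and c: "peval N c \<noteq> 0" and eps: "0 < \<epsilon>"
  shows "\<exists>\<delta>>0. \<forall>x. dist x y1 < \<delta> \<longrightarrow> (\<exists>w t. peval C (x + w *s c + t *s b) = 0 \<and> peval D (x + w *s c + t *s b) = 0
    \<and> dist (x + w *s c + t *s b) y1 < \<epsilon>)"
proof (rule ccontr)
  assume neg: "\<not> ?thesis"
  have "\<exists>x. dist x y1 < inverse (real (Suc n)) \<and> (\<forall>w t. peval C (x + w *s c + t *s b) = 0 \<longrightarrow> peval D (x + w *s c + t *s b) = 0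
    \<longrightarrow> \<epsilon> \<le> dist (x + w *s c + t *s b) y1)" for n
  proof -
    have "0 < inverse (real (Suc n))" by simp
    then show ?thesis using neg by (meson not_le)
  qed
  then obtain x where x: "\<And>n. dist (x n) y1 < inverse (real (Suc n))"
    "\<And>n w t. peval C (x n + w *s c + t *s b) = 0 \<Longrightarrow> peval D (x n + w *s c + t *s b) = 0 \<Longrightarrow> \<epsilon> \<le> dist (x n + w *s c + t *s b) y1"
    by metis
  have "(\<lambda>n. dist (x n) y1) \<longlonglongrightarrow> 0"
  proof (rule real_tendsto_sandwich [OF _ _ tendsto_const LIMSEQ_inverse_real_of_nat])
    show "eventually (\<lambda>n. dist (x n) y1 \<le> inverse (real (Suc n))) sequentially"
      by (intro eventuallyI less_imp_le) (rule x(1))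
  qed simp
  then have xlim: "x \<longlonglongrightarrow> y1" using tendsto_dist_iff by blast
  have "\<exists>w. peval N (x n + w *s c) = 0 \<and> norm w ^ 12 * norm (peval N c) \<le> norm (peval N (x n))" for n
    using line_root [OF hN _ c] by (metis zero_less_numeral)
  then obtain w where w: "\<And>n. peval N (x n + w n *s c) = 0" "\<And>n. norm (w n) ^ 12 * norm (peval N c) \<le> norm (peval N (x n))" by metis
  have "peval N y1 = 0" unfolding N_zero_iff using y1 by (intro exI [of _ 0]) simp
  then have Nlim: "(\<lambda>n. norm (peval N (x n)) / norm (peval N c)) \<longlonglongrightarrow> 0"
    using tendsto_divide [OF tendsto_norm [OF tendsto_peval [OF xlim, of N]] tendsto_const [of "norm (peval N c)"]] c by simp
  have "(\<lambda>n. norm (w n) ^ 12) \<longlonglongrightarrow> 0"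
    by (rule real_tendsto_sandwich [OF _ _ tendsto_const Nlim]) (use w(2) c in \<open>auto simp: field_simps\<close>)
  from tendsto_real_root [OF this, of 12] have "(\<lambda>n. norm (w n)) \<longlonglongrightarrow> 0" by (simp add: real_root_power_cancel)
  then have wlim: "w \<longlonglongrightarrow> 0" by (rule tendsto_norm_zero_cancel)
  define z where "z n = x n + w n *s c" for n
  have "z \<longlonglongrightarrow> y1 + 0 *s c" unfolding z_def by (intro tendsto_intros xlim wlim)
  then have zlim: "z \<longlonglongrightarrow> y1" by simp
  have "\<exists>t. peval C (z n + t *s b) = 0 \<and> peval D (z n + t *s b) = 0" for n
    using w(1) unfolding z_def N_zero_iff .
  then obtain t where t: "\<And>n. peval C (z n + t n *s b) = 0" "\<And>n. peval D (z n + t n *s b) = 0" by metis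
  have far: "\<epsilon> \<le> dist (z n + t n *s b) y1" for n using x(2) t unfolding z_def by blast
  have "\<not> t \<longlonglongrightarrow> 0"
  proof
    assume tl: "t \<longlonglongrightarrow> 0"
    have "(\<lambda>n. z n + t n *s b) \<longlonglongrightarrow> y1 + 0 *s b" by (intro tendsto_intros zlim tl)
    then have "eventually (\<lambda>n. dist (z n + t n *s b) y1 < \<epsilon>) sequentially" using tendstoD [OF _ eps] by fastforce
    then obtain n where "dist (z n + t n *s b) y1 < \<epsilon>" by (meson eventually_happens sequentially_bot)
    then show False using far [of n] by linarith
  qed
  then obtain \<eta> where eta: "0 < \<eta>" "\<And>n0. \<exists>n\<ge>n0. \<eta> \<le> norm (t n)" unfolding LIMSEQ_iff by (simp add: not_less) blast
  have "infinite {n. \<eta> \<le> norm (t n)}" unfolding infinite_nat_iff_unbounded_le using eta(2) by auto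
  from infinite_enumerate [OF this] obtain r :: "nat \<Rightarrow> nat" where r0: "strict_mono r" "\<forall>n. r n \<in> {n. \<eta> \<le> norm (t n)}" by blast
  have r: "strict_mono r" "\<And>n. \<eta> \<le> norm (t (r n))" using r0 by auto
  have t0: "t (r n) \<noteq> 0" for n using r(2) [of n] eta(1) by auto
  define u where "u n = 1 / t (r n)" for n
  have "bounded (range u)"
    unfolding bounded_iff by (rule exI [of _ "1 / \<eta>"]) (use r(2) eta(1) in \<open>auto simp: u_def norm_divide intro!: divide_left_mono mult_pos_pos dest: less_le_trans\<close>)
  then obtain s u0 where s: "strict_mono s" "(u \<circ> s) \<longlonglongrightarrow> u0" using bounded_imp_convergent_subsequence by blast
  have zl: "(z \<circ> (r \<circ> s)) \<longlonglongrightarrow> y1" by (rule LIMSEQ_subseq_LIMSEQ [OF zlim]) (use r(1) s(1) in \<open>simp add: strict_mono_def\<close>)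
  have lim: "(\<lambda>n. (u \<circ> s) n *s (z \<circ> (r \<circ> s)) n + b) \<longlonglongrightarrow> u0 *s y1 + b" by (intro tendsto_intros s zl)
  have eq: "(u \<circ> s) n *s (z \<circ> (r \<circ> s)) n + b = u (s n) *s (z (r (s n)) + t (r (s n)) *s b)" for n
    using t0 [of "s n"] by (simp add: u_def vector_add_ldistrib vector_smult_assoc)
  have C0: "peval C (u0 *s y1 + b) = 0"
    by (rule peval_limit_zero [OF lim]) (unfold eq peval_homogeneous [OF hC], simp add: t)
  have D0: "peval D (u0 *s y1 + b) = 0"
    by (rule peval_limit_zero [OF lim]) (unfold eq peval_homogeneous [OF hD], simp add: t)
  show False
  proof (cases "u0 = 0")
    case True then show False using C0 b1 by simp
  next
    case False
    have eq': "u0 *s y1 + b = u0 *s (y1 + (1 / u0) *s b)" using False by (simp add: vector_add_ldistrib vector_smult_assoc)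
    have "peval C (y1 + (1 / u0) *s b) = 0" "peval D (y1 + (1 / u0) *s b) = 0"
      using C0 D0 False unfolding eq' peval_homogeneous [OF hC] peval_homogeneous [OF hD] by simp_all
    then show False using line [of "1 / u0"] False by simp
  qed
qed

subsection \<open>Linear forms\<close>

lemma peval_mpoly_numeral [simp]: "peval (numeral k :: ('n::finite) mpoly) x = numeral k"
proof -
  have "peval (of_nat n :: 'n mpoly) x = of_nat n" for n by (induction n) auto
  from this [of "numeral k"] show ?thesis by simp
qed

lemma dP_numeral [simp]: "dP (numeral k) y v = 0"
  by (rule dP_unique) simp

lemma linear_form:
  fixes P :: "('n::finite) mpoly"
  assumes "homogeneous 1 P" shows "\<exists>w. \<forall>x. peval P x = (\<Sum>i\<in>UNIV. w $ i * x $ i)"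
proof -
  obtain r where r: "\<And>i. homogeneous 0 (r i)" "\<And>x. peval P x = (\<Sum>i\<in>UNIV. x $ i * peval (r i) x)"
    using homogeneous_split_coords [of 0 P] assms by auto
  have "\<exists>c. r i = Poly_Mapping.single 0 c" for i by (rule homogeneous_degree_0 [OF r(1)])
  then obtain c where c: "\<And>i. r i = Poly_Mapping.single 0 (c i)" by metis
  show ?thesis by (rule exI [of _ "\<chi> i. c i"]) (simp add: r(2) c mult.commute)
qed

lemma linear_form_add:
  assumes "homogeneous 1 P" shows "peval P (x + y) = peval P x + peval P y"
proof -
  obtain w where "\<And>x. peval P x = (\<Sum>i\<in>UNIV. w $ i * x $ i)" using linear_form [OF assms] by blast
  then show ?thesis by (simp add: sum.distrib algebra_simps)
qed

lemma linear_form_scale: "homogeneous 1 P \<Longrightarrow> peval P (c *s x) = c * peval P x"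
  by (simp add: peval_homogeneous)

lemma dP_linear_form:
  assumes "homogeneous 1 P" shows "dP P x v = peval P v"
proof (rule dP_unique)
  have "(\<lambda>t. peval P (x + t *s v)) = (\<lambda>t. peval P x + t * peval P v)"
    by (simp add: linear_form_add [OF assms] linear_form_scale [OF assms])
  then show "((\<lambda>t. peval P (x + t *s v)) has_field_derivative peval P v) (at 0)"
    by (auto intro!: derivative_eq_intros)
qed

lemma dim_kernel_Int:
  fixes V :: "(complex^'n) set"
  assumes lin: "\<And>u v c. \<phi> (u + c *s v) = \<phi> u + c * \<phi> v" and V: "vec.subspace V"
  shows "vec.dim V \<le> Suc (vec.dim {v\<in>V. \<phi> v = 0})"
proof (cases "\<forall>v\<in>V. \<phi> v = (0::complex)")
  case True
  then have "{v\<in>V. \<phi> v = 0} = V" by blast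
  then show ?thesis by simp
next
  case False
  then obtain a where a: "a \<in> V" "\<phi> a \<noteq> 0" by blast
  let ?K = "{v\<in>V. \<phi> v = 0}"
  obtain B where B: "B \<subseteq> ?K" "vec.independent B" "?K \<subseteq> vec.span B" "card B = vec.dim ?K"
    by (rule vec.basis_exists [of ?K])
  have finB: "finite B" using B(2) vec.finiteI_independent by blast
  have "V \<subseteq> vec.span (insert a B)"
  proof
    fix v assume v: "v \<in> V"
    have "\<phi> (v + (- \<phi> v / \<phi> a) *s a) = 0" unfolding lin using a(2) by simp
    moreover have "v + (- \<phi> v / \<phi> a) *s a \<in> V"
      by (intro vec.subspace_add [OF V] vec.subspace_scale [OF V] v a(1))
    ultimately have "v + (- \<phi> v / \<phi> a) *s a \<in> vec.span B" using B(3) by blast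
    then have 1: "v + (- \<phi> v / \<phi> a) *s a \<in> vec.span (insert a B)"
      by (rule subsetD [OF vec.span_mono [OF subset_insertI]])
    have "(\<phi> v / \<phi> a) *s a \<in> vec.span (insert a B)" by (intro vec.span_scale vec.span_base) simp
    from vec.span_add [OF 1 this] show "v \<in> vec.span (insert a B)" by (simp add: add.assoc flip: vec.scale_left_distrib)
  qed
  then have "vec.dim V \<le> card (insert a B)" by (rule vec.dim_le_card) (use finB in simp)
  then show ?thesis using card_insert_le_m1 [of "Suc (card B)" B a] B(4) by simp
qed

lemma two_forms_kernel:
  fixes A L :: "5 mpoly"
  assumes A: "homogeneous 1 A" and L: "homogeneous 1 L"
  obtains u1 u2 where "\<And>t. u1 + t *s u2 \<noteq> 0" "u2 \<noteq> 0" "\<And>t. peval A (u1 + t *s u2) = 0" "peval A u2 = 0"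
    "\<And>t. peval L (u1 + t *s u2) = 0" "peval L u2 = 0"
proof -
  let ?V = "{v. peval A v = 0}" and ?K = "{v\<in>{v. peval A v = 0}. peval L v = 0}"
  have lin: "peval A (u + c *s v) = peval A u + c * peval A v" "peval L (u + c *s v) = peval L u + c * peval L v" for u v c
    using assms by (simp_all add: linear_form_add linear_form_scale)
  have z: "peval A 0 = 0" "peval L 0 = 0" using homogeneous_nonzero_at_0 A L by auto
  have V: "vec.subspace ?V" by (rule vec.subspaceI) (use z A in \<open>auto simp: linear_form_add linear_form_scale\<close>)
  have "vec.dim (UNIV :: (complex^5) set) \<le> Suc (vec.dim {v\<in>UNIV. peval A v = 0})"
    by (rule dim_kernel_Int [OF lin(1) vec.subspace_UNIV])
  moreover have "vec.dim (UNIV :: (complex^5) set) = 5" unfolding vec_dim_card by simp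
  moreover have "vec.dim ?V \<le> Suc (vec.dim ?K)" by (rule dim_kernel_Int [OF lin(2) V])
  ultimately have d: "3 \<le> vec.dim ?K" by simp
  have "\<exists>v\<in>?K. v \<notin> vec.span S" if "finite S" "card S < 3" for S
  proof (rule ccontr)
    assume "\<not> ?thesis"
    then have "?K \<subseteq> vec.span S" by blast
    then have "vec.dim ?K \<le> card S" by (rule vec.dim_le_card) (rule that(1))
    then show False using d that(2) by linarith
  qed note ex = this
  obtain u2 where u2: "u2 \<in> ?K" "u2 \<notin> vec.span {}" using ex [of "{}"] by auto
  obtain u1 where u1: "u1 \<in> ?K" "u1 \<notin> vec.span {u2}" using ex [of "{u2}"] by auto
  show ?thesis
  proof (rule that [of u1 u2])
    fix t
    show "u1 + t *s u2 \<noteq> 0"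
    proof
      assume "u1 + t *s u2 = 0"
      then have "u1 = (- t) *s u2" by (simp add: add_eq_0_iff2 vector_smult_lneg)
      moreover have "(- t) *s u2 \<in> vec.span {u2}" by (intro vec.span_scale vec.span_base) simp
      ultimately show False using u1(2) by metis
    qed
    show "peval A (u1 + t *s u2) = 0" "peval L (u1 + t *s u2) = 0" using u1(1) u2(1) by (simp_all add: lin)
  qed (use u1 u2 in auto)
qed

lemma small_multiple:
  fixes u :: "complex^'n"
  assumes "0 < \<delta>" obtains \<nu> where "\<nu> \<noteq> 0" "norm (\<nu> *s u) < \<delta>"
proof -
  let ?r = "\<delta> / (2 * (1 + norm u))"
  have pos: "0 < 2 * (1 + norm u)" by (simp add: add_pos_nonneg)
  then have r: "0 < ?r" using assms by simp
  have "norm (complex_of_real ?r *s u) = ?r * norm u" unfolding norm_smult_vec norm_of_real abs_of_pos [OF r] ..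
  also have "\<dots> < \<delta>" using assms pos by (simp add: field_simps add_strict_increasing2)
  finally show ?thesis using that [of "complex_of_real ?r"] r by (simp only: of_real_eq_0_iff)
qed

section \<open>Smoothness of the tangent cone and the branch surface\<close>

locale smooth_cone = cone_chart +
  fixes S :: "5 pspace set"
  assumes surfS: "is_surface S" and singS: "singular_points S = {}" and degS: "has_degree S 3"
    and tcS: "tangent_cone_ideal x0 M X = vanishing_ideal S"
    and isoX: "\<And>q. q \<in> singular_points X \<Longrightarrow> isolated_singularity X q"
begin

text \<open>The complete intersection of \<open>C\<close> with a form of degree \<open>e\<close> has degree \<open>3 e\<close>. The tangent cone has degree
  three, so the lowest form is linear: \<open>L\<close> is not zero, and the cubic surface \<open>S\<close> is \<open>C = L = 0\<close>.\<close>

lemma lowest_form_linear: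
  shows L0: "L \<noteq> 0" and IS: "vanishing_ideal S = {f. \<exists>\<alpha> \<beta>. f = \<alpha> * C + \<beta> * L}" and dimS: "has_dim S 2"
proof -
  obtain e E where e: "0 < e" "homogeneous e E" "\<not> C dvd E" "hom_part e g = E" "\<And>k. k < e \<Longrightarrow> hom_part k g = 0"
    "e = 1 \<Longrightarrow> E = L" by (rule lowest_form) blast
  have I: "vanishing_ideal S = {f. \<exists>\<alpha> \<beta>. f = \<alpha> * C + \<beta> * E}"
    using tangent_cone_eq [OF e(2,3,4,5)] tcS by simp
  have h: "is_hilbert_poly S (ci_poly e)" by (rule hilbert_ci [OF prime_C hC e(2,3) I])
  obtain p where p: "is_hilbert_poly S p" "fact (degree p) * lead_coeff p = 3" using degS unfolding has_degree_def by auto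
  have "p = ci_poly e" by (rule hilbert_poly_unique [OF p(1) h])
  then have "fact 2 * (3 * real e / 2) = 3" using p(2) ci_poly_degree [OF e(1)] by simp
  then have e1: "e = 1" by (simp add: fact_numeral)
  then have EL: "E = L" by (rule e(6))
  show "L \<noteq> 0" using e(3) EL by auto
  show "vanishing_ideal S = {f. \<exists>\<alpha> \<beta>. f = \<alpha> * C + \<beta> * L}" using I EL by simp
  have "ci_poly e \<noteq> 0" using ci_poly_degree [OF e(1)] by auto
  then show "has_dim S 2" unfolding has_dim_def using h ci_poly_degree [OF e(1)] by blast
qed

lemma IS_I:
  assumes "\<And>y. peval C y = 0 \<Longrightarrow> peval L y = 0 \<Longrightarrow> peval P y = 0"
  shows "\<exists>\<alpha> \<beta>. P = \<alpha> * C + \<beta> * L"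
proof -
  have "C \<in> vanishing_ideal S" unfolding IS by (intro CollectI exI [of _ 1] exI [of _ 0]) simp
  moreover have "L \<in> vanishing_ideal S" unfolding IS by (intro CollectI exI [of _ 0] exI [of _ 1]) simp
  ultimately have "P \<in> vanishing_ideal S" using assms unfolding vanishing_ideal_def by auto
  then show ?thesis unfolding IS by blast
qed

lemma smooth_S:
  assumes y: "y \<noteq> 0" "peval C y = 0" "peval L y = 0"
  shows "\<exists>v w. dP C y v * dP L y w \<noteq> dP C y w * dP L y v"
proof (rule ccontr)
  assume neg: "\<not> ?thesis"
  have cl: "zclosed S" using surfS by (simp add: is_surface_def)
  have "pt y \<in> S"
  proof (rule ccontr)
    assume "pt y \<notin> S"
    then obtain P d where P: "homogeneous d P" "P \<in> vanishing_ideal S" "\<exists>x\<in>hcoords (pt y). peval P x \<noteq> 0"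
      using zclosed_separate [OF cl] by metis
    obtain \<alpha> \<beta> where "P = \<alpha> * C + \<beta> * L" using P(2) unfolding IS by blast
    then have "peval P y = 0" using y by simp
    then show False using P(3) vanish_hcoords [OF P(1) y(1)] by blast
  qed
  then have "pt y \<in> singular_points S"
    by (intro singular_pointI [OF IS, of 2 0 y 2]) (use hC hL y(1) dimS neg in \<open>simp_all add: numeral_3_eq_3 numeral_2_eq_2\<close>)
  then show False using singS by simp
qed

text \<open>The discriminant of the quadratic equation for \<open>c\<close>.\<close>

definition "D = Q ^ 2 - 4 * L * K"

lemma peval_D: "peval D y = peval Q y ^ 2 - 4 * peval L y * peval K y"
  by (simp add: D_def)

lemma hD: "homogeneous 4 D"
  by (rule homogeneousI)
    (simp add: peval_D peval_homogeneous [OF hL] peval_homogeneous [OF hQ] peval_homogeneous [OF hK] power2_eq_square power3_eq_cube power4_eq_xxxx algebra_simps)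

lemma dP_D: "dP D y v = 2 * peval Q y * dP Q y v - 4 * peval K y * dP L y v - 4 * peval L y * dP K y v"
  by (simp add: D_def power2_eq_square algebra_simps)

lemma Q_on_S:
  assumes "\<And>y. peval C y = 0 \<Longrightarrow> peval L y = 0 \<Longrightarrow> peval Q y = 0" shows "\<exists>N. Q = L * N"
proof -
  obtain \<alpha> \<beta> where ab: "Q = \<alpha> * C + \<beta> * L" using IS_I [OF assms] by blast
  have "Q = L * hom_part 1 \<beta>"
    using arg_cong [OF ab, of "hom_part 2"] hom_part_mult [OF hC, of 2 \<alpha>] hom_part_mult [OF hL, of 2 \<beta>]
    by (simp add: hom_part_homogeneous [OF hQ] hom_part_add mult.commute)
  then show ?thesis by blast
qed

text \<open>If \<open>C\<close> divided \<open>D\<close>, then \<open>Q\<close> would vanish on \<open>S\<close> and be a multiple of \<open>L\<close>; then \<open>K\<close> would be in the ideal of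
  \<open>L\<close> and \<open>C\<close>, which \<open>irreducible_residual\<close> excludes.\<close>

lemma C_not_dvd_D: "\<not> C dvd D"
proof
  assume CD: "C dvd D"
  then obtain \<alpha> where a: "D = C * \<alpha>" unfolding dvd_def by blast
  have "peval Q y = 0" if y: "peval C y = 0" "peval L y = 0" for y
  proof -
    have "peval D y = 0" using y by (simp add: a)
    then show ?thesis using y by (simp add: peval_D)
  qed
  then obtain N where N: "Q = L * N" using Q_on_S by blast
  have "D = L * (L * N ^ 2 - 4 * K)" by (simp add: D_def N power2_eq_square algebra_simps)
  then have "C dvd L \<or> C dvd (L * N ^ 2 - 4 * K)" using CD prime_elem_dvd_multD [OF prime_C] by metis
  then have "C dvd (L * N ^ 2 - 4 * K)" using C_not_dvd_low [OF hL L0] by simp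
  then obtain \<beta> where b: "L * N ^ 2 - 4 * K = C * \<beta>" unfolding dvd_def by blast
  have "K = L * pscale (1/4) (N ^ 2) + C * pscale (- 1/4) \<beta>"
  proof (rule peval_inj)
    fix x
    have "peval L x * peval N x ^ 2 - 4 * peval K x = peval C x * peval \<beta> x" using arg_cong [OF b, of "\<lambda>P. peval P x"] by simp
    then have "peval K x = (peval L x * peval N x ^ 2 - peval C x * peval \<beta> x) / 4" by (simp flip: \<open>_ = peval C x * peval \<beta> x\<close>)
    then show "peval K x = peval (L * pscale (1/4) (N ^ 2) + C * pscale (- 1/4) \<beta>) x" by (simp add: diff_divide_distrib)
  qed
  then show False by (rule irreducible_residual [OF L0 N])
qed

subsection \<open>Singular points over dependent points of the branch surface\<close>

lemma dP_H_emb: "dP H (emb s y) (emb a v) = dP C y v"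
proof (rule dP_unique)
  have "(\<lambda>t. peval H (emb s y + t *s emb a v)) = (\<lambda>t. peval C (y + t *s v))"
    by (simp add: emb_add emb_scale H_emb)
  then show "((\<lambda>t. peval H (emb s y + t *s emb a v)) has_field_derivative dP C y v) (at 0)"
    using has_deriv_dP_0 by simp
qed

lemma dP_G_emb: "dP G (emb s y) (emb a v) = a * (2 * s * peval L y + peval Q y) + s ^ 2 * dP L y v + s * dP Q y v + dP K y v"
proof (rule dP_unique)
  have eq: "(\<lambda>t. peval G (emb s y + t *s emb a v)) =
    (\<lambda>t. (s + t * a) ^ 2 * peval L (y + t *s v) + (s + t * a) * peval Q (y + t *s v) + peval K (y + t *s v))"
    by (simp add: emb_add emb_scale G_emb)
  show "((\<lambda>t. peval G (emb s y + t *s emb a v)) has_field_derivative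
    a * (2 * s * peval L y + peval Q y) + s ^ 2 * dP L y v + s * dP Q y v + dP K y v) (at 0)"
    unfolding eq by (rule derivative_eq_intros has_deriv_dP_0 refl | simp add: algebra_simps)+
qed

text \<open>Over a point of the branch surface with \<open>L \<noteq> 0\<close> the two points of \<open>X\<close> coincide in \<open>c = - Q / (2 L)\<close>. There
  \<open>G\<close> has no derivative along \<open>c\<close>, and along \<open>v\<close> its derivative is proportional to that of \<open>D\<close>.\<close>

lemma singular_over_dependent:
  assumes y: "peval C y = 0" "peval D y = 0" "peval L y \<noteq> 0"
    and dep: "\<And>v w. dP C y v * dP D y w = dP C y w * dP D y v"
  shows "pt (emb (- peval Q y / (2 * peval L y)) y) \<in> singular_points X"
proof -
  define s where "s = - peval Q y / (2 * peval L y)"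
  have y0: "y \<noteq> 0" using y(3) homogeneous_nonzero_at_0 [OF hL] by auto
  have s2: "2 * s * peval L y + peval Q y = 0" using y(3) by (simp add: s_def)
  have "4 * peval L y * peval G (emb s y) = (2 * s * peval L y + peval Q y) ^ 2 - peval D y"
    by (simp add: G_emb peval_D power2_eq_square algebra_simps)
  then have G0: "peval G (emb s y) = 0" using y s2 by simp
  have H0: "peval H (emb s y) = 0" using y by (simp add: H_emb)
  have q: "pt (emb s y) \<in> X" unfolding XZ
    using pt_in_zeros [of "{H, G}" "emb s y"] hH hG G0 H0 y0 by auto
  have dG: "- 4 * peval L y * dP G (emb s y) (emb a v) = dP D y v" for a v
  proof -
    have sL: "2 * s * peval L y = - peval Q y" using s2 by (simp add: add_eq_0_iff2)
    have D4: "4 * peval L y * peval K y = peval Q y ^ 2" using y(2) by (simp add: peval_D)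
    have "peval L y * (- 4 * peval L y * dP G (emb s y) (emb a v)) =
       - ((2 * s * peval L y) ^ 2) * dP L y v - 2 * peval L y * (2 * s * peval L y) * dP Q y v - 4 * peval L y ^ 2 * dP K y v"
    proof -
      have "dP G (emb s y) (emb a v) = s ^ 2 * dP L y v + s * dP Q y v + dP K y v" unfolding dP_G_emb s2 by simp
      then show ?thesis by (simp add: power2_eq_square algebra_simps)
    qed
    also have "\<dots> = - (4 * peval L y * peval K y) * dP L y v + 2 * peval L y * peval Q y * dP Q y v - 4 * peval L y ^ 2 * dP K y v"
      unfolding sL D4 by simp
    also have "\<dots> = peval L y * dP D y v" by (simp add: dP_D power2_eq_square algebra_simps)
    finally show ?thesis using y(3) by (simp only: mult_cancel_left simp_thms)
  qed
  have "dP H (emb s y) v * dP G (emb s y) w = dP H (emb s y) w * dP G (emb s y) v" for v w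
  proof -
    obtain a v' where v: "v = emb a v'" using emb_decomp by metis
    obtain b w' where w: "w = emb b w'" using emb_decomp by metis
    have "- 4 * peval L y * (dP H (emb s y) v * dP G (emb s y) w) = dP C y v' * dP D y w'"
      using dG [of b w'] by (simp add: v w dP_H_emb mult_ac flip: dG)
    moreover have "- 4 * peval L y * (dP H (emb s y) w * dP G (emb s y) v) = dP C y w' * dP D y v'"
      using dG [of a v'] by (simp add: v w dP_H_emb mult_ac flip: dG)
    ultimately have "- 4 * peval L y * (dP H (emb s y) v * dP G (emb s y) w) = - 4 * peval L y * (dP H (emb s y) w * dP G (emb s y) v)"
      using dep [of v' w'] by simp
    then show ?thesis using y(3) by simp
  qed
  then show ?thesis unfolding s_def [symmetric]
    by (intro singular_pointI [OF IX, of 2 2 "emb s y" 3]) (use hH hG q dimX y0 in \<open>simp_all add: numeral_3_eq_3 numeral_2_eq_2\<close>)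
qed

lemma generic_direction:
  fixes r :: "5 mpoly"
  assumes "r \<noteq> 0"
  obtains \<kappa> b where "\<kappa> \<noteq> 0" "peval r b \<noteq> 0" "peval C (\<kappa> *s b) = 1"
proof -
  have "r * C \<noteq> 0" using assms C0 by simp
  then obtain b where b: "peval (r * C) b \<noteq> 0" using peval_nonzero_ex by blast
  then have "peval r b \<noteq> 0" "peval C b \<noteq> 0" by auto
  then show ?thesis using unit_value [OF hC] that by metis
qed

text \<open>Dependence on an open piece of the branch surface would produce a convergent sequence of singular points
  of \<open>X\<close>, and all singular points are isolated. The vector \<open>u\<close> keeps the sequence away from its limit.\<close>

lemma no_dependent_off_L:
  assumes y1: "peval C y1 = 0" "peval D y1 = 0" "peval L y1 \<noteq> 0" and eps: "0 < \<epsilon>"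
    and dep: "\<And>y v w. peval C y = 0 \<Longrightarrow> peval D y = 0 \<Longrightarrow> dist y y1 < \<epsilon> \<Longrightarrow> dP C y v * dP D y w = dP C y w * dP D y v"
  shows False
proof -
  have y10: "y1 \<noteq> 0" using y1(3) homogeneous_nonzero_at_0 [OF hL] by auto
  obtain r :: "5 mpoly" where r: "r \<noteq> 0"
    "\<And>b t. peval r b \<noteq> 0 \<Longrightarrow> peval C (y1 + t *s b) = 0 \<Longrightarrow> peval D (y1 + t *s b) = 0 \<Longrightarrow> t = 0"
    using avoid_direction [OF prime_C hC hD C_not_dvd_D, of y1] by blast
  obtain \<kappa> b0 where b0: "\<kappa> \<noteq> 0" "peval r b0 \<noteq> 0" "peval C (\<kappa> *s b0) = 1" by (rule generic_direction [OF r(1)])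
  define b where "b = \<kappa> *s b0"
  interpret cn: cubic_norm C D b by unfold_locales (use hC hD b0 in \<open>simp_all add: b_def\<close>)
  have line: "t = 0" if "peval C (y1 + t *s b) = 0" "peval D (y1 + t *s b) = 0" for t
    using r(2) [OF b0(2), of "t * \<kappa>"] that b0(1) by (simp add: b_def vector_smult_assoc)
  obtain c where c: "peval cn.N c \<noteq> 0" using cn.N_nonzero_ex [OF prime_C C_not_dvd_D] by blast
  have "card {y1, c, b} \<le> 3" by (metis card_length length_Cons list.set(1) list.set(2) list.size(3) numeral_3_eq_3)
  then have cd: "card {y1, c, b} < CARD(5)" by simp
  obtain u where u: "u \<notin> vec.span {y1, c, b}" using not_in_span_ex [OF _ cd] by blast
  have "open {y. peval L y \<noteq> 0}" using open_nonzero [of "\<lambda>y. y" L] by simp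
  then obtain \<epsilon>1 where e1: "0 < \<epsilon>1" "ball y1 \<epsilon>1 \<subseteq> {y. peval L y \<noteq> 0}" 
    by (rule openE [of _ y1]) (use y1(3) in simp_all)
  have "\<exists>y. peval C y = 0 \<and> peval D y = 0 \<and> dist y y1 < \<epsilon> \<and> peval L y \<noteq> 0 \<and> dist y y1 < inverse (real (Suc n)) \<and> (\<forall>\<mu>. y \<noteq> \<mu> *s y1)" for n
  proof -
    have "0 < min \<epsilon> (min \<epsilon>1 (inverse (real (Suc n))))" using eps e1(1) by simp
    from cn.nearby_zero [OF y1(1,2) line c this] obtain \<delta> where d: "0 < \<delta>"
      "\<And>x. dist x y1 < \<delta> \<Longrightarrow> \<exists>w t. peval C (x + w *s c + t *s b) = 0 \<and> peval D (x + w *s c + t *s b) = 0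
        \<and> dist (x + w *s c + t *s b) y1 < min \<epsilon> (min \<epsilon>1 (inverse (real (Suc n))))" by blast
    obtain \<nu> where l0: "\<nu> \<noteq> 0" and small: "norm (\<nu> *s u) < \<delta>" by (rule small_multiple [OF d(1)])
    have "dist (y1 + \<nu> *s u) y1 < \<delta>" using small by (simp add: dist_norm)
    from d(2) [OF this] obtain w t where wt: "peval C (y1 + \<nu> *s u + w *s c + t *s b) = 0" "peval D (y1 + \<nu> *s u + w *s c + t *s b) = 0"
      "dist (y1 + \<nu> *s u + w *s c + t *s b) y1 < min \<epsilon> (min \<epsilon>1 (inverse (real (Suc n))))" by blast
    have "y1 + \<nu> *s u + w *s c + t *s b \<noteq> \<mu> *s y1" for \<mu>
    proof
      assume "y1 + \<nu> *s u + w *s c + t *s b = \<mu> *s y1"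
      then have "\<nu> *s u = \<mu> *s y1 - y1 - w *s c - t *s b" by (simp add: algebra_simps)
      also have "\<dots> \<in> vec.span {y1, c, b}"
        by (intro vec.span_diff vec.span_scale vec.span_base) auto
      finally have "(1 / \<nu>) *s (\<nu> *s u) \<in> vec.span {y1, c, b}" by (rule vec.span_scale)
      then show False using l0 u by (simp add: vector_smult_assoc)
    qed
    moreover have "peval L (y1 + \<nu> *s u + w *s c + t *s b) \<noteq> 0" using e1(2) wt(3) by (auto simp: dist_commute)
    ultimately show ?thesis using wt by (intro exI [of _ "y1 + \<nu> *s u + w *s c + t *s b"]) simp
  qed
  then obtain ys where ys: "\<And>n. peval C (ys n) = 0" "\<And>n. peval D (ys n) = 0" "\<And>n. dist (ys n) y1 < \<epsilon>" "\<And>n. peval L (ys n) \<noteq> 0"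
    "\<And>n. dist (ys n) y1 < inverse (real (Suc n))" "\<And>n \<mu>. ys n \<noteq> \<mu> *s y1" by metis
  have "(\<lambda>n. dist (ys n) y1) \<longlonglongrightarrow> 0"
  proof (rule real_tendsto_sandwich [OF _ _ tendsto_const LIMSEQ_inverse_real_of_nat])
    show "eventually (\<lambda>n. dist (ys n) y1 \<le> inverse (real (Suc n))) sequentially"
      by (intro eventuallyI less_imp_le) (rule ys(5))
  qed simp
  then have ylim: "ys \<longlonglongrightarrow> y1" using tendsto_dist_iff by blast
  define p where "p y = emb (- peval Q y / (2 * peval L y)) y" for y
  have plim: "(\<lambda>n. p (ys n)) \<longlonglongrightarrow> p y1" unfolding p_def emb_def
    by (intro tendsto_intros ylim) (use y1(3) in simp)
  have sing1: "pt (p y1) \<in> singular_points X" unfolding p_def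
    by (rule singular_over_dependent [OF y1]) (rule dep, use y1 eps in simp_all)
  have sing: "pt (p (ys n)) \<in> singular_points X" for n unfolding p_def
    by (rule singular_over_dependent [OF ys(1) ys(2) ys(4)]) (rule dep [OF ys(1) ys(2) ys(3)])
  have ys0: "ys n \<noteq> 0" for n using ys(6) [of n 0] by simp
  have pn: "p (ys n) \<noteq> 0" "p y1 \<noteq> 0" for n using ys0 y10 by (simp_all add: p_def)
  obtain n where "pt (p (ys n)) = pt (p y1)"
    using isolated_no_accumulation [OF isoX [OF sing1] pn(2) plim pn(1) sing] by blast
  then obtain k where "p (ys n) = k *s p y1" using pt_eq_iff pn by blast
  then have "ys n = k *s y1" by (simp add: p_def emb_scale emb_inj)
  then show False using ys(6) by blast
qed

end

context smooth_cone begin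

subsection \<open>Dependent points on the tangent cone\<close>

definition "c0 = (SOME c. peval L c = 1)"

lemma L_c0 [simp]: "peval L c0 = 1"
proof -
  obtain x where x: "peval L x \<noteq> 0" using peval_nonzero_ex [OF L0] by blast
  have "peval L ((1 / peval L x) *s x) = 1" using x by (simp add: linear_form_scale [OF hL])
  then show ?thesis unfolding c0_def by (rule someI)
qed

text \<open>Projection to the hyperplane \<open>L = 0\<close> of the tangent cone. Composing with it makes polynomials on this
  hyperplane available as polynomials in five variables.\<close>

definition prj :: "complex^5 \<Rightarrow> complex^5" where "prj v = v - peval L v *s c0"

lemma prj_add: "prj (u + t *s v) = prj u + t *s prj v"
  by (simp add: prj_def linear_form_add [OF hL] linear_form_scale [OF hL] vec.scale_left_distrib vec.scale_right_diff_distrib vector_smult_assoc)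

lemma L_prj [simp]: "peval L (prj v) = 0"
  using linear_form_add [OF hL, of "prj v" "peval L v *s c0"] by (simp add: prj_def linear_form_scale [OF hL])

lemma prj_fix: "peval L y = 0 \<Longrightarrow> prj y = y"
  by (simp add: prj_def)

lemma prj_scale: "prj (t *s v) = t *s prj v"
  by (simp add: prj_def linear_form_scale [OF hL] vec.scale_right_diff_distrib vector_smult_assoc)

lemma polyfun_prj: "polyfun (\<lambda>x. prj x $ i)"
  unfolding prj_def vector_minus_component vector_smult_component
  by (intro polyfun_diff polyfun_mult polyfun_peval polyfun_const polyfun_coord)

definition proj :: "5 mpoly \<Rightarrow> 5 mpoly" where "proj P = (SOME P'. \<forall>x. peval P' x = peval P (prj x))"

lemma peval_proj [simp]: "peval (proj P) x = peval P (prj x)"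
  unfolding proj_def using someI_ex [OF polyfun_ex [OF polyfun_comp [OF polyfun_prj]]] by blast

lemma proj_hom: "homogeneous d P \<Longrightarrow> homogeneous d (proj P)"
  by (rule homogeneousI) (simp add: prj_scale peval_homogeneous)

lemma dP_proj: "dP (proj P) y v = dP P (prj y) (prj v)"
proof (rule dP_unique)
  have "(\<lambda>t. peval (proj P) (y + t *s v)) = (\<lambda>t. peval P (prj y + t *s prj v))" by (simp add: prj_add)
  then show "((\<lambda>t. peval (proj P) (y + t *s v)) has_field_derivative dP P (prj y) (prj v)) (at 0)"
    using has_deriv_dP_0 by simp
qed

lemma proj_C_smooth:
  assumes y: "y \<noteq> 0" "peval L y = 0" "peval C y = 0" and d: "\<And>v. dP (proj C) y v = 0"
  shows False
proof -
  have lin: "dP C y v = peval L v * dP C y c0" for v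
  proof -
    have v: "v = prj v + peval L v *s c0" by (simp add: prj_def)
    have "dP C y (prj v) = 0" using d [of v] by (simp add: dP_proj prj_fix y)
    moreover have "dP C y v = dP C y (prj v) + peval L v * dP C y c0" by (subst v) (simp only: dP_add dP_scale)
    ultimately show ?thesis by simp
  qed
  have "dP C y v * dP L y w = dP C y w * dP L y v" for v w
    unfolding lin [of v] lin [of w] by (simp add: dP_linear_form [OF hL])
  then show False using smooth_S y by blast
qed

text \<open>A plane and a quadric in the projective 3-space \<open>L = 0\<close> meet, and their union is singular where they do;
  but \<open>S\<close> is smooth.\<close>

lemma proj_C_no_split:
  assumes A: "homogeneous 1 A" and B: "homogeneous 2 B" and eq: "proj C = A * B"
  shows False
proof -
  obtain u1 u2 where u: "\<And>t. u1 + t *s u2 \<noteq> 0" "u2 \<noteq> 0" "\<And>t. peval A (u1 + t *s u2) = 0" "peval A u2 = 0"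
    "\<And>t. peval L (u1 + t *s u2) = 0" "peval L u2 = 0" by (rule two_forms_kernel [OF A hL]) blast
  obtain y where y: "y \<noteq> 0" "peval A y = 0" "peval L y = 0" "peval B y = 0"
  proof (cases "peval B u2 = 0")
    case True then show ?thesis using that u by blast
  next
    case False
    have "0 < (2::nat)" by simp
    then obtain t where "peval B (u1 + t *s u2) = 0" by (rule line_root [OF B _ False, where x = u1]) blast
    then show ?thesis using that u by blast
  qed
  have "peval C (prj y) = 0" using y by (simp flip: peval_proj add: eq)
  then have "peval C y = 0" by (simp add: prj_fix y)
  then show False by (rule proj_C_smooth [OF y(1,3)]) (simp add: eq y)
qed

lemma prime_proj_C: "prime_elem (proj C)"
proof (rule irreducible_imp_prime_mpoly, rule irreducibleI)
  have h: "homogeneous 3 (proj C)" by (rule proj_hom [OF hC])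
  show nz: "proj C \<noteq> 0" using proj_C_no_split [of 0 0] by auto
  show "\<not> proj C dvd 1"
  proof
    assume "proj C dvd 1"
    then obtain B where "1 = proj C * B" unfolding dvd_def by blast
    then have "peval (proj C) 0 * peval B 0 = 1" by (metis peval_1 peval_mult)
    then show False using homogeneous_nonzero_at_0 [OF h] by simp
  qed
  fix A B assume AB: "proj C = A * B"
  then have n: "A \<noteq> 0" "B \<noteq> 0" using nz by auto
  obtain i j where ij: "homogeneous i A" "homogeneous j B" "i + j = 3"
    using homogeneous_factor [of 3 A B] h AB n by metis
  have "\<not> (i = 1 \<and> j = 2)" using proj_C_no_split [OF _ _ AB] ij by blast
  moreover have "proj C = B * A" using AB by (simp only: mult.commute)
  then have "\<not> (i = 2 \<and> j = 1)" using proj_C_no_split [of B A] ij by blast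
  ultimately have "i = 0 \<or> j = 0" using ij(3) by presburger
  then show "A dvd 1 \<or> B dvd 1" using const_dvd_1 ij n by blast
qed

lemma root_limit:
  fixes P :: "('n::finite) mpoly"
  assumes P: "homogeneous d P" "0 < d" "peval P e \<noteq> 0" and x: "x \<longlonglongrightarrow> y" "peval P y = 0"
  obtains t where "t \<longlonglongrightarrow> 0" "\<And>n. peval P (x n + t n *s e) = 0"
proof -
  have "\<exists>w. peval P (x n + w *s e) = 0 \<and> norm w ^ d * norm (peval P e) \<le> norm (peval P (x n))" for n
    using line_root [OF P] by metis
  then obtain w where w: "\<And>n. peval P (x n + w n *s e) = 0" "\<And>n. norm (w n) ^ d * norm (peval P e) \<le> norm (peval P (x n))" by metis
  have lim: "(\<lambda>n. norm (peval P (x n)) / norm (peval P e)) \<longlonglongrightarrow> 0"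
    using tendsto_divide [OF tendsto_norm [OF tendsto_peval [OF x(1), of P]] tendsto_const [of "norm (peval P e)"]] P(3) x(2) by simp
  have "(\<lambda>n. norm (w n) ^ d) \<longlonglongrightarrow> 0"
    by (rule real_tendsto_sandwich [OF _ _ tendsto_const lim]) (use w(2) P(3) in \<open>auto simp: field_simps\<close>)
  from tendsto_real_root [OF this, of d] have "(\<lambda>n. norm (w n)) \<longlonglongrightarrow> 0" using P(2) by (simp add: real_root_power_cancel)
  then have "w \<longlonglongrightarrow> 0" by (rule tendsto_norm_zero_cancel)
  then show ?thesis using that w(1) by blast
qed

text \<open>If \<open>Q\<close> is a multiple of \<open>L\<close>, then dependence with the smooth \<open>C\<close> forces \<open>K = 0\<close> on a piece of \<open>S\<close>, hence on all of
  \<open>S\<close>, contrary to \<open>irreducible_residual\<close>. If not, then \<open>L = 0\<close> on the branch surface means \<open>C = L = Q = 0\<close>, a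
  curve; moving \<open>y0\<close> out of \<open>L = 0\<close> and correcting by directions inside \<open>L = 0\<close> gives points with \<open>L \<noteq> 0\<close>.\<close>

lemma no_dependent_on_L:
  assumes y0: "y0 \<noteq> 0" "peval C y0 = 0" "peval D y0 = 0" "peval L y0 = 0" and eps: "0 < \<epsilon>"
    and dep: "\<And>y v w. peval C y = 0 \<Longrightarrow> peval D y = 0 \<Longrightarrow> dist y y0 < \<epsilon> \<Longrightarrow> dP C y v * dP D y w = dP C y w * dP D y v"
    and onL: "\<And>y. peval C y = 0 \<Longrightarrow> peval D y = 0 \<Longrightarrow> dist y y0 < \<epsilon> \<Longrightarrow> peval L y = 0"
  shows False
proof (cases "\<exists>N. Q = L * N")
  case True
  then obtain N where N: "Q = L * N" by blast
  have Kz: "peval K y = 0" if y: "peval C y = 0" "peval L y = 0" "dist y y0 < \<epsilon>" for y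
  proof (cases "y = 0")
    case True then show ?thesis using homogeneous_nonzero_at_0 [OF hK] by simp
  next
    case False
    have Q0: "peval Q y = 0" using y by (simp add: N)
    then have "peval D y = 0" using y by (simp add: peval_D)
    then have "dP C y v * dP D y w = dP C y w * dP D y v" for v w using dep y by blast
    moreover have "dP D y v = - 4 * peval K y * dP L y v" for v using Q0 y by (simp add: dP_D)
    ultimately have "- 4 * peval K y * (dP C y v * dP L y w) = - 4 * peval K y * (dP C y w * dP L y v)" for v w
      by (simp add: mult_ac)
    then have "peval K y = 0 \<or> dP C y v * dP L y w = dP C y w * dP L y v" for v w by simp
    then show ?thesis using smooth_S [OF False y(1,2)] by blast
  qed
  have "proj C dvd proj K"
  proof (rule ccontr)
    assume nd: "\<not> proj C dvd proj K"
    have cop: "\<And>\<sigma>. prime_elem \<sigma> \<Longrightarrow> \<sigma> dvd proj C \<Longrightarrow> \<not> \<sigma> dvd proj K" by (rule prime_mpoly_coprime [OF prime_proj_C nd])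
    have nz: "proj C \<noteq> 0" using prime_proj_C by (simp add: prime_elem_def)
    obtain e where e: "peval (proj C) e \<noteq> 0" using peval_nonzero_ex [OF nz] by blast
    obtain r :: "5 mpoly" where r: "r \<noteq> 0"
      "\<And>x t. peval (proj C) (x + t *s e) = 0 \<Longrightarrow> peval (proj K) (x + t *s e) = 0 \<Longrightarrow> peval r x = 0"
      using elimination [OF nz cop, of e] by blast
    have "y0 \<in> closure {x. peval r x \<noteq> 0}" using dense_nonzero [OF r(1)] by simp
    then obtain x where x: "\<And>n. peval r (x n) \<noteq> 0" "x \<longlonglongrightarrow> y0" unfolding closure_sequential by auto
    have "peval (proj C) y0 = 0" using y0 by (simp add: prj_fix)
    from root_limit [OF proj_hom [OF hC] _ e x(2) this] obtain t where t: "t \<longlonglongrightarrow> 0" "\<And>n. peval (proj C) (x n + t n *s e) = 0" by auto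
    have "(\<lambda>n. prj (x n + t n *s e)) \<longlonglongrightarrow> prj (y0 + 0 *s e)" unfolding prj_def by (intro tendsto_intros x t)
    then have "eventually (\<lambda>n. dist (prj (x n + t n *s e)) y0 < \<epsilon>) sequentially" using tendstoD [OF _ eps] y0(4) by (fastforce simp: prj_fix)
    then obtain n where "dist (prj (x n + t n *s e)) y0 < \<epsilon>" by (meson eventually_happens sequentially_bot)
    then have "peval K (prj (x n + t n *s e)) = 0" using Kz t(2) [of n] by simp
    then have "peval r (x n) = 0" using r(2) [OF t(2) [of n]] by simp
    then show False using x(1) by blast
  qed
  then obtain \<alpha> where a: "proj K = proj C * \<alpha>" unfolding dvd_def by blast
  have "peval K y = 0" if y: "peval C y = 0" "peval L y = 0" for y
    using arg_cong [OF a, of "\<lambda>P. peval P y"] y by (simp add: prj_fix)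
  then obtain \<alpha> \<beta> where "K = \<alpha> * C + \<beta> * L" using IS_I by metis
  then have "K = L * \<beta> + C * \<alpha>" by (simp add: algebra_simps)
  then show False by (rule irreducible_residual [OF L0 N])
next
  case noN: False
  have nd: "\<not> proj C dvd proj Q"
  proof
    assume "proj C dvd proj Q"
    then obtain \<alpha> where a: "proj Q = proj C * \<alpha>" unfolding dvd_def by blast
    have "peval Q y = 0" if y: "peval C y = 0" "peval L y = 0" for y
      using arg_cong [OF a, of "\<lambda>P. peval P y"] y by (simp add: prj_fix)
    then show False using Q_on_S noN by blast
  qed
  have cop: "\<And>\<sigma>. prime_elem \<sigma> \<Longrightarrow> \<sigma> dvd proj C \<Longrightarrow> \<not> \<sigma> dvd proj Q" by (rule prime_mpoly_coprime [OF prime_proj_C nd])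
  have nz: "proj C \<noteq> 0" using prime_proj_C by (simp add: prime_elem_def)
  obtain r :: "5 mpoly" where r: "r \<noteq> 0" "\<And>b t. peval r b \<noteq> 0 \<Longrightarrow> peval (proj C) (y0 + t *s b) = 0 \<Longrightarrow> peval (proj Q) (y0 + t *s b) = 0 \<Longrightarrow> t = 0"
    using avoid_direction [OF prime_proj_C proj_hom [OF hC] proj_hom [OF hQ] nd, of y0] by blast
  have "r * proj C \<noteq> 0" using r(1) nz by simp
  then obtain x where "peval (r * proj C) x \<noteq> 0" using peval_nonzero_ex by blast
  then have x: "peval r x \<noteq> 0" "peval C (prj x) \<noteq> 0" by auto
  obtain \<kappa> where k: "\<kappa> \<noteq> 0" "peval C (\<kappa> *s prj x) = 1" using unit_value [OF hC x(2)] by blast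
  define b where "b = \<kappa> *s prj x"
  have Lb: "peval L b = 0" by (simp add: b_def linear_form_scale [OF hL])
  interpret cn: cubic_norm C D b by unfold_locales (use hC hD k in \<open>simp_all add: b_def\<close>)
  have DQ: "peval D y = 0 \<longleftrightarrow> peval Q y = 0" if "peval L y = 0" for y using that by (simp add: peval_D)
  have line: "t = 0" if t: "peval C (y0 + t *s b) = 0" "peval D (y0 + t *s b) = 0" for t
  proof -
    have eq: "y0 + t *s b = prj (y0 + (t * \<kappa>) *s x)" by (simp add: prj_add prj_fix y0 b_def vector_smult_assoc)
    have "peval L (y0 + t *s b) = 0" unfolding eq by simp
    then have "peval Q (y0 + t *s b) = 0" using t(2) DQ by blast
    then have "t * \<kappa> = 0" using r(2) [OF x(1), of "t * \<kappa>"] t(1) unfolding eq by simp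
    then show ?thesis using k(1) by simp
  qed
  obtain r2 :: "5 mpoly" where r2: "r2 \<noteq> 0"
    "\<And>x t. peval (proj C) (x + t *s b) = 0 \<Longrightarrow> peval (proj Q) (x + t *s b) = 0 \<Longrightarrow> peval r2 x = 0"
    using elimination [OF nz cop, of b] by blast
  obtain x2 where x2: "peval r2 x2 \<noteq> 0" using peval_nonzero_ex [OF r2(1)] by blast
  have c: "peval cn.N (prj x2) \<noteq> 0"
  proof
    assume "peval cn.N (prj x2) = 0"
    then obtain t where t: "peval C (prj x2 + t *s b) = 0" "peval D (prj x2 + t *s b) = 0" unfolding cn.N_zero_iff by blast
    have eq: "prj x2 + t *s b = prj (x2 + t *s b)" by (simp add: prj_add prj_fix Lb)
    have "peval L (prj x2 + t *s b) = 0" unfolding eq by simp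
    then have "peval Q (prj x2 + t *s b) = 0" using t(2) DQ by blast
    then show False using r2(2) x2 t(1) unfolding eq by simp
  qed
  from cn.nearby_zero [OF y0(2,3) line c eps] obtain \<delta> where d: "0 < \<delta>"
    "\<And>x. dist x y0 < \<delta> \<Longrightarrow> \<exists>w t. peval C (x + w *s prj x2 + t *s b) = 0 \<and> peval D (x + w *s prj x2 + t *s b) = 0
      \<and> dist (x + w *s prj x2 + t *s b) y0 < \<epsilon>" by blast
  obtain \<nu> where l0: "\<nu> \<noteq> 0" and small: "norm (\<nu> *s c0) < \<delta>" by (rule small_multiple [OF d(1)])
  have "dist (y0 + \<nu> *s c0) y0 < \<delta>" using small by (simp add: dist_norm)
  from d(2) [OF this] obtain w t where wt: "peval C (y0 + \<nu> *s c0 + w *s prj x2 + t *s b) = 0"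
    "peval D (y0 + \<nu> *s c0 + w *s prj x2 + t *s b) = 0" "dist (y0 + \<nu> *s c0 + w *s prj x2 + t *s b) y0 < \<epsilon>" by blast
  have "peval L (y0 + \<nu> *s c0 + w *s prj x2 + t *s b) = \<nu>"
    by (simp add: linear_form_add [OF hL] linear_form_scale [OF hL] y0 Lb)
  then show False using onL [OF wt] l0 by simp
qed

text \<open>Generic dependence of the derivatives is excluded off \<open>L = 0\<close> by the isolatedness of the singularities of \<open>X\<close>
  and on \<open>L = 0\<close> by the smoothness of \<open>S\<close>.\<close>

lemma radical:
  assumes "\<And>x. peval C x = 0 \<Longrightarrow> peval D x = 0 \<Longrightarrow> peval P x = 0"
  shows "\<exists>\<alpha> \<beta>. P = \<alpha> * C + \<beta> * D"
proof (rule ccontr)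
  assume no: "\<not> ?thesis"
  from radical_or_dependent [OF prime_C hC hD C_not_dvd_D] no assms obtain y0 \<epsilon> where y0: "y0 \<noteq> 0" "peval C y0 = 0" "peval D y0 = 0" "0 < \<epsilon>"
    and dep: "\<And>y v w. peval C y = 0 \<Longrightarrow> peval D y = 0 \<Longrightarrow> dist y y0 < \<epsilon> \<Longrightarrow> dP C y v * dP D y w = dP C y w * dP D y v"
    by metis
  have onL: "peval L y = 0" if y: "peval C y = 0" "peval D y = 0" "dist y y0 < \<epsilon>" for y
  proof (rule ccontr)
    assume "peval L y \<noteq> 0"
    moreover have "dP C z v * dP D z w = dP C z w * dP D z v"
      if z: "peval C z = 0" "peval D z = 0" "dist z y < \<epsilon> - dist y y0" for z v w
      by (rule dep [OF z(1,2)]) (use z(3) dist_triangle [of z y0 y] in linarith)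
    ultimately show False using no_dependent_off_L [OF y(1,2), of "\<epsilon> - dist y y0"] y(3) by simp
  qed
  have "peval L y0 = 0" using onL [OF y0(2,3)] y0(4) by simp
  then show False using no_dependent_on_L [OF y0(1,2,3) _ y0(4) dep onL] by blast
qed

subsection \<open>The branch surface\<close>

lemma CD_hom: "P \<in> {C, D} \<Longrightarrow> \<exists>d. homogeneous d P" using hC hD by blast

lemma pt_in_branch: "x \<noteq> 0 \<Longrightarrow> pt x \<in> zeros {C, D} \<longleftrightarrow> peval C x = 0 \<and> peval D x = 0"
  using pt_in_zeros [of "{C, D}" x, OF CD_hom] by simp

lemma branch_nonempty: "\<exists>y. y \<noteq> 0 \<and> peval C y = 0 \<and> peval D y = 0"
proof -
  obtain \<kappa> b where b: "\<kappa> \<noteq> 0" "peval C b \<noteq> 0" "peval C (\<kappa> *s b) = 1" by (rule generic_direction [OF C0])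
  interpret cn: cubic_norm C D "\<kappa> *s b" by unfold_locales (use hC hD b in simp_all)
  obtain c where "peval cn.N c \<noteq> 0" using cn.N_nonzero_ex [OF prime_C C_not_dvd_D] by blast
  then show ?thesis by (rule cn.common_zero_ex)
qed

lemma branch_ideal: "vanishing_ideal (zeros {C, D}) = {P. \<exists>\<alpha> \<beta>. P = \<alpha> * C + \<beta> * D}"
proof (intro subset_antisym subsetI)
  fix P assume P: "P \<in> vanishing_ideal (zeros {C, D})"
  have nz: "peval P x = 0" if x: "x \<noteq> 0" "peval C x = 0" "peval D x = 0" for x
  proof -
    have "pt x \<in> zeros {C, D}" using pt_in_branch x by simp
    then show ?thesis using vanishing_idealD [OF P] pt_in_hcoords [OF x(1)] by blast
  qed
  obtain y where y: "y \<noteq> 0" "peval C y = 0" "peval D y = 0" using branch_nonempty by blast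
  have "pt y \<in> zeros {C, D}" using pt_in_branch y by simp
  moreover have "0 \<in> line_of (pt y)" using line_of_pt [OF y(1)] by (auto intro: range_eqI [of _ _ 0])
  ultimately have z: "peval P 0 = 0" using P unfolding vanishing_ideal_def by blast
  have "peval P x = 0" if "peval C x = 0" "peval D x = 0" for x using nz z that by (cases "x = 0") auto
  then show "P \<in> {P. \<exists>\<alpha> \<beta>. P = \<alpha> * C + \<beta> * D}" using radical by blast
next
  fix P assume "P \<in> {P. \<exists>\<alpha> \<beta>. P = \<alpha> * C + \<beta> * D}"
  then obtain \<alpha> \<beta> where P: "P = \<alpha> * C + \<beta> * D" by blast
  have "C \<in> vanishing_ideal (zeros {C, D})" by (rule vanishing_idealI [OF hC]) (auto simp: zeros_def)
  moreover have "D \<in> vanishing_ideal (zeros {C, D})" by (rule vanishing_idealI [OF hD]) (auto simp: zeros_def)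
  ultimately show "P \<in> vanishing_ideal (zeros {C, D})" unfolding P vanishing_ideal_def by auto
qed

lemma branch_surface: "is_surface (zeros {C, D})"
  unfolding is_surface_def
proof (intro conjI ballI)
  show cl: "zclosed (zeros {C, D})" by (rule zclosed_zeros [OF CD_hom])
  obtain y where y: "y \<noteq> 0" "peval C y = 0" "peval D y = 0" using branch_nonempty by blast
  then have "pt y \<in> zeros {C, D}" using pt_in_branch by simp
  then show "zeros {C, D} \<noteq> {}" by blast
  show "has_dim T 2" if "T \<in> components (zeros {C, D})" for T
    by (rule component_dim [OF prime_C hC hD C_not_dvd_D cl branch_ideal that])
qed

lemma branch_degree: "has_degree (zeros {C, D}) 12"
proof -
  have "is_hilbert_poly (zeros {C, D}) (ci_poly 4)" by (rule hilbert_ci [OF prime_C hC hD C_not_dvd_D branch_ideal])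
  moreover have "degree (ci_poly 4) = 2" "lead_coeff (ci_poly 4) = 6" using ci_poly_degree [of 4] by simp_all
  ultimately show ?thesis unfolding has_degree_def by (intro exI [of _ "ci_poly 4"]) (auto simp: fact_numeral)
qed

end

lemma segre_nth [simp]: "segre x m $ (i, k) = x $ i * m $ k"
  by (simp add: segre_def)

lemma segre_scale: "segre (a *s x) (b *s m) = (a * b) *s segre x m"
  by (simp add: vec_eq_iff segre_def)

lemma segre_eq_0: "segre x m = 0 \<longleftrightarrow> x = 0 \<or> m = 0"
proof
  assume 0: "segre x m = 0"
  show "x = 0 \<or> m = 0"
  proof (rule ccontr)
    assume "\<not> (x = 0 \<or> m = 0)"
    then obtain i k where "x $ i \<noteq> 0" "m $ k \<noteq> 0" by (auto simp: vec_eq_iff)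
    then show False using arg_cong [OF 0, of "\<lambda>z. z $ (i, k)"] by simp
  qed
qed (auto simp: vec_eq_iff segre_def)

lemma segre_cancel:
  assumes "segre x m = k *s segre x' m" "m \<noteq> 0" shows "x = k *s x'"
proof (unfold vec_eq_iff, intro allI)
  fix i
  obtain j where "m $ j \<noteq> 0" using assms(2) by (auto simp: vec_eq_iff)
  then show "x $ i = (k *s x') $ i" using arg_cong [OF assms(1), of "\<lambda>z. z $ (i, j)"] by simp
qed

lemma rank_one_segre:
  fixes z :: "complex^('n::finite \<times> 'k::finite)"
  assumes "z \<noteq> 0" "\<And>i k i' k'. z $ (i, k) * z $ (i', k') = z $ (i, k') * z $ (i', k)"
  obtains x m where "x \<noteq> 0" "m \<noteq> 0" "z = segre x m"
proof -
  obtain p where "z $ p \<noteq> 0" using assms(1) by (auto simp: vec_eq_iff)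
  then obtain i0 k0 where nz: "z $ (i0, k0) \<noteq> 0" by (cases p) auto
  define x where "x = (\<chi> i. z $ (i, k0))"
  define m where "m = (\<chi> k. z $ (i0, k) / z $ (i0, k0))"
  have "z $ (i, k) = x $ i * m $ k" for i k
    using assms(2) [of i k0 i0 k] nz by (simp add: x_def m_def field_simps)
  then have "z = segre x m" by (simp add: vec_eq_iff segre_def)
  moreover have "x \<noteq> 0" "m \<noteq> 0" using calculation assms(1) by (auto simp: segre_eq_0)
  ultimately show ?thesis using that by blast
qed

lemma minors_scale: "minors (a *s y) (b *s x) = (a * b) *s minors y x"
  by (simp add: vec_eq_iff minors_def algebra_simps)

text \<open>It suffices to use homogeneous equations that hold on \<open>W\<close>, one at a time, to recognise a point of \<open>W\<close>.\<close>

lemma zclosed_by_equations: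
  fixes W :: "('n::finite) pspace set"
  assumes "\<And>z. z \<noteq> 0 \<Longrightarrow> (\<And>f d. polyfun f \<Longrightarrow> (\<And>k z. f (k *s z) = k ^ d * f z) \<Longrightarrow>
      (\<And>z'. z' \<noteq> 0 \<Longrightarrow> pt z' \<in> W \<Longrightarrow> f z' = 0) \<Longrightarrow> f z = 0) \<Longrightarrow> pt z \<in> W"
  shows "zclosed W"
proof -
  define S where "S = {P. (\<exists>d. homogeneous d P) \<and> (\<forall>z'. z' \<noteq> 0 \<longrightarrow> pt z' \<in> W \<longrightarrow> peval P z' = 0)}"
  have "W = zeros S"
  proof (intro subset_antisym subsetI)
    fix q assume "q \<in> W"
    then show "q \<in> zeros S" unfolding zeros_def S_def by (auto simp: hcoords_iff)
  next
    fix q assume q: "q \<in> zeros S"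
    obtain z where z: "z \<noteq> 0" "q = pt z" by (rule pt_cases)
    have "pt z \<in> W"
    proof (rule assms [OF z(1)])
      fix f d assume f: "polyfun f" "\<And>k z. f (k *s z) = k ^ d * f z" "\<And>z'. z' \<noteq> 0 \<Longrightarrow> pt z' \<in> W \<Longrightarrow> f z' = 0"
      obtain P where P: "\<And>x. peval P x = f x" using polyfun_ex [OF f(1)] by blast
      have "homogeneous d P" by (rule homogeneousI) (simp add: P f(2))
      then have "P \<in> S" unfolding S_def using f(3) P by auto
      then show "f z = 0" using q z pt_in_hcoords [OF z(1)] P unfolding zeros_def by auto
    qed
    then show "q \<in> W" using z by simp
  qed
  moreover have "\<forall>P\<in>S. \<exists>d. homogeneous d P" unfolding S_def by blast
  ultimately show ?thesis unfolding zclosed_def by blast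
qed

lemma zclosure_eqI:
  assumes "A \<subseteq> W" "zclosed W" "\<And>Z. zclosed Z \<Longrightarrow> A \<subseteq> Z \<Longrightarrow> W \<subseteq> Z"
  shows "zclosure A = W"
  unfolding zclosure_def using assms by blast

subsection \<open>Binary quadratic forms\<close>

lemma quadratic_vieta:
  fixes a b e :: complex
  assumes "a \<noteq> 0"
  obtains r1 r2 where "b = - a * (r1 + r2)" "e = a * (r1 * r2)"
proof -
  define s where "s = csqrt (b ^ 2 - 4 * a * e)"
  have s2: "s ^ 2 = b ^ 2 - 4 * a * e" by (simp add: s_def)
  define r1 r2 where "r1 = (- b + s) / (2 * a)" and "r2 = (- b - s) / (2 * a)"
  have sum: "r1 + r2 = - b / a" by (simp add: r1_def r2_def add_divide_distrib diff_divide_distrib)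
  have "r1 * r2 = (b ^ 2 - s ^ 2) / (4 * a ^ 2)" by (simp add: r1_def r2_def power2_eq_square algebra_simps)
  also have "b ^ 2 - s ^ 2 = 4 * a * e" by (simp add: s2)
  finally have prod: "r1 * r2 = e / a" using assms by (simp add: power2_eq_square)
  show ?thesis by (rule that [of r1 r2]) (use sum prod assms in simp_all)
qed

lemma binary_quadratic:
  fixes a b e :: complex
  assumes "a \<noteq> 0 \<or> b \<noteq> 0 \<or> e \<noteq> 0"
  obtains k c1 t1 c2 t2 where "k \<noteq> 0" "c1 \<noteq> 0 \<or> t1 \<noteq> 0" "c2 \<noteq> 0 \<or> t2 \<noteq> 0"
    "\<And>c t. c ^ 2 * a + c * t * b + t ^ 2 * e = k * (c * t1 - t * c1) * (c * t2 - t * c2)"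
    "b ^ 2 - 4 * a * e = (k * (t1 * c2 - c1 * t2)) ^ 2"
proof (cases "a = 0")
  case True
  show ?thesis
  proof (cases "b = 0")
    case b0: True
    show ?thesis by (rule that [of e 1 0 1 0]) (use assms True b0 in \<open>auto simp: power2_eq_square\<close>)
  next
    case False
    show ?thesis
      by (rule that [of "- 1" 1 0 "- e" b]) (use True False in \<open>auto simp: power2_eq_square algebra_simps\<close>)
  qed
next
  case False
  then obtain r1 r2 where ab: "b = - a * (r1 + r2)" "e = a * (r1 * r2)" by (rule quadratic_vieta)
  show ?thesis
    by (rule that [of a r1 1 r2 1]) (use False in \<open>simp_all add: ab power2_eq_square algebra_simps\<close>)
qed

text \<open>With \<open>|r| \<le> |r'|\<close> for the two roots, \<open>b = - a (r + r')\<close> and \<open>e = a r r'\<close> give both bounds for \<open>r\<close>.\<close>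

lemma quadratic_small_root:
  fixes a b e :: complex
  assumes "a \<noteq> 0 \<or> b \<noteq> 0"
  shows "\<exists>u. e + u * b + u ^ 2 * a = 0 \<and> norm u * norm b \<le> 2 * norm e \<and> norm u ^ 2 * norm a \<le> norm e"
proof (cases "a = 0")
  case True
  then have b: "b \<noteq> 0" using assms by simp
  show ?thesis
    by (rule exI [of _ "- e / b"]) (use b True in \<open>simp add: norm_divide\<close>)
next
  case False
  then obtain r1 r2 where ab: "b = - a * (r1 + r2)" "e = a * (r1 * r2)" by (rule quadratic_vieta)
  have main: ?thesis if le: "norm r \<le> norm r'" and ab': "b = - a * (r + r')" "e = a * (r * r')" for r r'
  proof (intro exI [of _ r] conjI)
    show "e + r * b + r ^ 2 * a = 0" by (simp add: ab' power2_eq_square algebra_simps)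
    have "norm (r + r') \<le> 2 * norm r'" using norm_triangle_ineq [of r r'] le by linarith
    then have "norm r * (norm a * norm (r + r')) \<le> norm r * (norm a * (2 * norm r'))" by (intro mult_left_mono) auto
    moreover have "norm b = norm a * norm (r + r')" "norm e = norm a * (norm r * norm r')" unfolding ab' by (simp_all only: norm_mult norm_minus_cancel)
    ultimately show "norm r * norm b \<le> 2 * norm e" by (simp only: mult_ac)
    have "norm r * norm r * norm a \<le> norm r * norm r' * norm a" using le by (intro mult_right_mono mult_left_mono) auto
    then show "norm r ^ 2 * norm a \<le> norm e" unfolding ab' norm_mult power2_eq_square by (simp only: mult_ac)
  qed
  show ?thesis
  proof (cases "norm r1 \<le> norm r2")
    case True then show ?thesis by (rule main) (rule ab)+
  next
    case False
    then have "norm r2 \<le> norm r1" by simp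
    then show ?thesis by (rule main) (simp_all only: ab add.commute mult.commute)
  qed
qed

section \<open>The blow-up at the vertex\<close>

context smooth_cone
begin

text \<open>A point of the blow-up is \<open>x \<otimes> m\<close> with \<open>x = c x0 + t M v\<close> on the line joining \<open>x0\<close> to the point of
  direction \<open>v\<close>, and \<open>m\<close> the vector of minors of \<open>x0\<close> and \<open>M v\<close>. The direction is recovered linearly from \<open>m\<close> by
  \<open>vm\<close>, and \<open>vr i\<close> applies this to the row \<open>i\<close> of the tensor, giving a multiple of \<open>v\<close>.\<close>

definition mm :: "complex^5 \<Rightarrow> complex^(6 \<times> 6)" where "mm v = minors x0 (M *v v)"
definition pnt :: "complex \<Rightarrow> complex \<Rightarrow> complex^5 \<Rightarrow> complex^(6 \<times> 6 \<times> 6)" where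
  "pnt c t v = segre (emb c (t *s v)) (mm v)"
definition vm :: "complex^(6 \<times> 6) \<Rightarrow> complex^5" where
  "vm m = R *v (\<chi> b. \<Sum>a\<in>UNIV. l $ a * m $ (a, b))"
definition vr :: "6 \<Rightarrow> complex^(6 \<times> 6 \<times> 6) \<Rightarrow> complex^5" where
  "vr i z = vm (\<chi> k. z $ (i, k))"
definition qf :: "complex \<Rightarrow> complex \<Rightarrow> complex^5 \<Rightarrow> complex" where
  "qf c t v = c ^ 2 * peval L v + c * t * peval Q v + t ^ 2 * peval K v"

lemma x0_emb: "emb 1 0 = x0" and Mv_emb: "M *v v = emb 0 v"
  by (simp_all add: emb_def)

lemma vm_mm [simp]: "vm (mm v) = v"
proof -
  have 1: "(\<Sum>a\<in>UNIV. l $ a * x0 $ a) = 1" using lc_emb [of 1 0] by (simp add: x0_emb lc_def)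
  have 2: "(\<Sum>a\<in>UNIV. l $ a * (M *v v) $ a) = 0" using lc_emb [of 0 v] by (simp add: Mv_emb lc_def)
  have "(\<Sum>a\<in>UNIV. l $ a * mm v $ (a, b)) = (\<Sum>a\<in>UNIV. l $ a * x0 $ a) * (M *v v) $ b - x0 $ b * (\<Sum>a\<in>UNIV. l $ a * (M *v v) $ a)" for b
    by (simp add: mm_def minors_def sum_distrib_left sum_distrib_right sum_subtractf [symmetric] algebra_simps)
  then have "(\<chi> b. \<Sum>a\<in>UNIV. l $ a * mm v $ (a, b)) = M *v v" unfolding 1 2 by (simp add: vec_eq_iff)
  then show ?thesis by (simp add: vm_def Mv_emb)
qed

lemma vm_scale: "vm (k *s m) = k *s vm m"
proof -
  have "(\<chi> b. \<Sum>a\<in>UNIV. l $ a * (k *s m) $ (a, b)) = k *s (\<chi> b. \<Sum>a\<in>UNIV. l $ a * m $ (a, b))"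
    by (simp add: vec_eq_iff sum_distrib_left mult_ac)
  then show ?thesis by (simp add: vm_def vector_scalar_commute)
qed

lemma mm_scale: "mm (k *s v) = k *s mm v"
  using minors_scale [of 1 x0 k "M *v v"] by (simp add: mm_def vector_scalar_commute)

lemma mm_eq_0: "mm v = 0 \<longleftrightarrow> v = 0"
proof
  assume "mm v = 0"
  then show "v = 0" using vm_mm [of v] vm_scale [of 0 "mm v"] by simp
qed (use mm_scale [of 0 0] in simp)

lemma vr_scale: "vr i (k *s z) = k *s vr i z"
proof -
  have "(\<chi> j. (k *s z) $ (i, j)) = k *s (\<chi> j. z $ (i, j))" by (simp add: vec_eq_iff)
  then show ?thesis by (simp add: vr_def vm_scale)
qed

lemma vr_segre: "vr i (segre x m) = x $ i *s vm m"
proof -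
  have "(\<chi> k. segre x m $ (i, k)) = x $ i *s m" by (simp add: vec_eq_iff)
  then show ?thesis by (simp add: vr_def vm_scale)
qed

lemma polyfun_vr: "polyfun (\<lambda>z. vr i z $ a)"
  unfolding vr_def vm_def matrix_vector_mult_def vec_lambda_beta
  by (intro polyfun_sum polyfun_mult polyfun_const polyfun_coord)

definition Tf :: "5 \<Rightarrow> 5 \<Rightarrow> complex^(6 \<times> 6 \<times> 6) \<Rightarrow> complex" where
  "Tf a b z = (\<Sum>j\<in>UNIV. R $ b $ j * vr j z $ a)"
definition Af :: "5 \<Rightarrow> complex^(6 \<times> 6 \<times> 6) \<Rightarrow> complex" where
  "Af a z = (\<Sum>j\<in>UNIV. l $ j * vr j z $ a)"

lemma Tf_segre: "Tf a b (segre x m) = (R *v x) $ b * vm m $ a"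
  by (simp add: Tf_def vr_segre matrix_vector_mult_def sum_distrib_left mult_ac)

lemma Af_segre: "Af a (segre x m) = lc x * vm m $ a"
  by (simp add: Af_def vr_segre lc_def sum_distrib_left mult_ac)

lemma Tf_scale: "Tf a b (k *s z) = k * Tf a b z" and Af_scale: "Af a (k *s z) = k * Af a z"
  by (simp_all add: Tf_def Af_def vr_scale sum_distrib_left mult_ac)

lemma polyfun_Tf: "polyfun (\<lambda>z. Tf a b z)" and polyfun_Af: "polyfun (\<lambda>z. Af a z)"
  unfolding Tf_def Af_def by (intro polyfun_sum polyfun_mult polyfun_const polyfun_vr)+

definition W :: "(6 \<times> 6 \<times> 6) pspace set" where
  "W = {pt (pnt c t v) | c t v. v \<noteq> 0 \<and> (c \<noteq> 0 \<or> t \<noteq> 0) \<and> peval C v = 0 \<and> qf c t v = 0}"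

lemma in_W: "v \<noteq> 0 \<Longrightarrow> c \<noteq> 0 \<or> t \<noteq> 0 \<Longrightarrow> peval C v = 0 \<Longrightarrow> qf c t v = 0 \<Longrightarrow> pt (pnt c t v) \<in> W"
  unfolding W_def by blast

lemma pnt_eq_0: "v \<noteq> 0 \<Longrightarrow> pnt c t v = 0 \<longleftrightarrow> c = 0 \<and> t = 0"
  by (auto simp: pnt_def segre_eq_0 mm_eq_0 vec.scale_eq_0_iff)

lemma W_cases:
  assumes "z \<noteq> 0" "pt z \<in> W"
  obtains k c t v where "k \<noteq> 0" "v \<noteq> 0" "c \<noteq> 0 \<or> t \<noteq> 0" "peval C v = 0" "qf c t v = 0" "z = segre (k *s emb c (t *s v)) (mm v)"
proof -
  obtain c t v where h: "pt z = pt (pnt c t v)" "v \<noteq> 0" "c \<noteq> 0 \<or> t \<noteq> 0" "peval C v = 0" "qf c t v = 0"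
    using assms(2) unfolding W_def by blast
  have "pnt c t v \<noteq> 0" using pnt_eq_0 [OF h(2)] h(3) by blast
  then obtain k where "k \<noteq> 0" "z = k *s pnt c t v" using h(1) pt_eq_iff assms(1) by blast
  then show ?thesis using that h segre_scale [of k "emb c (t *s v)" 1 "mm v"] by (simp add: pnt_def)
qed

lemma qf_scale: "qf c t (k *s v) = k * qf c (t * k) v"
  by (simp add: qf_def peval_homogeneous [OF hL] peval_homogeneous [OF hQ] peval_homogeneous [OF hK] power2_eq_square power3_eq_cube algebra_simps)

text \<open>The equation \<open>c\<^sup>2 L + c t Q + t\<^sup>2 K = 0\<close> in terms of the entries of the tensor, after multiplication by
  \<open>x\<^sub>i\<^sup>3 v\<^sub>a\<^sup>4\<close>: there \<open>Af a\<close> is \<open>c v\<^sub>a\<close>, \<open>Tf a a\<close> is \<open>t v\<^sub>a\<^sup>2\<close>, and \<open>vr i\<close> is \<open>x\<^sub>i v\<close>.\<close>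

definition Pf :: "5 \<Rightarrow> 6 \<Rightarrow> complex^(6 \<times> 6 \<times> 6) \<Rightarrow> complex" where
  "Pf a i z = Af a z ^ 2 * vr i z $ a ^ 2 * peval L (vr i z) + Af a z * Tf a a z * vr i z $ a * peval Q (vr i z) + Tf a a z ^ 2 * peval K (vr i z)"

lemma Pf_scale: "Pf a i (k *s z) = k ^ 5 * Pf a i z"
  by (simp add: Pf_def Af_scale Tf_scale vr_scale peval_homogeneous [OF hL] peval_homogeneous [OF hQ] peval_homogeneous [OF hK]
    power2_eq_square power3_eq_cube eval_nat_numeral algebra_simps)

lemma Pf_segre:
  assumes "R *v x = t *s v"
  shows "Pf a i (segre x (mm v)) = x $ i ^ 3 * v $ a ^ 4 * qf (lc x) t v"
  by (simp add: Pf_def Af_segre Tf_segre vr_segre assms qf_def peval_homogeneous [OF hL] peval_homogeneous [OF hQ] peval_homogeneous [OF hK]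
    power2_eq_square power3_eq_cube power4_eq_xxxx algebra_simps)

lemma lc_scale: "lc (k *s x) = k * lc x"
  by (simp add: lc_def sum_distrib_left mult_ac)

text \<open>The equations say that the tensor has rank one, that \<open>m\<close> is a vector of minors, that \<open>x\<close> lies on the line
  through \<open>x0\<close> in direction \<open>v\<close>, and that \<open>C\<close> and the quadratic equation hold.\<close>

lemma zclosed_W: "zclosed W"
proof (rule zclosed_by_equations)
  fix z :: "complex^(6 \<times> 6 \<times> 6)"
  assume z0: "z \<noteq> 0" and van: "\<And>f d. polyfun f \<Longrightarrow> (\<And>k z. f (k *s z) = k ^ d * f z) \<Longrightarrow>
      (\<And>z'. z' \<noteq> 0 \<Longrightarrow> pt z' \<in> W \<Longrightarrow> f z' = 0) \<Longrightarrow> f z = 0"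
  have vanW: "f z = 0" if f: "polyfun f" "\<And>k z. f (k *s z) = k ^ d * f z"
    and w: "\<And>k c t v. v \<noteq> 0 \<Longrightarrow> peval C v = 0 \<Longrightarrow> qf c t v = 0 \<Longrightarrow> f (segre (k *s emb c (t *s v)) (mm v)) = 0" for f d
    by (rule van [OF f]) (metis W_cases w)
  have E1: "z $ (i, k) * z $ (i', k') = z $ (i, k') * z $ (i', k)" for i k i' k'
  proof -
    have "(\<lambda>z. z $ (i, k) * z $ (i', k') - z $ (i, k') * z $ (i', k)) z = 0"
      by (rule vanW [of _ 2]) (intro polyfun_diff polyfun_mult polyfun_coord, simp_all add: power2_eq_square algebra_simps)
    then show ?thesis by simp
  qed
  obtain x m where xm: "x \<noteq> 0" "m \<noteq> 0" "z = segre x m" by (rule rank_one_segre [OF z0 E1])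
  obtain i where i: "x $ i \<noteq> 0" using xm(1) by (auto simp: vec_eq_iff)
  define v where "v = vm m"
  have mm_lin: "polyfun (\<lambda>z. mm (vr i z) $ k)" for k
    unfolding mm_def minors_def matrix_vector_mult_def vec_lambda_beta
    by (intro polyfun_diff polyfun_sum polyfun_mult polyfun_const polyfun_vr)
  have "z $ (i, k) - mm (vr i z) $ k = 0" for k
  proof -
    have "(\<lambda>z. z $ (i, k) - mm (vr i z) $ k) z = 0"
      by (rule vanW [of _ 1]) (intro polyfun_diff polyfun_coord mm_lin, simp_all add: vr_scale vr_segre mm_scale algebra_simps)
    then show ?thesis by simp
  qed
  then have "x $ i * m $ k = x $ i * mm v $ k" for k by (simp add: xm(3) vr_segre mm_scale v_def)
  then have m: "m = mm v" using i by (simp add: vec_eq_iff)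
  have v0: "v \<noteq> 0" using xm(2) m mm_eq_0 by blast
  have "Tf a b z - Tf b a z = 0" for a b
  proof -
    have "(\<lambda>z. Tf a b z - Tf b a z) z = 0"
      by (rule vanW [of _ 1]) (intro polyfun_diff polyfun_Tf, simp_all add: Tf_scale Tf_segre vector_scalar_commute algebra_simps)
    then show ?thesis by simp
  qed
  then have T: "(R *v x) $ b * v $ a = (R *v x) $ a * v $ b" for a b by (simp add: xm(3) Tf_segre m)
  obtain a where a: "v $ a \<noteq> 0" using v0 by (auto simp: vec_eq_iff)
  define t where "t = (R *v x) $ a / v $ a"
  have t: "R *v x = t *s v" unfolding vec_eq_iff using T [of _ a] a by (simp add: t_def field_simps)
  have x: "x = emb (lc x) (t *s v)" using emb_decomp [of x] by (simp add: t)
  have "peval C (vr i z) = 0"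
    by (rule vanW [of "\<lambda>z. peval C (vr i z)" 3]) (intro polyfun_comp polyfun_vr, simp_all add: vr_scale vr_segre peval_homogeneous [OF hC])
  then have C: "peval C v = 0" using i by (simp add: xm(3) vr_segre m peval_homogeneous [OF hC])
  have "Pf a i z = 0"
  proof (rule vanW [of "Pf a i" 5])
    show "polyfun (Pf a i)" unfolding Pf_def
      by (intro polyfun_add polyfun_mult polyfun_power polyfun_Af polyfun_Tf polyfun_vr polyfun_comp)
    show "Pf a i (segre (k *s emb c (t *s v)) (mm v)) = 0" if "qf c t v = 0" for k c t v
    proof -
      have "qf (k * c) (k * t) v = k ^ 2 * qf c t v" by (simp add: qf_def power2_eq_square algebra_simps)
      moreover have R: "R *v (k *s emb c (t *s v)) = (k * t) *s v" by (simp add: vector_scalar_commute vector_smult_assoc)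
      ultimately show ?thesis unfolding Pf_segre [OF R] using that by (simp add: lc_scale)
    qed
  qed (rule Pf_scale)
  then have q: "qf (lc x) t v = 0" using Pf_segre [OF t, of a i] i a by (simp add: xm(3) m)
  have "x = 0" if "lc x = 0" "t = 0" using x unfolding that by simp
  then have "lc x \<noteq> 0 \<or> t \<noteq> 0" using xm(1) by blast
  then have "pt (pnt (lc x) t v) \<in> W" by (rule in_W [OF v0 _ C q])
  moreover have "z = pnt (lc x) t v" unfolding pnt_def x [symmetric] using xm(3) m by simp
  ultimately show "pt z \<in> W" by simp
qed

subsection \<open>The blow-up contains the tangent directions\<close>

lemma qf_0_t: "qf c 0 v = c ^ 2 * peval L v"
  by (simp add: qf_def)

lemma C_root_direction:
  obtains e where "peval C e \<noteq> 0" "peval L e = 0"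
proof -
  have "proj C \<noteq> 0" using prime_proj_C by (simp add: prime_elem_def)
  then obtain x where "peval (proj C) x \<noteq> 0" using peval_nonzero_ex by blast
  then show ?thesis using that [of "prj x"] by simp
qed

text \<open>A tangent direction with \<open>C = L = 0\<close> is approached by points of \<open>X\<close>: leave \<open>L = 0\<close> inside \<open>C = 0\<close>, and take the small
  root \<open>u = 1 / c\<close> of \<open>L + u Q + u\<^sup>2 K\<close>. If \<open>Q\<close> and \<open>K\<close> vanish as well, the line in this direction lies on \<open>X\<close>.\<close>

lemma approximation:
  assumes v: "v \<noteq> 0" "peval C v = 0" "peval L v = 0"
  obtains w u where "w \<longlonglongrightarrow> v" "u \<longlonglongrightarrow> 0" "\<And>n. peval C (w n) = 0"
    "eventually (\<lambda>n. u n \<noteq> 0 \<and> qf 1 (u n) (w n) = 0) sequentially"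
proof (cases "peval K v = 0 \<and> peval Q v = 0")
  case True
  show ?thesis
  proof (rule that [of "\<lambda>n. v" "\<lambda>n. complex_of_real (inverse (real (Suc n)))"])
    show "(\<lambda>n. complex_of_real (inverse (real (Suc n)))) \<longlonglongrightarrow> 0"
      using tendsto_of_real [OF LIMSEQ_inverse_real_of_nat, where ?'a = complex] by simp
  qed (use v True in \<open>simp_all add: qf_def del: of_nat_Suc\<close>)
next
  case False
  obtain e where e: "peval C e \<noteq> 0" "peval L e = 0" by (rule C_root_direction)
  define x where "x n = v + complex_of_real (inverse (real (Suc n))) *s c0" for n
  have "x \<longlonglongrightarrow> v + complex_of_real 0 *s c0" unfolding x_def by (intro tendsto_intros LIMSEQ_inverse_real_of_nat)
  then have xl: "x \<longlonglongrightarrow> v" by simp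
  have "0 < (3::nat)" by simp
  from root_limit [OF hC this e(1) xl v(2)] obtain t where t: "t \<longlonglongrightarrow> 0" "\<And>n. peval C (x n + t n *s e) = 0" by blast
  define w where "w n = x n + t n *s e" for n
  have "w \<longlonglongrightarrow> v + 0 *s e" unfolding w_def by (intro tendsto_intros xl t)
  then have wl: "w \<longlonglongrightarrow> v" by simp
  have Lw: "peval L (w n) \<noteq> 0" for n
    by (simp add: w_def x_def linear_form_add [OF hL] linear_form_scale [OF hL] v e del: of_nat_Suc)
  have "\<exists>u. (peval K (w n) \<noteq> 0 \<or> peval Q (w n) \<noteq> 0) \<longrightarrow> peval L (w n) + u * peval Q (w n) + u ^ 2 * peval K (w n) = 0 \<and>
      norm u * norm (peval Q (w n)) \<le> 2 * norm (peval L (w n)) \<and> norm u ^ 2 * norm (peval K (w n)) \<le> norm (peval L (w n))" for n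
    using quadratic_small_root [of "peval K (w n)" "peval Q (w n)" "peval L (w n)"] by blast
  then obtain u where u: "\<And>n. peval K (w n) \<noteq> 0 \<or> peval Q (w n) \<noteq> 0 \<Longrightarrow> peval L (w n) + u n * peval Q (w n) + u n ^ 2 * peval K (w n) = 0 \<and>
      norm (u n) * norm (peval Q (w n)) \<le> 2 * norm (peval L (w n)) \<and> norm (u n) ^ 2 * norm (peval K (w n)) \<le> norm (peval L (w n))" by metis
  have lim: "(\<lambda>n. peval P (w n)) \<longlonglongrightarrow> peval P v" for P by (rule tendsto_peval [OF wl])
  have evnz: "eventually (\<lambda>n. peval P (w n) \<noteq> 0) sequentially" if "peval P v \<noteq> 0" for P
    using tendsto_imp_eventually_ne [OF lim that] .
  have ev: "eventually (\<lambda>n. peval K (w n) \<noteq> 0 \<or> peval Q (w n) \<noteq> 0) sequentially"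
    using False evnz [of K] evnz [of Q] by (auto elim: eventually_mono)
  have ul: "u \<longlonglongrightarrow> 0"
  proof (cases "peval Q v = 0")
    case False
    have "(\<lambda>n. 2 * norm (peval L (w n)) / norm (peval Q (w n))) \<longlonglongrightarrow> 2 * norm (peval L v) / norm (peval Q v)"
      by (intro tendsto_intros lim) (use False in simp)
    then have l0: "(\<lambda>n. 2 * norm (peval L (w n)) / norm (peval Q (w n))) \<longlonglongrightarrow> 0" using v by simp
    have "(\<lambda>n. norm (u n)) \<longlonglongrightarrow> 0"
    proof (rule real_tendsto_sandwich [OF _ _ tendsto_const l0])
      show "eventually (\<lambda>n. norm (u n) \<le> 2 * norm (peval L (w n)) / norm (peval Q (w n))) sequentially"
        using evnz [OF False] by (rule eventually_mono) (use u in \<open>simp add: pos_le_divide_eq\<close>)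
    qed simp
    then show ?thesis by (rule tendsto_norm_zero_cancel)
  next
    case True
    then have K0: "peval K v \<noteq> 0" using False by simp
    have "(\<lambda>n. norm (peval L (w n)) / norm (peval K (w n))) \<longlonglongrightarrow> norm (peval L v) / norm (peval K v)"
      by (intro tendsto_intros lim) (use K0 in simp)
    then have l0: "(\<lambda>n. norm (peval L (w n)) / norm (peval K (w n))) \<longlonglongrightarrow> 0" using v by simp
    have "(\<lambda>n. norm (u n) ^ 2) \<longlonglongrightarrow> 0"
    proof (rule real_tendsto_sandwich [OF _ _ tendsto_const l0])
      show "eventually (\<lambda>n. norm (u n) ^ 2 \<le> norm (peval L (w n)) / norm (peval K (w n))) sequentially"
        using evnz [OF K0] by (rule eventually_mono) (use u in \<open>simp add: pos_le_divide_eq\<close>)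
    qed simp
    from tendsto_real_root [OF this, of 2] have "(\<lambda>n. norm (u n)) \<longlonglongrightarrow> 0" by (simp add: real_root_power_cancel)
    then show ?thesis by (rule tendsto_norm_zero_cancel)
  qed
  have "eventually (\<lambda>n. u n \<noteq> 0 \<and> qf 1 (u n) (w n) = 0) sequentially"
    using ev
  proof (rule eventually_mono)
    fix n assume "peval K (w n) \<noteq> 0 \<or> peval Q (w n) \<noteq> 0"
    then have eq: "peval L (w n) + u n * peval Q (w n) + u n ^ 2 * peval K (w n) = 0" using u by blast
    then have "u n \<noteq> 0" using Lw [of n] by auto
    then show "u n \<noteq> 0 \<and> qf 1 (u n) (w n) = 0" using eq by (simp add: qf_def)
  qed
  then show ?thesis by (intro that [OF wl ul]) (simp_all add: w_def t)
qed

definition graph :: "(6 \<times> 6 \<times> 6) pspace set" where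
  "graph = {pt (segre x (minors y x)) | x y q. q \<in> X - {pt x0} \<and> x \<in> hcoords q \<and> y \<in> hcoords (pt x0)}"

lemma x0_nz: "x0 \<noteq> 0"
  using emb_eq_0 [of 1 0] by (simp add: x0_emb)

lemma emb_in_X: "emb c v \<noteq> 0 \<Longrightarrow> pt (emb c v) \<in> X \<longleftrightarrow> peval C v = 0 \<and> qf c 1 v = 0"
  using pt_in_zeros [of "{H, G}" "emb c v"] hH hG by (auto simp: XZ H_emb G_emb qf_def)

lemma minors_emb: "minors x0 (emb c v) = mm v"
  by (simp add: vec_eq_iff minors_def mm_def emb_def algebra_simps)

lemma graph_eq: "graph = {pt (pnt c 1 v) | c v. v \<noteq> 0 \<and> peval C v = 0 \<and> qf c 1 v = 0}"
proof (intro subset_antisym subsetI)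
  fix w assume "w \<in> graph"
  then obtain x y q where h: "w = pt (segre x (minors y x))" "q \<in> X" "q \<noteq> pt x0" "x \<in> hcoords q" "y \<in> hcoords (pt x0)"
    unfolding graph_def by blast
  obtain a where a: "a \<noteq> 0" "y = a *s x0" using h(5) hcoords_pt [OF x0_nz] by blast
  have x: "x \<noteq> 0" "pt x = q" using h(4) by (auto simp: hcoords_iff)
  define c v where "c = lc x" and "v = R *v x"
  have xe: "x = emb c v" by (simp add: c_def v_def emb_decomp)
  have v0: "v \<noteq> 0"
  proof
    assume "v = 0"
    then have "x = c *s x0" using xe by (simp add: emb_def)
    then have "pt x = pt x0" using x(1) x0_nz by (metis pt_scale vec.scale_zero_left)
    then show False using h(3) x(2) by simp
  qed
  have eqs: "peval C v = 0 \<and> qf c 1 v = 0" using emb_in_X [of c v] x h(2) unfolding xe by simp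
  have "segre x (minors y x) = a *s pnt c 1 v"
    using segre_scale [of 1 x a "mm v"] minors_scale [of a x0 1 x] by (simp add: a xe minors_emb pnt_def)
  moreover have "pnt c 1 v \<noteq> 0" using pnt_eq_0 [OF v0] by simp
  ultimately have "w = pt (pnt c 1 v)" using h(1) pt_scale [OF a(1)] by simp
  then show "w \<in> {pt (pnt c 1 v) | c v. v \<noteq> 0 \<and> peval C v = 0 \<and> qf c 1 v = 0}" using v0 eqs by blast
next
  fix w assume "w \<in> {pt (pnt c 1 v) | c v. v \<noteq> 0 \<and> peval C v = 0 \<and> qf c 1 v = 0}"
  then obtain c v where h: "w = pt (pnt c 1 v)" "v \<noteq> 0" "peval C v = 0" "qf c 1 v = 0" by blast
  have nz: "emb c v \<noteq> 0" using h(2) by simp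
  have "pt (emb c v) \<in> X" using emb_in_X [OF nz] h by blast
  moreover have "pt (emb c v) \<noteq> pt x0"
  proof
    assume "pt (emb c v) = pt x0"
    then obtain k where "emb c v = k *s emb 1 0" using pt_eq_iff [OF nz x0_nz] by (auto simp: x0_emb)
    then show False using h(2) by (simp add: emb_scale emb_inj)
  qed
  moreover have "w = pt (segre (emb c v) (minors x0 (emb c v)))" using h(1) by (simp add: pnt_def minors_emb)
  ultimately show "w \<in> graph" unfolding graph_def using pt_in_hcoords [OF nz] pt_in_hcoords [OF x0_nz] by blast
qed

lemma pnt_scale: "pnt c t (k *s v) = k *s pnt c (t * k) v"
  using segre_scale [of 1 "emb c ((t * k) *s v)" k "mm v"] by (simp add: pnt_def mm_scale vector_smult_assoc)

lemma pnt_hom: "pnt (k * c) (k * t) v = k *s pnt c t v"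
  using segre_scale [of k "emb c (t *s v)" 1 "mm v"] by (simp add: pnt_def emb_scale vector_smult_assoc)

lemma qf_hom: "qf (k * c) (k * t) v = k ^ 2 * qf c t v"
  by (simp add: qf_def power2_eq_square algebra_simps)

lemma in_graph:
  assumes "v \<noteq> 0" "t \<noteq> 0" "peval C v = 0" "qf c t v = 0" shows "pt (pnt c t v) \<in> graph"
proof -
  have "pnt c t v = t *s pnt (c / t) 1 v" using pnt_hom [of t "c / t" 1 v] assms(2) by simp
  moreover have "qf (c / t) 1 v = 0" using qf_hom [of t "c / t" 1 v] assms by simp
  moreover have "pnt (c / t) 1 v \<noteq> 0" using pnt_eq_0 [OF assms(1)] by simp
  ultimately show ?thesis unfolding graph_eq using assms pt_scale by auto
qed

text \<open>The points with \<open>t \<noteq> 0\<close> are those of the graph. The others have \<open>L v = 0\<close> and are limits of points of the graph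
  in the usual topology, so every closed set containing the graph contains them.\<close>

lemma blowup_eq: "blowup X (pt x0) = W"
proof -
  have "zclosure graph = W"
  proof (rule zclosure_eqI [OF _ zclosed_W])
    show "graph \<subseteq> W" unfolding graph_eq using in_W [of _ _ 1] by auto
    fix Z assume Z: "zclosed Z" "graph \<subseteq> Z"
    show "W \<subseteq> Z"
    proof
      fix w assume "w \<in> W"
      then obtain c t v where h: "w = pt (pnt c t v)" "v \<noteq> 0" "c \<noteq> 0 \<or> t \<noteq> 0" "peval C v = 0" "qf c t v = 0"
        unfolding W_def by blast
      show "w \<in> Z"
      proof (cases "t = 0")
        case False then show ?thesis using in_graph h Z(2) by blast
      next
        case t0: True
        then have c: "c \<noteq> 0" and L: "peval L v = 0" using h by (auto simp: qf_0_t)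
        have wp: "w = pt (pnt 1 0 v)"
          using h(1) t0 pnt_hom [of c 1 0 v] pt_scale [OF c, of "pnt 1 0 v"] pnt_eq_0 [OF h(2), of 1 0] by simp
        show ?thesis
        proof (rule ccontr)
          assume "w \<notin> Z"
          then obtain P d where P: "homogeneous d P" "P \<in> vanishing_ideal Z" "\<exists>x\<in>hcoords w. peval P x \<noteq> 0"
            using zclosed_separate [OF Z(1)] by metis
          have nz: "pnt 1 0 v \<noteq> 0" using pnt_eq_0 [OF h(2)] by simp
          have P0: "peval P (pnt 1 0 v) \<noteq> 0" using P(3) vanish_hcoords [OF P(1) nz] wp by blast
          obtain y u where yu: "y \<longlonglongrightarrow> v" "u \<longlonglongrightarrow> 0" "\<And>n. peval C (y n) = 0"
            "eventually (\<lambda>n. u n \<noteq> 0 \<and> qf 1 (u n) (y n) = 0) sequentially" by (rule approximation [OF h(2,4) L]) blast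
          have ynz: "eventually (\<lambda>n. y n \<noteq> 0) sequentially" by (rule tendsto_imp_eventually_ne [OF yu(1) h(2)])
          have mlim: "(\<lambda>n. mm (y n)) \<longlonglongrightarrow> mm v"
          proof (rule vec_tendstoI)
            fix k
            show "(\<lambda>n. mm (y n) $ k) \<longlonglongrightarrow> mm v $ k" unfolding mm_def minors_def vec_lambda_beta
              by (intro tendsto_diff tendsto_mult tendsto_const tendsto_vec_nth tendsto_matrix_mult yu)
          qed
          have elim: "(\<lambda>n. emb 1 (u n *s y n)) \<longlonglongrightarrow> emb 1 (0 *s v)" unfolding emb_def by (intro tendsto_intros yu)
          have "(\<lambda>n. pnt 1 (u n) (y n)) \<longlonglongrightarrow> pnt 1 0 v"
          proof (rule vec_tendstoI)
            fix k show "(\<lambda>n. pnt 1 (u n) (y n) $ k) \<longlonglongrightarrow> pnt 1 0 v $ k"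
              unfolding pnt_def segre_def vec_lambda_beta by (intro tendsto_mult tendsto_vec_nth elim mlim)
          qed
          from tendsto_peval [OF this] have lim: "(\<lambda>n. peval P (pnt 1 (u n) (y n))) \<longlonglongrightarrow> peval P (pnt 1 0 v)" .
          have "eventually (\<lambda>n. peval P (pnt 1 (u n) (y n)) = 0) sequentially"
            using ynz yu(4)
          proof eventually_elim
            case (elim n)
            then have "pt (pnt 1 (u n) (y n)) \<in> Z" using in_graph yu(3) Z(2) by blast
            moreover have "pnt 1 (u n) (y n) \<noteq> 0" using pnt_eq_0 [of "y n"] elim by simp
            ultimately show ?case using vanishing_idealD [OF P(2)] pt_in_hcoords by blast
          qed
          then have "(\<lambda>n. peval P (pnt 1 (u n) (y n))) \<longlonglongrightarrow> 0" by (rule tendsto_eventually)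
          then show False using LIMSEQ_unique [OF lim] P0 by blast
        qed
      qed
    qed
  qed
  then show ?thesis by (simp add: blowup_def graph_def)
qed

end

section \<open>The double cover\<close>

context smooth_cone
begin

definition Y :: "5 pspace set" where "Y = zeros {C}"

lemma pt_in_Y: "v \<noteq> 0 \<Longrightarrow> pt v \<in> Y \<longleftrightarrow> peval C v = 0"
  using pt_in_zeros [of "{C}" v] hC by (auto simp: Y_def)

lemma irreducible_Y: "zirreducible Y"
  unfolding zirreducible_def
proof (intro conjI allI impI)
  show cl: "zclosed Y" unfolding Y_def by (rule zclosed_zeros) (use hC in blast)
  obtain y where "y \<noteq> 0" "peval C y = 0" using branch_nonempty by blast
  then show "Y \<noteq> {}" using pt_in_Y by blast
  fix A B assume AB: "zclosed A \<and> zclosed B \<and> Y = A \<union> B"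
  show "Y = A \<or> Y = B"
  proof (rule ccontr)
    assume "\<not> (Y = A \<or> Y = B)"
    then obtain q1 q2 where q: "q1 \<in> Y" "q1 \<notin> A" "q2 \<in> Y" "q2 \<notin> B" using AB by blast
    obtain P d where P: "homogeneous d P" "P \<in> vanishing_ideal A" "\<exists>x\<in>hcoords q1. peval P x \<noteq> 0"
      using zclosed_separate AB q(2) by metis
    obtain P' d' where P': "homogeneous d' P'" "P' \<in> vanishing_ideal B" "\<exists>x\<in>hcoords q2. peval P' x \<noteq> 0"
      using zclosed_separate AB q(4) by metis
    have "C dvd (P * P' * L)"
    proof (rule hypersurface_nullstellensatz [OF prime_C hC])
      fix x assume x: "peval C x = 0"
      show "peval (P * P' * L) x = 0"
      proof (cases "x = 0")
        case True then show ?thesis using homogeneous_nonzero_at_0 [OF hL] by simp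
      next
        case False
        then have "pt x \<in> A \<or> pt x \<in> B" using pt_in_Y x AB by blast
        then show ?thesis using vanishing_idealD [OF P(2)] vanishing_idealD [OF P'(2)] pt_in_hcoords [OF False] by auto
      qed
    qed
    from prime_elem_dvd_multD [OF prime_C this] have "C dvd P * P'"
      using C_not_dvd_low [OF hL L0] by simp
    then have "C dvd P \<or> C dvd P'" by (rule prime_elem_dvd_multD [OF prime_C])
    moreover have "peval C x = 0" if "x \<in> hcoords q" "q \<in> Y" for x q
      using that unfolding Y_def zeros_def by blast
    ultimately show False using P(3) P'(3) q(1,3) by (auto simp: dvd_def)
  qed
qed

text \<open>The projection to the direction \<open>v\<close>; the choice of the representative and of the row does not matter.\<close>

definition \<phi> :: "(6 \<times> 6 \<times> 6) pspace \<Rightarrow> 5 pspace" where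
  "\<phi> w = (let z = (SOME z. z \<in> hcoords w) in pt (vr (SOME i. vr i z \<noteq> 0) z))"

lemma vr_pnt: "vr i (k *s pnt c t v) = (k * emb c (t *s v) $ i) *s v"
  by (simp add: pnt_def vr_scale vr_segre vector_smult_assoc)

lemma vr_pnt_ex:
  assumes "v \<noteq> 0" "c \<noteq> 0 \<or> t \<noteq> 0" "k \<noteq> 0" shows "\<exists>i. vr i (k *s pnt c t v) \<noteq> 0"
proof -
  have "emb c (t *s v) \<noteq> 0" using assms(1,2) by (auto simp: vec.scale_eq_0_iff)
  then obtain i where "emb c (t *s v) $ i \<noteq> 0" by (auto simp: vec_eq_iff)
  then show ?thesis using assms by (auto simp: vr_pnt vec.scale_eq_0_iff)
qed

lemma hcoords_pnt:
  assumes "v \<noteq> 0" "c \<noteq> 0 \<or> t \<noteq> 0"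
  shows "z \<in> hcoords (pt (pnt c t v)) \<longleftrightarrow> (\<exists>k. k \<noteq> 0 \<and> z = k *s pnt c t v)"
  by (rule hcoords_pt) (use pnt_eq_0 [OF assms(1)] assms(2) in blast)

lemma pt_vr_pnt:
  assumes "v \<noteq> 0" "vr i (k *s pnt c t v) \<noteq> 0" shows "pt (vr i (k *s pnt c t v)) = pt v"
proof -
  have "k * emb c (t *s v) $ i \<noteq> 0" using assms(2) by (auto simp: vr_pnt)
  then show ?thesis unfolding vr_pnt by (rule pt_scale [OF _ assms(1)])
qed

lemma phi_pnt:
  assumes v: "v \<noteq> 0" "c \<noteq> 0 \<or> t \<noteq> 0" shows "\<phi> (pt (pnt c t v)) = pt v"
proof -
  define z where "z = (SOME z. z \<in> hcoords (pt (pnt c t v)))"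
  have "z \<in> hcoords (pt (pnt c t v))" unfolding z_def by (rule someI_ex [OF hcoords_nonempty])
  then obtain k where k: "k \<noteq> 0" "z = k *s pnt c t v" using hcoords_pnt [OF v] by blast
  have "vr (SOME i. vr i z \<noteq> 0) z \<noteq> 0" by (rule someI_ex) (use vr_pnt_ex [OF v k(1)] k(2) in simp)
  then have "pt (vr (SOME i. vr i z \<noteq> 0) z) = pt v" using pt_vr_pnt [OF v(1)] unfolding k(2) by blast
  then show ?thesis by (simp add: \<phi>_def Let_def flip: z_def)
qed

lemma regular_phi: "regular_map W \<phi>"
  unfolding regular_map_def
proof
  fix w assume "w \<in> W"
  then obtain c t v where w: "w = pt (pnt c t v)" "v \<noteq> 0" "c \<noteq> 0 \<or> t \<noteq> 0" unfolding W_def by blast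
  obtain i where i: "vr i (1 *s pnt c t v) \<noteq> 0" using vr_pnt_ex [OF w(2,3), of 1] by auto
  have "\<exists>P. \<forall>z. peval P z = vr i z $ j" for j by (rule polyfun_ex [OF polyfun_vr])
  then obtain f where f: "\<And>j z. peval (f j) z = vr i z $ j" by metis
  have hf: "homogeneous 1 (f j)" for j by (rule homogeneousI) (simp add: f vr_scale)
  have vf: "(\<chi> j. peval (f j) z) = vr i z" for z by (simp add: vec_eq_iff f)
  let ?A = "zeros (range f)"
  have cl: "zclosed ?A" by (rule zclosed_zeros) (use hf in blast)
  have wA: "w \<notin> ?A"
  proof
    assume "w \<in> ?A"
    moreover have "1 *s pnt c t v \<in> hcoords w" using hcoords_pnt [OF w(2,3)] w(1) by (metis zero_neq_one)
    ultimately have "vr i (1 *s pnt c t v) $ j = 0" for j unfolding zeros_def by (auto simp flip: f)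
    then show False using i by (simp add: vec_eq_iff)
  qed
  have u: "vr i x \<noteq> 0 \<and> \<phi> u = pt (vr i x)" if u: "u \<in> W - ?A" "x \<in> hcoords u" for u x
  proof -
    obtain c t v where w: "u = pt (pnt c t v)" "v \<noteq> 0" "c \<noteq> 0 \<or> t \<noteq> 0" using u(1) unfolding W_def by blast
    obtain k where k: "k \<noteq> 0" "x = k *s pnt c t v" using u(2) hcoords_pnt [OF w(2,3)] w(1) by blast
    have nz: "vr i x \<noteq> 0"
    proof
      assume 0: "vr i x = 0"
      have "vr i (pnt c t v) = 0" using 0 k vr_scale [of i k "pnt c t v"] by (simp add: vec.scale_eq_0_iff)
      then have "peval (f j) y = 0" if "y \<in> hcoords u" for j y
        using that hcoords_pnt [OF w(2,3)] w(1) by (auto simp: f vr_scale)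
      then have "u \<in> ?A" unfolding zeros_def by blast
      then show False using u(1) by blast
    qed
    then show ?thesis using phi_pnt [OF w(2,3)] pt_vr_pnt [OF w(2)] w(1) k(2) by simp
  qed
  show "\<exists>A d (f :: 5 \<Rightarrow> (6 \<times> 6 \<times> 6) mpoly). zclosed A \<and> w \<notin> A \<and> (\<forall>j. homogeneous d (f j)) \<and>
        (\<forall>u\<in>W - A. \<forall>x\<in>hcoords u. (\<chi> j. peval (f j) x) \<noteq> 0 \<and> \<phi> u = pt (\<chi> j. peval (f j) x))"
    by (rule exI [of _ ?A], rule exI [of _ 1], rule exI [of _ f], unfold vf) (use cl wA hf u in blast)
qed

lemma fibre_eq:
  assumes v: "v \<noteq> 0" "peval C v = 0"
  shows "fibre W \<phi> (pt v) = {pt (pnt c t v) | c t. (c \<noteq> 0 \<or> t \<noteq> 0) \<and> qf c t v = 0}"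
proof (intro subset_antisym subsetI)
  fix w assume "w \<in> fibre W \<phi> (pt v)"
  then obtain c t v' where w: "w = pt (pnt c t v')" "v' \<noteq> 0" "c \<noteq> 0 \<or> t \<noteq> 0" "qf c t v' = 0" "\<phi> w = pt v"
    unfolding fibre_def W_def by blast
  then have "pt v' = pt v" using phi_pnt by metis
  then obtain k where k: "k \<noteq> 0" "v' = k *s v" using pt_eq_iff w(2) v(1) by blast
  have ct: "c \<noteq> 0 \<or> t * k \<noteq> 0" using w(3) k(1) by simp
  have "w = pt (pnt c (t * k) v)" using w(1) pt_scale [OF k(1), of "pnt c (t * k) v"] pnt_eq_0 [OF v(1)] ct by (simp add: k(2) pnt_scale)
  moreover have "qf c (t * k) v = 0" using w(4) k by (simp add: qf_scale)
  ultimately show "w \<in> {pt (pnt c t v) | c t. (c \<noteq> 0 \<or> t \<noteq> 0) \<and> qf c t v = 0}" using ct by blast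
next
  fix w assume "w \<in> {pt (pnt c t v) | c t. (c \<noteq> 0 \<or> t \<noteq> 0) \<and> qf c t v = 0}"
  then obtain c t where w: "w = pt (pnt c t v)" "c \<noteq> 0 \<or> t \<noteq> 0" "qf c t v = 0" by blast
  then show "w \<in> fibre W \<phi> (pt v)" unfolding fibre_def using in_W [OF v(1) w(2) v(2) w(3)] phi_pnt [OF v(1) w(2)] by blast
qed

lemma pnt_inj:
  assumes v: "v \<noteq> 0" and ct: "c \<noteq> 0 \<or> t \<noteq> 0" and ct': "c' \<noteq> 0 \<or> t' \<noteq> 0"
  shows "pt (pnt c t v) = pt (pnt c' t' v) \<longleftrightarrow> c * t' = t * c'"
proof
  have nz: "pnt c t v \<noteq> 0" "pnt c' t' v \<noteq> 0" using pnt_eq_0 [OF v] ct ct' by blast+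
  assume "pt (pnt c t v) = pt (pnt c' t' v)"
  then obtain k where "pnt c t v = k *s pnt c' t' v" using pt_eq_iff [OF nz] by blast
  then have "emb c (t *s v) = k *s emb c' (t' *s v)" unfolding pnt_def
    by (rule segre_cancel) (use v mm_eq_0 in blast)
  then have "c = k * c'" "t *s v = (k * t') *s v" by (simp_all add: emb_scale emb_inj vector_smult_assoc)
  then have "c = k * c'" "t = k * t'" using v vec.scale_right_imp_eq by blast+
  then show "c * t' = t * c'" by simp
next
  assume eq: "c * t' = t * c'"
  define k where "k = (if c' = 0 then t / t' else c / c')"
  have k: "c = k * c'" "t = k * t'" using eq ct' by (auto simp: k_def field_simps)
  then have k0: "k \<noteq> 0" using ct by auto
  have "pnt c' t' v \<noteq> 0" using pnt_eq_0 [OF v] ct' by blast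
  then show "pt (pnt c t v) = pt (pnt c' t' v)" using pt_scale [OF k0] by (simp add: k pnt_hom)
qed

text \<open>The fibre over \<open>v\<close> is the set of zeros \<open>(c : t)\<close> of the binary quadratic form with coefficients \<open>L v\<close>, \<open>Q v\<close>, \<open>K v\<close>,
  whose discriminant is \<open>D v\<close>. It is a line if all three vanish.\<close>

lemma fibre_card:
  assumes v: "v \<noteq> 0" "peval C v = 0"
  shows "card (fibre W \<phi> (pt v)) = 2 \<longleftrightarrow> peval D v \<noteq> 0" "finite (fibre W \<phi> (pt v)) \<Longrightarrow> card (fibre W \<phi> (pt v)) \<le> 2"
proof -
  have "(card (fibre W \<phi> (pt v)) = 2 \<longleftrightarrow> peval D v \<noteq> 0) \<and> (finite (fibre W \<phi> (pt v)) \<longrightarrow> card (fibre W \<phi> (pt v)) \<le> 2)"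
  proof (cases "peval L v \<noteq> 0 \<or> peval Q v \<noteq> 0 \<or> peval K v \<noteq> 0")
    case False
    have "inj (\<lambda>c. pt (pnt c 1 v))" by (rule injI) (simp add: pnt_inj [OF v(1)])
    then have "infinite (range (\<lambda>c. pt (pnt c 1 v)))" using finite_imageD infinite_UNIV_char_0 by blast
    moreover have "range (\<lambda>c. pt (pnt c 1 v)) \<subseteq> fibre W \<phi> (pt v)"
    proof
      fix w assume "w \<in> range (\<lambda>c. pt (pnt c 1 v))"
      then obtain c where "w = pt (pnt c 1 v)" by blast
      moreover have "qf c 1 v = 0" using False by (simp add: qf_def)
      ultimately show "w \<in> fibre W \<phi> (pt v)" unfolding fibre_eq [OF v] by (intro CollectI exI [of _ c] exI [of _ 1]) simp
    qed
    ultimately have "infinite (fibre W \<phi> (pt v))" by (rule infinite_super [rotated])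
    then show ?thesis using False by (simp add: peval_D)
  next
    case True
    then obtain k c1 t1 c2 t2 where k: "k \<noteq> 0" "c1 \<noteq> 0 \<or> t1 \<noteq> 0" "c2 \<noteq> 0 \<or> t2 \<noteq> 0"
      "\<And>c t. c ^ 2 * peval L v + c * t * peval Q v + t ^ 2 * peval K v = k * (c * t1 - t * c1) * (c * t2 - t * c2)"
      "peval Q v ^ 2 - 4 * peval L v * peval K v = (k * (t1 * c2 - c1 * t2)) ^ 2"
      by (rule binary_quadratic) blast
    have q0: "qf c t v = 0 \<longleftrightarrow> c * t1 = t * c1 \<or> c * t2 = t * c2" for c t
      unfolding qf_def k(4) using k(1) by simp
    have fib: "fibre W \<phi> (pt v) = {pt (pnt c1 t1 v), pt (pnt c2 t2 v)}"
    proof (intro subset_antisym subsetI)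
      fix w assume "w \<in> fibre W \<phi> (pt v)"
      then obtain c t where w: "w = pt (pnt c t v)" "c \<noteq> 0 \<or> t \<noteq> 0" "qf c t v = 0" unfolding fibre_eq [OF v] by blast
      then show "w \<in> {pt (pnt c1 t1 v), pt (pnt c2 t2 v)}"
        using pnt_inj [OF v(1) w(2) k(2)] pnt_inj [OF v(1) w(2) k(3)] q0 by blast
    next
      fix w assume w: "w \<in> {pt (pnt c1 t1 v), pt (pnt c2 t2 v)}"
      have "qf c1 t1 v = 0" "qf c2 t2 v = 0" unfolding q0 by simp_all
      then show "w \<in> fibre W \<phi> (pt v)" unfolding fibre_eq [OF v] using w k(2,3) by blast
    qed
    have D0: "peval D v \<noteq> 0 \<longleftrightarrow> pt (pnt c1 t1 v) \<noteq> pt (pnt c2 t2 v)"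
      unfolding pnt_inj [OF v(1) k(2,3)] peval_D k(5) using k(1) by auto
    show ?thesis
    proof (cases "peval D v = 0")
      case True then show ?thesis using D0 by (simp add: fib)
    next
      case False then show ?thesis using D0 by (simp add: fib)
    qed
  qed
  then show "card (fibre W \<phi> (pt v)) = 2 \<longleftrightarrow> peval D v \<noteq> 0" "finite (fibre W \<phi> (pt v)) \<Longrightarrow> card (fibre W \<phi> (pt v)) \<le> 2"
    by blast+
qed

lemma fibre_nonempty:
  obtains c t where "c \<noteq> 0 \<or> t \<noteq> 0" "qf c t v = 0"
proof (cases "peval L v \<noteq> 0 \<or> peval Q v \<noteq> 0 \<or> peval K v \<noteq> 0")
  case True
  then obtain k c1 t1 c2 t2 where "c1 \<noteq> 0 \<or> t1 \<noteq> 0"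
    "\<And>c t. c ^ 2 * peval L v + c * t * peval Q v + t ^ 2 * peval K v = k * (c * t1 - t * c1) * (c * t2 - t * c2)"
    by (rule binary_quadratic) blast
  then show ?thesis using that [of c1 t1] by (simp add: qf_def)
next
  case False
  then show ?thesis using that [of 1 0] by (simp add: qf_def)
qed

lemma branch_eq: "branch_locus W Y \<phi> = zeros {C, D}"
proof (rule set_eqI)
  fix q :: "5 pspace"
  obtain v where v: "v \<noteq> 0" "q = pt v" by (rule pt_cases)
  show "q \<in> branch_locus W Y \<phi> \<longleftrightarrow> q \<in> zeros {C, D}"
    using fibre_card(1) [OF v(1)] pt_in_branch [OF v(1)] pt_in_Y [OF v(1)] by (auto simp: branch_locus_def v(2))
qed

lemma double_cover_phi: "double_cover W Y \<phi>"
  unfolding double_cover_def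
proof (intro conjI)
  show "zirreducible Y" by (rule irreducible_Y)
  show "regular_map W \<phi>" by (rule regular_phi)
  show "\<phi> ` W = Y"
  proof (intro subset_antisym subsetI)
    fix q assume "q \<in> \<phi> ` W"
    then obtain c t v where "q = \<phi> (pt (pnt c t v))" "v \<noteq> 0" "c \<noteq> 0 \<or> t \<noteq> 0" "peval C v = 0" unfolding W_def by blast
    then show "q \<in> Y" using phi_pnt pt_in_Y by simp
  next
    fix q assume q: "q \<in> Y"
    obtain v where v: "v \<noteq> 0" "q = pt v" by (rule pt_cases)
    have C: "peval C v = 0" using q v pt_in_Y by simp
    obtain c t where ct: "c \<noteq> 0 \<or> t \<noteq> 0" "qf c t v = 0" by (rule fibre_nonempty)
    show "q \<in> \<phi> ` W" using in_W [OF v(1) ct(1) C ct(2)] phi_pnt [OF v(1) ct(1)] v(2) by (metis image_eqI)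
  qed
  show "\<exists>A. zclosed A \<and> \<not> Y \<subseteq> A \<and> (\<forall>y\<in>Y - A. card (fibre W \<phi> y) = 2)"
  proof (intro exI [of _ "zeros {D}"] conjI ballI)
    have pD: "pt v \<in> zeros {D} \<longleftrightarrow> peval D v = 0" if "v \<noteq> 0" for v
      using pt_in_zeros [of "{D}" v] hD that by auto
    show "zclosed (zeros {D})" by (rule zclosed_zeros) (use hD in blast)
    show "\<not> Y \<subseteq> zeros {D}"
    proof
      assume sub: "Y \<subseteq> zeros {D}"
      have "C dvd D"
      proof (rule hypersurface_nullstellensatz [OF prime_C hC])
        fix x assume "peval C x = 0"
        then show "peval D x = 0"
          using sub pD [of x] pt_in_Y [of x] homogeneous_nonzero_at_0 [OF hD] by (cases "x = 0") auto
      qed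
      then show False using C_not_dvd_D by blast
    qed
    fix y assume y: "y \<in> Y - zeros {D}"
    obtain v where v: "v \<noteq> 0" "y = pt v" by (rule pt_cases)
    show "card (fibre W \<phi> y) = 2" using y fibre_card(1) [OF v(1)] pt_in_Y [OF v(1)] pD [OF v(1)] by (simp add: v(2))
  qed
  show "\<forall>y\<in>Y. finite (fibre W \<phi> y) \<longrightarrow> card (fibre W \<phi> y) \<le> 2"
  proof (intro ballI impI)
    fix y assume y: "y \<in> Y" "finite (fibre W \<phi> y)"
    obtain v where v: "v \<noteq> 0" "y = pt v" by (rule pt_cases)
    show "card (fibre W \<phi> y) \<le> 2" using y fibre_card(2) [OF v(1)] pt_in_Y [OF v(1)] by (simp add: v(2))
  qed
qed

lemma cubic_Y: "cubic_threefold Y"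
  unfolding cubic_threefold_def Y_def using hC irreducible_C by blast

lemma blowup_double_cover:
  "\<exists>(Y :: 5 pspace set) \<phi>. cubic_threefold Y \<and> double_cover (blowup X (pt x0)) Y \<phi> \<and>
     is_surface (branch_locus (blowup X (pt x0)) Y \<phi>) \<and> has_degree (branch_locus (blowup X (pt x0)) Y \<phi>) 12"
  unfolding blowup_eq
  by (rule exI [of _ Y], rule exI [of _ \<phi>])
    (simp add: branch_eq cubic_Y double_cover_phi branch_surface branch_degree)

end

section \<open>The cone in the pencil\<close>

text \<open>On a line through the triple point the cubic is \<open>t ^ 3\<close> times its value in the direction, because the terms
  of lower order vanish and the degree is three. So the cubic is constant along the vertex direction.\<close>

lemma triple_point_cone:
  fixes H :: "('n::finite) mpoly" and M :: "complex^('m::finite)^'n"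
  assumes H: "homogeneous 3 H" and chart: "affine_chart q x M" and loc: "local_equation x M H P" and ord: "order_at_0 P = 3"
  shows "peval H (y + s *s x) = peval H y"
proof -
  have low: "hom_part k P = 0" if "k < 3" for k
    using not_less_Least [of k "\<lambda>d. hom_part d P \<noteq> 0"] that ord unfolding order_at_0_def by simp
  have cone: "peval H (x + t *s (M *v v)) = t ^ 3 * peval H (M *v v)" for t v
  proof -
    obtain p where p: "\<And>t. poly p t = peval H (x + t *s (M *v v))" "degree p \<le> 3" "coeff p 3 = peval H (M *v v)"
      by (rule line_poly [OF H, where x = x and e = "M *v v"]) blast
    let ?A = "mdeg ` Poly_Mapping.keys P"
    define r where "r = (\<Sum>d\<in>?A. monom (peval (hom_part d P) v) d)"
    have "poly p t = poly r t" for t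
    proof -
      have "poly p t = peval P (t *s v)" using loc by (simp add: p(1) local_equation_def vector_scalar_commute)
      also have "\<dots> = peval (\<Sum>d\<in>?A. hom_part d P) (t *s v)"
        by (rule arg_cong [OF hom_part_decomp, where f = "\<lambda>P. peval P (t *s v)"])
      also have "\<dots> = poly r t" by (simp add: r_def poly_sum poly_monom peval_homogeneous [OF homogeneous_hom_part] mult.commute)
      finally show ?thesis .
    qed
    then have pr: "p = r" by (simp add: poly_eq_poly_eq_iff [symmetric] fun_eq_iff)
    have c: "coeff p k = 0" if "k < 3" for k
      unfolding pr r_def coeff_sum coeff_monom using low [OF that] by (intro sum.neutral) auto
    have "poly p t = coeff p 0 + coeff p 1 * t + coeff p 2 * t ^ 2 + coeff p 3 * t ^ 3" for t
      unfolding poly_altdef by (subst sum.mono_neutral_left [of "{..3}"]) (use p(2) in \<open>auto simp: coeff_eq_0 numeral_2_eq_2 numeral_3_eq_3\<close>)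
    then have "poly p t = coeff p 3 * t ^ 3" using c [of 0] c [of 1] c [of 2] by simp
    then show ?thesis by (simp add: p mult.commute)
  qed
  have vertex: "peval H (c *s x + M *v v) = peval H (M *v v)" for c v
  proof (cases "c = 0")
    case False
    have "c *s x + M *v v = c *s (x + (1 / c) *s (M *v v))" using False by (simp add: vector_add_ldistrib vector_smult_assoc)
    then have "peval H (c *s x + M *v v) = c ^ 3 * ((1 / c) ^ 3 * peval H (M *v v))" by (simp only: peval_homogeneous [OF H] cone)
    then show ?thesis using False by (simp add: field_simps)
  qed simp
  obtain c v where y: "y = c *s x + M *v v"
    using chart unfolding affine_chart_def by (metis (no_types, lifting) bij_pointE case_prod_beta)
  have "y + s *s x = (c + s) *s x + M *v v" by (simp add: y vector_sadd_rdistrib)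
  then show ?thesis by (simp only: y vertex)
qed

lemma ideal_of_pair: "ideal_of {F, G} = {f. \<exists>\<alpha> \<beta>. f = \<alpha> * F + \<beta> * (G :: 'a::comm_ring_1)}"
proof (intro subset_antisym subsetI)
  fix f assume "f \<in> ideal_of {F, G}"
  then obtain T c where T: "finite T" "T \<subseteq> {F, G}" and f: "f = (\<Sum>a\<in>T. c a * a)" unfolding ideal_of_def by blast
  have "(\<Sum>a\<in>T. c a * a) = (\<Sum>a\<in>{F, G}. (if a \<in> T then c a else 0) * a)"
    using T(2) by (intro sum.mono_neutral_cong_left) auto
  also have "\<dots> = (if F \<in> T then c F else 0) * F + (if F = G then 0 else if G \<in> T then c G else 0) * G" by simp
  finally show "f \<in> {f. \<exists>\<alpha> \<beta>. f = \<alpha> * F + \<beta> * G}" using f by blast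
next
  fix f assume "f \<in> {f. \<exists>\<alpha> \<beta>. f = \<alpha> * F + \<beta> * G}"
  then obtain \<alpha> \<beta> where f: "f = \<alpha> * F + \<beta> * G" by blast
  show "f \<in> ideal_of {F, G}"
  proof (cases "F = G")
    case True
    have "f = (\<Sum>a\<in>{F}. (\<alpha> + \<beta>) * a)" by (simp add: f True distrib_right)
    then show ?thesis unfolding ideal_of_def by (intro CollectI exI [of _ "{F}"] exI [of _ "\<lambda>a. \<alpha> + \<beta>"]) simp
  next
    case False
    have "f = (\<Sum>a\<in>{F, G}. (if a = F then \<alpha> else \<beta>) * a)" using False by (simp add: f)
    then show ?thesis unfolding ideal_of_def by (intro CollectI exI [of _ "{F, G}"] exI [of _ "\<lambda>a. if a = F then \<alpha> else \<beta>"]) simp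
  qed
qed

lemma ideal_of_pencil:
  fixes F G :: "('n::finite) mpoly"
  assumes "\<alpha> \<noteq> 0"
  shows "ideal_of {pscale \<alpha> F + pscale \<beta> G, G} = ideal_of {F, G}" "zeros {pscale \<alpha> F + pscale \<beta> G, G} = zeros {F, G}"
proof -
  have 1: "a * (pscale \<alpha> F + pscale \<beta> G) + b * G = pscale \<alpha> a * F + (pscale \<beta> a + b) * G" for a b
    by (rule peval_inj) (simp add: algebra_simps)
  define \<gamma> where "\<gamma> = 1 / \<alpha>"
  have g: "\<gamma> * \<alpha> = 1" using assms by (simp add: \<gamma>_def)
  have alg: "x * f + y * h = (\<gamma> * x) * (\<alpha> * f + \<beta> * h) + (y - (\<beta> * \<gamma>) * x) * h" for x y f h :: complex
    using g by algebra
  have 2: "a * F + b * G = pscale \<gamma> a * (pscale \<alpha> F + pscale \<beta> G) + (b - pscale (\<beta> * \<gamma>) a) * G" for a b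
    by (rule peval_inj) (unfold peval_add peval_mult peval_pscale peval_diff, rule alg)
  show "ideal_of {pscale \<alpha> F + pscale \<beta> G, G} = ideal_of {F, G}"
    unfolding ideal_of_pair
  proof (intro subset_antisym subsetI)
    fix f assume "f \<in> {f. \<exists>a b. f = a * (pscale \<alpha> F + pscale \<beta> G) + b * G}"
    then obtain a b where "f = a * (pscale \<alpha> F + pscale \<beta> G) + b * G" by blast
    then show "f \<in> {f. \<exists>a b. f = a * F + b * G}" using 1 by blast
  next
    fix f assume "f \<in> {f. \<exists>a b. f = a * F + b * G}"
    then obtain a b where "f = a * F + b * G" by blast
    then show "f \<in> {f. \<exists>a b. f = a * (pscale \<alpha> F + pscale \<beta> G) + b * G}" using 2 by blast
  qed
  show "zeros {pscale \<alpha> F + pscale \<beta> G, G} = zeros {F, G}"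
    using assms by (auto simp: zeros_def)
qed

lemma cubic_complete_intersection_commute:
  "cubic_complete_intersection F G X \<longleftrightarrow> cubic_complete_intersection G F X"
  by (auto simp: cubic_complete_intersection_def insert_commute)

lemma cone_in_pencil:
  assumes ci: "cubic_complete_intersection F G X" and a: "\<alpha> \<noteq> 0"
  shows "cubic_complete_intersection (pscale \<alpha> F + pscale \<beta> G) G X"
  using ci unfolding cubic_complete_intersection_def ideal_of_pencil [OF a]
  by (auto intro: homogeneous_add homogeneous_pscale)

text \<open>The vertex of the cone is a singular point of \<open>X\<close>, since the derivative of \<open>H\<close> vanishes there; so it is an
  ordinary triple point, and the blow-up is taken at this point.\<close>

lemma cone_double_cover:
  fixes H G :: "6 mpoly"
  assumes ci: "cubic_complete_intersection H G X" and ord: "\<forall>q\<in>singular_points X. ordinary_triple_point X q"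
    and q: "q \<in> X" and mult: "has_multiplicity H q 3"
  shows "\<exists>p. ordinary_triple_point X p \<and>
           (\<exists>(Y :: 5 pspace set) \<phi>. cubic_threefold Y \<and> double_cover (blowup X p) Y \<phi> \<and>
              is_surface (branch_locus (blowup X p) Y \<phi>) \<and> has_degree (branch_locus (blowup X p) Y \<phi>) 12)"
proof -
  have hH: "homogeneous 3 H" and hG: "homogeneous 3 G" and XZ: "X = zeros {H, G}" and irr: "zirreducible X" and dim: "has_dim X 3"
    and I: "vanishing_ideal X = {f. \<exists>\<alpha> \<beta>. f = \<alpha> * H + \<beta> * G}"
    using ci by (auto simp: cubic_complete_intersection_def ideal_of_pair)
  obtain x1 and M1 :: "complex^5^6" and P where m: "affine_chart q x1 M1" "local_equation x1 M1 H P" "P \<noteq> 0" "order_at_0 P = 3"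
    using mult unfolding has_multiplicity_def by blast
  have x1: "x1 \<noteq> 0" "pt x1 = q" using m(1) by (auto simp: affine_chart_def hcoords_iff)
  have cone: "peval H (y + s *s x1) = peval H y" for y s by (rule triple_point_cone [OF hH m(1,2,4)])
  have H0: "H \<noteq> 0"
  proof
    assume "H = 0"
    then have "peval P v = 0" for v using m(2) by (simp add: local_equation_def)
    then show False using m(3) peval_inj_0 by blast
  qed
  have "dP H x1 v = 0" for v
  proof (rule dP_unique)
    have "peval H (x1 + t *s v) = peval H (t *s v)" for t using cone [of "t *s v" 1] by (simp add: add.commute)
    then have "(\<lambda>t. peval H (x1 + t *s v)) = (\<lambda>t. t ^ 3 * peval H v)" by (simp add: peval_homogeneous [OF hH])
    then show "((\<lambda>t. peval H (x1 + t *s v)) has_field_derivative 0) (at 0)"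
      by (auto intro!: derivative_eq_intros)
  qed
  then have "pt x1 \<in> singular_points X"
    by (intro singular_pointI [OF I, of 2 2 x1 3]) (use hH hG x1 q dim in \<open>simp_all add: numeral_3_eq_3 numeral_2_eq_2\<close>)
  then have otp: "ordinary_triple_point X q" using ord x1(2) by blast
  then obtain x0 and M :: "complex^5^6" and S where S: "affine_chart q x0 M" "is_surface S" "singular_points S = {}" "has_degree S 3"
    "tangent_cone_ideal x0 M X = vanishing_ideal S" unfolding ordinary_triple_point_def by blast
  have x0: "x0 \<noteq> 0" "pt x0 = q" using S(1) by (auto simp: affine_chart_def hcoords_iff)
  obtain k where k: "x0 = k *s x1" using pt_eq_iff [OF x0(1) x1(1)] x0(2) x1(2) by auto
  obtain l R where lR: "\<And>c v. (\<Sum>i\<in>UNIV. l $ i * (c *s x0 + M *v v) $ i) = c" "\<And>c v. R *v (c *s x0 + M *v v) = v"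
    "\<And>x. x = (\<Sum>i\<in>UNIV. l $ i * x $ i) *s x0 + M *v (R *v x)"
    using chart_coordinates [of x0 M] S(1) unfolding affine_chart_def by blast
  have cone': "peval H (c *s x0 + M *v v) = peval H (M *v v)" for c v
    using cone [of "M *v v" "c * k"] by (simp add: k vector_smult_assoc add.commute)
  have Gx0: "peval G x0 = 0" using q x0 by (auto simp: XZ zeros_def hcoords_iff)
  have iso: "isolated_singularity X q" if "q \<in> singular_points X" for q
    using ord that unfolding ordinary_triple_point_def by blast
  interpret smooth_cone H G X x0 M l R S
    by unfold_locales (fact hH hG XZ irr dim I lR cone' H0 Gx0 S iso)+
  show ?thesis using otp blowup_double_cover x0(2) by blast
qed

theorem lemma3p2:
  fixes F G :: "6 mpoly" and X :: "6 pspace set"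
  assumes "cubic_complete_intersection F G X"
    and "\<forall>q\<in>singular_points X. ordinary_triple_point X q"
    and "\<exists>\<alpha> \<beta>. (\<alpha> \<noteq> 0 \<or> \<beta> \<noteq> 0) \<and>
           (\<exists>q\<in>X. has_multiplicity (pscale \<alpha> F + pscale \<beta> G) q 3)"
  shows "\<exists>p. ordinary_triple_point X p \<and>
           (\<exists>(Y :: 5 pspace set) \<phi>. cubic_threefold Y \<and>
              double_cover (blowup X p) Y \<phi> \<and>
              is_surface (branch_locus (blowup X p) Y \<phi>) \<and>
              has_degree (branch_locus (blowup X p) Y \<phi>) 12)"
proof -
  obtain \<alpha> \<beta> q where ab: "\<alpha> \<noteq> 0 \<or> \<beta> \<noteq> 0" and q: "q \<in> X" "has_multiplicity (pscale \<alpha> F + pscale \<beta> G) q 3"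
    using assms(3) by blast
  from ab show ?thesis
  proof
    assume "\<alpha> \<noteq> 0"
    from cone_double_cover [OF cone_in_pencil [OF assms(1) this] assms(2) q] show ?thesis .
  next
    assume "\<beta> \<noteq> 0"
    moreover have "cubic_complete_intersection G F X" using assms(1) cubic_complete_intersection_commute by blast
    ultimately have "cubic_complete_intersection (pscale \<beta> G + pscale \<alpha> F) F X" by (intro cone_in_pencil)
    moreover have "pscale \<beta> G + pscale \<alpha> F = pscale \<alpha> F + pscale \<beta> G" by (rule add.commute)
    then have "has_multiplicity (pscale \<beta> G + pscale \<alpha> F) q 3" using q(2) by (rule ssubst)
    ultimately show ?thesis by (rule cone_double_cover [OF _ assms(2) q(1)])
  qed
qed

end
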